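(* There are Galois adjunctions $$\Psi W\dashv U\Phi\colon\mathrm{peCat}_c(\mathrm{Top}_p)\to\mathrm{jrCat}\qquad\text{and}\qquad\Psi W\dashv U\Phi_g\colon\mathrm{peGpd}_c(\mathrm{Top}_p)\to\mathrm{jiCat},$$ together with their obvious restrictions to the one-object case (one-component internal categories/groupoids, resp. one-object join restriction/join inverse categories). The fixpoints to each side are those $\mathbb X\in\mathrm{peCat}_c(\mathrm{Top}_p)$ with sober spaces of objects, and those $\mathcal A\in\mathrm{jrCat}$ with spatial locales of restriction idempotents.
   Context: For an adjunction $F\dashv G\colon\mathcal B\to\mathcal A$, a left (right) fixpoint is an object of $\mathcal B$ (of $\mathcal A$) at which the counit (unit) is invertible; the adjunction is Galois if every $FA$ is a left fixpoint (equivalently every $GB$ is a right fixpoint). RESTRICTION CATEGORIES. A restriction category is a category with an operation assigning to each $f\colon A\to B$ a map $\bar f\colon A\to A$ such that $f\bar f=f$; $\bar f\bar g=\bar g\bar f$ and $\overline{g\bar f}=\bar g\bar f$ for $f\colon A\to B$, $g\colon A\to C$; and $\bar g f=f\,\overline{gf}$ for $f\colon A\to B$, $g\colon B\to C$. $\mathcal O(A)$ is the set of restriction idempotents on $A$ (maps $e\colon A\to A$ with $\bar e=e$). A map $f$ is total if $\bar f=1$. For parallel maps, $f\leqslant g$ iff $f=g\bar f$, and $f\smile g$ (compatible) iff $f\bar g=g\bar f$. A restriction functor satisfies $F\bar f=\overline{Ff}$; it is hyperconnected if each induced function $\mathcal O(A)\to\mathcal O(FA)$ is an isomorphism. A join restriction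 category is a restriction category in which every pairwise-compatible family of parallel maps has a join for $\leqslant$, preserved by precomposition; $\mathrm{jrCat}$ is the category of these and join-preserving restriction functors. A partial isomorphism is a map $s$ with a (unique) partial inverse $s^*$: $s^*s=\bar s$, $ss^*=\overline{s^*}$. A local homeomorphism is a total map which is a join of partial isomorphisms. A local atlas on $X$ is a set $I$ and a family $\varphi_{ij}\in\mathcal O(X)$ $(i,j\in I)$ with $\varphi_{ij}=\varphi_{ji}$ and $\varphi_{jk}\varphi_{ij}\leqslant\varphi_{ik}$; a glueing of it is a local homeomorphism $p=\bigvee_i p_i\colon A\to X$, with each $p_i$ a partial isomorphism with partial inverse $s_i$, such that $\varphi_{ij}=p_js_i$. A partial section of a total map $p\colon A\to X$ is $s\colon X\to A$ with $ps=\bar s$. An inverse category is a category in which every $s\colon A\to B$ has a unique $s^*\colon B\to A$ with $ss^*s=s$, $s^*ss^*=s^*$; it is a restriction category with $\bar s=s^*s$. A join inverse category is an inverse category in which every family of parallel maps which is pairwise bicompatible ($s\smile t$ and $s^*\smile t^*$) has a join, preserved by precomposition; $\mathrm{jiCat}$ is the category of these and join-preserving functors. SPACES AND LOCALES. $\mathrm{Top}_p$ is the join restriction category of topological spaces and partial continuous maps defined on an open subset of the domain, $\bar f$ being the partial identity on the domain of definition of $f$; it has glueings of all local atlases. A locale is a complete lattice with $a\wedge\bigvee_ib_i=\bigvee_ia\wedge b_i$. $\mathrm{Loc}_p$ has locales as objects; a map $f\colon A\to B$ is a function $f^*\colon B\to A$ preserving binary meets and arbitrary joins; $\bar f^*(a)=f^*(\top)\wedge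 a$. For a join restriction (or join inverse) category $\mathcal A$, the fundamental functor $\mathcal O_{\mathcal A}\colon\mathcal A\to\mathrm{Loc}_p$ sends $X$ to the locale $\mathcal O(X)$ and $f$ to the map with $\mathcal O(f)^*(e)=\overline{ef}$. A point of a locale $X$ is a function $p\colon X\to\{\bot\leqslant\top\}$ preserving finite meets and all joins; $\mathrm{pt}(X)$ is the space of points with open sets $\{p:p(x)=\top\}$, $x\in X$. The functor $\mathrm{pt}\colon\mathrm{Loc}_p\to\mathrm{Top}_p$ so obtained is right adjoint to the fundamental functor $\mathcal O\colon\mathrm{Top}_p\to\mathrm{Loc}_p$ (sending a space to its locale of open sets); on maps, $\mathrm{pt}(f)$ is defined at those $p$ with $p(f^*(\top))=\top$ by $p\mapsto p\circ f^*$. A locale is spatial if for $x\neq y$ there is a point $p$ with $p(x)\neq p(y)$; a space is sober if each irreducible closed set is the closure of a unique point. PARTITE INTERNAL CATEGORIES in $\mathcal C=\mathrm{Top}_p$. For a set $I$, an $I$-partite internal category $\mathbb A$ comprises objects (of objects) $A_i$; objects $A_{ij}$ with total maps $\sigma_{ij}\colon A_{ij}\to A_i$, $\tau_{ij}\colon A_{ij}\to A_j$, where $\sigma_{ij}$ admits pullbacks along all total maps; maps $\eta_i\colon A_i\to A_{ii}$ with $\sigma_{ii}\eta_i=1=\tau_{ii}\eta_i$; and maps $\mu_{ijk}\colon A_{jk}\times_{A_j}A_{ij}\to A_{ik}$ (domain the pullback of $\sigma_{jk}$ along $\tau_{ij}$) with $\sigma_{ik}\mu_{ijk}=\sigma_{ij}\pi_2$,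 $\tau_{ik}\mu_{ijk}=\tau_{jk}\pi_1$, satisfying $\mu_{iij}(1,\eta_i\sigma_{ij})=1=\mu_{ijj}(\eta_j\tau_{ij},1)$ and $\mu_{ik\ell}(1\times\mu_{ijk})=\mu_{ij\ell}(\mu_{jk\ell}\times 1)$. It is source-étale (for groupoids: étale) if every $\sigma_{ij}$ is a local homeomorphism, and a groupoid if there are (unique) total maps $\iota_{ij}\colon A_{ij}\to A_{ji}$ with $\iota_{ij}\iota_{ji}=1$, $\sigma_{ji}\iota_{ij}=\tau_{ij}$ and $\mu_{iji}(\iota_{ij},1)=\eta_i\sigma_{ij}$. A partite cofunctor $F\colon\mathbb A\rightsquigarrow\mathbb B$ from an $I$-partite to a $J$-partite internal category comprises a function $I\to J$, $i\mapsto Fi$; total maps $F_i\colon B_{Fi}\to A_i$; and total maps $F_{ij}\colon A_{ij}\times_{A_i}B_{Fi}\to B_{Fi,Fj}$ with $\sigma_{Fi,Fj}F_{ij}=\pi_2$, $F_j\tau_{Fi,Fj}F_{ij}=\tau_{ij}\pi_1$, $F_{ii}(\eta_iF_i,1)=\eta_{Fi}$, and $F_{ik}(\mu_{ijk}\times1)=\mu_{Fi,Fj,Fk}(F_{jk}\times1)(1\times F_{ij})$ on $A_{jk}\times_{A_j}A_{ij}\times_{A_i}B_{Fi}$ (using $A_{jk}\times_{A_j}B_{Fi,Fj}\cong(A_{jk}\times_{A_j}B_{Fj})\times_{B_{Fj}}B_{Fi,Fj}$). Composition: $(GF)i=G(Fi)$, $(GF)_i=F_iG_{Fi}$, $(GF)_{ij}=G_{Fi,Fj}(F_{ij}\times1)$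 up to canonical isomorphism. $\mathrm{peCat}_c(\mathcal C)$, $\mathrm{peGpd}_c(\mathcal C)$: source-étale partite internal categories, resp. étale partite internal groupoids, with partite cofunctors. FUNCTORS. $\mathrm{jrCat}/\!/_h\,\mathcal C$ (resp. $\mathrm{jiCat}/\!/_h\,\mathcal C$) has as objects pairs $(\mathcal A,P)$ of a join restriction (resp. join inverse) category $\mathcal A$ and a hyperconnected restriction functor $P\colon\mathcal A\to\mathcal C$; maps $(\mathcal A,P)\to(\mathcal B,Q)$ are pairs of a restriction functor $F\colon\mathcal A\to\mathcal B$ (automatically join-preserving) and a natural transformation $\alpha\colon QF\Rightarrow P$ with total components. $\Phi\colon\mathrm{peCat}_c(\mathcal C)\to\mathrm{jrCat}/\!/_h\,\mathcal C$ sends $\mathbb A$ to $(\Phi\mathbb A,\pi_{\mathbb A})$: object-set $I$; $\Phi\mathbb A(i,j)$ the partial sections of $\sigma_{ij}$; identities $\eta_i$; composite of $s\colon i\to j$, $t\colon j\to k$ is $\mu_{ijk}\circ\tau_{ij}^*(t)\circ s$ with $\tau_{ij}^*(t)=(t\tau_{ij},\overline{t\tau_{ij}})$; restriction of $s$ is $\eta_i\bar s$; $\pi_{\mathbb A}(i)=A_i$, $\pi_{\mathbb A}(s)=\tau_{ij}s$; a cofunctor $F$ goes to $i\mapsto Fi$, $s\mapsto F_{ij}(sF_i,\overline{sF_i})$ with 2-cell components $F_i$. $\Phi_g\colon\mathrm{peGpd}_c(\mathcal C)\to\mathrm{jiCat}/\!/_h\,\mathcal C$ is defined likewise on groupoids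 but using only those $s$ with $\tau_{ij}s$ a partial isomorphism. Both $\Phi$ and $\Phi_g$ are equivalences of categories, and $\Psi$ denotes the pseudoinverse (left adjoint) in each case. Explicitly, for $(\mathcal A,P)$ put $[\![f=_Pg]\!]=\bigvee\{Pe: e\in\mathcal O(i),\ e\leqslant\bar f\bar g,\ fe=ge\}$ for $f,g\in\mathcal A(i,j)$; then $\Psi P$ is the $\mathrm{ob}(\mathcal A)$-partite source-étale internal category (a groupoid when $\mathcal A$ is inverse) with objects of objects $Pi$, $\sigma_{ij}$ a glueing of $([\![f=_Pg]\!])_{f,g\in\mathcal A(i,j)}$ with associated partial sections $s_f$, $\tau_{ij}$ unique with $\tau_{ij}s_f=Pf$, $\eta_i=s_{1_i}$, and $\mu_{ijk}$ unique with $\mu_{ijk}\tau_{ij}^*(s_g)s_f=s_{gf}$; the unit is $f\mapsto s_f$. $U\colon\mathrm{jrCat}/\!/_h\,\mathrm{Top}_p\to\mathrm{jrCat}$ forgets the projection to $\mathrm{Top}_p$, and $W\colon\mathrm{jrCat}\to\mathrm{jrCat}/\!/_h\,\mathrm{Top}_p$ is its left adjoint, sending $\mathcal A$ to $(\mathcal A,\mathrm{pt}\circ\mathcal O_{\mathcal A})$ and $F\colon\mathcal A\to\mathcal B$ to $(F,\mathrm{pt}\circ\alpha)$, where $\alpha_i\colon\mathcal O_{\mathcal B}(Fi)\to\mathcal O_{\mathcal A}(i)$ has $\alpha_i^*(e)=Fe$ for $e\in\mathcal O_{\mathcal A}(i)$. In the second adjunction, $U$ and $W$ denote the corresponding functors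 between $\mathrm{jiCat}/\!/_h\,\mathrm{Top}_p$ and $\mathrm{jiCat}$, given by the same formulas. *)

theory Defs
  imports "HOL-Analysis.Analysis" "HOL-Algebra.Complete_Lattice"
begin

section \<open>Restriction categories and inverse categories\<close>

text \<open>
  A map is always considered together with its source and target, so hom-sets need not be
  disjoint: \<open>Comp C i j k g f\<close> is the composite of \<open>f : i \<rightarrow> j\<close> followed by \<open>g : j \<rightarrow> k\<close>,
  and \<open>Rst C i j f : i \<rightarrow> i\<close> is the restriction of \<open>f : i \<rightarrow> j\<close>.
\<close>

record ('o, 'm) rcat =
  Obj :: "'o set"
  Hom :: "'o \<Rightarrow> 'o \<Rightarrow> 'm set"
  Idn :: "'o \<Rightarrow> 'm"
  Comp :: "'o \<Rightarrow> 'o \<Rightarrow> 'o \<Rightarrow> 'm \<Rightarrow> 'm \<Rightarrow> 'm"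
  Rst :: "'o \<Rightarrow> 'o \<Rightarrow> 'm \<Rightarrow> 'm"

locale category =
  fixes C :: "('o, 'm) rcat"
  assumes hom_obj: "f \<in> Hom C i j \<Longrightarrow> i \<in> Obj C \<and> j \<in> Obj C"
    and idn_hom: "i \<in> Obj C \<Longrightarrow> Idn C i \<in> Hom C i i"
    and comp_hom: "f \<in> Hom C i j \<Longrightarrow> g \<in> Hom C j k \<Longrightarrow> Comp C i j k g f \<in> Hom C i k"
    and comp_idn: "f \<in> Hom C i j \<Longrightarrow> Comp C i i j f (Idn C i) = f"
    and idn_comp: "f \<in> Hom C i j \<Longrightarrow> Comp C i j j (Idn C j) f = f"
    and comp_assoc: "f \<in> Hom C i j \<Longrightarrow> g \<in> Hom C j k \<Longrightarrow> h \<in> Hom C k l \<Longrightarrow>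
      Comp C i k l h (Comp C i j k g f) = Comp C i j l (Comp C j k l h g) f"

locale restriction_category = category C for C :: "('o, 'm) rcat" +
  assumes rst_hom: "f \<in> Hom C i j \<Longrightarrow> Rst C i j f \<in> Hom C i i"
    and comp_rst: "f \<in> Hom C i j \<Longrightarrow> Comp C i i j f (Rst C i j f) = f"
    and rst_commute: "f \<in> Hom C i j \<Longrightarrow> g \<in> Hom C i k \<Longrightarrow>
      Comp C i i i (Rst C i j f) (Rst C i k g) = Comp C i i i (Rst C i k g) (Rst C i j f)"
    and rst_comp_rst: "f \<in> Hom C i j \<Longrightarrow> g \<in> Hom C i k \<Longrightarrow>
      Rst C i k (Comp C i i k g (Rst C i j f)) = Comp C i i i (Rst C i k g) (Rst C i j f)"
    and rst_after: "f \<in> Hom C i j \<Longrightarrow> g \<in> Hom C j k \<Longrightarrow>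
      Comp C i j j (Rst C j k g) f = Comp C i i j f (Rst C i k (Comp C i j k g f))"

definition RIdem :: "('o, 'm) rcat \<Rightarrow> 'o \<Rightarrow> 'm set" where
  "RIdem C i = {e \<in> Hom C i i. Rst C i i e = e}"

definition rle :: "('o, 'm) rcat \<Rightarrow> 'o \<Rightarrow> 'o \<Rightarrow> 'm \<Rightarrow> 'm \<Rightarrow> bool" where
  "rle C i j f g \<longleftrightarrow> f = Comp C i i j g (Rst C i j f)"

definition rcompat :: "('o, 'm) rcat \<Rightarrow> 'o \<Rightarrow> 'o \<Rightarrow> 'm \<Rightarrow> 'm \<Rightarrow> bool" where
  "rcompat C i j f g \<longleftrightarrow> Comp C i i j f (Rst C i j g) = Comp C i i j g (Rst C i j f)"

definition is_join :: "('o, 'm) rcat \<Rightarrow> 'o \<Rightarrow> 'o \<Rightarrow> 'm set \<Rightarrow> 'm \<Rightarrow> bool" where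
  "is_join C i j S f \<longleftrightarrow> f \<in> Hom C i j \<and> (\<forall>g \<in> S. rle C i j g f) \<and>
     (\<forall>h \<in> Hom C i j. (\<forall>g \<in> S. rle C i j g h) \<longrightarrow> rle C i j f h)"

text \<open>The family \<open>S\<close> has a join, and this join is preserved by precomposition.\<close>

definition has_stable_join :: "('o, 'm) rcat \<Rightarrow> 'o \<Rightarrow> 'o \<Rightarrow> 'm set \<Rightarrow> bool" where
  "has_stable_join C i j S \<longleftrightarrow> (\<exists>f. is_join C i j S f \<and>
     (\<forall>h. \<forall>g \<in> Hom C h i. is_join C h j ((\<lambda>s. Comp C h i j s g) ` S) (Comp C h i j f g)))"

locale join_restriction_category = restriction_category C for C :: "('o, 'm) rcat" +
  assumes joins: "i \<in> Obj C \<Longrightarrow> j \<in> Obj C \<Longrightarrow> S \<subseteq> Hom C i j \<Longrightarrow>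
    (\<forall>f \<in> S. \<forall>g \<in> S. rcompat C i j f g) \<Longrightarrow> has_stable_join C i j S"

definition is_pinv :: "('o, 'm) rcat \<Rightarrow> 'o \<Rightarrow> 'o \<Rightarrow> 'm \<Rightarrow> 'm \<Rightarrow> bool" where
  "is_pinv C i j s t \<longleftrightarrow> t \<in> Hom C j i \<and>
     Comp C i i j s (Comp C i j i t s) = s \<and> Comp C j j i t (Comp C j i j s t) = t"

definition pinv :: "('o, 'm) rcat \<Rightarrow> 'o \<Rightarrow> 'o \<Rightarrow> 'm \<Rightarrow> 'm" where
  "pinv C i j s = (THE t. is_pinv C i j s t)"

text \<open>
  An inverse category carries no extra structure: the component \<open>Rst\<close> of the record is
  required to be the restriction determined by the partial inverses.
\<close>

locale inverse_category = category C for C :: "('o, 'm) rcat" +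
  assumes unique_pinv: "s \<in> Hom C i j \<Longrightarrow> \<exists>!t. is_pinv C i j s t"
    and rst_pinv: "s \<in> Hom C i j \<Longrightarrow> Rst C i j s = Comp C i j i (pinv C i j s) s"

definition rbicompat :: "('o, 'm) rcat \<Rightarrow> 'o \<Rightarrow> 'o \<Rightarrow> 'm \<Rightarrow> 'm \<Rightarrow> bool" where
  "rbicompat C i j s t \<longleftrightarrow> rcompat C i j s t \<and> rcompat C j i (pinv C i j s) (pinv C i j t)"

locale join_inverse_category = inverse_category C for C :: "('o, 'm) rcat" +
  assumes joins: "i \<in> Obj C \<Longrightarrow> j \<in> Obj C \<Longrightarrow> S \<subseteq> Hom C i j \<Longrightarrow>
    (\<forall>s \<in> S. \<forall>t \<in> S. rbicompat C i j s t) \<Longrightarrow> has_stable_join C i j S"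

section \<open>The categories jrCat and jiCat\<close>

record ('o, 'm, 'p, 'n) ftor =
  fob :: "'o \<Rightarrow> 'p"
  fmap :: "'o \<Rightarrow> 'o \<Rightarrow> 'm \<Rightarrow> 'n"

text \<open>Functors are extensional outside the source category, so that equality of functors is
  equality of records.\<close>

definition is_functor ::
    "('o, 'm) rcat \<Rightarrow> ('p, 'n) rcat \<Rightarrow> ('o, 'm, 'p, 'n) ftor \<Rightarrow> bool" where
  "is_functor A B F \<longleftrightarrow>
     fob F \<in> Obj A \<rightarrow>\<^sub>E Obj B \<and>
     (\<forall>i j. fmap F i j \<in> Hom A i j \<rightarrow>\<^sub>E Hom B (fob F i) (fob F j)) \<and>
     (\<forall>i \<in> Obj A. fmap F i i (Idn A i) = Idn B (fob F i)) \<and>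
     (\<forall>i j k. \<forall>f \<in> Hom A i j. \<forall>g \<in> Hom A j k.
        fmap F i k (Comp A i j k g f) =
        Comp B (fob F i) (fob F j) (fob F k) (fmap F j k g) (fmap F i j f))"

definition jr_functor ::
    "('o, 'm) rcat \<Rightarrow> ('p, 'n) rcat \<Rightarrow> ('o, 'm, 'p, 'n) ftor \<Rightarrow> bool" where
  "jr_functor A B F \<longleftrightarrow> is_functor A B F \<and>
     (\<forall>i j. \<forall>f \<in> Hom A i j. fmap F i i (Rst A i j f) = Rst B (fob F i) (fob F j) (fmap F i j f)) \<and>
     (\<forall>i \<in> Obj A. \<forall>j \<in> Obj A. \<forall>S \<subseteq> Hom A i j. \<forall>f.
        (\<forall>g \<in> S. \<forall>h \<in> S. rcompat A i j g h) \<longrightarrow> is_join A i j S f \<longrightarrow>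
        is_join B (fob F i) (fob F j) (fmap F i j ` S) (fmap F i j f))"

definition ji_functor ::
    "('o, 'm) rcat \<Rightarrow> ('p, 'n) rcat \<Rightarrow> ('o, 'm, 'p, 'n) ftor \<Rightarrow> bool" where
  "ji_functor A B F \<longleftrightarrow> is_functor A B F \<and>
     (\<forall>i \<in> Obj A. \<forall>j \<in> Obj A. \<forall>S \<subseteq> Hom A i j. \<forall>f.
        (\<forall>g \<in> S. \<forall>h \<in> S. rbicompat A i j g h) \<longrightarrow> is_join A i j S f \<longrightarrow>
        is_join B (fob F i) (fob F j) (fmap F i j ` S) (fmap F i j f))"

definition id_functor :: "('o, 'm) rcat \<Rightarrow> ('o, 'm, 'o, 'm) ftor" where
  "id_functor A = \<lparr>fob = (\<lambda>i \<in> Obj A. i), fmap = (\<lambda>i j. \<lambda>f \<in> Hom A i j. f)\<rparr>"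

text \<open>Composite of \<open>F\<close>, with source \<open>A\<close>, followed by \<open>G\<close>.\<close>

definition comp_functor :: "('o, 'm) rcat \<Rightarrow> ('p, 'n, 'q, 'r) ftor \<Rightarrow> ('o, 'm, 'p, 'n) ftor \<Rightarrow>
    ('o, 'm, 'q, 'r) ftor" where
  "comp_functor A G F = \<lparr>fob = (\<lambda>i \<in> Obj A. fob G (fob F i)),
     fmap = (\<lambda>i j. \<lambda>f \<in> Hom A i j. fmap G (fob F i) (fob F j) (fmap F i j f))\<rparr>"

text \<open>
  Both adjunctions, and their one-object versions, are treated uniformly:
  \<open>Categories\<close> selects \<open>jrCat\<close> and source-etale partite internal categories,
  \<open>Groupoids\<close> selects \<open>jiCat\<close> and etale partite internal groupoids, and \<open>One_object\<close> selects the
  full subcategories on the objects with exactly one object (component).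
\<close>

datatype variant = Categories | Groupoids
datatype scope = Many_objects | One_object

definition join_cat :: "variant \<Rightarrow> scope \<Rightarrow> ('o, 'm) rcat \<Rightarrow> bool" where
  "join_cat v sc A \<longleftrightarrow>
     (case v of Categories \<Rightarrow> join_restriction_category A | Groupoids \<Rightarrow> join_inverse_category A) \<and>
     (case sc of Many_objects \<Rightarrow> True | One_object \<Rightarrow> (\<exists>i. Obj A = {i}))"

definition join_functor ::
    "variant \<Rightarrow> ('o, 'm) rcat \<Rightarrow> ('p, 'n) rcat \<Rightarrow> ('o, 'm, 'p, 'n) ftor \<Rightarrow> bool" where
  "join_functor v A B F \<longleftrightarrow>
     (case v of Categories \<Rightarrow> jr_functor A B F | Groupoids \<Rightarrow> ji_functor A B F)"

definition join_functor_iso ::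
    "variant \<Rightarrow> ('o, 'm) rcat \<Rightarrow> ('p, 'n) rcat \<Rightarrow> ('o, 'm, 'p, 'n) ftor \<Rightarrow> bool" where
  "join_functor_iso v A B F \<longleftrightarrow> join_functor v A B F \<and>
     (\<exists>G. join_functor v B A G \<and> comp_functor A G F = id_functor A \<and>
          comp_functor B F G = id_functor B)"

section \<open>Partial continuous maps\<close>

text \<open>
  Maps of \<open>Top\<^sub>p\<close> are partial functions whose domain is an open subset of the source; they compose
  by \<open>(\<circ>\<^sub>m)\<close>. The spaces involved may live on different types.
\<close>

definition Top_p :: "'a topology \<Rightarrow> 'b topology \<Rightarrow> ('a \<rightharpoonup> 'b) set" where
  "Top_p X Y = {f. openin X (dom f) \<and> continuous_map (subtopology X (dom f)) Y (the \<circ> f)}"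

definition idp :: "'a topology \<Rightarrow> ('a \<rightharpoonup> 'a)" where
  "idp X = (\<lambda>x. if x \<in> topspace X then Some x else None)"

definition rstp :: "('a \<rightharpoonup> 'b) \<Rightarrow> ('a \<rightharpoonup> 'a)" where
  "rstp f = (\<lambda>x. if x \<in> dom f then Some x else None)"

definition total_maps :: "'a topology \<Rightarrow> 'b topology \<Rightarrow> ('a \<rightharpoonup> 'b) set" where
  "total_maps X Y = {f \<in> Top_p X Y. rstp f = idp X}"

definition lep :: "('a \<rightharpoonup> 'b) \<Rightarrow> ('a \<rightharpoonup> 'b) \<Rightarrow> bool" where
  "lep f g \<longleftrightarrow> f = g \<circ>\<^sub>m rstp f"

definition is_joinp ::
    "'a topology \<Rightarrow> 'b topology \<Rightarrow> ('a \<rightharpoonup> 'b) set \<Rightarrow> ('a \<rightharpoonup> 'b) \<Rightarrow> bool" where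
  "is_joinp X Y S f \<longleftrightarrow> f \<in> Top_p X Y \<and> (\<forall>g \<in> S. lep g f) \<and>
     (\<forall>h \<in> Top_p X Y. (\<forall>g \<in> S. lep g h) \<longrightarrow> lep f h)"

definition partial_isos :: "'a topology \<Rightarrow> 'b topology \<Rightarrow> ('a \<rightharpoonup> 'b) set" where
  "partial_isos X Y =
     {s \<in> Top_p X Y. \<exists>t \<in> Top_p Y X. t \<circ>\<^sub>m s = rstp s \<and> s \<circ>\<^sub>m t = rstp t}"

definition local_homeo :: "'a topology \<Rightarrow> 'b topology \<Rightarrow> ('a \<rightharpoonup> 'b) \<Rightarrow> bool" where
  "local_homeo X Y p \<longleftrightarrow> p \<in> total_maps X Y \<and> (\<exists>S \<subseteq> partial_isos X Y. is_joinp X Y S p)"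

definition pairp :: "('a \<rightharpoonup> 'b) \<Rightarrow> ('a \<rightharpoonup> 'c) \<Rightarrow> ('a \<rightharpoonup> 'b \<times> 'c)" where
  "pairp f g = (\<lambda>x. case f x of None \<Rightarrow> None | Some y \<Rightarrow>
     (case g x of None \<Rightarrow> None | Some z \<Rightarrow> Some (y, z)))"

text \<open>
  The fibre product of \<open>f : X \<rightarrow> Z\<close> and \<open>g : Y \<rightarrow> Z\<close>. For total \<open>f\<close>, \<open>g\<close> it is a pullback in \<open>Top\<^sub>p\<close>;
  in particular every total map admits pullbacks along all total maps.
\<close>

definition fprod ::
    "'a topology \<Rightarrow> 'b topology \<Rightarrow> ('a \<rightharpoonup> 'c) \<Rightarrow> ('b \<rightharpoonup> 'c) \<Rightarrow> ('a \<times> 'b) topology" where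
  "fprod X Y f g = subtopology (prod_topology X Y) {(x, y). f x = g y}"

definition proj1 :: "('a \<times> 'b) topology \<Rightarrow> ('a \<times> 'b \<rightharpoonup> 'a)" where
  "proj1 T = (\<lambda>z. if z \<in> topspace T then Some (fst z) else None)"

definition proj2 :: "('a \<times> 'b) topology \<Rightarrow> ('a \<times> 'b \<rightharpoonup> 'b)" where
  "proj2 T = (\<lambda>z. if z \<in> topspace T then Some (snd z) else None)"

section \<open>Locales and their points\<close>

text \<open>
  A map \<open>f : A \<rightarrow> B\<close> of locales is represented by the function \<open>f\<^sup>*\<close> from \<open>B\<close> to \<open>A\<close>. Points are
  extended by \<open>False\<close> outside the carrier of the locale.
\<close>

definition points :: "'l gorder \<Rightarrow> ('l \<Rightarrow> bool) set" where
  "points L = {p. (\<forall>x. p x \<longrightarrow> x \<in> carrier L) \<and> p \<top>\<^bsub>L\<^esub> \<and>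
     (\<forall>x \<in> carrier L. \<forall>y \<in> carrier L. p (x \<sqinter>\<^bsub>L\<^esub> y) \<longleftrightarrow> p x \<and> p y) \<and>
     (\<forall>S \<subseteq> carrier L. p (\<Squnion>\<^bsub>L\<^esub> S) \<longleftrightarrow> (\<exists>x \<in> S. p x))}"

definition pt :: "'l gorder \<Rightarrow> ('l \<Rightarrow> bool) topology" where
  "pt L = topology (\<lambda>U. \<exists>x \<in> carrier L. U = {p \<in> points L. p x})"

definition pt_map :: "'l gorder \<Rightarrow> 'k gorder \<Rightarrow> ('k \<Rightarrow> 'l) \<Rightarrow> (('l \<Rightarrow> bool) \<rightharpoonup> ('k \<Rightarrow> bool))" where
  "pt_map A B fs = (\<lambda>p. if p \<in> points A \<and> p (fs \<top>\<^bsub>B\<^esub>)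
     then Some (\<lambda>y. y \<in> carrier B \<and> p (fs y)) else None)"

definition spatial :: "'l gorder \<Rightarrow> bool" where
  "spatial L \<longleftrightarrow> (\<forall>x \<in> carrier L. \<forall>y \<in> carrier L. x \<noteq> y \<longrightarrow> (\<exists>p \<in> points L. p x \<noteq> p y))"

definition irreducible_closed :: "'a topology \<Rightarrow> 'a set \<Rightarrow> bool" where
  "irreducible_closed X K \<longleftrightarrow> closedin X K \<and> K \<noteq> {} \<and>
     (\<forall>K1 K2. closedin X K1 \<longrightarrow> closedin X K2 \<longrightarrow> K = K1 \<union> K2 \<longrightarrow> K = K1 \<or> K = K2)"

definition sober :: "'a topology \<Rightarrow> bool" where
  "sober X \<longleftrightarrow> (\<forall>K. irreducible_closed X K \<longrightarrow> (\<exists>!x. x \<in> topspace X \<and> K = X closure_of {x}))"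

definition RLoc :: "('o, 'm) rcat \<Rightarrow> 'o \<Rightarrow> 'm gorder" where
  "RLoc C i = \<lparr>carrier = RIdem C i, eq = (=), le = rle C i i\<rparr>"

text \<open>The function \<open>\<O>(f)\<^sup>*\<close> from \<open>\<O>(j)\<close> to \<open>\<O>(i)\<close>, for \<open>f : i \<rightarrow> j\<close>.\<close>

definition RLoc_map :: "('o, 'm) rcat \<Rightarrow> 'o \<Rightarrow> 'o \<Rightarrow> 'm \<Rightarrow> ('m \<Rightarrow> 'm)" where
  "RLoc_map C i j f = (\<lambda>e. Rst C i j (Comp C i j j e f))"

section \<open>Partite internal categories\<close>

text \<open>
  \<open>Sp X i\<close> and \<open>Ar X i j\<close> are the spaces of objects and of arrows; \<open>Mu X i j k\<close> takes a pair
  \<open>(g, f)\<close> with \<open>g\<close> in \<open>Ar X j k\<close> and \<open>f\<close> in \<open>Ar X i j\<close>.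
\<close>

record ('i, 'a, 'b) pcat =
  Ix :: "'i set"
  Sp :: "'i \<Rightarrow> 'a topology"
  Ar :: "'i \<Rightarrow> 'i \<Rightarrow> 'b topology"
  Src :: "'i \<Rightarrow> 'i \<Rightarrow> ('b \<rightharpoonup> 'a)"
  Tgt :: "'i \<Rightarrow> 'i \<Rightarrow> ('b \<rightharpoonup> 'a)"
  Eta :: "'i \<Rightarrow> ('a \<rightharpoonup> 'b)"
  Mu :: "'i \<Rightarrow> 'i \<Rightarrow> 'i \<Rightarrow> ('b \<times> 'b \<rightharpoonup> 'b)"

definition Ar2 :: "('i, 'a, 'b) pcat \<Rightarrow> 'i \<Rightarrow> 'i \<Rightarrow> 'i \<Rightarrow> ('b \<times> 'b) topology" where
  "Ar2 X i j k = fprod (Ar X j k) (Ar X i j) (Src X j k) (Tgt X i j)"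

definition Ar3 :: "('i, 'a, 'b) pcat \<Rightarrow> 'i \<Rightarrow> 'i \<Rightarrow> 'i \<Rightarrow> 'i \<Rightarrow> ('b \<times> 'b \<times> 'b) topology" where
  "Ar3 X i j k l =
     fprod (Ar X k l) (Ar2 X i j k) (Src X k l) (Tgt X j k \<circ>\<^sub>m proj1 (Ar2 X i j k))"

locale partite_category =
  fixes X :: "('i, 'a, 'b) pcat"
  assumes src: "i \<in> Ix X \<Longrightarrow> j \<in> Ix X \<Longrightarrow> Src X i j \<in> total_maps (Ar X i j) (Sp X i)"
    and tgt: "i \<in> Ix X \<Longrightarrow> j \<in> Ix X \<Longrightarrow> Tgt X i j \<in> total_maps (Ar X i j) (Sp X j)"
    and eta: "i \<in> Ix X \<Longrightarrow> Eta X i \<in> Top_p (Sp X i) (Ar X i i)"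
    and src_eta: "i \<in> Ix X \<Longrightarrow> Src X i i \<circ>\<^sub>m Eta X i = idp (Sp X i)"
    and tgt_eta: "i \<in> Ix X \<Longrightarrow> Tgt X i i \<circ>\<^sub>m Eta X i = idp (Sp X i)"
    and mu: "i \<in> Ix X \<Longrightarrow> j \<in> Ix X \<Longrightarrow> k \<in> Ix X \<Longrightarrow> Mu X i j k \<in> Top_p (Ar2 X i j k) (Ar X i k)"
    and src_mu: "i \<in> Ix X \<Longrightarrow> j \<in> Ix X \<Longrightarrow> k \<in> Ix X \<Longrightarrow>
      Src X i k \<circ>\<^sub>m Mu X i j k = Src X i j \<circ>\<^sub>m proj2 (Ar2 X i j k)"
    and tgt_mu: "i \<in> Ix X \<Longrightarrow> j \<in> Ix X \<Longrightarrow> k \<in> Ix X \<Longrightarrow>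
      Tgt X i k \<circ>\<^sub>m Mu X i j k = Tgt X j k \<circ>\<^sub>m proj1 (Ar2 X i j k)"
    and mu_eta_right: "i \<in> Ix X \<Longrightarrow> j \<in> Ix X \<Longrightarrow>
      Mu X i i j \<circ>\<^sub>m pairp (idp (Ar X i j)) (Eta X i \<circ>\<^sub>m Src X i j) = idp (Ar X i j)"
    and mu_eta_left: "i \<in> Ix X \<Longrightarrow> j \<in> Ix X \<Longrightarrow>
      Mu X i j j \<circ>\<^sub>m pairp (Eta X j \<circ>\<^sub>m Tgt X i j) (idp (Ar X i j)) = idp (Ar X i j)"
    and mu_assoc: "i \<in> Ix X \<Longrightarrow> j \<in> Ix X \<Longrightarrow> k \<in> Ix X \<Longrightarrow> l \<in> Ix X \<Longrightarrow>
      (let T = Ar3 X i j k l; h = proj1 T; gf = proj2 T;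
           g = proj1 (Ar2 X i j k) \<circ>\<^sub>m gf; f = proj2 (Ar2 X i j k) \<circ>\<^sub>m gf
       in Mu X i k l \<circ>\<^sub>m pairp h (Mu X i j k \<circ>\<^sub>m gf) =
          Mu X i j l \<circ>\<^sub>m pairp (Mu X j k l \<circ>\<^sub>m pairp h g) f)"

locale source_etale_category = partite_category X for X :: "('i, 'a, 'b) pcat" +
  assumes src_local_homeo:
    "i \<in> Ix X \<Longrightarrow> j \<in> Ix X \<Longrightarrow> local_homeo (Ar X i j) (Sp X i) (Src X i j)"

locale etale_groupoid = source_etale_category X for X :: "('i, 'a, 'b) pcat" +
  assumes inverses: "\<exists>\<iota>. \<forall>i \<in> Ix X. \<forall>j \<in> Ix X.
      \<iota> i j \<in> total_maps (Ar X i j) (Ar X j i) \<and>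
      \<iota> i j \<circ>\<^sub>m \<iota> j i = idp (Ar X j i) \<and>
      Src X j i \<circ>\<^sub>m \<iota> i j = Tgt X i j \<and>
      Mu X i j i \<circ>\<^sub>m pairp (\<iota> i j) (idp (Ar X i j)) = Eta X i \<circ>\<^sub>m Src X i j"

definition internal_cat :: "variant \<Rightarrow> scope \<Rightarrow> ('i, 'a, 'b) pcat \<Rightarrow> bool" where
  "internal_cat v sc X \<longleftrightarrow>
     (case v of Categories \<Rightarrow> source_etale_category X | Groupoids \<Rightarrow> etale_groupoid X) \<and>
     (case sc of Many_objects \<Rightarrow> True | One_object \<Rightarrow> (\<exists>i. Ix X = {i}))"

text \<open>
  A cofunctor from \<open>X\<close> to \<open>Y\<close> with its maps \<open>F\<^sub>i\<close> (\<open>cob\<close>) from \<open>Y\<^bsub>Fi\<^esub>\<close> to \<open>X\<^sub>i\<close> and \<open>F\<^bsub>ij\<^esub>\<close> (\<open>car\<close>).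
  Outside \<open>Ix X\<close> the components are fixed arbitrarily, so that equality of cofunctors is equality
  of records.
\<close>

record ('i, 'a, 'b, 'j, 'c, 'd) cofun =
  cix :: "'i \<Rightarrow> 'j"
  cob :: "'i \<Rightarrow> ('c \<rightharpoonup> 'a)"
  car :: "'i \<Rightarrow> 'i \<Rightarrow> ('b \<times> 'c \<rightharpoonup> 'd)"

definition act_dom :: "('i, 'a, 'b) pcat \<Rightarrow> ('j, 'c, 'd) pcat \<Rightarrow> ('i \<Rightarrow> 'j) \<Rightarrow> ('i \<Rightarrow> ('c \<rightharpoonup> 'a)) \<Rightarrow>
    'i \<Rightarrow> 'i \<Rightarrow> ('b \<times> 'c) topology" where
  "act_dom X Y fi f i j = fprod (Ar X i j) (Sp Y (fi i)) (Src X i j) (f i)"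

definition cofunctor :: "('i, 'a, 'b) pcat \<Rightarrow> ('j, 'c, 'd) pcat \<Rightarrow>
    ('i, 'a, 'b, 'j, 'c, 'd) cofun \<Rightarrow> bool" where
  "cofunctor X Y F \<longleftrightarrow>
     cix F \<in> Ix X \<rightarrow>\<^sub>E Ix Y \<and>
     (\<forall>i. i \<notin> Ix X \<longrightarrow> cob F i = Map.empty) \<and>
     (\<forall>i j. i \<notin> Ix X \<or> j \<notin> Ix X \<longrightarrow> car F i j = Map.empty) \<and>
     (\<forall>i \<in> Ix X. cob F i \<in> total_maps (Sp Y (cix F i)) (Sp X i)) \<and>
     (\<forall>i \<in> Ix X. \<forall>j \<in> Ix X. let D = act_dom X Y (cix F) (cob F) i j in
        car F i j \<in> total_maps D (Ar Y (cix F i) (cix F j)) \<and>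
        Src Y (cix F i) (cix F j) \<circ>\<^sub>m car F i j = proj2 D \<and>
        cob F j \<circ>\<^sub>m (Tgt Y (cix F i) (cix F j) \<circ>\<^sub>m car F i j) = Tgt X i j \<circ>\<^sub>m proj1 D) \<and>
     (\<forall>i \<in> Ix X. car F i i \<circ>\<^sub>m pairp (Eta X i \<circ>\<^sub>m cob F i) (idp (Sp Y (cix F i))) =
        Eta Y (cix F i)) \<and>
     (\<forall>i \<in> Ix X. \<forall>j \<in> Ix X. \<forall>k \<in> Ix X.
        let D = act_dom X Y (cix F) (cob F) i j;
            T = fprod (Ar X j k) D (Src X j k) (Tgt X i j \<circ>\<^sub>m proj1 D);
            g = proj1 T; f = proj1 D \<circ>\<^sub>m proj2 T; y = proj2 D \<circ>\<^sub>m proj2 T;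
            b = car F i j \<circ>\<^sub>m proj2 T
        in car F i k \<circ>\<^sub>m pairp (Mu X i j k \<circ>\<^sub>m pairp g f) y =
           Mu Y (cix F i) (cix F j) (cix F k) \<circ>\<^sub>m
             pairp (car F j k \<circ>\<^sub>m pairp g (Tgt Y (cix F i) (cix F j) \<circ>\<^sub>m b)) b)"

definition id_cofunctor :: "('i, 'a, 'b) pcat \<Rightarrow> ('i, 'a, 'b, 'i, 'a, 'b) cofun" where
  "id_cofunctor X = \<lparr>cix = (\<lambda>i \<in> Ix X. i),
     cob = (\<lambda>i. if i \<in> Ix X then idp (Sp X i) else Map.empty),
     car = (\<lambda>i j. if i \<in> Ix X \<and> j \<in> Ix X
        then proj1 (act_dom X X (\<lambda>i. i) (\<lambda>i. idp (Sp X i)) i j) else Map.empty)\<rparr>"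

text \<open>
  The composite of \<open>F\<close>, with source \<open>X\<close>, followed by \<open>G\<close>. Its arrow component sends \<open>(a, c)\<close> to
  \<open>G\<^bsub>Fi,Fj\<^esub> (F\<^bsub>ij\<^esub> (a, G\<^bsub>Fi\<^esub> c), c)\<close>; it is undefined off the appropriate fibre product because \<open>G\<^bsub>Fi\<^esub>\<close>
  and \<open>F\<^bsub>ij\<^esub>\<close> are.
\<close>

definition comp_cofunctor :: "('i, 'a, 'b) pcat \<Rightarrow> ('j, 'c, 'd, 'k, 'e, 'f) cofun \<Rightarrow>
    ('i, 'a, 'b, 'j, 'c, 'd) cofun \<Rightarrow> ('i, 'a, 'b, 'k, 'e, 'f) cofun" where
  "comp_cofunctor X G F = \<lparr>cix = (\<lambda>i \<in> Ix X. cix G (cix F i)),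
     cob = (\<lambda>i. cob F i \<circ>\<^sub>m cob G (cix F i)),
     car = (\<lambda>i j. let a = Some \<circ> fst; c = Some \<circ> snd
        in car G (cix F i) (cix F j) \<circ>\<^sub>m
             pairp (car F i j \<circ>\<^sub>m pairp a (cob G (cix F i) \<circ>\<^sub>m c)) c)\<rparr>"

definition cofunctor_iso :: "('i, 'a, 'b) pcat \<Rightarrow> ('j, 'c, 'd) pcat \<Rightarrow>
    ('i, 'a, 'b, 'j, 'c, 'd) cofun \<Rightarrow> bool" where
  "cofunctor_iso X Y F \<longleftrightarrow> cofunctor X Y F \<and>
     (\<exists>G. cofunctor Y X G \<and> comp_cofunctor X G F = id_cofunctor X \<and>
          comp_cofunctor Y F G = id_cofunctor Y)"

section \<open>Categories over \<open>Top\<^sub>p\<close>\<close>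

text \<open>
  An object over \<open>Top\<^sub>p\<close> is a pair \<open>(A, P)\<close> with \<open>P\<close> a functor from \<open>A\<close> to \<open>Top\<^sub>p\<close>, and a map between
  such is a pair \<open>(F, \<alpha>)\<close> where \<open>\<alpha> i\<close> goes from \<open>Q (F i)\<close> to \<open>P i\<close>.
\<close>

record ('o, 'm, 'a) topfun =
  tob :: "'o \<Rightarrow> 'a topology"
  tmap :: "'o \<Rightarrow> 'o \<Rightarrow> 'm \<Rightarrow> ('a \<rightharpoonup> 'a)"

type_synonym ('o, 'm, 'a) over = "('o, 'm) rcat \<times> ('o, 'm, 'a) topfun"
type_synonym ('o, 'm, 'a, 'p, 'n, 'c) over_map = "('o, 'm, 'p, 'n) ftor \<times> ('o \<Rightarrow> ('c \<rightharpoonup> 'a))"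

definition U :: "('o, 'm, 'a) over \<Rightarrow> ('o, 'm) rcat" where
  "U = fst"

definition U_map :: "('o, 'm, 'a, 'p, 'n, 'c) over_map \<Rightarrow> ('o, 'm, 'p, 'n) ftor" where
  "U_map = fst"

definition W :: "('o, 'm) rcat \<Rightarrow> ('o, 'm, 'm \<Rightarrow> bool) over" where
  "W A = (A, \<lparr>tob = (\<lambda>i. pt (RLoc A i)),
     tmap = (\<lambda>i j f. pt_map (RLoc A i) (RLoc A j) (RLoc_map A i j f))\<rparr>)"

definition W_map :: "('o, 'm) rcat \<Rightarrow> ('p, 'n) rcat \<Rightarrow> ('o, 'm, 'p, 'n) ftor \<Rightarrow>
    ('o, 'm, 'm \<Rightarrow> bool, 'p, 'n, 'n \<Rightarrow> bool) over_map" where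
  "W_map A B F = (F, \<lambda>i. if i \<in> Obj A
     then pt_map (RLoc B (fob F i)) (RLoc A i) (fmap F i i) else Map.empty)"

section \<open>The functor \<open>\<Phi>\<close>\<close>

text \<open>\<open>tau_star \<tau> t\<close> is the pullback of the partial section \<open>t\<close> along \<open>\<tau>\<close>.\<close>

definition tau_star :: "('b \<rightharpoonup> 'a) \<Rightarrow> ('a \<rightharpoonup> 'c) \<Rightarrow> ('b \<rightharpoonup> 'c \<times> 'b)" where
  "tau_star \<tau> t = pairp (t \<circ>\<^sub>m \<tau>) (rstp (t \<circ>\<^sub>m \<tau>))"

definition Phi_hom :: "variant \<Rightarrow> ('i, 'a, 'b) pcat \<Rightarrow> 'i \<Rightarrow> 'i \<Rightarrow> ('a \<rightharpoonup> 'b) set" where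
  "Phi_hom v X i j = {s. i \<in> Ix X \<and> j \<in> Ix X \<and>
     s \<in> Top_p (Sp X i) (Ar X i j) \<and> Src X i j \<circ>\<^sub>m s = rstp s \<and>
     (case v of Categories \<Rightarrow> True
      | Groupoids \<Rightarrow> Tgt X i j \<circ>\<^sub>m s \<in> partial_isos (Sp X i) (Sp X j))}"

definition Phi :: "variant \<Rightarrow> ('i, 'a, 'b) pcat \<Rightarrow> ('i, 'a \<rightharpoonup> 'b, 'a) over" where
  "Phi v X =
     (\<lparr>Obj = Ix X, Hom = Phi_hom v X, Idn = Eta X,
       Comp = (\<lambda>i j k t s. Mu X i j k \<circ>\<^sub>m (tau_star (Tgt X i j) t \<circ>\<^sub>m s)),
       Rst = (\<lambda>i j s. Eta X i \<circ>\<^sub>m rstp s)\<rparr>,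
      \<lparr>tob = Sp X, tmap = (\<lambda>i j s. Tgt X i j \<circ>\<^sub>m s)\<rparr>)"

definition Phi_map :: "variant \<Rightarrow> ('i, 'a, 'b) pcat \<Rightarrow> ('i, 'a, 'b, 'j, 'c, 'd) cofun \<Rightarrow>
    ('i, 'a \<rightharpoonup> 'b, 'a, 'j, 'c \<rightharpoonup> 'd, 'c) over_map" where
  "Phi_map v X F =
     (\<lparr>fob = cix F,
       fmap = (\<lambda>i j. \<lambda>s \<in> Phi_hom v X i j.
         car F i j \<circ>\<^sub>m pairp (s \<circ>\<^sub>m cob F i) (rstp (s \<circ>\<^sub>m cob F i)))\<rparr>,
      cob F)"

section \<open>The functor \<open>\<Psi>\<close>\<close>

text \<open>The partial identity where \<open>f\<close> and \<open>g\<close> agree.\<close>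

definition agree :: "('o, 'm, 'a) over \<Rightarrow> 'o \<Rightarrow> 'o \<Rightarrow> 'm \<Rightarrow> 'm \<Rightarrow> ('a \<rightharpoonup> 'a)" where
  "agree AP i j f g = (case AP of (A, P) \<Rightarrow>
     THE h. is_joinp (tob P i) (tob P i)
       {tmap P i i e |e. e \<in> RIdem A i \<and> rle A i i e (Comp A i i i (Rst A i j f) (Rst A i j g)) \<and>
          Comp A i i j f e = Comp A i i j g e} h)"

text \<open>
  The glueing of the local atlas \<open>agree AP i j f g\<close> (indexed by \<open>f\<close>, \<open>g\<close> in \<open>A(i, j)\<close>) is realised as
  the space of germs: the germ of \<open>f\<close> at \<open>x\<close> is the class of \<open>(f, x)\<close> under the relation identifying
  \<open>(f, x)\<close> with \<open>(g, x)\<close> when \<open>agree AP i j f g\<close> is defined at \<open>x\<close>. Its topology is the finest one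
  making the canonical partial sections \<open>sect AP i j f\<close> continuous, and its projection sends a germ
  to its base point.
\<close>

type_synonym ('m, 'a) germ = "('m \<times> 'a) set"

definition sect :: "('o, 'm, 'a) over \<Rightarrow> 'o \<Rightarrow> 'o \<Rightarrow> 'm \<Rightarrow> ('a \<rightharpoonup> ('m, 'a) germ)" where
  "sect AP i j f = (\<lambda>x. if x \<in> dom (agree AP i j f f)
     then Some {(g, x) |g. g \<in> Hom (fst AP) i j \<and> x \<in> dom (agree AP i j f g)} else None)"

definition germs :: "('o, 'm, 'a) over \<Rightarrow> 'o \<Rightarrow> 'o \<Rightarrow> ('m, 'a) germ set" where
  "germs AP i j = (\<Union>f \<in> Hom (fst AP) i j. ran (sect AP i j f))"

definition germ_space :: "('o, 'm, 'a) over \<Rightarrow> 'o \<Rightarrow> 'o \<Rightarrow> ('m, 'a) germ topology" where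
  "germ_space AP i j = topology (\<lambda>V. V \<subseteq> germs AP i j \<and>
     (\<forall>f \<in> Hom (fst AP) i j. openin (tob (snd AP) i) {x. \<exists>a \<in> V. sect AP i j f x = Some a}))"

definition germ_base :: "('o, 'm, 'a) over \<Rightarrow> 'o \<Rightarrow> 'o \<Rightarrow> (('m, 'a) germ \<rightharpoonup> 'a)" where
  "germ_base AP i j = (\<lambda>a. if a \<in> germs AP i j then Some (THE x. \<exists>g. (g, x) \<in> a) else None)"

definition germ_target :: "('o, 'm, 'a) over \<Rightarrow> 'o \<Rightarrow> 'o \<Rightarrow> (('m, 'a) germ \<rightharpoonup> 'a)" where
  "germ_target AP i j = (THE t. t \<in> Top_p (germ_space AP i j) (tob (snd AP) j) \<and>
     (\<forall>f \<in> Hom (fst AP) i j. t \<circ>\<^sub>m sect AP i j f = tmap (snd AP) i j f))"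

definition germ_mult :: "('o, 'm, 'a) over \<Rightarrow> 'o \<Rightarrow> 'o \<Rightarrow> 'o \<Rightarrow>
    (('m, 'a) germ \<times> ('m, 'a) germ \<rightharpoonup> ('m, 'a) germ)" where
  "germ_mult AP i j k = (THE m.
     m \<in> Top_p (fprod (germ_space AP j k) (germ_space AP i j) (germ_base AP j k) (germ_target AP i j))
               (germ_space AP i k) \<and>
     (\<forall>f \<in> Hom (fst AP) i j. \<forall>g \<in> Hom (fst AP) j k.
        m \<circ>\<^sub>m (tau_star (germ_target AP i j) (sect AP j k g) \<circ>\<^sub>m sect AP i j f) =
        sect AP i k (Comp (fst AP) i j k g f)))"

definition Psi :: "('o, 'm, 'a) over \<Rightarrow> ('o, 'a, ('m, 'a) germ) pcat" where
  "Psi AP = \<lparr>Ix = Obj (fst AP), Sp = tob (snd AP), Ar = germ_space AP,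
     Src = germ_base AP, Tgt = germ_target AP,
     Eta = (\<lambda>i. sect AP i i (Idn (fst AP) i)), Mu = germ_mult AP\<rparr>"

text \<open>
  The action on maps is the one making \<open>f \<mapsto> s\<^sub>f\<close> natural, i.e. the arrow components are determined
  by the requirement that \<open>\<Phi> (\<Psi> (F, \<alpha>))\<close> send \<open>s\<^sub>f\<close> to \<open>s\<^bsub>F f\<^esub>\<close>.
\<close>

definition Psi_map :: "('o, 'm, 'a) over \<Rightarrow> ('p, 'n, 'c) over \<Rightarrow>
    ('o, 'm, 'a, 'p, 'n, 'c) over_map \<Rightarrow>
    ('o, 'a, ('m, 'a) germ, 'p, 'c, ('n, 'c) germ) cofun" where
  "Psi_map AP BQ H = (case H of (F, \<alpha>) \<Rightarrow>
     \<lparr>cix = fob F, cob = \<alpha>,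
      car = (\<lambda>i j. if i \<in> Obj (fst AP) \<and> j \<in> Obj (fst AP) then
        (THE h. h \<in> Top_p (act_dom (Psi AP) (Psi BQ) (fob F) \<alpha> i j)
                          (germ_space BQ (fob F i) (fob F j)) \<and>
           (\<forall>f \<in> Hom (fst AP) i j.
              h \<circ>\<^sub>m pairp (sect AP i j f \<circ>\<^sub>m \<alpha> i) (rstp (sect AP i j f \<circ>\<^sub>m \<alpha> i)) =
              sect BQ (fob F i) (fob F j) (fmap F i j f)))
        else Map.empty)\<rparr>)"

section \<open>The composite functors, unit and counit\<close>

definition PsiW :: "('o, 'm) rcat \<Rightarrow> ('o, 'm \<Rightarrow> bool, ('m, 'm \<Rightarrow> bool) germ) pcat" where
  "PsiW A = Psi (W A)"

definition PsiW_map :: "('o, 'm) rcat \<Rightarrow> ('p, 'n) rcat \<Rightarrow> ('o, 'm, 'p, 'n) ftor \<Rightarrow>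
    ('o, 'm \<Rightarrow> bool, ('m, 'm \<Rightarrow> bool) germ, 'p, 'n \<Rightarrow> bool, ('n, 'n \<Rightarrow> bool) germ) cofun" where
  "PsiW_map A B F = Psi_map (W A) (W B) (W_map A B F)"

definition UPhi :: "variant \<Rightarrow> ('i, 'a, 'b) pcat \<Rightarrow> ('i, 'a \<rightharpoonup> 'b) rcat" where
  "UPhi v X = U (Phi v X)"

definition UPhi_map :: "variant \<Rightarrow> ('i, 'a, 'b) pcat \<Rightarrow> ('i, 'a, 'b, 'j, 'c, 'd) cofun \<Rightarrow>
    ('i, 'a \<rightharpoonup> 'b, 'j, 'c \<rightharpoonup> 'd) ftor" where
  "UPhi_map v X F = U_map (Phi_map v X F)"

definition unit_at ::
    "('o, 'm) rcat \<Rightarrow> ('o, 'm, 'o, ('m \<Rightarrow> bool) \<rightharpoonup> ('m, 'm \<Rightarrow> bool) germ) ftor" where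
  "unit_at A = \<lparr>fob = (\<lambda>i \<in> Obj A. i), fmap = (\<lambda>i j. \<lambda>f \<in> Hom A i j. sect (W A) i j f)\<rparr>"

text \<open>
  The object component of the counit sends \<open>x\<close> to the point \<open>e \<mapsto> (x \<in> dom e)\<close> of
  \<open>\<O>\<^bsub>U\<Phi>X\<^esub>(i)\<close>; its arrow component sends the germ of \<open>s\<close> at that point, paired with \<open>x\<close>, to \<open>s x\<close>.
\<close>

definition counit_ob :: "variant \<Rightarrow> ('i, 'a, 'b) pcat \<Rightarrow> 'i \<Rightarrow> ('a \<rightharpoonup> (('a \<rightharpoonup> 'b) \<Rightarrow> bool))" where
  "counit_ob v X i = (\<lambda>x. if i \<in> Ix X \<and> x \<in> topspace (Sp X i)
     then Some (\<lambda>e. e \<in> RIdem (UPhi v X) i \<and> x \<in> dom e) else None)"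

definition counit_at :: "variant \<Rightarrow> ('i, 'a, 'b) pcat \<Rightarrow>
    ('i, ('a \<rightharpoonup> 'b) \<Rightarrow> bool, ('a \<rightharpoonup> 'b, ('a \<rightharpoonup> 'b) \<Rightarrow> bool) germ, 'i, 'a, 'b) cofun" where
  "counit_at v X = \<lparr>cix = (\<lambda>i \<in> Ix X. i), cob = counit_ob v X,
     car = (\<lambda>i j. if i \<in> Ix X \<and> j \<in> Ix X then
       (THE h. h \<in> Top_p (act_dom (PsiW (UPhi v X)) X (\<lambda>i. i) (counit_ob v X) i j) (Ar X i j) \<and>
          (\<forall>s \<in> Phi_hom v X i j.
             h \<circ>\<^sub>m pairp (sect (W (UPhi v X)) i j s \<circ>\<^sub>m counit_ob v X i)
                      (rstp (sect (W (UPhi v X)) i j s \<circ>\<^sub>m counit_ob v X i)) = s))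
       else Map.empty)\<rparr>"

text \<open>Fixpoints: the objects at which the counit, respectively the unit, is invertible.\<close>

definition left_fixpoint :: "variant \<Rightarrow> ('i, 'a, 'b) pcat \<Rightarrow> bool" where
  "left_fixpoint v X \<longleftrightarrow> cofunctor_iso (PsiW (UPhi v X)) X (counit_at v X)"

definition right_fixpoint :: "variant \<Rightarrow> ('o, 'm) rcat \<Rightarrow> bool" where
  "right_fixpoint v A \<longleftrightarrow> join_functor_iso v A (UPhi v (PsiW A)) (unit_at A)"

end

(*
  A join restriction category C carries, for each pair of objects i and j, the space of
  germs of its maps at points of the locale O(i): the maps f, g have the same germ at p when they
  agree on a restriction idempotent e with p(e) true.  The germs of f form an open set that the
  source map carries homeomorphically onto {p. p(rst f)}, so germs glue to a source-etale internal
  category.  Conversely an internal category gives the join restriction category of its partial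
  sections, whose restriction idempotents at i are the open subsets of the space of objects A_i.
  All arrow spaces are covered by the images of partial sections, so every axiom and every
  identity between (co)functors is checked on points of these sections, and continuity is checked
  after composition with them.

  The object part of the counit at X sends x to the point e |-> (x in dom e) of the locale of open
  sets, and it is bijective at every i precisely when each space of objects is sober; the arrow
  part is then invertible, since germs of partial sections at x correspond to arrows with source x.
  The spaces of points are sober, hence the adjunction is Galois.  The unit sends f to its section
  of germs.  Two maps with the same section agree on an idempotent that no point separates from
  their restrictions, so spatiality makes the unit injective, and a partial section of germs is
  locally of the form p |-> germ of f at p; these local representatives are compatible by
  injectivity, and their join is a preimage.
*)

theory Submission
  imports Defs
begin

section \<open>Partial continuous maps\<close>

text \<open>\<open>germ_target\<close>, \<open>germ_mult\<close>, the action on functors and the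
  counit are defined by \<open>THE\<close>, so nothing is known about them before existence and
  uniqueness are proved. Two glueing lemmas do this in all cases: \<open>germ_glue\<close> for maps
  out of a germ space and \<open>fprod_glue\<close> for maps out of a fibre product with a germ
  space. After that only values on germs matter. Cofunctor equations are equations of partial maps;
  they are translated once into equations between elements (\<open>src_ax\<close>,
  \<open>unit_ax\<close>, \<open>mult_ax\<close>). Both variants share their lemmas:
  \<open>join_category\<close> and \<open>icat\<close> carry \<open>v\<close> as a parameter, and
  inverses enter as a conditional assumption. The extra work for groupoids sits in a few places:
  inverse categories are restriction categories, partial inverses of sections are unique, inversion
  descends to germs, cofunctors carry local bisections to local bisections, and each arrow lies on a
  local bisection. The one-object case comes along because every construction keeps the set of
  objects.\<close>

lemma map_eqI: "(\<And>x y. f x = Some y \<longleftrightarrow> g x = Some y) \<Longrightarrow> f = g"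
  by (metis ext option.exhaust)

lemma map_comp_assoc: "(f \<circ>\<^sub>m g) \<circ>\<^sub>m h = f \<circ>\<^sub>m (g \<circ>\<^sub>m h)"
  by (rule ext) (simp add: map_comp_def split: option.split)

lemma pairp_Some: "pairp f g x = Some w \<longleftrightarrow> f x = Some (fst w) \<and> g x = Some (snd w)"
  by (cases w) (auto simp: pairp_def split: option.splits)

lemma rstp_Some: "rstp f x = Some y \<longleftrightarrow> y = x \<and> x \<in> dom f"
  by (auto simp: rstp_def)

lemma dom_rstp [simp]: "dom (rstp f) = dom f"
  by (auto simp: rstp_def dom_def)

lemma idp_Some: "idp X x = Some y \<longleftrightarrow> y = x \<and> x \<in> topspace X"
  by (auto simp: idp_def)

lemma proj1_Some: "proj1 T z = Some y \<longleftrightarrow> z \<in> topspace T \<and> y = fst z"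
  by (auto simp: proj1_def)

lemma comp_pairp_rstp_Some:
  "(h \<circ>\<^sub>m pairp f (rstp f)) x = Some z \<longleftrightarrow> (\<exists>a. f x = Some a \<and> h (a, x) = Some z)"
  by (auto simp: map_comp_Some_iff pairp_Some rstp_Some)

lemma topspace_fprod [simp]:
  "topspace (fprod X Y f g) = {(x, y). x \<in> topspace X \<and> y \<in> topspace Y \<and> f x = g y}"
  by (auto simp: fprod_def)

lemma openin_fprod:
  "openin X A \<Longrightarrow> openin Y B \<Longrightarrow> openin (fprod X Y f g) {(x, y). x \<in> A \<and> y \<in> B \<and> f x = g y}"
  unfolding fprod_def openin_subtopology
  by (rule exI[of _ "A \<times> B"]) (auto simp: openin_prod_Times_iff)

text \<open>Undefined points belong to no preimage, so \<open>pre f (topspace Y)\<close> is the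
  domain when the range lies in \<open>Y\<close>. Openness of the domain thus becomes a special case
  of openness of preimages, and continuity passes to composites by \<open>pre_comp\<close>.\<close>

definition pre :: "('a \<rightharpoonup> 'b) \<Rightarrow> 'b set \<Rightarrow> 'a set" where
  "pre f V = {x. \<exists>y\<in>V. f x = Some y}"

lemma pre_comp: "pre (g \<circ>\<^sub>m f) V = pre f (pre g V)"
  by (auto simp: pre_def map_comp_Some_iff)

lemma Top_p_iff:
  "f \<in> Top_p X Y \<longleftrightarrow> ran f \<subseteq> topspace Y \<and> (\<forall>V. openin Y V \<longrightarrow> openin X (pre f V))"
proof
  assume "f \<in> Top_p X Y"
  then have d: "openin X (dom f)" and c: "continuous_map (subtopology X (dom f)) Y (the \<circ> f)"
    by (auto simp: Top_p_def)
  have sub: "dom f \<subseteq> topspace X" using d openin_subset by blast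
  have "ran f \<subseteq> topspace Y"
  proof
    fix y assume "y \<in> ran f"
    then obtain x where x: "f x = Some y" by (auto simp: ran_def)
    then have "x \<in> topspace (subtopology X (dom f))" using sub by auto
    then have "(the \<circ> f) x \<in> topspace Y" using c continuous_map_image_subset_topspace by blast
    then show "y \<in> topspace Y" using x by simp
  qed
  moreover have "openin X (pre f V)" if V: "openin Y V" for V
  proof -
    have "openin (subtopology X (dom f)) {x \<in> topspace (subtopology X (dom f)). (the \<circ> f) x \<in> V}"
      using c V openin_continuous_map_preimage by blast
    moreover have "{x \<in> topspace (subtopology X (dom f)). (the \<circ> f) x \<in> V} = pre f V"
      using sub by (auto simp: pre_def)
    ultimately show ?thesis using d openin_open_subtopology by metis
  qed
  ultimately show "ran f \<subseteq> topspace Y \<and> (\<forall>V. openin Y V \<longrightarrow> openin X (pre f V))" by blast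
next
  assume H: "ran f \<subseteq> topspace Y \<and> (\<forall>V. openin Y V \<longrightarrow> openin X (pre f V))"
  have "dom f = pre f (topspace Y)" using H by (auto simp: pre_def ran_def)
  then have d: "openin X (dom f)" using H by auto
  have sub: "dom f \<subseteq> topspace X" using d openin_subset by blast
  have "continuous_map (subtopology X (dom f)) Y (the \<circ> f)"
    unfolding continuous_map
  proof (intro conjI allI impI)
    show "(the \<circ> f) ` topspace (subtopology X (dom f)) \<subseteq> topspace Y"
      using H by (auto simp: ran_def)
    fix V assume V: "openin Y V"
    have "{x \<in> topspace (subtopology X (dom f)). (the \<circ> f) x \<in> V} = pre f V"
      using sub by (auto simp: pre_def)
    moreover have "openin X (pre f V)" using H V by blast
    moreover have "pre f V \<subseteq> dom f" by (auto simp: pre_def)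
    ultimately show "openin (subtopology X (dom f))
        {x \<in> topspace (subtopology X (dom f)). (the \<circ> f) x \<in> V}"
      using d openin_open_subtopology by metis
  qed
  then show "f \<in> Top_p X Y" using d by (simp add: Top_p_def)
qed

lemma Top_pD:
  assumes "f \<in> Top_p X Y"
  shows "openin X (dom f)" "dom f \<subseteq> topspace X" "ran f \<subseteq> topspace Y"
    "\<And>V. openin Y V \<Longrightarrow> openin X (pre f V)" "\<And>x y. f x = Some y \<Longrightarrow> x \<in> topspace X"
    "\<And>x y. f x = Some y \<Longrightarrow> y \<in> topspace Y"
proof -
  show d: "openin X (dom f)" using assms by (simp add: Top_p_def)
  then show s: "dom f \<subseteq> topspace X" using openin_subset by blast
  show r: "ran f \<subseteq> topspace Y" "\<And>V. openin Y V \<Longrightarrow> openin X (pre f V)"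
    using assms by (auto simp: Top_p_iff)
  show "\<And>x y. f x = Some y \<Longrightarrow> x \<in> topspace X" "\<And>x y. f x = Some y \<Longrightarrow> y \<in> topspace Y"
    using s r by (auto simp: ran_def)
qed

lemma Top_p_comp: "f \<in> Top_p X Y \<Longrightarrow> g \<in> Top_p Y Z \<Longrightarrow> g \<circ>\<^sub>m f \<in> Top_p X Z"
  unfolding Top_p_iff by (auto simp: pre_comp ran_def map_comp_Some_iff)

lemma idp_Top_p: "idp X \<in> Top_p X X"
proof -
  have "pre (idp X) V = V \<inter> topspace X" for V by (auto simp: pre_def idp_Some)
  then show ?thesis unfolding Top_p_iff by (auto simp: ran_def idp_Some)
qed

lemma comp_idp: "f \<in> Top_p X Y \<Longrightarrow> f \<circ>\<^sub>m idp X = f"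
  by (rule map_eqI) (auto simp: map_comp_Some_iff idp_Some dest: Top_pD(5))

lemma rstp_Top_p: "f \<in> Top_p X Y \<Longrightarrow> rstp f \<in> Top_p X X"
proof -
  assume f: "f \<in> Top_p X Y"
  have "pre (rstp f) V = V \<inter> dom f" for V by (auto simp: pre_def rstp_Some)
  then show ?thesis using Top_pD[OF f] unfolding Top_p_iff by (auto simp: ran_def rstp_Some)
qed

lemma restrict_Top_p: "f \<in> Top_p X Y \<Longrightarrow> openin X G \<Longrightarrow> f |` G \<in> Top_p X Y"
proof -
  assume f: "f \<in> Top_p X Y" and G: "openin X G"
  have "pre (f |` G) V = pre f V \<inter> G" for V by (auto simp: pre_def restrict_map_def)
  moreover have "ran (f |` G) \<subseteq> topspace Y"
    using Top_pD(6)[OF f] by (auto simp: ran_def restrict_map_def split: if_splits)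
  ultimately show ?thesis using Top_pD(4)[OF f] G unfolding Top_p_iff by (simp add: openin_Int)
qed

lemma map_le_iff_Some: "f \<subseteq>\<^sub>m g \<longleftrightarrow> (\<forall>x y. f x = Some y \<longrightarrow> g x = Some y)"
  by (force simp: map_le_def dom_def)

text \<open>Preimages under a union of graphs are unions of preimages. That the union is a function
  at all is expressed by naming it \<open>f\<close> and requiring every member to lie below
  it.\<close>

lemma Top_p_union:
  assumes "\<And>x y. f x = Some y \<Longrightarrow> \<exists>s\<in>S. s x = Some y"
    and "\<And>s. s \<in> S \<Longrightarrow> s \<in> Top_p X Y \<and> s \<subseteq>\<^sub>m f"
  shows "f \<in> Top_p X Y"
proof -
  have *: "f x = Some y \<longleftrightarrow> (\<exists>s\<in>S. s x = Some y)" for x y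
    using assms unfolding map_le_iff_Some by blast
  have "pre f V = (\<Union>s\<in>S. pre s V)" for V
    by (simp only: pre_def *) blast
  moreover have "openin X (\<Union>s\<in>S. pre s V)" if "openin Y V" for V
    using assms(2) Top_pD(4) that by blast
  moreover have "ran f \<subseteq> topspace Y"
  proof
    fix y assume "y \<in> ran f"
    then obtain x s where "s \<in> S" "s x = Some y" using * by (auto simp: ran_def)
    then show "y \<in> topspace Y" using assms(2) Top_pD(6) by metis
  qed
  ultimately show ?thesis unfolding Top_p_iff by simp
qed

lemma comp_rstp_Some: "(g \<circ>\<^sub>m rstp f) x = Some y \<longleftrightarrow> x \<in> dom f \<and> g x = Some y"
  by (auto simp: map_comp_Some_iff rstp_Some)

text \<open>The restriction order on partial functions is inclusion of graphs, so joins of partial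
  maps can be handled as unions.\<close>

lemma lep_iff: "lep f g \<longleftrightarrow> f \<subseteq>\<^sub>m g"
proof
  assume "lep f g"
  then have "f x = (g \<circ>\<^sub>m rstp f) x" for x unfolding lep_def by (rule fun_cong)
  then show "f \<subseteq>\<^sub>m g" unfolding map_le_iff_Some using comp_rstp_Some by metis
next
  assume "f \<subseteq>\<^sub>m g"
  then have "f x = Some y \<longleftrightarrow> (g \<circ>\<^sub>m rstp f) x = Some y" for x y
    unfolding comp_rstp_Some map_le_iff_Some dom_def by force
  then show "lep f g" unfolding lep_def by (rule map_eqI)
qed

text \<open>Any upper bound can be cut down to the open set where some member of \<open>S\<close> is
  defined, and the result is again an upper bound. Hence the least one is defined nowhere else, and
  it is the union of the graphs.\<close>

lemma is_joinp_iff: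
  assumes S: "S \<subseteq> Top_p X Y"
  shows "is_joinp X Y S f \<longleftrightarrow>
    f \<in> Top_p X Y \<and> (\<forall>x y. f x = Some y \<longleftrightarrow> (\<exists>s\<in>S. s x = Some y))"
proof
  assume J: "is_joinp X Y S f"
  let ?G = "\<Union>(dom ` S)"
  have f: "f \<in> Top_p X Y" and ub: "\<And>s. s \<in> S \<Longrightarrow> s \<subseteq>\<^sub>m f" using J by (auto simp: is_joinp_def lep_iff)
  have "openin X ?G" using S Top_pD(1) by blast
  then have "f |` ?G \<in> Top_p X Y" using f restrict_Top_p by blast
  moreover have "\<forall>s\<in>S. s \<subseteq>\<^sub>m f |` ?G" using ub
    by (force simp: map_le_def restrict_map_def)
  ultimately have "f \<subseteq>\<^sub>m f |` ?G" using J by (auto simp: is_joinp_def lep_iff)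
  then have le: "\<And>x y. f x = Some y \<Longrightarrow> (f |` ?G) x = Some y" unfolding map_le_iff_Some by blast
  have "\<exists>s\<in>S. s x = Some y" if y: "f x = Some y" for x y
  proof -
    obtain s where s: "s \<in> S" "x \<in> dom s"
      using le[OF y] by (auto simp: restrict_map_def split: if_splits)
    then have "s x = f x" using ub by (auto simp: map_le_def)
    then show ?thesis using s y by auto
  qed
  moreover have "f x = Some y" if "s \<in> S" "s x = Some y" for s x y
    using ub that by (force simp: map_le_iff_Some)
  ultimately show "f \<in> Top_p X Y \<and> (\<forall>x y. f x = Some y \<longleftrightarrow> (\<exists>s\<in>S. s x = Some y))"
    using f by (intro conjI allI iffI) auto
next
  assume "f \<in> Top_p X Y \<and> (\<forall>x y. f x = Some y \<longleftrightarrow> (\<exists>s\<in>S. s x = Some y))"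
  then show "is_joinp X Y S f" by (auto simp: is_joinp_def lep_iff map_le_iff_Some)
qed

lemma is_joinp_unique:
  "is_joinp X Y S f \<Longrightarrow> is_joinp X Y S g \<Longrightarrow> f = g"
  unfolding is_joinp_def lep_iff using map_le_antisym by blast

lemma total_maps_iff: "f \<in> total_maps X Y \<longleftrightarrow> f \<in> Top_p X Y \<and> dom f = topspace X"
proof -
  have "rstp f = idp X \<longleftrightarrow> dom f = topspace X"
  proof
    assume "rstp f = idp X"
    then have "dom (rstp f) = dom (idp X)" by simp
    then show "dom f = topspace X" by (simp only: dom_rstp) (simp add: idp_def dom_def)
  qed (simp add: rstp_def idp_def)
  then show ?thesis by (simp add: total_maps_def)
qed

lemma total_mapsD:
  assumes "f \<in> total_maps X Y"
  shows "f \<in> Top_p X Y" "\<And>x. x \<in> topspace X \<Longrightarrow> \<exists>y\<in>topspace Y. f x = Some y"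
    "\<And>x y. f x = Some y \<Longrightarrow> x \<in> topspace X \<and> y \<in> topspace Y"
proof -
  show f: "f \<in> Top_p X Y" using assms by (simp add: total_maps_iff)
  show "\<And>x y. f x = Some y \<Longrightarrow> x \<in> topspace X \<and> y \<in> topspace Y"
    using Top_pD(5,6)[OF f] by blast
  show "\<exists>y\<in>topspace Y. f x = Some y" if "x \<in> topspace X" for x
  proof -
    have "x \<in> dom f" using assms that by (simp add: total_maps_iff)
    then show ?thesis using Top_pD(6)[OF f] by blast
  qed
qed

text \<open>The two equations for a partial inverse say together that the graphs of \<open>s\<close>
  and \<open>t\<close> are converse to each other.\<close>

lemma partial_isos_iff:
  "s \<in> partial_isos X Y \<longleftrightarrow>
     s \<in> Top_p X Y \<and> (\<exists>t\<in>Top_p Y X. \<forall>x y. s x = Some y \<longleftrightarrow> t y = Some x)"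
proof -
  have "t \<circ>\<^sub>m s = rstp s \<and> s \<circ>\<^sub>m t = rstp t \<longleftrightarrow> (\<forall>x y. s x = Some y \<longleftrightarrow> t y = Some x)" for t
  proof
    assume H: "t \<circ>\<^sub>m s = rstp s \<and> s \<circ>\<^sub>m t = rstp t"
    then have 1: "(t \<circ>\<^sub>m s) x = rstp s x" "(s \<circ>\<^sub>m t) y = rstp t y" for x y by auto
    have "t y = Some x" if "s x = Some y" for x y
      using 1(1)[of x] that by (simp add: rstp_def dom_def)
    moreover have "s x = Some y" if "t y = Some x" for x y
      using 1(2)[of y] that by (simp add: rstp_def dom_def)
    ultimately show "\<forall>x y. s x = Some y \<longleftrightarrow> t y = Some x" by blast
  next
    assume H: "\<forall>x y. s x = Some y \<longleftrightarrow> t y = Some x"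
    have "t \<circ>\<^sub>m s = rstp s" by (rule map_eqI) (auto simp: map_comp_Some_iff rstp_Some H)
    moreover have "s \<circ>\<^sub>m t = rstp t" by (rule map_eqI) (auto simp: map_comp_Some_iff rstp_Some H[rule_format, symmetric])
    ultimately show "t \<circ>\<^sub>m s = rstp s \<and> s \<circ>\<^sub>m t = rstp t" by simp
  qed
  then show ?thesis by (auto simp: partial_isos_def)
qed

text \<open>Since joins are unions, the family may be enlarged to all partial isomorphisms below
  \<open>p\<close>; what remains is a condition at each point.\<close>

lemma local_homeo_iff:
  "local_homeo X Y p \<longleftrightarrow> p \<in> total_maps X Y \<and>
     (\<forall>x\<in>topspace X. \<exists>s\<in>partial_isos X Y. x \<in> dom s \<and> s \<subseteq>\<^sub>m p)"
proof
  assume "local_homeo X Y p"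
  then obtain S where p: "p \<in> total_maps X Y" and S: "S \<subseteq> partial_isos X Y" and "is_joinp X Y S p"
    by (auto simp: local_homeo_def)
  moreover have "S \<subseteq> Top_p X Y" using S by (auto simp: partial_isos_def)
  ultimately have "\<And>x y. p x = Some y \<longleftrightarrow> (\<exists>s\<in>S. s x = Some y)" by (simp add: is_joinp_iff)
  note * = this
  have "\<exists>s\<in>partial_isos X Y. x \<in> dom s \<and> s \<subseteq>\<^sub>m p" if "x \<in> topspace X" for x
  proof -
    obtain y where "p x = Some y" using total_mapsD(2)[OF p \<open>x \<in> topspace X\<close>] by blast
    then obtain s where "s \<in> S" "s x = Some y" using * by blast
    moreover have "s \<subseteq>\<^sub>m p" using * \<open>s \<in> S\<close> unfolding map_le_iff_Some by blast
    ultimately show ?thesis using S by blast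
  qed
  then show "p \<in> total_maps X Y \<and>
     (\<forall>x\<in>topspace X. \<exists>s\<in>partial_isos X Y. x \<in> dom s \<and> s \<subseteq>\<^sub>m p)"
    using p by blast
next
  assume H: "p \<in> total_maps X Y \<and>
     (\<forall>x\<in>topspace X. \<exists>s\<in>partial_isos X Y. x \<in> dom s \<and> s \<subseteq>\<^sub>m p)"
  let ?S = "{s \<in> partial_isos X Y. s \<subseteq>\<^sub>m p}"
  have "is_joinp X Y ?S p"
  proof (subst is_joinp_iff)
    show "?S \<subseteq> Top_p X Y" by (auto simp: partial_isos_def)
    show "p \<in> Top_p X Y \<and> (\<forall>x y. p x = Some y \<longleftrightarrow> (\<exists>s\<in>?S. s x = Some y))"
    proof (intro conjI allI iffI)
      show "p \<in> Top_p X Y" using H by (simp add: total_maps_iff)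
      fix x y
      show "p x = Some y" if "\<exists>s\<in>?S. s x = Some y" using that by (auto simp: map_le_iff_Some)
      assume y: "p x = Some y"
      then have "x \<in> topspace X" using H total_mapsD(3) by metis
      then obtain s where s: "s\<in>partial_isos X Y" "x \<in> dom s" "s \<subseteq>\<^sub>m p" using H by blast
      then have "s x = Some y" using y by (force simp: map_le_def)
      then show "\<exists>s\<in>?S. s x = Some y" using s by blast
    qed
  qed
  then show "local_homeo X Y p" using H by (auto simp: local_homeo_def intro!: exI[of _ ?S])
qed

text \<open>Open sets of the fibre product are traces of open sets of the product, so every value
  has a box around it, and the preimage of a box is an intersection of two preimages. Hypothesis
  \<open>c\<close> keeps the values inside the fibre product.\<close>

lemma pairp_Top_p:
  assumes f: "f \<in> Top_p T0 X" and g: "g \<in> Top_p T0 Y"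
    and c: "\<And>w x y. f w = Some x \<Longrightarrow> g w = Some y \<Longrightarrow> p x = q y"
  shows "pairp f g \<in> Top_p T0 (fprod X Y p q)"
  unfolding Top_p_iff
proof (intro conjI allI impI)
  show "ran (pairp f g) \<subseteq> topspace (fprod X Y p q)"
    using Top_pD(6)[OF f] Top_pD(6)[OF g] c by (auto simp: ran_def pairp_Some)
  fix V assume "openin (fprod X Y p q) V"
  then obtain T where T: "openin (prod_topology X Y) T" and V: "V = T \<inter> {(x, y). p x = q y}"
    by (auto simp: fprod_def openin_subtopology)
  have "\<exists>N. openin T0 N \<and> w \<in> N \<and> N \<subseteq> pre (pairp f g) V" if "w \<in> pre (pairp f g) V" for w
  proof -
    obtain x y where xy: "f w = Some x" "g w = Some y" "(x, y) \<in> V"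
      using \<open>w \<in> pre (pairp f g) V\<close> by (auto simp: pre_def pairp_Some)
    then have "(x, y) \<in> T" using V by blast
    then obtain A B where AB: "openin X A" "openin Y B" "x \<in> A" "y \<in> B" "A \<times> B \<subseteq> T"
      using T[unfolded openin_prod_topology_alt, rule_format, of x y] by blast
    have "openin T0 (pre f A \<inter> pre g B)" by (intro openin_Int Top_pD(4)[OF f] Top_pD(4)[OF g] AB)
    moreover have "w \<in> pre f A \<inter> pre g B" using xy AB by (auto simp: pre_def)
    moreover have "pre f A \<inter> pre g B \<subseteq> pre (pairp f g) V"
    proof
      fix v assume "v \<in> pre f A \<inter> pre g B"
      then obtain a b where ab: "f v = Some a" "g v = Some b" "a \<in> A" "b \<in> B"
        by (auto simp: pre_def)
      then have "(a, b) \<in> V" using c[OF ab(1,2)] AB(5) V by auto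
      then show "v \<in> pre (pairp f g) V" using ab by (force simp: pre_def pairp_Some)
    qed
    ultimately show ?thesis by blast
  qed
  then show "openin T0 (pre (pairp f g) V)" by (subst openin_subopen) blast
qed

lemma section_Some:
  assumes "p \<circ>\<^sub>m s = rstp s" "s x = Some a"
  shows "p a = Some x"
proof -
  have "(p \<circ>\<^sub>m s) x = rstp s x" using assms(1) by (rule fun_cong)
  then show ?thesis using assms(2) by (simp add: rstp_def dom_def)
qed

text \<open>Near \<open>a = s x\<close> openness comes from injectivity. Let \<open>u\<close> be a
  partial isomorphism below \<open>p\<close> through \<open>a\<close>, and take the points
  \<open>b\<close> for which \<open>s (u b)\<close> is defined and again in \<open>dom u\<close>.
  Both \<open>b\<close> and \<open>s (u b)\<close> have the image \<open>u b\<close> under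
  \<open>u\<close>, so they coincide and \<open>b\<close> lies in the image of
  \<open>s\<close>.\<close>

lemma local_homeo_section_open:
  assumes p: "local_homeo E X p" and s: "s \<in> Top_p X E" "p \<circ>\<^sub>m s = rstp s"
  shows "openin E (ran s)"
proof (subst openin_subopen, intro ballI)
  have ps: "p a = Some x" if "s x = Some a" for x a
    using section_Some[OF s(2) that] .
  fix a assume "a \<in> ran s"
  then obtain x where x: "s x = Some a" by (auto simp: ran_def)
  then have "a \<in> topspace E" using Top_pD(6)[OF s(1)] by blast
  then obtain u where u: "u \<in> partial_isos E X" and a: "a \<in> dom u" and up: "u \<subseteq>\<^sub>m p"
    using p by (auto simp: local_homeo_iff)
  obtain t where ut: "u \<in> Top_p E X" "\<And>x y. u x = Some y \<longleftrightarrow> t y = Some x"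
    using u unfolding partial_isos_iff by blast
  let ?N = "pre u (pre s (dom u))"
  have "openin E ?N" using Top_pD(1,4)[OF ut(1)] Top_pD(4)[OF s(1)] by blast
  moreover have "a \<in> ?N" using a x up ps[OF x] by (auto simp: pre_def map_le_iff_Some)
  moreover have "?N \<subseteq> ran s"
  proof
    fix b assume "b \<in> ?N"
    then obtain y c where bc: "u b = Some y" "s y = Some c" "c \<in> dom u" by (auto simp: pre_def)
    then have "u c = Some y" using ps[of y c] up by (force simp: map_le_def)
    then have "b = c" using bc ut(2) by (metis option.inject)
    then show "b \<in> ran s" using bc by (auto simp: ran_def)
  qed
  ultimately show "\<exists>T. openin E T \<and> a \<in> T \<and> T \<subseteq> ran s" by blast
qed

text \<open>The maps \<open>(s \<circ> \<alpha>, 1)\<close>, for \<open>s\<close> a partial section of \<open>p\<close>, are open embeddings into the fibre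
  product, so continuity may be tested along a jointly surjective family of them.\<close>

lemma fprod_Top_pI:
  assumes p: "local_homeo E X p" and \<alpha>: "\<alpha> \<in> total_maps Y X"
    and F: "\<And>s. s \<in> F \<Longrightarrow> s \<in> Top_p X E" "\<And>s. s \<in> F \<Longrightarrow> p \<circ>\<^sub>m s = rstp s"
    and cover: "\<And>a. a \<in> topspace E \<Longrightarrow> \<exists>s\<in>F. a \<in> ran s"
    and d: "dom h \<subseteq> topspace (fprod E Y p \<alpha>)"
    and h: "\<And>s. s \<in> F \<Longrightarrow> h \<circ>\<^sub>m pairp (s \<circ>\<^sub>m \<alpha>) (rstp (s \<circ>\<^sub>m \<alpha>)) \<in> Top_p Y Z"
  shows "h \<in> Top_p (fprod E Y p \<alpha>) Z"
proof -
  let ?k = "\<lambda>s. h \<circ>\<^sub>m pairp (s \<circ>\<^sub>m \<alpha>) (rstp (s \<circ>\<^sub>m \<alpha>))"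
  have ps: "p a = Some x" if "s \<in> F" "s x = Some a" for s x a
    by (rule section_Some[OF F(2)[OF that(1)] that(2)])
  \<comment> \<open>Over the image of \<open>s\<close> the first coordinate is determined by the
    second, so \<open>h\<close> depends there on \<open>y\<close> alone.\<close>
  have hk: "?k s y = h (a, y)" if s: "s \<in> F" "a \<in> ran s" "p a = \<alpha> y" for s a y
  proof -
    obtain x where x: "s x = Some a" using s(2) unfolding ran_def by blast
    then have "\<alpha> y = Some x" using ps[OF s(1) x] s(3) by simp
    then have "(s \<circ>\<^sub>m \<alpha>) y = Some a" using x by simp
    then show ?thesis by (simp add: pairp_def rstp_def dom_def)
  qed
  have "ran h \<subseteq> topspace Z"
  proof
    fix z assume "z \<in> ran h"
    then obtain a y where ay: "h (a, y) = Some z" by (auto simp: ran_def)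
    then have "(a, y) \<in> topspace (fprod E Y p \<alpha>)" using d by blast
    then obtain s where "s \<in> F" "a \<in> ran s" "p a = \<alpha> y" using cover[of a] by auto
    then show "z \<in> topspace Z" using hk[of s a y] ay Top_pD(6)[OF h[of s]] by metis
  qed
  moreover have "openin (fprod E Y p \<alpha>) (pre h V)" if V: "openin Z V" for V
  proof -
    \<comment> \<open>Each piece is the trace of a box with open sides: the image of
      \<open>s\<close> is open because \<open>s\<close> is a section of a local
      homeomorphism.\<close>
    have "pre h V = (\<Union>s\<in>F. {(a, y). a \<in> ran s \<and> y \<in> pre (?k s) V \<and> p a = \<alpha> y})" (is "_ = ?R")
    proof
      show "pre h V \<subseteq> ?R"
      proof
        fix w assume w: "w \<in> pre h V"
        obtain a y where ay: "w = (a, y)" by (cases w)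
        then have "(a, y) \<in> topspace (fprod E Y p \<alpha>)" using d w by (auto simp: pre_def)
        then obtain s where "s \<in> F" "a \<in> ran s" "p a = \<alpha> y" using cover[of a] by auto
        moreover then have "y \<in> pre (?k s) V" using hk[of s a y] w ay by (simp add: pre_def)
        ultimately show "w \<in> ?R" using ay by blast
      qed
      show "?R \<subseteq> pre h V"
      proof
        fix w assume "w \<in> ?R"
        then obtain s a y where "w = (a, y)" "s \<in> F" "a \<in> ran s" "y \<in> pre (?k s) V" "p a = \<alpha> y"
          by auto
        then show "w \<in> pre h V" using hk[of s a y] by (simp add: pre_def)
      qed
    qed
    moreover have "openin (fprod E Y p \<alpha>) {(a, y). a \<in> ran s \<and> y \<in> pre (?k s) V \<and> p a = \<alpha> y}"
      if "s \<in> F" for s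
      by (intro openin_fprod local_homeo_section_open[OF p] F(1)[OF that] F(2)[OF that]
          Top_pD(4)[OF h[OF that] V])
    ultimately show ?thesis by auto
  qed
  ultimately show ?thesis by (auto simp: Top_p_iff)
qed

section \<open>Join restriction and join inverse categories\<close>

context category
begin

lemma comp_in [simp]: "f \<in> Hom C i j \<Longrightarrow> g \<in> Hom C j k \<Longrightarrow> Comp C i j k g f \<in> Hom C i k"
  by (rule comp_hom)

lemma hom_dom: "f \<in> Hom C i j \<Longrightarrow> i \<in> Obj C"
  and hom_cod: "f \<in> Hom C i j \<Longrightarrow> j \<in> Obj C"
  using hom_obj by auto

end

section \<open>Calculus of restriction idempotents and the restriction order\<close>

context restriction_category
begin

lemma rst_in [simp]: "f \<in> Hom C i j \<Longrightarrow> Rst C i j f \<in> Hom C i i"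
  by (rule rst_hom)

lemma rst_idn: "i \<in> Obj C \<Longrightarrow> Rst C i i (Idn C i) = Idn C i"
  using comp_rst[OF idn_hom] idn_comp[OF rst_hom[OF idn_hom]] by simp

lemma rst_rst: "f \<in> Hom C i j \<Longrightarrow> Rst C i i (Rst C i j f) = Rst C i j f"
  using rst_comp_rst[of f i j "Idn C i" i] idn_comp[OF rst_hom] rst_idn
  by (simp add: idn_hom hom_dom)

lemma RIdem_in: "e \<in> RIdem C i \<Longrightarrow> e \<in> Hom C i i"
  by (simp add: RIdem_def)

lemma RIdem_rst: "e \<in> RIdem C i \<Longrightarrow> Rst C i i e = e"
  by (simp add: RIdem_def)

lemma rst_RIdem: "f \<in> Hom C i j \<Longrightarrow> Rst C i j f \<in> RIdem C i"
  by (simp add: RIdem_def rst_rst)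

lemma idn_RIdem: "i \<in> Obj C \<Longrightarrow> Idn C i \<in> RIdem C i"
  by (simp add: RIdem_def rst_idn idn_hom)

lemma rst_comp_RIdem:
  "g \<in> Hom C i k \<Longrightarrow> e \<in> RIdem C i \<Longrightarrow> Rst C i k (Comp C i i k g e) = Comp C i i i (Rst C i k g) e"
  using rst_comp_rst[of e i i g k] by (simp add: RIdem_def)

lemma RIdem_comp: "e \<in> RIdem C i \<Longrightarrow> d \<in> RIdem C i \<Longrightarrow> Comp C i i i e d \<in> RIdem C i"
  using rst_comp_RIdem[of e i i d] by (simp add: RIdem_def)

lemma RIdem_commute: "e \<in> RIdem C i \<Longrightarrow> d \<in> RIdem C i \<Longrightarrow> Comp C i i i e d = Comp C i i i d e"
  using rst_commute[of e i i d i] by (simp add: RIdem_def)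

lemma RIdem_idem: "e \<in> RIdem C i \<Longrightarrow> Comp C i i i e e = e"
  using comp_rst[of e i i] by (simp add: RIdem_def)

lemma comp_assoc': "f \<in> Hom C i j \<Longrightarrow> g \<in> Hom C j k \<Longrightarrow> h \<in> Hom C k l \<Longrightarrow>
    Comp C i j l (Comp C j k l h g) f = Comp C i k l h (Comp C i j k g f)"
  by (rule comp_assoc[symmetric])

text \<open>Moving \<open>Rst g\<close> across \<open>f\<close> by \<open>rst_after\<close> leaves a
  product of the idempotents of \<open>f\<close> and of \<open>g f\<close>. After commuting them,
  the one of \<open>f\<close> is absorbed because \<open>g f\<close> absorbs it. This makes inverse
  images of idempotents functorial, see \<open>push_comp\<close>.\<close>

lemma rst_comp:
  assumes f: "f \<in> Hom C i j" and g: "g \<in> Hom C j k"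
  shows "Rst C i j (Comp C i j j (Rst C j k g) f) = Rst C i k (Comp C i j k g f)"
proof -
  have gf: "Comp C i j k g f \<in> Hom C i k" using f g by simp
  have "Rst C i j (Comp C i j j (Rst C j k g) f) =
      Rst C i j (Comp C i i j f (Rst C i k (Comp C i j k g f)))"
    using rst_after[OF f g] by simp
  also have "\<dots> = Comp C i i i (Rst C i j f) (Rst C i k (Comp C i j k g f))"
    by (rule rst_comp_rst[OF gf f])
  also have "\<dots> = Comp C i i i (Rst C i k (Comp C i j k g f)) (Rst C i j f)"
    by (rule rst_commute[OF f gf])
  also have "\<dots> = Rst C i k (Comp C i i k (Comp C i j k g f) (Rst C i j f))"
    by (rule rst_comp_rst[OF f gf, symmetric])
  also have "Comp C i i k (Comp C i j k g f) (Rst C i j f) = Comp C i j k g f"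
    using comp_assoc'[OF rst_hom[OF f] f g] comp_rst[OF f] by simp
  finally show ?thesis .
qed

text \<open>Any idempotent \<open>e\<close> with \<open>f = g e\<close> serves as a witness: the
  restriction of \<open>g e\<close> is that of \<open>g\<close> times \<open>e\<close>, and
  \<open>g\<close> absorbs its own restriction.\<close>

lemma rleI:
  assumes "g \<in> Hom C i j" "e \<in> RIdem C i" "f = Comp C i i j g e"
  shows "rle C i j f g"
proof -
  have "Comp C i i j g (Rst C i j f) = Comp C i i j g (Comp C i i i (Rst C i j g) e)"
    using rst_comp_RIdem[OF assms(1,2)] assms(3) by simp
  also have "\<dots> = Comp C i i j g e"
    using comp_assoc[OF RIdem_in[OF assms(2)] rst_hom[OF assms(1)] assms(1)] comp_rst[OF assms(1)]
    by simp
  finally show ?thesis using assms(3) by (simp add: rle_def)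
qed

lemma rle_refl: "f \<in> Hom C i j \<Longrightarrow> rle C i j f f"
  by (simp add: rle_def comp_rst)

lemma rle_rst:
  assumes "f \<in> Hom C i j" "g \<in> Hom C i j" "rle C i j f g"
  shows "rle C i i (Rst C i j f) (Rst C i j g)"
proof (rule rleI)
  show "Rst C i j g \<in> Hom C i i" "Rst C i j f \<in> RIdem C i" using assms by (auto intro: rst_RIdem)
  show "Rst C i j f = Comp C i i i (Rst C i j g) (Rst C i j f)"
    using rst_comp_rst[OF assms(1,2)] assms(3) by (simp add: rle_def)
qed

lemma rle_RIdem:
  "e \<in> RIdem C i \<Longrightarrow> d \<in> RIdem C i \<Longrightarrow> rle C i i e d \<longleftrightarrow> Comp C i i i d e = e"
  by (auto simp: rle_def RIdem_rst)

lemma rle_RIdem_antisym: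
  "e \<in> RIdem C i \<Longrightarrow> d \<in> RIdem C i \<Longrightarrow> rle C i i e d \<Longrightarrow> rle C i i d e \<Longrightarrow> e = d"
  using RIdem_commute[of e i d] by (simp add: rle_RIdem)

lemma rle_eqI:
  assumes "f \<in> Hom C i j" "g \<in> Hom C i j" "rle C i j f g" "rle C i i (Rst C i j g) (Rst C i j f)"
  shows "f = g"
proof -
  have "Rst C i j f = Rst C i j g"
    by (rule rle_RIdem_antisym[OF rst_RIdem[OF assms(1)] rst_RIdem[OF assms(2)]
          rle_rst[OF assms(1,2,3)] assms(4)])
  then show ?thesis using assms comp_rst[of g i j] by (simp add: rle_def)
qed

lemma rle_antisym:
  assumes "f \<in> Hom C i j" "g \<in> Hom C i j" "rle C i j f g" "rle C i j g f"
  shows "f = g"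
  by (rule rle_eqI[OF assms(1,2,3) rle_rst[OF assms(2,1,4)]])

lemma rle_comp_left:
  assumes f: "f \<in> Hom C i j" and g: "g \<in> Hom C i j" and le: "rle C i j f g" and h: "h \<in> Hom C j k"
  shows "rle C i k (Comp C i j k h f) (Comp C i j k h g)"
proof (rule rleI)
  show "Comp C i j k h g \<in> Hom C i k" "Rst C i j f \<in> RIdem C i"
    using f g h by (auto intro: rst_RIdem)
  show "Comp C i j k h f = Comp C i i k (Comp C i j k h g) (Rst C i j f)"
    using comp_assoc'[OF rst_hom[OF f] g h] le by (simp add: rle_def)
qed

lemma rle_comp_RIdem: "f \<in> Hom C i j \<Longrightarrow> e \<in> RIdem C i \<Longrightarrow> rle C i j (Comp C i i j f e) f"
  by (rule rleI) auto

lemma rle_idn: "e \<in> RIdem C i \<Longrightarrow> rle C i i e (Idn C i)"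
  using RIdem_in[of e i] hom_dom[of e i i] idn_comp[of e i i] idn_hom[of i]
  by (intro rleI[of "Idn C i" i i e]) auto

text \<open>Together with \<open>rle_idn\<close> this identifies the restriction idempotents with
  the maps below the identity, which is why a join of idempotents is again an idempotent.\<close>

lemma rle_idnD: "e \<in> Hom C i i \<Longrightarrow> rle C i i e (Idn C i) \<Longrightarrow> e \<in> RIdem C i"
  unfolding rle_def using idn_comp[OF rst_hom, of e i i] by (simp add: RIdem_def)

text \<open>Both composites equal \<open>h\<close> restricted to the common domain. Hence
  compatibility comes for free for every family that has an upper bound.\<close>

lemma rcompat_bounded:
  assumes f: "f \<in> Hom C i j" and g: "g \<in> Hom C i j" and h: "h \<in> Hom C i j"
    and le: "rle C i j f h" "rle C i j g h"
  shows "rcompat C i j f g"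
proof -
  have "Comp C i i j f (Rst C i j g) = Comp C i i j (Comp C i i j h (Rst C i j f)) (Rst C i j g)"
    using le(1) by (simp add: rle_def)
  also have "\<dots> = Comp C i i j h (Comp C i i i (Rst C i j f) (Rst C i j g))"
    using f g h by (intro comp_assoc') auto
  also have "\<dots> = Comp C i i j h (Comp C i i i (Rst C i j g) (Rst C i j f))"
    using rst_commute[OF f g] by simp
  also have "\<dots> = Comp C i i j (Comp C i i j h (Rst C i j g)) (Rst C i j f)"
    using f g h by (intro comp_assoc) auto
  also have "\<dots> = Comp C i i j g (Rst C i j f)"
    using le(2) by (simp add: rle_def)
  finally show ?thesis by (simp add: rcompat_def)
qed

lemma is_join_unique: "is_join C i j S f \<Longrightarrow> is_join C i j S g \<Longrightarrow> f = g"
  unfolding is_join_def using rle_antisym by blast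

end

section \<open>Commuting idempotents and the restriction structure of an inverse category\<close>

context inverse_category
begin

lemma is_pinv: "s \<in> Hom C i j \<Longrightarrow> is_pinv C i j s (pinv C i j s)"
  unfolding pinv_def by (rule theI') (rule unique_pinv)

lemma pinv_in [simp]: "s \<in> Hom C i j \<Longrightarrow> pinv C i j s \<in> Hom C j i"
  using is_pinv by (simp add: is_pinv_def)

lemma pinv_eqI: "s \<in> Hom C i j \<Longrightarrow> is_pinv C i j s t \<Longrightarrow> pinv C i j s = t"
  using is_pinv unique_pinv by blast

lemma comp_pinv_comp:
  "s \<in> Hom C i j \<Longrightarrow> Comp C i i j s (Comp C i j i (pinv C i j s) s) = s"
  "s \<in> Hom C i j \<Longrightarrow> Comp C j j i (pinv C i j s) (Comp C j i j s (pinv C i j s)) = pinv C i j s"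
  using is_pinv by (auto simp: is_pinv_def)

lemma comp_pinv_comp':
  "s \<in> Hom C i j \<Longrightarrow> Comp C i j j (Comp C j i j s (pinv C i j s)) s = s"
  "s \<in> Hom C i j \<Longrightarrow> Comp C j i i (Comp C i j i (pinv C i j s) s) (pinv C i j s) = pinv C i j s"
  using comp_pinv_comp comp_assoc[of s i j "pinv C i j s" i s j]
    comp_assoc[of "pinv C i j s" j i s j "pinv C i j s" i] by auto

lemma pinv_pinv: "s \<in> Hom C i j \<Longrightarrow> pinv C j i (pinv C i j s) = s"
  by (rule pinv_eqI) (auto simp: is_pinv_def comp_pinv_comp)

lemma pinv_idem: "e \<in> Hom C i i \<Longrightarrow> Comp C i i i e e = e \<Longrightarrow> pinv C i i e = e"
  by (rule pinv_eqI) (auto simp: is_pinv_def)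

lemma pinv_comp_idem:
  assumes "s \<in> Hom C i j"
  shows "Comp C i i i (Comp C i j i (pinv C i j s) s) (Comp C i j i (pinv C i j s) s) =
    Comp C i j i (pinv C i j s) s"
  using comp_assoc[of "Comp C i j i (pinv C i j s) s" i i s j "pinv C i j s" i] comp_pinv_comp(1)[OF assms]
    assms by simp

text \<open>The classical argument for inverse semigroups. If \<open>t\<close> is the inverse of
  \<open>e f\<close>, then so is \<open>f t e\<close>; hence \<open>t = f t e\<close>, and this
  element is idempotent. An idempotent is its own inverse, so \<open>e f = t\<close>.\<close>

lemma idem_comp_idem:
  assumes e: "e \<in> Hom C i i" "Comp C i i i e e = e" and f: "f \<in> Hom C i i" "Comp C i i i f f = f"
  shows "Comp C i i i (Comp C i i i e f) (Comp C i i i e f) = Comp C i i i e f"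
proof -
  \<comment> \<open>Hiding the object indices turns the endomorphisms of \<open>i\<close> into a
    plain monoid, so that associativity can be used as a rewrite rule.\<close>
  define m where "m = Comp C i i i"
  define H where "H = Hom C i i"
  have cl: "\<And>x y. x \<in> H \<Longrightarrow> y \<in> H \<Longrightarrow> m x y \<in> H" by (simp add: m_def H_def)
  have as: "\<And>x y z. x \<in> H \<Longrightarrow> y \<in> H \<Longrightarrow> z \<in> H \<Longrightarrow> m (m x y) z = m x (m y z)"
    unfolding m_def H_def by (rule comp_assoc[symmetric])
  have eH: "e \<in> H" "m e e = e" and fH: "f \<in> H" "m f f = f" using e f by (simp_all add: m_def H_def)
  have ee: "\<And>x. x \<in> H \<Longrightarrow> m e (m e x) = m e x" and ff: "\<And>x. x \<in> H \<Longrightarrow> m f (m f x) = m f x"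
    using as eH fH by metis+
  define t where "t = pinv C i i (m e f)"
  have ef: "m e f \<in> H" using cl eH fH by simp
  have t: "t \<in> H" using ef by (simp add: t_def H_def)
  have t1: "m e (m f (m t (m e f))) = m e f" and t2: "m t (m e (m f t)) = t"
    using is_pinv[of "m e f" i i] ef t as cl eH fH by (simp_all add: is_pinv_def t_def H_def m_def)
  have t2': "m t (m e (m f (m t x))) = m t x" if "x \<in> H" for x
    using t2 that as cl eH fH t by metis
  have "is_pinv C i i (m e f) (m f (m t e))"
    unfolding is_pinv_def m_def[symmetric] H_def[symmetric]
    using t1 t2' ee ff t eH fH by (simp add: as cl)
  then have tt: "m f (m t e) = t"
    using pinv_eqI[of "m e f" i i "m f (m t e)"] ef by (simp only: t_def H_def)
  have "m (m f (m t e)) (m f (m t e)) = m f (m t e)"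
    using t2' t eH fH by (simp add: as cl)
  then have mt: "m t t = t" unfolding tt .
  then have "pinv C i i t = t" using t by (intro pinv_idem) (simp_all add: m_def H_def)
  moreover have "pinv C i i t = m e f" using ef by (simp add: t_def pinv_pinv H_def)
  ultimately show ?thesis using mt by (simp add: m_def)
qed

text \<open>Since \<open>e f\<close> and \<open>f e\<close> are idempotent, both are inverses of
  \<open>e f\<close>, and inverses are unique.\<close>

lemma idem_commute:
  assumes e: "e \<in> Hom C i i" "Comp C i i i e e = e" and f: "f \<in> Hom C i i" "Comp C i i i f f = f"
  shows "Comp C i i i e f = Comp C i i i f e"
proof -
  define m where "m = Comp C i i i"
  define H where "H = Hom C i i"
  have cl: "\<And>x y. x \<in> H \<Longrightarrow> y \<in> H \<Longrightarrow> m x y \<in> H" by (simp add: m_def H_def)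
  have as: "\<And>x y z. x \<in> H \<Longrightarrow> y \<in> H \<Longrightarrow> z \<in> H \<Longrightarrow> m (m x y) z = m x (m y z)"
    unfolding m_def H_def by (rule comp_assoc[symmetric])
  have eH: "e \<in> H" "m e e = e" and fH: "f \<in> H" "m f f = f" using e f by (simp_all add: m_def H_def)
  have ee: "\<And>x. x \<in> H \<Longrightarrow> m e (m e x) = m e x" and ff: "\<And>x. x \<in> H \<Longrightarrow> m f (m f x) = m f x"
    using as eH fH by metis+
  have 1: "m (m e f) (m e f) = m e f" "m (m f e) (m f e) = m f e"
    using idem_comp_idem[OF e f] idem_comp_idem[OF f e] by (simp_all add: m_def)
  then have "m e (m f (m e f)) = m e f" "m f (m e (m f e)) = m f e"
    using as cl eH fH by simp_all
  then have "is_pinv C i i (m e f) (m f e)"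
    unfolding is_pinv_def m_def[symmetric] H_def[symmetric]
    using ee ff eH fH by (simp add: as cl)
  moreover have "is_pinv C i i (m e f) (m e f)"
    unfolding is_pinv_def m_def[symmetric] H_def[symmetric] using 1 cl eH fH by simp
  moreover have "m e f \<in> Hom C i i" using cl eH fH by (simp add: H_def)
  ultimately show ?thesis using unique_pinv m_def by metis
qed

text \<open>In the product of \<open>g f\<close> with its candidate inverse, two idempotents meet on
  the middle object: the domain of \<open>g\<close> and the range of \<open>f\<close>. They commute,
  and after the exchange each is absorbed by its neighbour.\<close>

lemma pinv_comp:
  assumes f: "f \<in> Hom C i j" and g: "g \<in> Hom C j k"
  shows "pinv C i k (Comp C i j k g f) = Comp C k j i (pinv C i j f) (pinv C j k g)"
proof (rule pinv_eqI)
  let ?f = "pinv C i j f" and ?g = "pinv C j k g"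
  let ?a = "Comp C j k j ?g g" and ?b = "Comp C j i j f ?f"
  have ff: "?f \<in> Hom C j i" and gg: "?g \<in> Hom C k j" using f g by auto
  have a: "?a \<in> Hom C j j" "Comp C j j j ?a ?a = ?a" using g pinv_comp_idem by auto
  have b: "?b \<in> Hom C j j" "Comp C j j j ?b ?b = ?b"
    using f ff pinv_comp_idem[OF ff] by (auto simp: pinv_pinv)
  have ab: "Comp C j j j ?a ?b = Comp C j j j ?b ?a" by (rule idem_commute[OF a b])
  show "Comp C i j k g f \<in> Hom C i k" using f g by simp
  show "is_pinv C i k (Comp C i j k g f) (Comp C k j i ?f ?g)"
    unfolding is_pinv_def
  proof (intro conjI)
    show "Comp C k j i ?f ?g \<in> Hom C k i" using ff gg by simp
    have "Comp C i k i (Comp C k j i ?f ?g) (Comp C i j k g f) = Comp C i j i ?f (Comp C i j j ?a f)"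
      using f g ff gg
      by (simp add: comp_assoc[of f i j g k ?g j, symmetric]
            comp_assoc[of "Comp C i j k g f" i k ?g j ?f i, symmetric])
    then have "Comp C i i k (Comp C i j k g f) (Comp C i k i (Comp C k j i ?f ?g) (Comp C i j k g f))
        = Comp C i i k (Comp C i j k g f) (Comp C i j i ?f (Comp C i j j ?a f))" by simp
    also have "\<dots> = Comp C i j k g (Comp C i i j f (Comp C i j i ?f (Comp C i j j ?a f)))"
      by (rule comp_assoc[symmetric]) (use f g ff gg in auto)
    also have "Comp C i i j f (Comp C i j i ?f (Comp C i j j ?a f)) = Comp C i j j ?b (Comp C i j j ?a f)"
      by (rule comp_assoc) (use f g ff gg in auto)
    also have "\<dots> = Comp C i j j (Comp C j j j ?a ?b) f"
      using comp_assoc[OF f a(1) b(1)] ab by simp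
    also have "\<dots> = Comp C i j j ?a f"
      using comp_assoc[OF f b(1) a(1)] comp_pinv_comp'(1)[OF f] by simp
    also have "Comp C i j k g \<dots> = Comp C i j k g f"
      using comp_assoc[OF f a(1) g] comp_pinv_comp(1)[OF g] by simp
    finally show "Comp C i i k (Comp C i j k g f) (Comp C i k i (Comp C k j i ?f ?g) (Comp C i j k g f))
        = Comp C i j k g f" .
    have "Comp C k i k (Comp C i j k g f) (Comp C k j i ?f ?g) = Comp C k j k g (Comp C k j j ?b ?g)"
      using f g ff gg
      by (simp add: comp_assoc[of ?g k j ?f i f j, symmetric]
            comp_assoc[of "Comp C k j i ?f ?g" k i f j g k, symmetric])
    then have "Comp C k k i (Comp C k j i ?f ?g) (Comp C k i k (Comp C i j k g f) (Comp C k j i ?f ?g))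
        = Comp C k k i (Comp C k j i ?f ?g) (Comp C k j k g (Comp C k j j ?b ?g))" by simp
    also have "\<dots> = Comp C k j i ?f (Comp C k k j ?g (Comp C k j k g (Comp C k j j ?b ?g)))"
      by (rule comp_assoc[symmetric]) (use f g ff gg in auto)
    also have "Comp C k k j ?g (Comp C k j k g (Comp C k j j ?b ?g)) = Comp C k j j ?a (Comp C k j j ?b ?g)"
      by (rule comp_assoc) (use f g ff gg in auto)
    also have "\<dots> = Comp C k j j (Comp C j j j ?b ?a) ?g"
      using comp_assoc[OF gg b(1) a(1)] ab by simp
    also have "\<dots> = Comp C k j j ?b ?g"
      using comp_assoc[OF gg a(1) b(1)] comp_pinv_comp'(2)[OF g] by simp
    also have "Comp C k j i ?f \<dots> = Comp C k j i ?f ?g"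
      using comp_assoc[OF gg b(1) ff] comp_pinv_comp(2)[OF f] by simp
    finally show "Comp C k k i (Comp C k j i ?f ?g) (Comp C k i k (Comp C i j k g f) (Comp C k j i ?f ?g))
        = Comp C k j i ?f ?g" .
  qed
qed

lemma rst_eq: "s \<in> Hom C i j \<Longrightarrow> Rst C i j s = Comp C i j i (pinv C i j s) s"
  by (rule rst_pinv)

lemma rst_idem: "s \<in> Hom C i j \<Longrightarrow> Comp C i i i (Rst C i j s) (Rst C i j s) = Rst C i j s"
  by (simp add: rst_eq pinv_comp_idem)

text \<open>The axioms follow by inverting composites with \<open>pinv_comp\<close> and commuting
  idempotents. For \<open>rst_after\<close>, write a prime for partial inverses: the right side is
  \<open>f f' g' g f\<close>, and exchanging the idempotents \<open>f f'\<close> and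
  \<open>g' g\<close> leaves \<open>g' g f\<close>.\<close>

lemma restriction_category: "restriction_category C"
proof
  fix f i j assume f: "f \<in> Hom C i j"
  show r: "Rst C i j f \<in> Hom C i i" using f by (simp add: rst_eq)
  show "Comp C i i j f (Rst C i j f) = f" using f by (simp add: rst_eq comp_pinv_comp)
  fix g k
  show "Comp C i i i (Rst C i j f) (Rst C i k g) = Comp C i i i (Rst C i k g) (Rst C i j f)"
    if g: "g \<in> Hom C i k"
    by (rule idem_commute) (use f g in \<open>auto simp: rst_eq pinv_comp_idem\<close>)
  show "Rst C i k (Comp C i i k g (Rst C i j f)) = Comp C i i i (Rst C i k g) (Rst C i j f)"
    if g: "g \<in> Hom C i k"
  proof -
    let ?e = "Rst C i j f" and ?d = "Rst C i k g"
    have e: "?e \<in> Hom C i i" "Comp C i i i ?e ?e = ?e" using r f by (auto simp: rst_idem)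
    have d: "?d \<in> Hom C i i" "Comp C i i i ?d ?d = ?d" using g by (auto simp: rst_idem) (simp add: rst_eq)
    have pe: "pinv C i i ?e = ?e" using e by (rule pinv_idem)
    have "Rst C i k (Comp C i i k g ?e) =
        Comp C i k i (Comp C k i i ?e (pinv C i k g)) (Comp C i i k g ?e)"
      using rst_eq[of "Comp C i i k g ?e" i k] pinv_comp[OF e(1) g] pe e g by simp
    also have "\<dots> = Comp C i i i ?e (Comp C i k i (pinv C i k g) (Comp C i i k g ?e))"
      by (rule comp_assoc[symmetric]) (use e g in auto)
    also have "Comp C i k i (pinv C i k g) (Comp C i i k g ?e) = Comp C i i i ?d ?e"
      using comp_assoc[OF e(1) g pinv_in[OF g]] rst_eq[OF g] by simp
    also have "\<dots> = Comp C i i i ?e ?d" by (rule idem_commute[OF d e])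
    also have "Comp C i i i ?e \<dots> = Comp C i i i ?e ?d"
      using comp_assoc[OF d(1) e(1) e(1)] e by simp
    also have "\<dots> = Comp C i i i ?d ?e" by (rule idem_commute[OF e d])
    finally show ?thesis .
  qed
  show "Comp C i j j (Rst C j k g) f = Comp C i i j f (Rst C i k (Comp C i j k g f))"
    if g: "g \<in> Hom C j k"
  proof -
    let ?f = "pinv C i j f" and ?g = "pinv C j k g"
    let ?a = "Comp C j k j ?g g" and ?b = "Comp C j i j f ?f"
    have ff: "?f \<in> Hom C j i" and gg: "?g \<in> Hom C k j" using f g by auto
    have a: "?a \<in> Hom C j j" "Comp C j j j ?a ?a = ?a" using g pinv_comp_idem by auto
    have b: "?b \<in> Hom C j j" "Comp C j j j ?b ?b = ?b"
      using f ff pinv_comp_idem[OF ff] by (auto simp: pinv_pinv)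
    have "Rst C i k (Comp C i j k g f) = Comp C i k i (Comp C k j i ?f ?g) (Comp C i j k g f)"
      using rst_eq[of "Comp C i j k g f" i k] pinv_comp[OF f g] f g by simp
    also have "\<dots> = Comp C i j i ?f (Comp C i j j ?a f)"
      using f g ff gg
      by (simp add: comp_assoc[of f i j g k ?g j, symmetric]
            comp_assoc[of "Comp C i j k g f" i k ?g j ?f i, symmetric])
    finally have "Comp C i i j f (Rst C i k (Comp C i j k g f)) =
        Comp C i i j f (Comp C i j i ?f (Comp C i j j ?a f))" by simp
    also have "\<dots> = Comp C i j j ?b (Comp C i j j ?a f)"
      by (rule comp_assoc) (use f g ff gg in auto)
    also have "\<dots> = Comp C i j j (Comp C j j j ?a ?b) f"
      using comp_assoc[OF f a(1) b(1)] idem_commute[OF a b] by simp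
    also have "\<dots> = Comp C i j j ?a f"
      using comp_assoc[OF f b(1) a(1)] comp_pinv_comp'(1)[OF f] by simp
    finally show ?thesis using rst_eq[OF g] by simp
  qed
qed

end

sublocale inverse_category \<subseteq> restriction_category
  by (rule restriction_category)

context inverse_category
begin

text \<open>If \<open>f = g e\<close>, then inverting gives \<open>e\<close> after the inverse of
  \<open>g\<close>, and \<open>rst_after\<close> moves this idempotent to the other side. So
  inversion preserves the order, although it reverses composition.\<close>

lemma rle_pinv:
  assumes f: "f \<in> Hom C i j" and g: "g \<in> Hom C i j" and le: "rle C i j f g"
  shows "rle C j i (pinv C i j f) (pinv C i j g)"
proof -
  let ?e = "Rst C i j f"
  have e: "?e \<in> Hom C i i" "Comp C i i i ?e ?e = ?e" using f by (auto simp: rst_idem)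
  have "f = Comp C i i j g ?e" using le by (simp add: rle_def)
  then have "pinv C i j f = Comp C j i i (pinv C i i ?e) (pinv C i j g)"
    using pinv_comp[OF e(1) g] by simp
  also have "pinv C i i ?e = Rst C i i ?e" using pinv_idem[OF e] rst_rst[OF f] by simp
  also have "Comp C j i i \<dots> (pinv C i j g) =
      Comp C j j i (pinv C i j g) (Rst C j i (Comp C j i i ?e (pinv C i j g)))"
    by (rule rst_after) (use e g in auto)
  finally show ?thesis using f g e
    by (intro rleI[of _ _ _ "Rst C j i (Comp C j i i ?e (pinv C i j g))"]) (auto intro!: rst_RIdem)
qed

end

text \<open>Compatibility for categories, bicompatibility for groupoids. With this single condition
  the two kinds of category with joins become instances of one locale.\<close>

definition vcompat :: "variant \<Rightarrow> ('o, 'm) rcat \<Rightarrow> 'o \<Rightarrow> 'o \<Rightarrow> 'm \<Rightarrow> 'm \<Rightarrow> bool" where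
  "vcompat v C i j s t \<longleftrightarrow> rcompat C i j s t \<and>
     (v = Groupoids \<longrightarrow> rcompat C j i (pinv C i j s) (pinv C i j t))"

locale join_category = restriction_category C for C :: "('o, 'm) rcat" +
  fixes v :: variant
  assumes inverses: "v = Groupoids \<Longrightarrow> inverse_category C"
    and vjoins: "i \<in> Obj C \<Longrightarrow> j \<in> Obj C \<Longrightarrow> S \<subseteq> Hom C i j \<Longrightarrow>
      (\<forall>s\<in>S. \<forall>t\<in>S. vcompat v C i j s t) \<Longrightarrow> has_stable_join C i j S"

lemma join_cat_iff:
  "join_cat v sc C \<longleftrightarrow> join_category C v \<and> (sc = One_object \<longrightarrow> (\<exists>i. Obj C = {i}))"
proof (cases v)
  case Categories
  have "join_restriction_category C \<longleftrightarrow> join_category C v"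
    using Categories
    by (simp add: join_restriction_category_def join_restriction_category_axioms_def
        join_category_def join_category_axioms_def vcompat_def)
  then show ?thesis using Categories by (cases sc) (auto simp: join_cat_def)
next
  case Groupoids
  have "join_inverse_category C \<longleftrightarrow> join_category C v"
    using Groupoids inverse_category.restriction_category[of C]
    by (auto simp: join_inverse_category_def join_inverse_category_axioms_def
        join_category_def join_category_axioms_def vcompat_def rbicompat_def)
  then show ?thesis using Groupoids by (cases sc) (auto simp: join_cat_def)
qed

section \<open>Joins in the structure common to both variants\<close>

context join_category
begin

text \<open>For the groupoid half, inversion preserves the order, so the inverses are bounded by the
  inverse of \<open>h\<close>. Consequently each bounded family has a stable join, in either
  variant.\<close>

lemma bounded_vcompat:
  assumes S: "S \<subseteq> Hom C i j" and h: "h \<in> Hom C i j" "\<And>s. s \<in> S \<Longrightarrow> rle C i j s h"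
  shows "\<forall>s\<in>S. \<forall>t\<in>S. vcompat v C i j s t"
proof (intro ballI)
  fix s t assume st: "s \<in> S" "t \<in> S"
  then have H: "s \<in> Hom C i j" "t \<in> Hom C i j" "rle C i j s h" "rle C i j t h" using S h by auto
  have "rcompat C i j s t" by (rule rcompat_bounded[OF H(1,2) h(1) H(3,4)])
  moreover have "rcompat C j i (pinv C i j s) (pinv C i j t)" if "v = Groupoids"
  proof -
    interpret inverse_category C using inverses that by blast
    show ?thesis using H h(1) by (intro rcompat_bounded[of _ _ _ _ "pinv C i j h"] rle_pinv pinv_in)
  qed
  ultimately show "vcompat v C i j s t" by (simp add: vcompat_def)
qed

lemma bounded_join:
  assumes S: "S \<subseteq> Hom C i j" and h: "h \<in> Hom C i j" "\<And>s. s \<in> S \<Longrightarrow> rle C i j s h"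
  shows "has_stable_join C i j S"
  using vjoins[OF hom_dom[OF h(1)] hom_cod[OF h(1)] S bounded_vcompat[OF S h]] .

text \<open>The axiom supplies some join with the stability property; the given \<open>f\<close>
  bounds \<open>S\<close>, so the axiom applies, and uniqueness of joins transfers stability to
  \<open>f\<close>.\<close>

lemma is_join_stable:
  assumes S: "S \<subseteq> Hom C i j" and f: "is_join C i j S f" and g: "g \<in> Hom C k i"
  shows "is_join C k j ((\<lambda>s. Comp C k i j s g) ` S) (Comp C k i j f g)"
proof -
  have "has_stable_join C i j S"
    by (rule bounded_join[OF S, of f]) (use f in \<open>auto simp: is_join_def\<close>)
  then obtain f' where f': "is_join C i j S f'"
      "\<And>h g. g \<in> Hom C h i \<Longrightarrow> is_join C h j ((\<lambda>s. Comp C h i j s g) ` S) (Comp C h i j f' g)"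
    unfolding has_stable_join_def by blast
  then have "f' = f" using f is_join_unique by blast
  then show ?thesis using f'(2)[OF g] by simp
qed

lemma is_join_ub: "is_join C i j S f \<Longrightarrow> s \<in> S \<Longrightarrow> rle C i j s f"
  by (simp add: is_join_def)

lemma is_join_in: "is_join C i j S f \<Longrightarrow> f \<in> Hom C i j"
  by (simp add: is_join_def)

lemma join_RIdem:
  assumes "S \<subseteq> RIdem C i" "is_join C i i S e"
  shows "e \<in> RIdem C i"
proof (rule rle_idnD)
  show e: "e \<in> Hom C i i" using assms is_join_in by blast
  then have "Idn C i \<in> Hom C i i" using hom_dom idn_hom by blast
  then show "rle C i i e (Idn C i)"
    using assms rle_idn unfolding is_join_def by blast
qed

text \<open>The identity bounds every set of idempotents, which makes the idempotents at
  \<open>i\<close> a complete lattice.\<close>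

lemma RIdem_has_join:
  assumes "i \<in> Obj C" "S \<subseteq> RIdem C i"
  shows "\<exists>e\<in>RIdem C i. is_join C i i S e"
proof -
  have "S \<subseteq> Hom C i i" using assms RIdem_in by blast
  moreover have "\<And>s. s \<in> S \<Longrightarrow> rle C i i s (Idn C i)" using assms rle_idn by blast
  ultimately have "has_stable_join C i i S" using bounded_join assms idn_hom by blast
  then obtain e where "is_join C i i S e" unfolding has_stable_join_def by blast
  then show ?thesis using join_RIdem assms by blast
qed

text \<open>Let \<open>e\<close> be the join of the restrictions. It lies below the restriction of
  \<open>f\<close> by monotonicity. Conversely, every member of \<open>S\<close> absorbs
  \<open>e\<close>, so by stability \<open>f e\<close> is a join of \<open>S\<close> as well; thus
  \<open>f e = f\<close>, and the restriction of \<open>f\<close> lies below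
  \<open>e\<close>.\<close>

lemma rst_join:
  assumes S: "S \<subseteq> Hom C i j" and f: "is_join C i j S f"
  shows "is_join C i i (Rst C i j ` S) (Rst C i j f)"
proof -
  have fH: "f \<in> Hom C i j" using f is_join_in by blast
  have R: "Rst C i j ` S \<subseteq> RIdem C i" using S rst_RIdem by blast
  obtain e where e: "e \<in> RIdem C i" "is_join C i i (Rst C i j ` S) e"
    using RIdem_has_join[OF hom_dom[OF fH] R] by blast
  have le: "rle C i i e (Rst C i j f)"
    using e(2) S f fH rst_hom[OF fH] rle_rst unfolding is_join_def by blast
  have "Comp C i i j s e = s" if "s \<in> S" for s
  proof -
    have s: "s \<in> Hom C i j" using S that by blast
    have "Comp C i i i (Rst C i j s) e = Rst C i j s"
      using is_join_ub[OF e(2), of "Rst C i j s"] that e(1) rst_RIdem[OF s]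
        RIdem_commute[OF e(1) rst_RIdem[OF s]] by (simp add: rle_RIdem)
    then show ?thesis
      using comp_assoc[OF RIdem_in[OF e(1)] rst_hom[OF s] s] comp_rst[OF s] by simp
  qed
  then have "(\<lambda>s. Comp C i i j s e) ` S = S" by force
  then have "is_join C i j S (Comp C i i j f e)"
    using is_join_stable[OF S f RIdem_in[OF e(1)]] by simp
  then have "Comp C i i j f e = f" using f is_join_unique by blast
  then have "Comp C i i i (Rst C i j f) e = Rst C i j f" using rst_comp_RIdem[OF fH e(1)] by simp
  then have "rle C i i (Rst C i j f) e"
    using e(1) rst_RIdem[OF fH] RIdem_commute[OF e(1) rst_RIdem[OF fH]] by (simp add: rle_RIdem)
  then have "e = Rst C i j f" using le e(1) rst_RIdem[OF fH] rle_RIdem_antisym by blast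
  then show ?thesis using e(2) by simp
qed

text \<open>Joins are stable under precomposition by axiom; this is postcomposition, for joins of
  idempotents. The join \<open>h\<close> of the maps \<open>f d\<close> lies below
  \<open>f e\<close>, and \<open>rst_join\<close> computes its restriction to be that of
  \<open>f e\<close>, so the two coincide by \<open>rle_eqI\<close>.\<close>

lemma comp_join:
  assumes S: "S \<subseteq> RIdem C i" and e: "is_join C i i S e" and f: "f \<in> Hom C i j"
  shows "is_join C i j ((\<lambda>d. Comp C i i j f d) ` S) (Comp C i i j f e)"
proof -
  let ?T = "(\<lambda>d. Comp C i i j f d) ` S"
  have SH: "S \<subseteq> Hom C i i" using S RIdem_in by blast
  have eR: "e \<in> RIdem C i" by (rule join_RIdem[OF S e])
  have fe: "Comp C i i j f e \<in> Hom C i j" using f RIdem_in[OF eR] by simp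
  have TH: "?T \<subseteq> Hom C i j" using SH f by auto
  have ub: "rle C i j t (Comp C i i j f e)" if "t \<in> ?T" for t
    using that SH f RIdem_in[OF eR] is_join_ub[OF e] by (auto intro!: rle_comp_left)
  obtain h where h: "is_join C i j ?T h"
    using bounded_join[OF TH fe ub] unfolding has_stable_join_def by blast
  have hH: "h \<in> Hom C i j" using h is_join_in by blast
  have rf: "Rst C i j f \<in> RIdem C i" by (rule rst_RIdem[OF f])
  have "Rst C i j ` ?T = (\<lambda>d. Comp C i i i d (Rst C i j f)) ` S"
    unfolding image_image
  proof (rule image_cong)
    fix d assume "d \<in> S"
    then have d: "d \<in> RIdem C i" using S by blast
    show "Rst C i j (Comp C i i j f d) = Comp C i i i d (Rst C i j f)"
      using rst_comp_RIdem[OF f d] RIdem_commute[OF d rf] by simp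
  qed simp
  then have "is_join C i i (Rst C i j ` ?T) (Comp C i i i e (Rst C i j f))"
    using is_join_stable[OF SH e rst_hom[OF f]] by simp
  then have "Rst C i j h = Comp C i i i e (Rst C i j f)"
    using rst_join[OF TH h] is_join_unique by blast
  also have "\<dots> = Rst C i j (Comp C i i j f e)"
    using rst_comp_RIdem[OF f eR] RIdem_commute[OF eR rf] by simp
  finally have eq: "Rst C i j h = Rst C i j (Comp C i i j f e)" .
  have "h = Comp C i i j f e"
  proof (rule rle_eqI[OF hH fe])
    show "rle C i j h (Comp C i i j f e)" using h fe ub unfolding is_join_def by blast
    show "rle C i i (Rst C i j (Comp C i i j f e)) (Rst C i j h)"
      unfolding eq by (rule rle_refl[OF rst_hom[OF fe]])
  qed
  then show ?thesis using h by simp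
qed

end

section \<open>Functors that preserve joins\<close>

lemma is_functorD:
  assumes "is_functor A B F"
  shows "i \<in> Obj A \<Longrightarrow> fob F i \<in> Obj B" "f \<in> Hom A i j \<Longrightarrow> fmap F i j f \<in> Hom B (fob F i) (fob F j)"
    "i \<in> Obj A \<Longrightarrow> fmap F i i (Idn A i) = Idn B (fob F i)"
    "f \<in> Hom A i j \<Longrightarrow> g \<in> Hom A j k \<Longrightarrow> fmap F i k (Comp A i j k g f) =
        Comp B (fob F i) (fob F j) (fob F k) (fmap F j k g) (fmap F i j f)"
  using assms unfolding is_functor_def by (auto simp: PiE_def Pi_def)

lemma functor_pinv:
  assumes "inverse_category A" "inverse_category B" "is_functor A B F" "f \<in> Hom A i j"
  shows "fmap F j i (pinv A i j f) = pinv B (fob F i) (fob F j) (fmap F i j f)"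
proof -
  interpret A: inverse_category A by fact
  interpret B: inverse_category B by fact
  note F = is_functorD[OF assms(3)]
  have p: "pinv A i j f \<in> Hom A j i" using assms(4) by simp
  have "is_pinv B (fob F i) (fob F j) (fmap F i j f) (fmap F j i (pinv A i j f))"
    unfolding is_pinv_def
    using F(2)[OF p] F(4)[OF assms(4) p, symmetric] F(4)[OF p assms(4), symmetric]
      F(4)[of "Comp A i j i (pinv A i j f) f" i i f j, symmetric]
      F(4)[of "Comp A j i j f (pinv A i j f)" j j "pinv A i j f" i, symmetric]
      A.comp_pinv_comp[OF assms(4)] p assms(4) by simp
  then show ?thesis using B.pinv_eqI[OF F(2)[OF assms(4)]] by metis
qed

text \<open>The two kinds of functor receive one description: a family with a join is bounded by it,
  hence compatible in the sense of either variant, and between inverse categories preservation of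
  partial inverses yields preservation of restrictions.\<close>

lemma join_functor_iff:
  assumes "join_category A v" "join_category B v"
  shows "join_functor v A B F \<longleftrightarrow> is_functor A B F \<and>
    (\<forall>i j. \<forall>f \<in> Hom A i j. fmap F i i (Rst A i j f) = Rst B (fob F i) (fob F j) (fmap F i j f)) \<and>
    (\<forall>i j S f. S \<subseteq> Hom A i j \<longrightarrow> is_join A i j S f \<longrightarrow>
       is_join B (fob F i) (fob F j) (fmap F i j ` S) (fmap F i j f))"
    (is "_ \<longleftrightarrow> ?R")
proof -
  interpret A: join_category A v by fact
  interpret B: join_category B v by fact
  have vc: "(\<forall>s\<in>S. \<forall>t\<in>S. vcompat v A i j s t) \<and> i \<in> Obj A \<and> j \<in> Obj A"
    if "S \<subseteq> Hom A i j" "is_join A i j S f" for S i j f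
    using A.bounded_vcompat[OF that(1) A.is_join_in[OF that(2)] A.is_join_ub[OF that(2)]]
      A.hom_obj[OF A.is_join_in[OF that(2)]] by blast
  show ?thesis
  proof (cases v)
    case Categories
    have "(\<forall>i \<in> Obj A. \<forall>j \<in> Obj A. \<forall>S \<subseteq> Hom A i j. \<forall>f.
        (\<forall>g \<in> S. \<forall>h \<in> S. rcompat A i j g h) \<longrightarrow> is_join A i j S f \<longrightarrow>
        is_join B (fob F i) (fob F j) (fmap F i j ` S) (fmap F i j f)) \<longleftrightarrow>
      (\<forall>i j S f. S \<subseteq> Hom A i j \<longrightarrow> is_join A i j S f \<longrightarrow>
        is_join B (fob F i) (fob F j) (fmap F i j ` S) (fmap F i j f))"
    proof (intro iffI allI impI ballI)
      fix i j S f assume H: "\<forall>i \<in> Obj A. \<forall>j \<in> Obj A. \<forall>S \<subseteq> Hom A i j. \<forall>f.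
        (\<forall>g \<in> S. \<forall>h \<in> S. rcompat A i j g h) \<longrightarrow> is_join A i j S f \<longrightarrow>
        is_join B (fob F i) (fob F j) (fmap F i j ` S) (fmap F i j f)"
        and S: "S \<subseteq> Hom A i j" "is_join A i j S f"
      have "i \<in> Obj A" "j \<in> Obj A" "\<forall>g \<in> S. \<forall>h \<in> S. rcompat A i j g h"
        using vc[OF S] by (auto simp: vcompat_def rbicompat_def)
      then show "is_join B (fob F i) (fob F j) (fmap F i j ` S) (fmap F i j f)" using H S by simp
    qed simp
    then show ?thesis using Categories by (simp add: join_functor_def jr_functor_def)
  next
    case Groupoids
    have inv: "inverse_category A" "inverse_category B"
      using A.inverses B.inverses Groupoids by auto
    interpret IA: inverse_category A by fact
    interpret IB: inverse_category B by fact
    have 1: "fmap F i i (Rst A i j f) = Rst B (fob F i) (fob F j) (fmap F i j f)"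
      if "is_functor A B F" "f \<in> Hom A i j" for i j f
      using is_functorD(2,4)[OF that(1)] functor_pinv[OF inv that] that(2)
      by (simp add: IA.rst_eq IB.rst_eq)
    have 2: "(\<forall>i \<in> Obj A. \<forall>j \<in> Obj A. \<forall>S \<subseteq> Hom A i j. \<forall>f.
        (\<forall>g \<in> S. \<forall>h \<in> S. rbicompat A i j g h) \<longrightarrow> is_join A i j S f \<longrightarrow>
        is_join B (fob F i) (fob F j) (fmap F i j ` S) (fmap F i j f)) \<longleftrightarrow>
      (\<forall>i j S f. S \<subseteq> Hom A i j \<longrightarrow> is_join A i j S f \<longrightarrow>
        is_join B (fob F i) (fob F j) (fmap F i j ` S) (fmap F i j f))"
    proof (intro iffI allI impI ballI)
      fix i j S f assume H: "\<forall>i \<in> Obj A. \<forall>j \<in> Obj A. \<forall>S \<subseteq> Hom A i j. \<forall>f.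
        (\<forall>g \<in> S. \<forall>h \<in> S. rbicompat A i j g h) \<longrightarrow> is_join A i j S f \<longrightarrow>
        is_join B (fob F i) (fob F j) (fmap F i j ` S) (fmap F i j f)"
        and S: "S \<subseteq> Hom A i j" "is_join A i j S f"
      have "i \<in> Obj A" "j \<in> Obj A" "\<forall>g \<in> S. \<forall>h \<in> S. rbicompat A i j g h"
        using vc[OF S] Groupoids by (auto simp: vcompat_def rbicompat_def)
      then show "is_join B (fob F i) (fob F j) (fmap F i j ` S) (fmap F i j f)" using H S by simp
    qed simp
    have "join_functor v A B F \<longleftrightarrow> ji_functor A B F" using Groupoids by (simp add: join_functor_def)
    then show ?thesis unfolding ji_functor_def 2 using 1 by meson
  qed
qed

section \<open>Points of the locale of restriction idempotents\<close>

text \<open>\<open>push C i j f\<close> is \<open>pt (\<O> f)\<close>, without the restriction of its domain to the points \<open>p\<close>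
  that hold at the restriction of \<open>f\<close>.\<close>

definition push :: "('o, 'm) rcat \<Rightarrow> 'o \<Rightarrow> 'o \<Rightarrow> 'm \<Rightarrow> ('m \<Rightarrow> bool) \<Rightarrow> 'm \<Rightarrow> bool" where
  "push C i j f p = (\<lambda>e. e \<in> RIdem C j \<and> p (Rst C i j (Comp C i j j e f)))"

text \<open>With \<open>p e\<close> read as "the point lies in the open set \<open>e\<close>", both
  maps are defined at \<open>p\<close> and coincide on a neighbourhood of it.\<close>

definition agr :: "('o, 'm) rcat \<Rightarrow> 'o \<Rightarrow> 'o \<Rightarrow> 'm \<Rightarrow> 'm \<Rightarrow> ('m \<Rightarrow> bool) \<Rightarrow> bool" where
  "agr C i j f g p \<longleftrightarrow> p (Rst C i j f) \<and> p (Rst C i j g) \<and>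
     (\<exists>e\<in>RIdem C i. p e \<and> Comp C i i j f e = Comp C i i j g e)"

text \<open>\<open>gm C i j f p\<close> is the germ of \<open>f\<close> at \<open>p\<close>; it is empty when \<open>f\<close> is not defined at \<open>p\<close>.\<close>

definition gm :: "('o, 'm) rcat \<Rightarrow> 'o \<Rightarrow> 'o \<Rightarrow> 'm \<Rightarrow> ('m \<Rightarrow> bool) \<Rightarrow> ('m, 'm \<Rightarrow> bool) germ" where
  "gm C i j f p = {(g, p) |g. g \<in> Hom C i j \<and> agr C i j f g p}"

abbreviation pts :: "('o, 'm) rcat \<Rightarrow> 'o \<Rightarrow> ('m \<Rightarrow> bool) set" where
  "pts C i \<equiv> points (RLoc C i)"

lemma W_sel [simp]: "fst (W C) = C" "tob (snd (W C)) = (\<lambda>i. pt (RLoc C i))"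
  "tmap (snd (W C)) = (\<lambda>i j f. pt_map (RLoc C i) (RLoc C j) (RLoc_map C i j f))"
  by (simp_all add: W_def)

section \<open>The locale of idempotents, its points, and agreement of maps at a point\<close>

context join_category
begin

text \<open>Top, meets and joins of a \<open>gorder\<close> are picked by choice among the greatest
  or least elements. Antisymmetry of the order on idempotents makes the choice unique; this is the
  pattern of \<open>RLoc_meet\<close> and \<open>RLoc_sup\<close> too.\<close>

lemma RLoc_top: "i \<in> Obj C \<Longrightarrow> \<top>\<^bsub>RLoc C i\<^esub> = Idn C i"
  unfolding top_def
  by (rule some_equality)
    (auto simp: greatest_def RLoc_def idn_RIdem rle_idn intro!: rle_RIdem_antisym)

lemma RLoc_meet:
  assumes e: "e \<in> RIdem C i" and d: "d \<in> RIdem C i"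
  shows "e \<sqinter>\<^bsub>RLoc C i\<^esub> d = Comp C i i i e d"
proof -
  have *: "greatest (RLoc C i) (Comp C i i i e d) (Lower (RLoc C i) {e, d})"
  proof -
    have 1: "Comp C i i i e d \<in> RIdem C i" by (rule RIdem_comp[OF e d])
    have 2: "rle C i i (Comp C i i i e d) e" by (rule rle_comp_RIdem[OF RIdem_in[OF e] d])
    have 3: "rle C i i (Comp C i i i e d) d"
      unfolding RIdem_commute[OF e d] by (rule rle_comp_RIdem[OF RIdem_in[OF d] e])
    have 4: "rle C i i x (Comp C i i i e d)"
      if "x \<in> RIdem C i" "rle C i i x e" "rle C i i x d" for x
      using that e d 1 comp_assoc[of x i i d i e i] by (simp add: rle_RIdem RIdem_in)
    show ?thesis using 1 2 3 4 e d by (auto simp: greatest_def Lower_def RLoc_def)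
  qed
  have "x = Comp C i i i e d" if x: "greatest (RLoc C i) x (Lower (RLoc C i) {e, d})" for x
  proof (rule rle_RIdem_antisym)
    show "x \<in> RIdem C i" "Comp C i i i e d \<in> RIdem C i" "rle C i i x (Comp C i i i e d)"
      "rle C i i (Comp C i i i e d) x"
      using x * by (auto simp: greatest_def Lower_def RLoc_def)
  qed
  then show ?thesis unfolding meet_def inf_def using * by (rule some_equality[rotated])
qed

lemma RLoc_sup:
  assumes S: "S \<subseteq> RIdem C i" and e: "is_join C i i S e"
  shows "\<Squnion>\<^bsub>RLoc C i\<^esub> S = e"
proof -
  have *: "least (RLoc C i) e (Upper (RLoc C i) S)"
  proof -
    have "rle C i i e x" if "x \<in> RIdem C i" "\<forall>s. s \<in> S \<and> s \<in> RIdem C i \<longrightarrow> rle C i i s x" for x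
      using that e S RIdem_in[OF that(1)] unfolding is_join_def by blast
    then show ?thesis using join_RIdem[OF S e] is_join_ub[OF e]
      by (auto simp: least_def Upper_def RLoc_def)
  qed
  have "x = e" if x: "least (RLoc C i) x (Upper (RLoc C i) S)" for x
  proof (rule rle_RIdem_antisym)
    show "x \<in> RIdem C i" "e \<in> RIdem C i" "rle C i i x e" "rle C i i e x"
      using x * by (auto simp: least_def Upper_def RLoc_def)
  qed
  then show ?thesis unfolding sup_def using * by (rule some_equality[rotated])
qed

text \<open>Replaces the operations of the ordered structure by composition and
  \<open>is_join\<close>, so that points can be treated as completely prime filters of idempotents
  inside the category.\<close>

lemma points_iff:
  assumes i: "i \<in> Obj C"
  shows "p \<in> pts C i \<longleftrightarrow> (\<forall>x. p x \<longrightarrow> x \<in> RIdem C i) \<and> p (Idn C i) \<and>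
    (\<forall>x\<in>RIdem C i. \<forall>y\<in>RIdem C i. p (Comp C i i i x y) \<longleftrightarrow> p x \<and> p y) \<and>
    (\<forall>S\<subseteq>RIdem C i. \<forall>e. is_join C i i S e \<longrightarrow> (p e \<longleftrightarrow> (\<exists>x\<in>S. p x)))"
proof -
  have car: "carrier (RLoc C i) = RIdem C i" by (simp add: RLoc_def)
  have 1: "(\<forall>x\<in>RIdem C i. \<forall>y\<in>RIdem C i. p (x \<sqinter>\<^bsub>RLoc C i\<^esub> y) \<longleftrightarrow> p x \<and> p y) \<longleftrightarrow>
      (\<forall>x\<in>RIdem C i. \<forall>y\<in>RIdem C i. p (Comp C i i i x y) \<longleftrightarrow> p x \<and> p y)"
    by (simp add: RLoc_meet)
  have 2: "(\<forall>S\<subseteq>RIdem C i. p (\<Squnion>\<^bsub>RLoc C i\<^esub> S) \<longleftrightarrow> (\<exists>x\<in>S. p x)) \<longleftrightarrow>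
      (\<forall>S\<subseteq>RIdem C i. \<forall>e. is_join C i i S e \<longrightarrow> (p e \<longleftrightarrow> (\<exists>x\<in>S. p x)))"
  proof (rule iffI; intro allI impI)
    fix S e assume H: "\<forall>S\<subseteq>RIdem C i. p (\<Squnion>\<^bsub>RLoc C i\<^esub> S) \<longleftrightarrow> (\<exists>x\<in>S. p x)"
      and S: "S \<subseteq> RIdem C i" and e: "is_join C i i S e"
    show "p e \<longleftrightarrow> (\<exists>x\<in>S. p x)" using H[rule_format, OF S] RLoc_sup[OF S e] by simp
  next
    fix S assume H: "\<forall>S\<subseteq>RIdem C i. \<forall>e. is_join C i i S e \<longrightarrow> (p e \<longleftrightarrow> (\<exists>x\<in>S. p x))"
      and S: "S \<subseteq> RIdem C i"
    obtain e where e: "is_join C i i S e" using RIdem_has_join[OF i S] by blast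
    show "p (\<Squnion>\<^bsub>RLoc C i\<^esub> S) \<longleftrightarrow> (\<exists>x\<in>S. p x)"
      using H[rule_format, OF S e] RLoc_sup[OF S e] by simp
  qed
  show ?thesis unfolding points_def mem_Collect_eq car RLoc_top[OF i] 1 2 ..
qed

lemma point_RIdem: "p \<in> pts C i \<Longrightarrow> p x \<Longrightarrow> x \<in> RIdem C i"
  by (simp add: points_def RLoc_def)

lemma point_idn: "i \<in> Obj C \<Longrightarrow> p \<in> pts C i \<Longrightarrow> p (Idn C i)"
  by (simp add: points_iff)

lemma point_comp:
  "p \<in> pts C i \<Longrightarrow> x \<in> RIdem C i \<Longrightarrow> y \<in> RIdem C i \<Longrightarrow> p (Comp C i i i x y) \<longleftrightarrow> p x \<and> p y"
  using points_iff[of i p] hom_dom[OF RIdem_in[of x i]] by simp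

lemma point_join:
  assumes "p \<in> pts C i" "S \<subseteq> RIdem C i" "is_join C i i S e"
  shows "p e \<longleftrightarrow> (\<exists>x\<in>S. p x)"
proof -
  have "i \<in> Obj C" using hom_dom[OF is_join_in[OF assms(3)]] .
  then show ?thesis using points_iff[of i p] assms by blast
qed

lemma point_mono:
  "p \<in> pts C i \<Longrightarrow> p x \<Longrightarrow> y \<in> RIdem C i \<Longrightarrow> rle C i i x y \<Longrightarrow> p y"
  using point_RIdem[of p i x] point_comp[of p i y x] by (simp add: rle_RIdem)

lemma openin_pt:
  assumes i: "i \<in> Obj C"
  shows "openin (pt (RLoc C i)) Q \<longleftrightarrow> (\<exists>e\<in>RIdem C i. Q = {p \<in> pts C i. p e})"
proof -
  have "istopology (\<lambda>Q. \<exists>e\<in>RIdem C i. Q = {p \<in> pts C i. p e})"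
    unfolding istopology_def
  proof (intro conjI allI impI)
    fix Q R assume "\<exists>e\<in>RIdem C i. Q = {p \<in> pts C i. p e}" "\<exists>e\<in>RIdem C i. R = {p \<in> pts C i. p e}"
    then obtain e d where "e \<in> RIdem C i" "Q = {p \<in> pts C i. p e}" "d \<in> RIdem C i" "R = {p \<in> pts C i. p d}"
      by blast
    then show "\<exists>e\<in>RIdem C i. Q \<inter> R = {p \<in> pts C i. p e}"
      by (intro bexI[of _ "Comp C i i i e d"]) (auto simp: point_comp RIdem_comp)
  next
    fix K assume K: "\<forall>Q\<in>K. \<exists>e\<in>RIdem C i. Q = {p \<in> pts C i. p e}"
    \<comment> \<open>Different idempotents may define the same open set, so the join runs over all
      idempotents whose open set belongs to \<open>K\<close>.\<close>
    let ?S = "{e \<in> RIdem C i. {p \<in> pts C i. p e} \<in> K}"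
    obtain e where e: "e \<in> RIdem C i" "is_join C i i ?S e"
      using RIdem_has_join[OF i, of ?S] by blast
    have "\<Union>K = {p \<in> pts C i. p e}"
    proof (intro equalityI subsetI)
      fix p assume "p \<in> \<Union>K"
      then obtain Q d where Q: "Q \<in> K" "p \<in> Q" "d \<in> RIdem C i" "Q = {p \<in> pts C i. p d}"
        using K by blast
      then have "p \<in> pts C i" "p d" "d \<in> ?S" by auto
      then show "p \<in> {p \<in> pts C i. p e}" using point_join[OF _ _ e(2), of p] by blast
    next
      fix p assume "p \<in> {p \<in> pts C i. p e}"
      then have p: "p \<in> pts C i" "p e" by auto
      then obtain d where "d \<in> ?S" "p d" using point_join[OF _ _ e(2), of p] by blast
      then show "p \<in> \<Union>K" using p by blast
    qed
    then show "\<exists>e\<in>RIdem C i. \<Union>K = {p \<in> pts C i. p e}" using e by blast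
  qed
  then show ?thesis unfolding pt_def by (simp add: topology_inverse' RLoc_def)
qed

lemma topspace_pt:
  assumes i: "i \<in> Obj C"
  shows "topspace (pt (RLoc C i)) = pts C i"
proof
  show "topspace (pt (RLoc C i)) \<subseteq> pts C i"
    using openin_pt[OF i] openin_topspace[of "pt (RLoc C i)"] by blast
  have "pts C i = {p \<in> pts C i. p (Idn C i)}" using point_idn[OF i] by blast
  then have "openin (pt (RLoc C i)) (pts C i)" using openin_pt[OF i] idn_RIdem[OF i] by blast
  then show "pts C i \<subseteq> topspace (pt (RLoc C i))" by (rule openin_subset)
qed

lemma openin_ptI: "e \<in> RIdem C i \<Longrightarrow> openin (pt (RLoc C i)) {p \<in> pts C i. p e}"
  using openin_pt[OF hom_dom[OF RIdem_in]] by blast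

lemma tmap_W:
  assumes f: "f \<in> Hom C i j"
  shows "pt_map (RLoc C i) (RLoc C j) (RLoc_map C i j f) =
    (\<lambda>p. if p \<in> pts C i \<and> p (Rst C i j f) then Some (push C i j f p) else None)"
  using RLoc_top[OF hom_cod[OF f]] idn_comp[OF f]
  by (intro ext) (simp add: pt_map_def RLoc_map_def push_def, simp add: RLoc_def)

text \<open>A composite absorbs the restriction of its first factor, so it is defined only where
  that factor is.\<close>

lemma rst_comp_le:
  assumes f: "f \<in> Hom C i j" and g: "g \<in> Hom C j k" and p: "p \<in> pts C i"
  shows "p (Rst C i k (Comp C i j k g f)) \<Longrightarrow> p (Rst C i j f)"
proof -
  have gf: "Comp C i j k g f \<in> Hom C i k" using f g by simp
  have "Comp C i i k (Comp C i j k g f) (Rst C i j f) = Comp C i j k g f"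
    using comp_assoc'[OF rst_hom[OF f] f g] comp_rst[OF f] by simp
  then have "Rst C i k (Comp C i j k g f) = Comp C i i i (Rst C i k (Comp C i j k g f)) (Rst C i j f)"
    using rst_comp_rst[OF f gf] by simp
  then show "p (Rst C i k (Comp C i j k g f)) \<Longrightarrow> p (Rst C i j f)"
    using point_comp[OF p rst_RIdem[OF gf] rst_RIdem[OF f]] by simp
qed

text \<open>The new point is \<open>p\<close> after the inverse image map of \<open>f\<close>. That
  map preserves meets by \<open>rst_after\<close>, and joins because precomposition with
  \<open>f\<close> does and \<open>rst_join\<close> passes this to restrictions. The top is sent to
  the restriction of \<open>f\<close>, whence the hypothesis that \<open>p\<close> holds
  there.\<close>

lemma push_point:
  assumes f: "f \<in> Hom C i j" and p: "p \<in> pts C i" "p (Rst C i j f)"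
  shows "push C i j f p \<in> pts C j"
  unfolding points_iff[OF hom_cod[OF f]]
proof (intro conjI allI ballI impI)
  have r: "Comp C i j j x f \<in> Hom C i j" if "x \<in> RIdem C j" for x using f RIdem_in[OF that] by simp
  show "push C i j f p x \<Longrightarrow> x \<in> RIdem C j" for x by (simp add: push_def)
  show "push C i j f p (Idn C j)"
    using idn_RIdem[OF hom_cod[OF f]] p idn_comp[OF f] by (simp add: push_def)
  show "push C i j f p (Comp C j j j x y) \<longleftrightarrow> push C i j f p x \<and> push C i j f p y"
    if x: "x \<in> RIdem C j" and y: "y \<in> RIdem C j" for x y
  proof -
    have "Comp C i j j (Comp C j j j x y) f = Comp C i j j x (Comp C i i j f (Rst C i j (Comp C i j j y f)))"
      using comp_assoc'[OF f RIdem_in[OF y] RIdem_in[OF x]] rst_after[OF f RIdem_in[OF y]] RIdem_rst[OF y]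
      by simp
    also have "\<dots> = Comp C i i j (Comp C i j j x f) (Rst C i j (Comp C i j j y f))"
      using comp_assoc[OF rst_hom[OF r[OF y]] f RIdem_in[OF x]] .
    finally have "Rst C i j (Comp C i j j (Comp C j j j x y) f) =
        Comp C i i i (Rst C i j (Comp C i j j x f)) (Rst C i j (Comp C i j j y f))"
      using rst_comp_rst[OF r[OF y] r[OF x]] by simp
    then show ?thesis using point_comp[OF p(1) rst_RIdem[OF r[OF x]] rst_RIdem[OF r[OF y]]] x y
      by (simp add: push_def RIdem_comp)
  qed
  show "push C i j f p e \<longleftrightarrow> (\<exists>x\<in>S. push C i j f p x)"
    if S: "S \<subseteq> RIdem C j" and e: "is_join C j j S e" for S e
  proof -
    have SH: "S \<subseteq> Hom C j j" using S RIdem_in by blast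
    have TH: "(\<lambda>s. Comp C i j j s f) ` S \<subseteq> Hom C i j" using S r by blast
    have "is_join C i i (Rst C i j ` (\<lambda>s. Comp C i j j s f) ` S) (Rst C i j (Comp C i j j e f))"
      by (rule rst_join[OF TH is_join_stable[OF SH e f]])
    moreover have "Rst C i j ` (\<lambda>s. Comp C i j j s f) ` S \<subseteq> RIdem C i"
      using TH rst_RIdem by blast
    ultimately have "p (Rst C i j (Comp C i j j e f)) \<longleftrightarrow>
        (\<exists>x\<in>Rst C i j ` (\<lambda>s. Comp C i j j s f) ` S. p x)"
      using point_join[OF p(1)] by blast
    then show ?thesis using S join_RIdem[OF S e] unfolding push_def by auto
  qed
qed

lemma push_RIdem:
  assumes e: "e \<in> RIdem C i" and p: "p \<in> pts C i" "p e"
  shows "push C i i e p = p"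
proof
  fix x
  show "push C i i e p x = p x"
  proof (cases "x \<in> RIdem C i")
    case True
    then show ?thesis using point_comp[OF p(1) True e] p(2) RIdem_rst[OF RIdem_comp[OF True e]]
      by (simp add: push_def)
  next
    case False
    then show ?thesis using point_RIdem[OF p(1)] by (auto simp: push_def)
  qed
qed

lemma push_comp:
  assumes f: "f \<in> Hom C i j" and g: "g \<in> Hom C j k"
  shows "push C i k (Comp C i j k g f) p = push C j k g (push C i j f p)"
proof
  fix x
  show "push C i k (Comp C i j k g f) p x = push C j k g (push C i j f p) x"
  proof (cases "x \<in> RIdem C k")
    case True
    have xg: "Comp C j k k x g \<in> Hom C j k" using g RIdem_in[OF True] by simp
    show ?thesis
      using True rst_RIdem[OF xg] rst_comp[OF f xg] comp_assoc[OF f g RIdem_in[OF True]]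
      by (simp add: push_def)
  qed (simp add: push_def)
qed

text \<open>Within \<open>e\<close>, the inverse image of \<open>x\<close> along \<open>f\<close>
  depends only on \<open>f e\<close>; and since \<open>p e\<close> holds, \<open>p\<close> does not
  distinguish an idempotent from its meet with \<open>e\<close>.\<close>

lemma push_agr:
  assumes f: "f \<in> Hom C i j" and g: "g \<in> Hom C i j" and p: "p \<in> pts C i" and a: "agr C i j f g p"
  shows "push C i j f p = push C i j g p"
proof
  obtain e where e: "e \<in> RIdem C i" "p e" "Comp C i i j f e = Comp C i i j g e"
    using a by (auto simp: agr_def)
  fix x
  show "push C i j f p x = push C i j g p x"
  proof (cases "x \<in> RIdem C j")
    case True
    have H: "Comp C i j j x f \<in> Hom C i j" "Comp C i j j x g \<in> Hom C i j"
      using f g RIdem_in[OF True] by auto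
    have "Comp C i i j (Comp C i j j x f) e = Comp C i i j (Comp C i j j x g) e"
      using comp_assoc'[OF RIdem_in[OF e(1)] f RIdem_in[OF True]]
        comp_assoc'[OF RIdem_in[OF e(1)] g RIdem_in[OF True]] e(3) by simp
    then have "Comp C i i i (Rst C i j (Comp C i j j x f)) e = Comp C i i i (Rst C i j (Comp C i j j x g)) e"
      using rst_comp_RIdem[OF H(1) e(1)] rst_comp_RIdem[OF H(2) e(1)] by simp
    then have "p (Rst C i j (Comp C i j j x f)) = p (Rst C i j (Comp C i j j x g))"
      using point_comp[OF p rst_RIdem[OF H(1)] e(1)] point_comp[OF p rst_RIdem[OF H(2)] e(1)] e(2)
      by simp
    then show ?thesis by (simp add: push_def)
  qed (simp add: push_def)
qed

lemma push_rst:
  assumes "f \<in> Hom C i j" "g \<in> Hom C j k"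
  shows "push C i j f p (Rst C j k g) \<longleftrightarrow> p (Rst C i k (Comp C i j k g f))"
  using rst_comp[OF assms] rst_RIdem[OF assms(2)] by (simp add: push_def)

lemma agr_refl: "f \<in> Hom C i j \<Longrightarrow> p (Rst C i j f) \<Longrightarrow> agr C i j f f p"
  unfolding agr_def using rst_RIdem by blast

lemma agr_sym: "agr C i j f g p \<Longrightarrow> agr C i j g f p"
  unfolding agr_def by metis

lemma agr_trans:
  assumes H: "f \<in> Hom C i j" "g \<in> Hom C i j" "h \<in> Hom C i j" "p \<in> pts C i"
    and 1: "agr C i j f g p" and 2: "agr C i j g h p"
  shows "agr C i j f h p"
proof -
  obtain e where e: "e \<in> RIdem C i" "p e" "Comp C i i j f e = Comp C i i j g e"
    using 1 by (auto simp: agr_def)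
  obtain d where d: "d \<in> RIdem C i" "p d" "Comp C i i j g d = Comp C i i j h d"
    using 2 by (auto simp: agr_def)
  note ed = RIdem_in[OF e(1)] RIdem_in[OF d(1)]
  have "Comp C i i j f (Comp C i i i e d) = Comp C i i j (Comp C i i j g e) d"
    using comp_assoc[OF ed(2,1) H(1)] e(3) by simp
  also have "\<dots> = Comp C i i j g (Comp C i i i d e)"
    using comp_assoc'[OF ed(2,1) H(2)] RIdem_commute[OF e(1) d(1)] by simp
  also have "\<dots> = Comp C i i j h (Comp C i i i d e)"
    using comp_assoc[OF ed(1,2) H(2)] comp_assoc[OF ed(1,2) H(3)] d(3) by simp
  also have "Comp C i i i d e = Comp C i i i e d" using RIdem_commute[OF e(1) d(1)] by simp
  finally show ?thesis
    using 1 2 point_comp[OF H(4) e(1) d(1)] e(2) d(2) RIdem_comp[OF e(1) d(1)]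
    unfolding agr_def by blast
qed

text \<open>If \<open>f\<close> and \<open>f'\<close> agree on \<open>e\<close>, and
  \<open>g\<close> and \<open>g'\<close> agree on \<open>d\<close>, then the composites agree on the
  meet of \<open>e\<close> with the inverse image of \<open>d\<close> along \<open>f\<close>. This
  makes multiplication of germs independent of representatives.\<close>

lemma agr_comp:
  assumes f: "f \<in> Hom C i j" "f' \<in> Hom C i j" and g: "g \<in> Hom C j k" "g' \<in> Hom C j k"
    and p: "p \<in> pts C i" and 1: "agr C i j f f' p" and 2: "agr C j k g g' (push C i j f p)"
  shows "agr C i k (Comp C i j k g f) (Comp C i j k g' f') p"
proof -
  obtain e where e: "e \<in> RIdem C i" "p e" "Comp C i i j f e = Comp C i i j f' e"
    using 1 by (auto simp: agr_def)
  obtain d where d: "d \<in> RIdem C j" "push C i j f p d" "Comp C j j k g d = Comp C j j k g' d"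
    using 2 by (auto simp: agr_def)
  note eH = RIdem_in[OF e(1)] and dH = RIdem_in[OF d(1)]
  have H: "Comp C i j j d f \<in> Hom C i j" "Comp C i j j d f' \<in> Hom C i j"
    using f dH by auto
  let ?r = "Rst C i j (Comp C i j j d f)" and ?r' = "Rst C i j (Comp C i j j d f')"
  have pd: "p ?r" using d(2) by (simp add: push_def)
  have rR: "?r \<in> RIdem C i" "?r' \<in> RIdem C i" using H by (auto intro: rst_RIdem)
  \<comment> \<open>Inside \<open>e\<close> the inverse images of \<open>d\<close> along
    \<open>f\<close> and along \<open>f'\<close> coincide, so one neighbourhood serves both
    composites.\<close>
  have re: "Comp C i i i ?r e = Comp C i i i ?r' e"
    using rst_comp_RIdem[OF H(1) e(1)] rst_comp_RIdem[OF H(2) e(1)] e(3)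
      comp_assoc'[OF eH f(1) dH] comp_assoc'[OF eH f(2) dH] by simp
  \<comment> \<open>By \<open>rst_after\<close>, restricting to the inverse image of
    \<open>d\<close> amounts to inserting \<open>d\<close> between the two factors.\<close>
  have key: "Comp C i i k (Comp C i j k h q) (Comp C i i i (Rst C i j (Comp C i j j d q)) e) =
      Comp C i j k (Comp C j j k h d) (Comp C i i j q e)"
    if q: "q \<in> Hom C i j" and h: "h \<in> Hom C j k" for q h
  proof -
    have dq: "Comp C i j j d q \<in> Hom C i j" using q dH by simp
    have qe: "Comp C i i j q e \<in> Hom C i j" using q eH by simp
    have "Comp C i i j q (Comp C i i i (Rst C i j (Comp C i j j d q)) e) =
        Comp C i i j (Comp C i j j (Rst C j j d) q) e"
      using comp_assoc[OF eH rst_hom[OF dq] q] rst_after[OF q dH] by simp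
    also have "\<dots> = Comp C i j j d (Comp C i i j q e)"
      using RIdem_rst[OF d(1)] comp_assoc'[OF eH q dH] by simp
    finally have "Comp C i j k h (Comp C i i j q (Comp C i i i (Rst C i j (Comp C i j j d q)) e)) =
        Comp C i j k h (Comp C i j j d (Comp C i i j q e))" by simp
    then show ?thesis
      using comp_assoc[OF comp_in[OF eH rst_hom[OF dq]] q h] comp_assoc[OF qe dH h] by simp
  qed
  have "Comp C i i k (Comp C i j k g f) (Comp C i i i ?r e) =
      Comp C i i k (Comp C i j k g' f') (Comp C i i i ?r e)"
    using key[OF f(1) g(1)] key[OF f(2) g(2)] re d(3) e(3) by simp
  moreover have "p (Comp C i i i ?r e)" using point_comp[OF p rR(1) e(1)] pd e(2) by simp
  moreover have "p (Rst C i k (Comp C i j k g f))" using push_rst[OF f(1) g(1)] 2 by (simp add: agr_def)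
  moreover have "p (Rst C i k (Comp C i j k g' f'))"
    using push_rst[OF f(2) g(2)] 2 push_agr[OF f p 1] by (simp add: agr_def)
  ultimately show ?thesis using RIdem_comp[OF rR(1) e(1)] unfolding agr_def by blast
qed

text \<open>\<open>E\<close> is the join of all idempotents on which the maps agree, each cut down
  to the common domain. Points respect joins, so \<open>E\<close> contains exactly the points where
  the germs agree; and by \<open>comp_join\<close> the maps agree on the whole of \<open>E\<close>.
  The latter is the passage from germs back to maps.\<close>

lemma agr_open:
  assumes f: "f \<in> Hom C i j" and g: "g \<in> Hom C i j"
  shows "\<exists>E\<in>RIdem C i. (\<forall>p\<in>pts C i. p E \<longleftrightarrow> agr C i j f g p) \<and> Comp C i i j f E = Comp C i i j g E"
proof -
  let ?x = "Comp C i i i (Rst C i j f) (Rst C i j g)"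
  let ?S = "{Comp C i i i ?x e |e. e \<in> RIdem C i \<and> Comp C i i j f e = Comp C i i j g e}"
  have x: "?x \<in> RIdem C i" by (rule RIdem_comp[OF rst_RIdem[OF f] rst_RIdem[OF g]])
  have S: "?S \<subseteq> RIdem C i" using RIdem_comp[OF x] by blast
  obtain E where E: "E \<in> RIdem C i" "is_join C i i ?S E"
    using RIdem_has_join[OF hom_dom[OF f] S] by blast
  have "p E \<longleftrightarrow> agr C i j f g p" if p: "p \<in> pts C i" for p
  proof -
    have "p E \<longleftrightarrow> (\<exists>e\<in>RIdem C i. Comp C i i j f e = Comp C i i j g e \<and> p (Comp C i i i ?x e))"
      using point_join[OF p S E(2)] by blast
    also have "\<dots> \<longleftrightarrow> agr C i j f g p"
      unfolding agr_def using point_comp[OF p x] point_comp[OF p rst_RIdem[OF f] rst_RIdem[OF g]] by blast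
    finally show ?thesis .
  qed
  moreover have "(\<lambda>d. Comp C i i j f d) ` ?S = (\<lambda>d. Comp C i i j g d) ` ?S"
  proof (rule image_cong[OF refl])
    fix d assume "d \<in> ?S"
    then obtain e where e: "d = Comp C i i i ?x e" "e \<in> RIdem C i" "Comp C i i j f e = Comp C i i j g e"
      by blast
    have "d = Comp C i i i e ?x" using e(1) RIdem_commute[OF x e(2)] by simp
    then show "Comp C i i j f d = Comp C i i j g d"
      using comp_assoc[OF RIdem_in[OF x] RIdem_in[OF e(2)] f]
        comp_assoc[OF RIdem_in[OF x] RIdem_in[OF e(2)] g] e(3) by simp
  qed
  then have "Comp C i i j f E = Comp C i i j g E"
    using comp_join[OF S E(2) f] comp_join[OF S E(2) g] is_join_unique by simp
  ultimately show ?thesis using E by blast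
qed

lemma openin_agr:
  assumes "f \<in> Hom C i j" "g \<in> Hom C i j"
  shows "openin (pt (RLoc C i)) {p \<in> pts C i. agr C i j f g p}"
proof -
  obtain E where "E \<in> RIdem C i" "\<forall>p\<in>pts C i. p E \<longleftrightarrow> agr C i j f g p"
    using agr_open[OF assms] by blast
  then have "{p \<in> pts C i. agr C i j f g p} = {p \<in> pts C i. p E}" by blast
  then show ?thesis using openin_ptI[OF \<open>E \<in> RIdem C i\<close>] by simp
qed

lemma openin_rst: "f \<in> Hom C i j \<Longrightarrow> openin (pt (RLoc C i)) {p \<in> pts C i. p (Rst C i j f)}"
  by (rule openin_ptI[OF rst_RIdem])

lemma tmap_W_Top_p:
  assumes f: "f \<in> Hom C i j"
  shows "pt_map (RLoc C i) (RLoc C j) (RLoc_map C i j f) \<in> Top_p (pt (RLoc C i)) (pt (RLoc C j))"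
    (is "?t \<in> _")
  unfolding Top_p_iff
proof (intro conjI allI impI)
  show "ran ?t \<subseteq> topspace (pt (RLoc C j))"
    using push_point[OF f] by (auto simp: tmap_W[OF f] topspace_pt[OF hom_cod[OF f]] ran_def)
  fix V assume "openin (pt (RLoc C j)) V"
  then obtain e where e: "e \<in> RIdem C j" "V = {p \<in> pts C j. p e}"
    using openin_pt[OF hom_cod[OF f]] by blast
  have ef: "Comp C i j j e f \<in> Hom C i j" using f RIdem_in[OF e(1)] by simp
  have "pre ?t V = {p \<in> pts C i. p (Rst C i j f)} \<inter> {p \<in> pts C i. p (Rst C i j (Comp C i j j e f))}"
    using push_point[OF f] e by (auto simp: tmap_W[OF f] pre_def push_def split: if_splits)
  then show "openin (pt (RLoc C i)) (pre ?t V)" using openin_rst[OF f] openin_rst[OF ef] by auto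
qed

text \<open>An idempotent acts on points as the partial identity on those at which it holds. The
  join that defines \<open>agree\<close> is therefore the partial identity on a union, namely on the
  points where the two germs coincide.\<close>

lemma agree_W:
  assumes f: "f \<in> Hom C i j" and g: "g \<in> Hom C i j"
  shows "agree (W C) i j f g = (\<lambda>p. if p \<in> pts C i \<and> agr C i j f g p then Some p else None)"
proof -
  let ?T = "pt (RLoc C i)"
  let ?x = "Comp C i i i (Rst C i j f) (Rst C i j g)"
  let ?h = "\<lambda>p. if p \<in> pts C i \<and> agr C i j f g p then Some p else None"
  let ?R = "{e \<in> RIdem C i. rle C i i e ?x \<and> Comp C i i j f e = Comp C i i j g e}"
  let ?t = "\<lambda>e. pt_map (RLoc C i) (RLoc C i) (RLoc_map C i i e)"
  have x: "?x \<in> RIdem C i" by (rule RIdem_comp[OF rst_RIdem[OF f] rst_RIdem[OF g]])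
  have te: "?t e p = Some q \<longleftrightarrow> p \<in> pts C i \<and> p e \<and> q = p" if e: "e \<in> RIdem C i" for e p q
    using push_RIdem[OF e] RIdem_rst[OF e] by (auto simp: tmap_W[OF RIdem_in[OF e]])
  have ex: "(\<exists>e\<in>?R. p e) \<longleftrightarrow> agr C i j f g p" if p: "p \<in> pts C i" for p
  proof
    assume "\<exists>e\<in>?R. p e"
    then obtain e where e: "e \<in> RIdem C i" "rle C i i e ?x" "Comp C i i j f e = Comp C i i j g e" "p e"
      by blast
    then have "p ?x" using point_mono[OF p _ x] by blast
    then show "agr C i j f g p"
      using e point_comp[OF p rst_RIdem[OF f] rst_RIdem[OF g]] unfolding agr_def by blast
  next
    assume a: "agr C i j f g p"
    then obtain e where e: "e \<in> RIdem C i" "p e" "Comp C i i j f e = Comp C i i j g e"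
      by (auto simp: agr_def)
    have "p ?x" using a point_comp[OF p rst_RIdem[OF f] rst_RIdem[OF g]] by (simp add: agr_def)
    then have "p (Comp C i i i e ?x)" using point_comp[OF p e(1) x] e(2) by simp
    moreover have "Comp C i i i e ?x \<in> ?R"
      using RIdem_comp[OF e(1) x] RIdem_commute[OF e(1) x] rle_comp_RIdem[OF RIdem_in[OF x] e(1)]
        comp_assoc[OF RIdem_in[OF x] RIdem_in[OF e(1)] f]
        comp_assoc[OF RIdem_in[OF x] RIdem_in[OF e(1)] g] e(3) by simp
    ultimately show "\<exists>e\<in>?R. p e" by blast
  qed
  have TT: "?t ` ?R \<subseteq> Top_p ?T ?T" using tmap_W_Top_p[OF RIdem_in] by blast
  have h: "?h p = Some q \<longleftrightarrow> (\<exists>s\<in>?t ` ?R. s p = Some q)" for p q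
  proof -
    have "(\<exists>s\<in>?t ` ?R. s p = Some q) \<longleftrightarrow> (\<exists>e\<in>?R. ?t e p = Some q)" by blast
    also have "\<dots> \<longleftrightarrow> (\<exists>e\<in>?R. p \<in> pts C i \<and> p e \<and> q = p)" using te by blast
    also have "\<dots> \<longleftrightarrow> p \<in> pts C i \<and> q = p \<and> (\<exists>e\<in>?R. p e)" by blast
    also have "\<dots> \<longleftrightarrow> p \<in> pts C i \<and> q = p \<and> agr C i j f g p" using ex by blast
    finally show ?thesis by auto
  qed
  have hT: "?h \<in> Top_p ?T ?T"
    by (rule Top_p_union[of _ "?t ` ?R"]) (use h TT in \<open>unfold map_le_iff_Some, blast+\<close>)
  have "is_joinp ?T ?T (?t ` ?R) ?h" using is_joinp_iff[OF TT] hT h by blast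
  moreover have "?t ` ?R = {?t e |e. e \<in> RIdem C i \<and> rle C i i e ?x \<and>
      Comp C i i j f e = Comp C i i j g e}" by blast
  ultimately have j: "is_joinp ?T ?T {?t e |e. e \<in> RIdem C i \<and> rle C i i e ?x \<and>
      Comp C i i j f e = Comp C i i j g e} ?h" by simp
  have "agree (W C) i j f g = (THE h. is_joinp ?T ?T {?t e |e. e \<in> RIdem C i \<and> rle C i i e ?x \<and>
      Comp C i i j f e = Comp C i i j g e} h)"
    by (simp only: agree_def W_def prod.case topfun.simps)
  also have "\<dots> = ?h"
    by (rule the_equality, rule j) (rule is_joinp_unique[OF _ j])
  finally show ?thesis .
qed

lemma sect_W:
  assumes f: "f \<in> Hom C i j"
  shows "sect (W C) i j f =
    (\<lambda>p. if p \<in> pts C i \<and> p (Rst C i j f) then Some (gm C i j f p) else None)"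
proof
  fix p
  have d: "p \<in> dom (agree (W C) i j f g) \<longleftrightarrow> p \<in> pts C i \<and> agr C i j f g p" if "g \<in> Hom C i j" for g
    by (auto simp: agree_W[OF f that] split: if_splits)
  have "agr C i j f f p \<longleftrightarrow> p (Rst C i j f)"
    using agr_refl[OF f] by (auto simp: agr_def)
  moreover have "{(g, p) |g. g \<in> Hom C i j \<and> p \<in> dom (agree (W C) i j f g)} = gm C i j f p"
    if "p \<in> pts C i" using d that unfolding gm_def by blast
  ultimately show "sect (W C) i j f p =
      (if p \<in> pts C i \<and> p (Rst C i j f) then Some (gm C i j f p) else None)"
    using d[OF f] by (simp add: sect_def)
qed

text \<open>Agreement at \<open>p\<close> is an equivalence on the maps defined there and germs are
  its classes. The base point can be recovered because every pair in a germ carries it, and the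
  hypothesis on \<open>f\<close> ensures that its germ is not empty.\<close>

lemma gm_eq_iff:
  assumes f: "f \<in> Hom C i j" and g: "g \<in> Hom C i j" and p: "p \<in> pts C i" "p (Rst C i j f)"
  shows "gm C i j f p = gm C i j g q \<longleftrightarrow> p = q \<and> agr C i j f g p"
proof
  assume "gm C i j f p = gm C i j g q"
  moreover have "(f, p) \<in> gm C i j f p" using f agr_refl[OF f] p by (simp add: gm_def)
  ultimately have "(f, p) \<in> gm C i j g q" by simp
  then show "p = q \<and> agr C i j f g p" using agr_sym by (auto simp: gm_def)
next
  assume H: "p = q \<and> agr C i j f g p"
  then have "agr C i j f h p \<longleftrightarrow> agr C i j g h p" if "h \<in> Hom C i j" for h
    using agr_trans[OF f g that p(1)] agr_trans[OF g f that p(1)] agr_sym by blast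
  then show "gm C i j f p = gm C i j g q" using H unfolding gm_def by blast
qed

lemma gm_base: "f \<in> Hom C i j \<Longrightarrow> p (Rst C i j f) \<Longrightarrow> (\<exists>g. (g, q) \<in> gm C i j f p) \<longleftrightarrow> q = p"
  using agr_refl[of f i j p] by (auto simp: gm_def)

end

section \<open>The space of germs\<close>

lemma pre_Int: "pre f (V \<inter> V') = pre f V \<inter> pre f V'"
  by (auto simp: pre_def)

lemma pre_Union: "pre f (\<Union>K) = (\<Union>V\<in>K. pre f V)"
  by (auto simp: pre_def)

text \<open>\<open>pre\<close> commutes with intersections and unions, so the sets with open
  preimages along all sections do form a topology, the final one.\<close>

lemma openin_germ_space:
  "openin (germ_space AP i j) V \<longleftrightarrow> V \<subseteq> germs AP i j \<and>
     (\<forall>f \<in> Hom (fst AP) i j. openin (tob (snd AP) i) (pre (sect AP i j f) V))"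
proof -
  have "istopology (\<lambda>V. V \<subseteq> germs AP i j \<and>
     (\<forall>f \<in> Hom (fst AP) i j. openin (tob (snd AP) i) (pre (sect AP i j f) V)))"
    unfolding istopology_def by (auto simp: pre_Int pre_Union)
  then show ?thesis unfolding germ_space_def pre_def[symmetric] by (simp add: topology_inverse')
qed

section \<open>Sections of germs and glueing of maps along them\<close>

context join_category
begin

lemma sect_Some:
  "f \<in> Hom C i j \<Longrightarrow>
    sect (W C) i j f p = Some a \<longleftrightarrow> p \<in> pts C i \<and> p (Rst C i j f) \<and> a = gm C i j f p"
  by (auto simp: sect_W)

lemma dom_sect: "f \<in> Hom C i j \<Longrightarrow> dom (sect (W C) i j f) = {p \<in> pts C i. p (Rst C i j f)}"
  by (auto simp: sect_W split: if_splits)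

lemma germs_iff: "a \<in> germs (W C) i j \<longleftrightarrow>
    (\<exists>f p. f \<in> Hom C i j \<and> p \<in> pts C i \<and> p (Rst C i j f) \<and> a = gm C i j f p)"
  unfolding germs_def ran_def W_sel by (auto simp: sect_Some)

lemma topspace_germ_space: "topspace (germ_space (W C) i j) = germs (W C) i j"
proof
  show "topspace (germ_space (W C) i j) \<subseteq> germs (W C) i j"
    using openin_topspace[of "germ_space (W C) i j"] unfolding openin_germ_space by blast
  have "openin (pt (RLoc C i)) (pre (sect (W C) i j f) (germs (W C) i j))" if f: "f \<in> Hom C i j" for f
  proof -
    have "pre (sect (W C) i j f) (germs (W C) i j) = {p \<in> pts C i. p (Rst C i j f)}"
      using f by (auto simp: pre_def sect_Some germs_iff)
    then show ?thesis using openin_rst[OF f] by simp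
  qed
  then have "openin (germ_space (W C) i j) (germs (W C) i j)" by (simp add: openin_germ_space)
  then show "germs (W C) i j \<subseteq> topspace (germ_space (W C) i j)" by (rule openin_subset)
qed

lemma gm_in: "f \<in> Hom C i j \<Longrightarrow> p \<in> pts C i \<Longrightarrow> p (Rst C i j f) \<Longrightarrow>
    gm C i j f p \<in> topspace (germ_space (W C) i j)"
  unfolding topspace_germ_space germs_iff by blast

lemma germE:
  assumes "a \<in> topspace (germ_space (W C) i j)"
  obtains f p where "f \<in> Hom C i j" "p \<in> pts C i" "p (Rst C i j f)" "a = gm C i j f p"
  using assms unfolding topspace_germ_space germs_iff by blast

lemma sect_Top_p:
  assumes f: "f \<in> Hom C i j"
  shows "sect (W C) i j f \<in> Top_p (pt (RLoc C i)) (germ_space (W C) i j)"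
proof -
  have "ran (sect (W C) i j f) \<subseteq> topspace (germ_space (W C) i j)"
    using gm_in[OF f] by (auto simp: ran_def sect_Some[OF f])
  moreover have "openin (pt (RLoc C i)) (pre (sect (W C) i j f) V)"
    if "openin (germ_space (W C) i j) V" for V
    using that f unfolding openin_germ_space W_sel by blast
  ultimately show ?thesis unfolding Top_p_iff by blast
qed

text \<open>For a final topology continuity is tested along the sections; the condition on the
  domain puts preimages inside the set of germs.\<close>

lemma germ_space_Top_pI:
  assumes d: "dom t \<subseteq> topspace (germ_space (W C) i j)"
    and c: "\<And>f. f \<in> Hom C i j \<Longrightarrow> t \<circ>\<^sub>m sect (W C) i j f \<in> Top_p (pt (RLoc C i)) Z"
  shows "t \<in> Top_p (germ_space (W C) i j) Z"
  unfolding Top_p_iff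
proof (intro conjI allI impI)
  show "ran t \<subseteq> topspace Z"
  proof
    fix z assume "z \<in> ran t"
    then obtain a where a: "t a = Some z" by (auto simp: ran_def)
    then have "a \<in> topspace (germ_space (W C) i j)" using d by blast
    then obtain f p where f: "f \<in> Hom C i j" "p \<in> pts C i" "p (Rst C i j f)" "a = gm C i j f p"
      by (rule germE)
    then have "(t \<circ>\<^sub>m sect (W C) i j f) p = Some z" using a by (simp add: sect_W)
    then show "z \<in> topspace Z" using Top_pD(6)[OF c[OF f(1)]] by blast
  qed
  fix V assume V: "openin Z V"
  have "pre t V \<subseteq> germs (W C) i j" using d by (auto simp: pre_def topspace_germ_space)
  moreover have "openin (pt (RLoc C i)) (pre (sect (W C) i j f) (pre t V))" if "f \<in> Hom C i j" for f
    using Top_pD(4)[OF c[OF that] V] by (simp add: pre_comp)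
  ultimately show "openin (germ_space (W C) i j) (pre t V)" by (simp add: openin_germ_space)
qed

lemma germ_map_eqI:
  assumes "dom t \<subseteq> topspace (germ_space (W C) i j)" "dom t' \<subseteq> topspace (germ_space (W C) i j)"
    and c: "\<And>f. f \<in> Hom C i j \<Longrightarrow> t \<circ>\<^sub>m sect (W C) i j f = t' \<circ>\<^sub>m sect (W C) i j f"
  shows "t = t'"
proof
  fix a
  show "t a = t' a"
  proof (cases "a \<in> topspace (germ_space (W C) i j)")
    case True
    then obtain f p where f: "f \<in> Hom C i j" "p \<in> pts C i" "p (Rst C i j f)" "a = gm C i j f p"
      by (rule germE)
    then show ?thesis using fun_cong[OF c[OF f(1)], of p] by (simp add: sect_W)
  next
    case False
    then have "a \<notin> dom t" "a \<notin> dom t'" using assms(1,2) by auto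
    then show ?thesis by (simp add: domIff)
  qed
qed

text \<open>The universal property in the form that unfolds a definition by \<open>THE\<close>: a
  family indexed by maps descends to germs when its members agree wherever the indices have the same
  germ. Uniqueness holds because the sections cover the space.\<close>

lemma germ_glue:
  assumes k: "\<And>f. f \<in> Hom C i j \<Longrightarrow> k f \<in> Top_p (pt (RLoc C i)) Z"
    and d: "\<And>f. f \<in> Hom C i j \<Longrightarrow> dom (k f) \<subseteq> dom (sect (W C) i j f)"
    and c: "\<And>f g p. f \<in> Hom C i j \<Longrightarrow> g \<in> Hom C i j \<Longrightarrow> p \<in> pts C i \<Longrightarrow> agr C i j f g p \<Longrightarrow> k f p = k g p"
  shows "\<exists>!t. t \<in> Top_p (germ_space (W C) i j) Z \<and> (\<forall>f\<in>Hom C i j. t \<circ>\<^sub>m sect (W C) i j f = k f)"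
proof (rule ex_ex1I)
  let ?R = "\<lambda>a (f, p). f \<in> Hom C i j \<and> p \<in> pts C i \<and> p (Rst C i j f) \<and> a = gm C i j f p"
  \<comment> \<open>A representative of the germ is chosen. By \<open>gm_eq_iff\<close> two choices
    have the same base point and agree there, so the value is independent of the choice by
    hypothesis \<open>c\<close>.\<close>
  define t where "t = (\<lambda>a. if a \<in> topspace (germ_space (W C) i j)
    then (case (SOME fp. ?R a fp) of (f, p) \<Rightarrow> k f p) else None)"
  have t: "t (gm C i j f p) = k f p" if f: "f \<in> Hom C i j" "p \<in> pts C i" "p (Rst C i j f)" for f p
  proof -
    obtain g q where gq: "(SOME fp. ?R (gm C i j f p) fp) = (g, q)" by (cases "SOME fp. ?R (gm C i j f p) fp")
    have "?R (gm C i j f p) (SOME fp. ?R (gm C i j f p) fp)"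
      by (rule someI[of _ "(f, p)"]) (use f in simp)
    then have g: "g \<in> Hom C i j" "gm C i j f p = gm C i j g q" unfolding gq by auto
    then have "p = q" "agr C i j f g p" using gm_eq_iff[OF f(1) g(1) f(2,3)] by auto
    then show ?thesis using c[OF f(1) g(1) f(2)] gm_in[OF f] gq by (simp add: t_def)
  qed
  have tk: "t \<circ>\<^sub>m sect (W C) i j f = k f" if f: "f \<in> Hom C i j" for f
  proof
    fix p
    show "(t \<circ>\<^sub>m sect (W C) i j f) p = k f p"
    proof (cases "p \<in> dom (sect (W C) i j f)")
      case True
      then show ?thesis using t[OF f, of p] by (simp add: dom_sect[OF f]) (simp add: sect_W[OF f])
    next
      case False
      then have "k f p = None" "sect (W C) i j f p = None" using d[OF f] by (auto simp: domIff)
      then show ?thesis by simp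
    qed
  qed
  have "t \<in> Top_p (germ_space (W C) i j) Z"
    by (rule germ_space_Top_pI) (use tk k in \<open>auto simp: t_def split: if_splits\<close>)
  then show "\<exists>t. t \<in> Top_p (germ_space (W C) i j) Z \<and> (\<forall>f\<in>Hom C i j. t \<circ>\<^sub>m sect (W C) i j f = k f)"
    using tk by blast
next
  fix t t'
  assume "t \<in> Top_p (germ_space (W C) i j) Z \<and> (\<forall>f\<in>Hom C i j. t \<circ>\<^sub>m sect (W C) i j f = k f)"
    "t' \<in> Top_p (germ_space (W C) i j) Z \<and> (\<forall>f\<in>Hom C i j. t' \<circ>\<^sub>m sect (W C) i j f = k f)"
  then show "t = t'" by (intro germ_map_eqI[of t i j t']) (auto dest: Top_pD(2))
qed

lemma germ_base_gm:
  assumes f: "f \<in> Hom C i j" "p \<in> pts C i" "p (Rst C i j f)"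
  shows "germ_base (W C) i j (gm C i j f p) = Some p"
  using gm_in[OF f] gm_base[where f=f and i=i and j=j and p=p, OF f(1,3)] by (simp add: germ_base_def topspace_germ_space)

lemma dom_germ_base: "dom (germ_base (W C) i j) = topspace (germ_space (W C) i j)"
  by (auto simp: germ_base_def topspace_germ_space split: if_splits)

lemma base_sect:
  assumes f: "f \<in> Hom C i j"
  shows "germ_base (W C) i j \<circ>\<^sub>m sect (W C) i j f = rstp (sect (W C) i j f)"
  using germ_base_gm[OF f] by (intro ext) (simp add: rstp_def dom_sect[OF f], simp add: sect_W[OF f])

lemma germ_base_Top_p:
  "germ_base (W C) i j \<in> Top_p (germ_space (W C) i j) (pt (RLoc C i))"
  by (rule germ_space_Top_pI)
    (auto simp: dom_germ_base base_sect intro: rstp_Top_p[OF sect_Top_p])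

lemma germ_base_total: "germ_base (W C) i j \<in> total_maps (germ_space (W C) i j) (pt (RLoc C i))"
  by (simp add: total_maps_iff germ_base_Top_p dom_germ_base)

text \<open>The preimage of the image of one section along another is the set of points where the
  two germs agree, which is open by \<open>openin_agr\<close>.\<close>

lemma open_ran_sect:
  assumes f: "f \<in> Hom C i j"
  shows "openin (germ_space (W C) i j) (ran (sect (W C) i j f))"
proof -
  have "pre (sect (W C) i j g) (ran (sect (W C) i j f)) = {p \<in> pts C i. agr C i j f g p}"
    if g: "g \<in> Hom C i j" for g
  proof (intro equalityI subsetI)
    fix p assume "p \<in> pre (sect (W C) i j g) (ran (sect (W C) i j f))"
    then obtain q where "p \<in> pts C i" "p (Rst C i j g)" "q \<in> pts C i" "q (Rst C i j f)"
        "gm C i j g p = gm C i j f q"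
      using f g by (auto simp: pre_def ran_def sect_Some)
    then show "p \<in> {p \<in> pts C i. agr C i j f g p}" using gm_eq_iff[OF g f] agr_sym by blast
  next
    fix p assume "p \<in> {p \<in> pts C i. agr C i j f g p}"
    then have p: "p \<in> pts C i" "agr C i j f g p" by auto
    then have "p (Rst C i j f)" "p (Rst C i j g)" by (auto simp: agr_def)
    then have "sect (W C) i j g p = Some (gm C i j f p)" "sect (W C) i j f p = Some (gm C i j f p)"
      using gm_eq_iff[OF f g, of p p] p by (auto simp: sect_W[OF f] sect_W[OF g])
    then show "p \<in> pre (sect (W C) i j g) (ran (sect (W C) i j f))" by (force simp: pre_def ran_def)
  qed
  moreover have "ran (sect (W C) i j f) \<subseteq> germs (W C) i j"
    using Top_pD(3)[OF sect_Top_p[OF f]] by (simp add: topspace_germ_space)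
  ultimately show ?thesis using openin_agr[OF f] by (simp add: openin_germ_space)
qed

text \<open>Restricted to the image of the section of \<open>f\<close>, the base point map is
  inverse to that section, and these images are open and cover the space.\<close>

lemma germ_base_local_homeo:
  "local_homeo (germ_space (W C) i j) (pt (RLoc C i)) (germ_base (W C) i j)"
  unfolding local_homeo_iff
proof (intro conjI ballI)
  fix a assume "a \<in> topspace (germ_space (W C) i j)"
  then obtain f p where f: "f \<in> Hom C i j" "p \<in> pts C i" "p (Rst C i j f)" "a = gm C i j f p"
    by (rule germE)
  let ?u = "germ_base (W C) i j |` ran (sect (W C) i j f)"
  have "?u \<in> Top_p (germ_space (W C) i j) (pt (RLoc C i))"
    by (rule restrict_Top_p[OF germ_base_Top_p open_ran_sect[OF f(1)]])
  moreover have "?u x = Some y \<longleftrightarrow> sect (W C) i j f y = Some x" for x y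
    using germ_base_gm[OF f(1)] by (auto simp: restrict_map_def ran_def sect_Some[OF f(1)])
  ultimately have "?u \<in> partial_isos (germ_space (W C) i j) (pt (RLoc C i))"
    unfolding partial_isos_iff using sect_Top_p[OF f(1)] by blast
  moreover have "a \<in> ran (sect (W C) i j f)"
    by (rule ranI[of _ p]) (use f in \<open>simp add: sect_W\<close>)
  then have "a \<in> dom ?u" using germ_base_gm[OF f(1-3)] f(4) by (simp add: dom_def)
  moreover have "?u \<subseteq>\<^sub>m germ_base (W C) i j" by (simp add: map_le_def)
  ultimately show "\<exists>s\<in>partial_isos (germ_space (W C) i j) (pt (RLoc C i)).
      a \<in> dom s \<and> s \<subseteq>\<^sub>m germ_base (W C) i j" by blast
qed (rule germ_base_total)

lemma fprod_germE:
  assumes "(a, y) \<in> topspace (fprod (germ_space (W C) i j) Y (germ_base (W C) i j) \<alpha>)"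
  obtains f p where "f \<in> Hom C i j" "p \<in> pts C i" "p (Rst C i j f)" "a = gm C i j f p"
    "y \<in> topspace Y" "\<alpha> y = Some p"
proof -
  have "a \<in> topspace (germ_space (W C) i j)" "y \<in> topspace Y" "germ_base (W C) i j a = \<alpha> y"
    using assms by auto
  moreover then obtain f p where f: "f \<in> Hom C i j" "p \<in> pts C i" "p (Rst C i j f)" "a = gm C i j f p"
    by (elim germE)
  ultimately show ?thesis using that[OF f] germ_base_gm[OF f(1-3)] by simp
qed

lemma fprod_germI:
  assumes "f \<in> Hom C i j" "p \<in> pts C i" "p (Rst C i j f)" "y \<in> topspace Y" "\<alpha> y = Some p"
  shows "(gm C i j f p, y) \<in> topspace (fprod (germ_space (W C) i j) Y (germ_base (W C) i j) \<alpha>)"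
  using assms gm_in germ_base_gm by simp

lemma fprod_eval:
  assumes "h \<circ>\<^sub>m pairp (sect (W C) i j f \<circ>\<^sub>m \<alpha>) (rstp (sect (W C) i j f \<circ>\<^sub>m \<alpha>)) = k"
    and "f \<in> Hom C i j" "p \<in> pts C i" "p (Rst C i j f)" "\<alpha> y = Some p"
  shows "h (gm C i j f p, y) = k y"
proof -
  have "(sect (W C) i j f \<circ>\<^sub>m \<alpha>) y = Some (gm C i j f p)" using assms by (simp add: sect_W)
  then show ?thesis unfolding assms(1)[symmetric] by (simp add: pairp_def rstp_def dom_def)
qed

text \<open>The relative form of \<open>germ_glue\<close>, along a total map \<alpha> into the space
  of points. It yields existence and uniqueness for multiplication (\<alpha> the target map), for
  the action of a functor on arrows, and for the arrow part of the counit.\<close>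

lemma fprod_glue:
  assumes \<alpha>: "\<alpha> \<in> total_maps Y (pt (RLoc C i))"
    and k: "\<And>f. f \<in> Hom C i j \<Longrightarrow> k f \<in> Top_p Y Z"
    and d: "\<And>f. f \<in> Hom C i j \<Longrightarrow> dom (k f) \<subseteq> dom (sect (W C) i j f \<circ>\<^sub>m \<alpha>)"
    and c: "\<And>f g p y. f \<in> Hom C i j \<Longrightarrow> g \<in> Hom C i j \<Longrightarrow> p \<in> pts C i \<Longrightarrow> \<alpha> y = Some p \<Longrightarrow>
      agr C i j f g p \<Longrightarrow> k f y = k g y"
  shows "\<exists>!h. h \<in> Top_p (fprod (germ_space (W C) i j) Y (germ_base (W C) i j) \<alpha>) Z \<and>
    (\<forall>f\<in>Hom C i j. h \<circ>\<^sub>m pairp (sect (W C) i j f \<circ>\<^sub>m \<alpha>) (rstp (sect (W C) i j f \<circ>\<^sub>m \<alpha>)) = k f)"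
    (is "\<exists>!h. h \<in> Top_p ?D Z \<and> _")
proof (rule ex_ex1I)
  let ?R = "\<lambda>a (f, p). f \<in> Hom C i j \<and> p \<in> pts C i \<and> p (Rst C i j f) \<and> a = gm C i j f p"
  define t where "t = (\<lambda>(a, y). if (a, y) \<in> topspace ?D
    then k (fst (SOME fp. ?R a fp)) y else None)"
  have t: "t (gm C i j f p, y) = k f y"
    if f: "f \<in> Hom C i j" "p \<in> pts C i" "p (Rst C i j f)" and y: "\<alpha> y = Some p" for f p y
  proof -
    obtain g q where gq: "(SOME fp. ?R (gm C i j f p) fp) = (g, q)" by (cases "SOME fp. ?R (gm C i j f p) fp")
    have "?R (gm C i j f p) (SOME fp. ?R (gm C i j f p) fp)"
      by (rule someI[of _ "(f, p)"]) (use f in simp)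
    then have g: "g \<in> Hom C i j" "gm C i j f p = gm C i j g q" unfolding gq by auto
    then have "p = q" "agr C i j f g p" using gm_eq_iff[OF f(1) g(1) f(2,3)] by auto
    then have "k f y = k g y" using c[OF f(1) g(1) f(2) y] by blast
    moreover have "y \<in> topspace Y" using total_mapsD(3)[OF \<alpha> y] by blast
    then have "(gm C i j f p, y) \<in> topspace ?D" by (rule fprod_germI[where \<alpha>=\<alpha>, OF f _ y])
    ultimately show ?thesis using gq by (simp add: t_def del: topspace_fprod)
  qed
  have tk: "t \<circ>\<^sub>m pairp (sect (W C) i j f \<circ>\<^sub>m \<alpha>) (rstp (sect (W C) i j f \<circ>\<^sub>m \<alpha>)) = k f"
    if f: "f \<in> Hom C i j" for f
  proof
    fix y
    show "(t \<circ>\<^sub>m pairp (sect (W C) i j f \<circ>\<^sub>m \<alpha>) (rstp (sect (W C) i j f \<circ>\<^sub>m \<alpha>))) y = k f y"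
    proof (cases "y \<in> dom (sect (W C) i j f \<circ>\<^sub>m \<alpha>)")
      case True
      then obtain p where p: "\<alpha> y = Some p" "p \<in> pts C i" "p (Rst C i j f)"
        by (auto simp: map_comp_Some_iff sect_Some[OF f])
      then have "(sect (W C) i j f \<circ>\<^sub>m \<alpha>) y = Some (gm C i j f p)" by (simp add: sect_W[OF f])
      then show ?thesis using t[OF f p(2,3,1)] by (simp add: pairp_def rstp_def dom_def)
    next
      case False
      then have "k f y = None" "(sect (W C) i j f \<circ>\<^sub>m \<alpha>) y = None" using d[OF f] by (auto simp: domIff)
      then show ?thesis by (simp add: pairp_def)
    qed
  qed
  have "t \<in> Top_p ?D Z"
  proof (rule fprod_Top_pI[OF germ_base_local_homeo \<alpha>, of "sect (W C) i j ` Hom C i j"])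
    show "\<And>s. s \<in> sect (W C) i j ` Hom C i j \<Longrightarrow> s \<in> Top_p (pt (RLoc C i)) (germ_space (W C) i j)"
      using sect_Top_p by blast
    show "\<And>s. s \<in> sect (W C) i j ` Hom C i j \<Longrightarrow> germ_base (W C) i j \<circ>\<^sub>m s = rstp s"
      using base_sect by blast
    show "\<exists>s\<in>sect (W C) i j ` Hom C i j. a \<in> ran s" if a: "a \<in> topspace (germ_space (W C) i j)" for a
    proof -
      obtain f p where f: "f \<in> Hom C i j" "p \<in> pts C i" "p (Rst C i j f)" "a = gm C i j f p"
        using a by (rule germE)
      then have "sect (W C) i j f p = Some a" by (simp add: sect_W)
      then show ?thesis using f(1) by (blast intro: ranI)
    qed
    show "dom t \<subseteq> topspace ?D" by (auto simp: t_def simp del: topspace_fprod split: if_splits)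
    show "\<And>s. s \<in> sect (W C) i j ` Hom C i j \<Longrightarrow> t \<circ>\<^sub>m pairp (s \<circ>\<^sub>m \<alpha>) (rstp (s \<circ>\<^sub>m \<alpha>)) \<in> Top_p Y Z"
      using tk k by auto
  qed
  then show "\<exists>h. h \<in> Top_p ?D Z \<and>
    (\<forall>f\<in>Hom C i j. h \<circ>\<^sub>m pairp (sect (W C) i j f \<circ>\<^sub>m \<alpha>) (rstp (sect (W C) i j f \<circ>\<^sub>m \<alpha>)) = k f)"
    using tk by blast
next
  fix h h'
  assume H: "h \<in> Top_p ?D Z \<and>
    (\<forall>f\<in>Hom C i j. h \<circ>\<^sub>m pairp (sect (W C) i j f \<circ>\<^sub>m \<alpha>) (rstp (sect (W C) i j f \<circ>\<^sub>m \<alpha>)) = k f)"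
    "h' \<in> Top_p ?D Z \<and>
    (\<forall>f\<in>Hom C i j. h' \<circ>\<^sub>m pairp (sect (W C) i j f \<circ>\<^sub>m \<alpha>) (rstp (sect (W C) i j f \<circ>\<^sub>m \<alpha>)) = k f)"
  show "h = h'"
  proof
    fix z
    show "h z = h' z"
    proof (cases "z \<in> topspace ?D")
      case True
      obtain a y where z: "z = (a, y)" by (cases z)
      obtain f p where f: "f \<in> Hom C i j" "p \<in> pts C i" "p (Rst C i j f)" "a = gm C i j f p"
          "y \<in> topspace Y" "\<alpha> y = Some p"
        using True unfolding z by (rule fprod_germE)
      show ?thesis
        using fprod_eval[of h i j f \<alpha> "k f" p y] fprod_eval[of h' i j f \<alpha> "k f" p y] H f z by simp
    next
      case False
      then have "z \<notin> dom h" "z \<notin> dom h'" using H Top_pD(2) by blast+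
      then show ?thesis by (simp add: domIff)
    qed
  qed
qed

section \<open>Target and multiplication of germs\<close>

lemma germ_target_spec:
  "germ_target (W C) i j \<in> Top_p (germ_space (W C) i j) (pt (RLoc C j)) \<and>
     (\<forall>f\<in>Hom C i j. germ_target (W C) i j \<circ>\<^sub>m sect (W C) i j f = tmap (snd (W C)) i j f)"
proof -
  let ?k = "\<lambda>f. pt_map (RLoc C i) (RLoc C j) (RLoc_map C i j f)"
  have "\<exists>!t. t \<in> Top_p (germ_space (W C) i j) (pt (RLoc C j)) \<and>
     (\<forall>f\<in>Hom C i j. t \<circ>\<^sub>m sect (W C) i j f = ?k f)"
  proof (rule germ_glue)
  fix f assume f: "f \<in> Hom C i j"
  show "?k f \<in> Top_p (pt (RLoc C i)) (pt (RLoc C j))" by (rule tmap_W_Top_p[OF f])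
  show "dom (?k f) \<subseteq> dom (sect (W C) i j f)"
    unfolding dom_sect[OF f] by (auto simp: tmap_W[OF f] split: if_splits)
  show "?k f p = ?k g p" if "g \<in> Hom C i j" "p \<in> pts C i" "agr C i j f g p" for g p
    using push_agr[OF f that] that f by (simp add: tmap_W agr_def)
  qed
  from theI'[OF this] show ?thesis unfolding germ_target_def W_sel .
qed

lemma germ_target_gm:
  assumes f: "f \<in> Hom C i j" "p \<in> pts C i" "p (Rst C i j f)"
  shows "germ_target (W C) i j (gm C i j f p) = Some (push C i j f p)"
proof -
  have "germ_target (W C) i j \<circ>\<^sub>m sect (W C) i j f = tmap (snd (W C)) i j f"
    using germ_target_spec[of i j] f(1) by blast
  then have "(germ_target (W C) i j \<circ>\<^sub>m sect (W C) i j f) p = tmap (snd (W C)) i j f p"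
    by simp
  then show ?thesis using f by (simp add: sect_W tmap_W)
qed

lemma germ_target_total: "germ_target (W C) i j \<in> total_maps (germ_space (W C) i j) (pt (RLoc C j))"
  unfolding total_maps_iff
proof
  show t: "germ_target (W C) i j \<in> Top_p (germ_space (W C) i j) (pt (RLoc C j))"
    using germ_target_spec[of i j] by blast
  show "dom (germ_target (W C) i j) = topspace (germ_space (W C) i j)"
    using Top_pD(2)[OF t] germ_target_gm by (auto elim!: germE)
qed

lemma Idn_rst: "i \<in> Obj C \<Longrightarrow> p \<in> pts C i \<Longrightarrow> p (Rst C i i (Idn C i))"
  by (simp add: rst_idn point_idn)

text \<open>The multiplication depends on two representatives, and these are removed one at a time.
  For fixed \<open>g\<close>, \<open>germ_glue\<close> turns the sections of \<open>g f\<close> into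
  a map \<open>n g\<close> on germs of \<open>f\<close>; then \<open>fprod_glue\<close> over the
  target map removes \<open>g\<close>. Both compatibility conditions are instances of
  \<open>agr_comp\<close>.\<close>

lemma germ_mult_spec:
  assumes ijk: "i \<in> Obj C" "j \<in> Obj C" "k \<in> Obj C"
  shows "germ_mult (W C) i j k \<in> Top_p (fprod (germ_space (W C) j k) (germ_space (W C) i j)
      (germ_base (W C) j k) (germ_target (W C) i j)) (germ_space (W C) i k) \<and>
    (\<forall>f\<in>Hom C i j. \<forall>g\<in>Hom C j k.
      germ_mult (W C) i j k \<circ>\<^sub>m (tau_star (germ_target (W C) i j) (sect (W C) j k g) \<circ>\<^sub>m sect (W C) i j f) =
      sect (W C) i k (Comp C i j k g f))"
    (is "_ \<in> Top_p ?D ?Z \<and> _")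
proof -
  let ?P = "\<lambda>m. m \<in> Top_p ?D ?Z \<and> (\<forall>f\<in>Hom C i j. \<forall>g\<in>Hom C j k.
      m \<circ>\<^sub>m (tau_star (germ_target (W C) i j) (sect (W C) j k g) \<circ>\<^sub>m sect (W C) i j f) =
      sect (W C) i k (Comp C i j k g f))"
  let ?s = "\<lambda>f. sect (W C) i j f" and ?t = "germ_target (W C) i j"
  have inner: "\<exists>!n. n \<in> Top_p (germ_space (W C) i j) ?Z \<and>
      (\<forall>f\<in>Hom C i j. n \<circ>\<^sub>m ?s f = sect (W C) i k (Comp C i j k g f))" if g: "g \<in> Hom C j k" for g
  proof (rule germ_glue)
    fix f assume f: "f \<in> Hom C i j"
    have gf: "Comp C i j k g f \<in> Hom C i k" using f g by simp
    show "sect (W C) i k (Comp C i j k g f) \<in> Top_p (pt (RLoc C i)) ?Z" by (rule sect_Top_p[OF gf])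
    show "dom (sect (W C) i k (Comp C i j k g f)) \<subseteq> dom (?s f)"
      using rst_comp_le[OF f g] by (auto simp: dom_sect[OF f] dom_sect[OF gf])
    fix f' p assume H: "f' \<in> Hom C i j" "p \<in> pts C i" "agr C i j f f' p"
    have gf': "Comp C i j k g f' \<in> Hom C i k" using H g by simp
    have e: "push C i j f p = push C i j f' p" by (rule push_agr[OF f H])
    have r: "p (Rst C i k (Comp C i j k g f)) \<longleftrightarrow> p (Rst C i k (Comp C i j k g f'))"
      using push_rst[OF f g, of p] push_rst[OF H(1) g, of p] e by metis
    have "gm C i k (Comp C i j k g f) p = gm C i k (Comp C i j k g f') p"
      if "p (Rst C i k (Comp C i j k g f))"
    proof -
      have "agr C j k g g (push C i j f p)" by (rule agr_refl[OF g]) (use that push_rst[OF f g] in simp)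
      then show ?thesis using agr_comp[OF f H(1) g g H(2,3)] gm_eq_iff[OF gf gf' H(2) that] by simp
    qed
    then show "sect (W C) i k (Comp C i j k g f) p = sect (W C) i k (Comp C i j k g f') p"
      using r H by (simp add: sect_W[OF gf] sect_W[OF gf'])
  qed
  then obtain n where n: "\<And>g. g \<in> Hom C j k \<Longrightarrow> n g \<in> Top_p (germ_space (W C) i j) ?Z"
      "\<And>f g. f \<in> Hom C i j \<Longrightarrow> g \<in> Hom C j k \<Longrightarrow> n g \<circ>\<^sub>m ?s f = sect (W C) i k (Comp C i j k g f)"
    by metis
  have ng: "n g (gm C i j f p) = sect (W C) i k (Comp C i j k g f) p"
    if "f \<in> Hom C i j" "g \<in> Hom C j k" "p \<in> pts C i" "p (Rst C i j f)" for f g p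
    using fun_cong[OF n(2)[OF that(1,2)], of p] that by (simp add: sect_W[OF that(1)])
  \<comment> \<open>Second stage: the family \<open>n g\<close> descends to germs of
    \<open>g\<close> on the fibre product. The composites with \<open>pairp\<close> here are
    \<open>tau_star\<close> of the section of \<open>g\<close>.\<close>
  have "\<exists>!m. m \<in> Top_p ?D ?Z \<and> (\<forall>g\<in>Hom C j k.
      m \<circ>\<^sub>m pairp (sect (W C) j k g \<circ>\<^sub>m ?t) (rstp (sect (W C) j k g \<circ>\<^sub>m ?t)) = n g)"
  proof (rule fprod_glue[OF germ_target_total n(1)])
    show "dom (n g) \<subseteq> dom (sect (W C) j k g \<circ>\<^sub>m ?t)" if g: "g \<in> Hom C j k" for g
    proof
      fix a assume a: "a \<in> dom (n g)"
      then have "a \<in> topspace (germ_space (W C) i j)" using Top_pD(2)[OF n(1)[OF g]] by blast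
      then obtain f p where f: "f \<in> Hom C i j" "p \<in> pts C i" "p (Rst C i j f)" "a = gm C i j f p"
        by (rule germE)
      have gf: "Comp C i j k g f \<in> Hom C i k" using f g by simp
      have "p (Rst C i k (Comp C i j k g f))"
        using a ng[OF f(1) g f(2,3)] f(4) by (auto simp: sect_W[OF gf] split: if_splits)
      then have "push C i j f p (Rst C j k g)" using push_rst[OF f(1) g] by simp
      then show "a \<in> dom (sect (W C) j k g \<circ>\<^sub>m ?t)"
        using germ_target_gm[OF f(1-3)] push_point[OF f(1-3)] f(4) by (simp add: sect_W[OF g] dom_def)
    qed
    fix g g' q a assume H: "g \<in> Hom C j k" "g' \<in> Hom C j k" "q \<in> pts C j" "?t a = Some q" "agr C j k g g' q"
    have "a \<in> topspace (germ_space (W C) i j)" using total_mapsD(3)[OF germ_target_total H(4)] by blast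
    then obtain f p where f: "f \<in> Hom C i j" "p \<in> pts C i" "p (Rst C i j f)" "a = gm C i j f p"
      by (rule germE)
    have q: "q = push C i j f p" using germ_target_gm[OF f(1-3)] H(4) f(4) by simp
    have gf: "Comp C i j k g f \<in> Hom C i k" "Comp C i j k g' f \<in> Hom C i k" using f H by auto
    have "agr C i k (Comp C i j k g f) (Comp C i j k g' f) p"
      using agr_comp[OF f(1,1) H(1,2) f(2) agr_refl[where p=p, OF f(1,3)]] H(5) q by simp
    then have "sect (W C) i k (Comp C i j k g f) p = sect (W C) i k (Comp C i j k g' f) p"
      using gm_eq_iff[OF gf f(2)] f(2) by (auto simp: sect_W[OF gf(1)] sect_W[OF gf(2)] agr_def)
    then show "n g a = n g' a" using ng[OF f(1) H(1) f(2,3)] ng[OF f(1) H(2) f(2,3)] f(4) by simp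
  qed
  then obtain m where m: "m \<in> Top_p ?D ?Z"
      "\<And>g. g \<in> Hom C j k \<Longrightarrow> m \<circ>\<^sub>m tau_star ?t (sect (W C) j k g) = n g"
    unfolding tau_star_def by blast
  have Pm: "?P m" using m n(2) by (simp add: map_comp_assoc[symmetric])
  \<comment> \<open>Every composable pair of germs is a value of \<open>tau_star\<close> of one
    section after another section, so the defining equations determine \<open>m'\<close> on the
    whole fibre product.\<close>
  have uniq: "m' = m" if P': "?P m'" for m'
  proof
    fix z
    show "m' z = m z"
    proof (cases "z \<in> topspace ?D")
      case True
      obtain b a where z: "z = (b, a)" by (cases z)
      obtain g q where g: "g \<in> Hom C j k" "q \<in> pts C j" "q (Rst C j k g)" "b = gm C j k g q"
          "a \<in> topspace (germ_space (W C) i j)" "?t a = Some q"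
        using True unfolding z by (rule fprod_germE)
      obtain f p where f: "f \<in> Hom C i j" "p \<in> pts C i" "p (Rst C i j f)" "a = gm C i j f p"
        using g(5) by (rule germE)
      have ev: "(tau_star ?t (sect (W C) j k g) \<circ>\<^sub>m ?s f) p = Some z"
        using f g z by (simp add: sect_W tau_star_def pairp_def rstp_def dom_def)
      have "m' \<circ>\<^sub>m (tau_star ?t (sect (W C) j k g) \<circ>\<^sub>m ?s f) = m \<circ>\<^sub>m (tau_star ?t (sect (W C) j k g) \<circ>\<^sub>m ?s f)"
        using Pm P' f(1) g(1) by simp
      from fun_cong[OF this, of p] show ?thesis unfolding map_comp_def[of _ "tau_star _ _ \<circ>\<^sub>m _"] ev by simp
    next
      case False
      then have "z \<notin> dom m" "z \<notin> dom m'" using m(1) P' Top_pD(2) by blast+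
      then show ?thesis by (simp add: domIff)
    qed
  qed
  have "germ_mult (W C) i j k = m"
    unfolding germ_mult_def W_sel using Pm uniq by (rule the_equality)
  then show ?thesis using Pm by simp
qed

lemma germ_mult_gm:
  assumes f: "f \<in> Hom C i j" "p \<in> pts C i" "p (Rst C i j f)"
    and g: "g \<in> Hom C j k" "push C i j f p (Rst C j k g)"
  shows "germ_mult (W C) i j k (gm C j k g (push C i j f p), gm C i j f p) =
    Some (gm C i k (Comp C i j k g f) p)"
proof -
  have o: "i \<in> Obj C" "j \<in> Obj C" "k \<in> Obj C" using hom_obj f g by blast+
  have gf: "Comp C i j k g f \<in> Hom C i k" using f g by simp
  have "germ_mult (W C) i j k \<circ>\<^sub>m (tau_star (germ_target (W C) i j) (sect (W C) j k g) \<circ>\<^sub>m sect (W C) i j f) =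
      sect (W C) i k (Comp C i j k g f)" using germ_mult_spec[OF o] f g by blast
  from fun_cong[OF this, of p] show ?thesis
    using f g push_point[OF f] germ_target_gm[OF f] push_rst[OF f(1) g(1)]
    by (simp add: sect_W[OF f(1)] sect_W[OF g(1)] sect_W[OF gf] tau_star_def pairp_def rstp_def dom_def)
qed

text \<open>An idempotent agrees with the identity on itself, so all idempotents that hold at
  \<open>p\<close> have one germ there. Unit arrows arise as germs of idempotents in this
  way.\<close>

lemma gm_RIdem:
  assumes "e \<in> RIdem C i" "p \<in> pts C i" "p e"
  shows "gm C i i e p = gm C i i (Idn C i) p"
proof -
  have i: "i \<in> Obj C" using hom_dom[OF RIdem_in[OF assms(1)]] .
  have "agr C i i e (Idn C i) p"
    unfolding agr_def using assms i RIdem_rst[OF assms(1)] rst_idn[OF i] point_idn[OF i]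
      RIdem_idem[OF assms(1)] idn_comp[OF RIdem_in[OF assms(1)]] by auto
  then show ?thesis
    using gm_eq_iff[OF RIdem_in[OF assms(1)] idn_hom[OF i] assms(2)] assms RIdem_rst by simp
qed

end

section \<open>Internal categories pointwise\<close>

lemma partial_isos_comp:
  assumes "s \<in> partial_isos X Y" "t \<in> partial_isos Y Z"
  shows "t \<circ>\<^sub>m s \<in> partial_isos X Z"
proof -
  obtain s' where s: "s \<in> Top_p X Y" "s' \<in> Top_p Y X" "\<forall>x y. s x = Some y \<longleftrightarrow> s' y = Some x"
    using assms(1) unfolding partial_isos_iff by blast
  obtain t' where t: "t \<in> Top_p Y Z" "t' \<in> Top_p Z Y" "\<forall>x y. t x = Some y \<longleftrightarrow> t' y = Some x"
    using assms(2) unfolding partial_isos_iff by blast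
  have "\<forall>x y. (t \<circ>\<^sub>m s) x = Some y \<longleftrightarrow> (s' \<circ>\<^sub>m t') y = Some x"
    unfolding map_comp_Some_iff using s(3) t(3) by blast
  then show ?thesis unfolding partial_isos_iff
    using Top_p_comp[OF s(1) t(1)] Top_p_comp[OF t(2) s(2)] by blast
qed

lemma partial_isos_idp_restrict:
  assumes "openin X G"
  shows "idp X |` G \<in> partial_isos X X"
  unfolding partial_isos_iff
  by (intro conjI bexI[of _ "idp X |` G"] restrict_Top_p[OF idp_Top_p assms])
    (auto simp: restrict_map_def idp_Some)

text \<open>Union of graphs. Where members disagree the value is an arbitrary choice, so it has a
  meaning only under the hypothesis of \<open>munion_Some\<close>.\<close>

definition munion :: "('a \<rightharpoonup> 'b) set \<Rightarrow> ('a \<rightharpoonup> 'b)" where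
  "munion S = (\<lambda>x. if \<exists>y. \<exists>s\<in>S. s x = Some y then Some (SOME y. \<exists>s\<in>S. s x = Some y) else None)"

lemma munion_Some:
  assumes "\<And>s t x y z. s \<in> S \<Longrightarrow> t \<in> S \<Longrightarrow> s x = Some y \<Longrightarrow> t x = Some z \<Longrightarrow> y = z"
  shows "munion S x = Some y \<longleftrightarrow> (\<exists>s\<in>S. s x = Some y)"
proof
  assume "munion S x = Some y"
  then have e: "\<exists>y. \<exists>s\<in>S. s x = Some y" and y: "y = (SOME y. \<exists>s\<in>S. s x = Some y)"
    unfolding munion_def by (auto split: if_splits)
  show "\<exists>s\<in>S. s x = Some y" unfolding y by (rule someI_ex[OF e])
next
  assume y: "\<exists>s\<in>S. s x = Some y"
  then have "(SOME y. \<exists>s\<in>S. s x = Some y) = y" using assms by (intro some_equality) blast+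
  moreover have "\<exists>y. \<exists>s\<in>S. s x = Some y" using y by blast
  ultimately show "munion S x = Some y" unfolding munion_def by simp
qed

text \<open>Element versions of the structure maps: on arrow spaces the partial maps are total, so
  \<open>the\<close> is harmless there, and axioms about partial maps become equations between
  arrows.\<close>

definition sr :: "('i, 'a, 'b) pcat \<Rightarrow> 'i \<Rightarrow> 'i \<Rightarrow> 'b \<Rightarrow> 'a" where "sr X i j a = the (Src X i j a)"
definition tg :: "('i, 'a, 'b) pcat \<Rightarrow> 'i \<Rightarrow> 'i \<Rightarrow> 'b \<Rightarrow> 'a" where "tg X i j a = the (Tgt X i j a)"
definition et :: "('i, 'a, 'b) pcat \<Rightarrow> 'i \<Rightarrow> 'a \<Rightarrow> 'b" where "et X i x = the (Eta X i x)"
definition mu :: "('i, 'a, 'b) pcat \<Rightarrow> 'i \<Rightarrow> 'i \<Rightarrow> 'i \<Rightarrow> 'b \<Rightarrow> 'b \<Rightarrow> 'b" where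
  "mu X i j k b a = the (Mu X i j k (b, a))"

abbreviation ar :: "('i, 'a, 'b) pcat \<Rightarrow> 'i \<Rightarrow> 'i \<Rightarrow> 'b set" where "ar X i j \<equiv> topspace (Ar X i j)"
abbreviation sp :: "('i, 'a, 'b) pcat \<Rightarrow> 'i \<Rightarrow> 'a set" where "sp X i \<equiv> topspace (Sp X i)"

lemma total_Some:
  assumes "f \<in> total_maps T S"
  shows "f x = Some y \<longleftrightarrow> x \<in> topspace T \<and> y = the (f x)"
  using total_mapsD(2,3)[OF assms] by (metis option.sel)

section \<open>Structure maps evaluated at arrows\<close>

context partite_category
begin

lemma Src_Some: "i \<in> Ix X \<Longrightarrow> j \<in> Ix X \<Longrightarrow> Src X i j a = Some x \<longleftrightarrow> a \<in> ar X i j \<and> x = sr X i j a"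
  unfolding sr_def by (rule total_Some[OF src])

lemma Tgt_Some: "i \<in> Ix X \<Longrightarrow> j \<in> Ix X \<Longrightarrow> Tgt X i j a = Some x \<longleftrightarrow> a \<in> ar X i j \<and> x = tg X i j a"
  unfolding tg_def by (rule total_Some[OF tgt])

lemma sr_in: "i \<in> Ix X \<Longrightarrow> j \<in> Ix X \<Longrightarrow> a \<in> ar X i j \<Longrightarrow> sr X i j a \<in> sp X i"
  using Src_Some total_mapsD(3)[OF src] by blast

lemma tg_in: "i \<in> Ix X \<Longrightarrow> j \<in> Ix X \<Longrightarrow> a \<in> ar X i j \<Longrightarrow> tg X i j a \<in> sp X j"
  using Tgt_Some total_mapsD(3)[OF tgt] by blast

text \<open>Composed with the source map, \<open>Eta\<close> gives the identity, which is defined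
  everywhere; so \<open>Eta\<close> is.\<close>

lemma Eta_total: "i \<in> Ix X \<Longrightarrow> Eta X i \<in> total_maps (Sp X i) (Ar X i i)"
proof -
  assume i: "i \<in> Ix X"
  have "x \<in> dom (Eta X i)" if "x \<in> sp X i" for x
  proof -
    have "(Src X i i \<circ>\<^sub>m Eta X i) x = Some x" using src_eta[OF i] that by (simp add: idp_def)
    then show ?thesis by (auto simp: map_comp_Some_iff)
  qed
  then show ?thesis using eta[OF i] Top_pD(2)[OF eta[OF i]] by (auto simp: total_maps_iff)
qed

lemma Eta_Some: "i \<in> Ix X \<Longrightarrow> Eta X i x = Some a \<longleftrightarrow> x \<in> sp X i \<and> a = et X i x"
  unfolding et_def by (rule total_Some[OF Eta_total])

lemma et_in: "i \<in> Ix X \<Longrightarrow> x \<in> sp X i \<Longrightarrow> et X i x \<in> ar X i i"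
  using Eta_Some total_mapsD(3)[OF Eta_total] by blast

lemma sr_et: "i \<in> Ix X \<Longrightarrow> x \<in> sp X i \<Longrightarrow> sr X i i (et X i x) = x"
proof -
  assume H: "i \<in> Ix X" "x \<in> sp X i"
  have "(Src X i i \<circ>\<^sub>m Eta X i) x = Some x" using src_eta H by (simp add: idp_def)
  moreover have "Eta X i x = Some (et X i x)" using H by (simp add: Eta_Some)
  ultimately show ?thesis using Src_Some[OF H(1,1)] by simp
qed

lemma tg_et: "i \<in> Ix X \<Longrightarrow> x \<in> sp X i \<Longrightarrow> tg X i i (et X i x) = x"
proof -
  assume H: "i \<in> Ix X" "x \<in> sp X i"
  have "(Tgt X i i \<circ>\<^sub>m Eta X i) x = Some x" using tgt_eta H by (simp add: idp_def)
  moreover have "Eta X i x = Some (et X i x)" using H by (simp add: Eta_Some)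
  ultimately show ?thesis using Tgt_Some[OF H(1,1)] by simp
qed

lemma Ar2_iff:
  assumes "i \<in> Ix X" "j \<in> Ix X" "k \<in> Ix X"
  shows "(b, a) \<in> topspace (Ar2 X i j k) \<longleftrightarrow> b \<in> ar X j k \<and> a \<in> ar X i j \<and> sr X j k b = tg X i j a"
proof -
  have "Src X j k b = Tgt X i j a \<longleftrightarrow> sr X j k b = tg X i j a" if "b \<in> ar X j k" "a \<in> ar X i j"
  proof -
    have "Src X j k b = Some (sr X j k b)" "Tgt X i j a = Some (tg X i j a)"
      using Src_Some[OF assms(2,3), of b] Tgt_Some[OF assms(1,2), of a] that by auto
    then show ?thesis by simp
  qed
  then show ?thesis by (auto simp: Ar2_def)
qed

text \<open>By \<open>src_mu\<close> the composite with the source map is defined on every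
  composable pair, which forces \<open>Mu\<close> to be defined there.\<close>

lemma Mu_total:
  assumes "i \<in> Ix X" "j \<in> Ix X" "k \<in> Ix X"
  shows "Mu X i j k \<in> total_maps (Ar2 X i j k) (Ar X i k)"
proof -
  have "z \<in> dom (Mu X i j k)" if z: "z \<in> topspace (Ar2 X i j k)" for z
  proof -
    obtain b a where ba: "z = (b, a)" by (cases z)
    then have "a \<in> ar X i j" using z Ar2_iff[OF assms] by simp
    then have "(Src X i j \<circ>\<^sub>m proj2 (Ar2 X i j k)) z = Some (sr X i j a)"
      using z ba Src_Some[OF assms(1,2)] by (simp add: proj2_def)
    then have "(Src X i k \<circ>\<^sub>m Mu X i j k) z = Some (sr X i j a)" using src_mu[OF assms] by simp
    then show ?thesis by (auto simp: map_comp_Some_iff)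
  qed
  then show ?thesis using mu[OF assms] Top_pD(2)[OF mu[OF assms]] by (auto simp: total_maps_iff)
qed

lemma Mu_Some:
  assumes "i \<in> Ix X" "j \<in> Ix X" "k \<in> Ix X"
  shows "Mu X i j k (b, a) = Some c \<longleftrightarrow>
    b \<in> ar X j k \<and> a \<in> ar X i j \<and> sr X j k b = tg X i j a \<and> c = mu X i j k b a"
  using total_Some[OF Mu_total[OF assms], of "(b, a)"] Ar2_iff[OF assms] by (auto simp: mu_def)

lemma mu_props:
  assumes "i \<in> Ix X" "j \<in> Ix X" "k \<in> Ix X" and ba: "b \<in> ar X j k" "a \<in> ar X i j" "sr X j k b = tg X i j a"
  shows "mu X i j k b a \<in> ar X i k" "sr X i k (mu X i j k b a) = sr X i j a"
    "tg X i k (mu X i j k b a) = tg X j k b"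
proof -
  have M: "Mu X i j k (b, a) = Some (mu X i j k b a)" using Mu_Some[OF assms(1-3)] ba by simp
  show m: "mu X i j k b a \<in> ar X i k" using total_mapsD(3)[OF Mu_total[OF assms(1-3)] M] by blast
  have z: "(b, a) \<in> topspace (Ar2 X i j k)" using Ar2_iff[OF assms(1-3)] ba by simp
  have "(Src X i k \<circ>\<^sub>m Mu X i j k) (b, a) = (Src X i j \<circ>\<^sub>m proj2 (Ar2 X i j k)) (b, a)"
    using src_mu[OF assms(1-3)] by simp
  then have "Src X i k (mu X i j k b a) = Src X i j a" using z M by (simp add: proj2_def)
  then show "sr X i k (mu X i j k b a) = sr X i j a" by (simp add: sr_def)
  have "(Tgt X i k \<circ>\<^sub>m Mu X i j k) (b, a) = (Tgt X j k \<circ>\<^sub>m proj1 (Ar2 X i j k)) (b, a)"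
    using tgt_mu[OF assms(1-3)] by simp
  then have "Tgt X i k (mu X i j k b a) = Tgt X j k b" using z M by (simp add: proj1_def)
  then show "tg X i k (mu X i j k b a) = tg X j k b" by (simp add: tg_def)
qed

lemma mu_et_right:
  assumes ij: "i \<in> Ix X" "j \<in> Ix X" and a: "a \<in> ar X i j"
  shows "mu X i i j a (et X i (sr X i j a)) = a"
proof -
  have "(Mu X i i j \<circ>\<^sub>m pairp (idp (Ar X i j)) (Eta X i \<circ>\<^sub>m Src X i j)) a = Some a"
    using mu_eta_right[OF ij] a by (simp add: idp_def)
  moreover have "Src X i j a = Some (sr X i j a)" using Src_Some[OF ij] a by simp
  moreover have "Eta X i (sr X i j a) = Some (et X i (sr X i j a))"
    using Eta_Some[OF ij(1)] sr_in[OF ij a] by simp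
  ultimately have "Mu X i i j (a, et X i (sr X i j a)) = Some a"
    using a by (simp add: pairp_def idp_def)
  then show ?thesis by (simp add: mu_def)
qed

lemma mu_et_left:
  assumes ij: "i \<in> Ix X" "j \<in> Ix X" and a: "a \<in> ar X i j"
  shows "mu X i j j (et X j (tg X i j a)) a = a"
proof -
  have "(Mu X i j j \<circ>\<^sub>m pairp (Eta X j \<circ>\<^sub>m Tgt X i j) (idp (Ar X i j))) a = Some a"
    using mu_eta_left[OF ij] a by (simp add: idp_def)
  moreover have "Tgt X i j a = Some (tg X i j a)" using Tgt_Some[OF ij] a by simp
  moreover have "Eta X j (tg X i j a) = Some (et X j (tg X i j a))"
    using Eta_Some[OF ij(2)] tg_in[OF ij a] by simp
  ultimately have "Mu X i j j (et X j (tg X i j a), a) = Some a"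
    using a by (simp add: pairp_def idp_def)
  then show ?thesis by (simp add: mu_def)
qed

lemma mu_mu:
  assumes I: "i \<in> Ix X" "j \<in> Ix X" "k \<in> Ix X" "l \<in> Ix X"
    and A: "a \<in> ar X i j" "b \<in> ar X j k" "c \<in> ar X k l" "sr X j k b = tg X i j a" "sr X k l c = tg X j k b"
  shows "mu X i k l c (mu X i j k b a) = mu X i j l (mu X j k l c b) a"
proof -
  let ?T = "Ar3 X i j k l"
  have ba: "(b, a) \<in> topspace (Ar2 X i j k)" using Ar2_iff[OF I(1-3)] A by simp
  have "Src X k l c = Some (sr X k l c)" "Tgt X j k b = Some (tg X j k b)"
    using Src_Some[OF I(3,4)] Tgt_Some[OF I(2,3)] A by auto
  then have cba: "(c, b, a) \<in> topspace ?T" using ba A by (simp add: Ar3_def proj1_def)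
  have "(Mu X i k l \<circ>\<^sub>m pairp (proj1 ?T) (Mu X i j k \<circ>\<^sub>m proj2 ?T)) (c, b, a) =
      (Mu X i j l \<circ>\<^sub>m pairp (Mu X j k l \<circ>\<^sub>m pairp (proj1 ?T) (proj1 (Ar2 X i j k) \<circ>\<^sub>m proj2 ?T))
        (proj2 (Ar2 X i j k) \<circ>\<^sub>m proj2 ?T)) (c, b, a)"
    using mu_assoc[OF I] unfolding Let_def by (rule fun_cong)
  moreover have "Mu X i j k (b, a) = Some (mu X i j k b a)" "Mu X j k l (c, b) = Some (mu X j k l c b)"
    using Mu_Some[OF I(1-3)] Mu_Some[OF I(2-4)] A by auto
  ultimately have "Mu X i k l (c, mu X i j k b a) = Mu X i j l (mu X j k l c b, a)"
    using cba ba by (simp add: pairp_def proj1_def proj2_def)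
  then show ?thesis by (simp add: mu_def)
qed

end

text \<open>Inverses are a conditional assumption, so that statements valid in both variants are
  proved once with \<open>v\<close> as a parameter.\<close>

locale icat = source_etale_category X for X :: "('i, 'a, 'b) pcat" +
  fixes v :: variant
  assumes groupoid: "v = Groupoids \<Longrightarrow> etale_groupoid X"

lemma internal_cat_iff:
  "internal_cat v sc X \<longleftrightarrow> icat X v \<and> (sc = One_object \<longrightarrow> (\<exists>i. Ix X = {i}))"
proof -
  have "(case v of Categories \<Rightarrow> source_etale_category X | Groupoids \<Rightarrow> etale_groupoid X) \<longleftrightarrow> icat X v"
    by (cases v) (auto simp: icat_def icat_axioms_def etale_groupoid_def)
  then show ?thesis by (cases sc) (auto simp: internal_cat_def)
qed

definition iota :: "('i, 'a, 'b) pcat \<Rightarrow> 'i \<Rightarrow> 'i \<Rightarrow> ('b \<rightharpoonup> 'b)" where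
  "iota X = (SOME \<iota>. \<forall>i \<in> Ix X. \<forall>j \<in> Ix X.
      \<iota> i j \<in> total_maps (Ar X i j) (Ar X j i) \<and>
      \<iota> i j \<circ>\<^sub>m \<iota> j i = idp (Ar X j i) \<and>
      Src X j i \<circ>\<^sub>m \<iota> i j = Tgt X i j \<and>
      Mu X i j i \<circ>\<^sub>m pairp (\<iota> i j) (idp (Ar X i j)) = Eta X i \<circ>\<^sub>m Src X i j)"

definition iv :: "('i, 'a, 'b) pcat \<Rightarrow> 'i \<Rightarrow> 'i \<Rightarrow> 'b \<Rightarrow> 'b" where "iv X i j a = the (iota X i j a)"

context etale_groupoid
begin

lemma iota_props:
  assumes "i \<in> Ix X" "j \<in> Ix X"
  shows "iota X i j \<in> total_maps (Ar X i j) (Ar X j i)"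
    "iota X i j \<circ>\<^sub>m iota X j i = idp (Ar X j i)"
    "Src X j i \<circ>\<^sub>m iota X i j = Tgt X i j"
    "Mu X i j i \<circ>\<^sub>m pairp (iota X i j) (idp (Ar X i j)) = Eta X i \<circ>\<^sub>m Src X i j"
  using someI_ex[OF inverses] assms unfolding iota_def[symmetric] by blast+

lemma iota_Some: "i \<in> Ix X \<Longrightarrow> j \<in> Ix X \<Longrightarrow> iota X i j a = Some b \<longleftrightarrow> a \<in> ar X i j \<and> b = iv X i j a"
  unfolding iv_def by (rule total_Some[OF iota_props(1)])

lemma iv_props:
  assumes ij: "i \<in> Ix X" "j \<in> Ix X" and a: "a \<in> ar X i j"
  shows "iv X i j a \<in> ar X j i" "iv X j i (iv X i j a) = a" "sr X j i (iv X i j a) = tg X i j a"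
    "mu X i j i (iv X i j a) a = et X i (sr X i j a)"
proof -
  have I: "iota X i j a = Some (iv X i j a)" using iota_Some[OF ij] a by simp
  show b: "iv X i j a \<in> ar X j i" using total_mapsD(3)[OF iota_props(1)[OF ij] I] by blast
  have "(iota X j i \<circ>\<^sub>m iota X i j) a = Some a" using iota_props(2)[OF ij(2,1)] a by (simp add: idp_def)
  then have "iota X j i (iv X i j a) = Some a" using I by simp
  then show "iv X j i (iv X i j a) = a" by (simp add: iv_def[of X j i "iv X i j a"])
  have "(Src X j i \<circ>\<^sub>m iota X i j) a = Tgt X i j a" using iota_props(3)[OF ij] by simp
  then show "sr X j i (iv X i j a) = tg X i j a" using I by (simp add: sr_def tg_def)
  have "(Mu X i j i \<circ>\<^sub>m pairp (iota X i j) (idp (Ar X i j))) a = (Eta X i \<circ>\<^sub>m Src X i j) a"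
    using iota_props(4)[OF ij] by simp
  then have "Mu X i j i (iv X i j a, a) = Some (et X i (sr X i j a))"
    using I a Src_Some[OF ij, of a "sr X i j a"] Eta_Some[OF ij(1)] sr_in[OF ij a]
    by (simp add: pairp_def idp_def)
  then show "mu X i j i (iv X i j a) a = et X i (sr X i j a)" by (simp add: mu_def)
qed

text \<open>The axioms state the source equation and one inverse law only. Applied to the inverse
  arrow, and using that inversion is an involution, they give the target equation and the other
  inverse law.\<close>

lemma iv_props':
  assumes ij: "i \<in> Ix X" "j \<in> Ix X" and a: "a \<in> ar X i j"
  shows "tg X j i (iv X i j a) = sr X i j a" "mu X j i j a (iv X i j a) = et X j (tg X i j a)"
  using iv_props[OF ij a] iv_props(3,4)[OF ij(2,1) iv_props(1)[OF ij a]] by auto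

end

definition pc :: "('i, 'a, 'b) pcat \<Rightarrow> 'i \<Rightarrow> 'i \<Rightarrow> 'i \<Rightarrow> ('a \<rightharpoonup> 'b) \<Rightarrow> ('a \<rightharpoonup> 'b) \<Rightarrow> ('a \<rightharpoonup> 'b)" where
  "pc X i j k t s = Mu X i j k \<circ>\<^sub>m (tau_star (Tgt X i j) t \<circ>\<^sub>m s)"

definition rs :: "('i, 'a, 'b) pcat \<Rightarrow> 'i \<Rightarrow> 'i \<Rightarrow> ('a \<rightharpoonup> 'b) \<Rightarrow> ('a \<rightharpoonup> 'b)" where
  "rs X i j s = Eta X i \<circ>\<^sub>m rstp s"

lemma UPhi_sel [simp]: "Obj (UPhi v X) = Ix X" "Hom (UPhi v X) = Phi_hom v X" "Idn (UPhi v X) = Eta X"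
  "Comp (UPhi v X) = pc X" "Rst (UPhi v X) = rs X"
  by (simp_all add: UPhi_def U_def Phi_def pc_def rs_def fun_eq_iff)

section \<open>Hom-sets of partial sections\<close>

context icat
begin

lemma Phi_hom_iff: "s \<in> Phi_hom v X i j \<longleftrightarrow> i \<in> Ix X \<and> j \<in> Ix X \<and>
     s \<in> Top_p (Sp X i) (Ar X i j) \<and> (\<forall>x a. s x = Some a \<longrightarrow> sr X i j a = x) \<and>
     (v = Groupoids \<longrightarrow> Tgt X i j \<circ>\<^sub>m s \<in> partial_isos (Sp X i) (Sp X j))"
proof -
  have "Src X i j \<circ>\<^sub>m s = rstp s \<longleftrightarrow> (\<forall>x a. s x = Some a \<longrightarrow> sr X i j a = x)"
    if H: "i \<in> Ix X" "j \<in> Ix X" "s \<in> Top_p (Sp X i) (Ar X i j)"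
  proof
    assume "Src X i j \<circ>\<^sub>m s = rstp s"
    then show "\<forall>x a. s x = Some a \<longrightarrow> sr X i j a = x"
      using section_Some Src_Some[OF H(1,2)] by metis
  next
    assume *: "\<forall>x a. s x = Some a \<longrightarrow> sr X i j a = x"
    have "(Src X i j \<circ>\<^sub>m s) x = Some y \<longleftrightarrow> rstp s x = Some y" for x y
      unfolding map_comp_Some_iff rstp_Some Src_Some[OF H(1,2)] using * Top_pD(6)[OF H(3)] by blast
    then show "Src X i j \<circ>\<^sub>m s = rstp s" by (rule map_eqI)
  qed
  then show ?thesis unfolding Phi_hom_def by (cases v) auto
qed

lemma Phi_homD:
  assumes "s \<in> Phi_hom v X i j"
  shows "i \<in> Ix X" "j \<in> Ix X" "s \<in> Top_p (Sp X i) (Ar X i j)"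
    "\<And>x a. s x = Some a \<Longrightarrow> x \<in> sp X i" "\<And>x a. s x = Some a \<Longrightarrow> a \<in> ar X i j"
    "\<And>x a. s x = Some a \<Longrightarrow> sr X i j a = x" "\<And>x a. s x = Some a \<Longrightarrow> tg X i j a \<in> sp X j"
proof -
  show I: "i \<in> Ix X" "j \<in> Ix X" and T: "s \<in> Top_p (Sp X i) (Ar X i j)"
    and "\<And>x a. s x = Some a \<Longrightarrow> sr X i j a = x"
    using assms by (auto simp: Phi_hom_iff)
  show a: "\<And>x a. s x = Some a \<Longrightarrow> a \<in> ar X i j" using Top_pD(6)[OF T] by blast
  show "\<And>x a. s x = Some a \<Longrightarrow> x \<in> sp X i" using Top_pD(5)[OF T] by blast
  show "\<And>x a. s x = Some a \<Longrightarrow> tg X i j a \<in> sp X j" using tg_in[OF I a] .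
qed

lemma Tgt_comp_Some:
  "s \<in> Phi_hom v X i j \<Longrightarrow> (Tgt X i j \<circ>\<^sub>m s) x = Some y \<longleftrightarrow> (\<exists>a. s x = Some a \<and> y = tg X i j a)"
  unfolding map_comp_Some_iff using Tgt_Some[of i j] Phi_homD(1,2,5) by blast

text \<open>In the groupoid variant the sections are local bisections: the target map is invertible
  along them, so a target determines the source.\<close>

lemma Tgt_comp_inj:
  assumes "v = Groupoids" "s \<in> Phi_hom v X i j" "s x = Some a" "s y = Some b" "tg X i j a = tg X i j b"
  shows "x = y"
proof -
  obtain t where t: "\<forall>x y. (Tgt X i j \<circ>\<^sub>m s) x = Some y \<longleftrightarrow> t y = Some x"
    using assms(1,2) unfolding Phi_hom_iff partial_isos_iff by blast
  have "t (tg X i j a) = Some x" "t (tg X i j a) = Some y"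
    using t[rule_format, of x "tg X i j a"] t[rule_format, of y "tg X i j a"] assms(3-5)
    unfolding Tgt_comp_Some[OF assms(2)] by blast+
  then show ?thesis by simp
qed

lemma Comp_Some:
  assumes s: "s \<in> Phi_hom v X i j" and t: "t \<in> Phi_hom v X j k"
  shows "pc X i j k t s x = Some c \<longleftrightarrow>
    (\<exists>a b. s x = Some a \<and> t (tg X i j a) = Some b \<and> c = mu X i j k b a)"
proof -
  note I = Phi_homD(1,2)[OF s] Phi_homD(2)[OF t]
  have tau: "tau_star (Tgt X i j) t a = Some w \<longleftrightarrow> (\<exists>b. t (tg X i j a) = Some b \<and> w = (b, a))"
    if "a \<in> ar X i j" for a w
  proof -
    have "Tgt X i j a = Some (tg X i j a)" using that by (simp add: Tgt_Some[OF I(1,2)])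
    then have "(t \<circ>\<^sub>m Tgt X i j) a = t (tg X i j a)" by simp
    then show ?thesis by (cases w) (auto simp: tau_star_def pairp_Some rstp_Some dom_def)
  qed
  have M: "Mu X i j k (b, a) = Some (mu X i j k b a)" if "s x = Some a" "t (tg X i j a) = Some b" for a b
    using Mu_Some[OF I] Phi_homD(5)[OF s that(1)] Phi_homD(5,6)[OF t that(2)] by simp
  show ?thesis
  proof (cases "s x")
    case None
    then show ?thesis by (simp add: pc_def map_comp_def)
  next
    case (Some a)
    note tau = tau[OF Phi_homD(5)[OF s Some]] and M = M[OF Some]
    show ?thesis
    proof (cases "t (tg X i j a)")
      case None
      then have "tau_star (Tgt X i j) t a = None" using tau by (cases "tau_star (Tgt X i j) t a") auto
      then show ?thesis using Some None by (simp add: pc_def)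
    next
      case b: (Some b)
      then have "tau_star (Tgt X i j) t a = Some (b, a)" using tau by blast
      then show ?thesis using Some b M[OF b] by (auto simp: pc_def)
    qed
  qed
qed

lemma Rst_Some:
  assumes s: "s \<in> Phi_hom v X i j"
  shows "rs X i j s x = Some a \<longleftrightarrow> x \<in> dom s \<and> a = et X i x"
  unfolding rs_def comp_rstp_Some Eta_Some[OF Phi_homD(1)[OF s]] using Phi_homD(4)[OF s] by blast

text \<open>By \<open>RIdem_UPhi\<close> every restriction idempotent has this form, so idempotents
  at \<open>i\<close> and open sets of \<open>Sp X i\<close> are the same thing.\<close>

lemma Eta_restrict_Phi_hom:
  assumes i: "i \<in> Ix X" and G: "openin (Sp X i) G"
  shows "Eta X i |` G \<in> Phi_hom v X i i"
proof -
  have *: "(Eta X i |` G) x = Some a \<longleftrightarrow> x \<in> G \<and> x \<in> sp X i \<and> a = et X i x" for x a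
    using Eta_Some[OF i] by (auto simp: restrict_map_def)
  have "Tgt X i i \<circ>\<^sub>m (Eta X i |` G) = idp (Sp X i) |` G"
    by (rule map_eqI)
      (use et_in[OF i] tg_et[OF i] in
        \<open>auto simp: map_comp_Some_iff Eta_Some[OF i] Tgt_Some[OF i i] restrict_map_def idp_def\<close>)
  then show ?thesis unfolding Phi_hom_iff
    using i restrict_Top_p[OF eta[OF i] G] partial_isos_idp_restrict[OF G] sr_et[OF i] * by auto
qed

lemma Eta_Phi_hom: "i \<in> Ix X \<Longrightarrow> Eta X i \<in> Phi_hom v X i i"
proof -
  assume i: "i \<in> Ix X"
  have "Eta X i |` sp X i = Eta X i"
    by (rule map_eqI) (auto simp: restrict_map_def Eta_Some[OF i])
  then show ?thesis using Eta_restrict_Phi_hom[OF i openin_topspace] by simp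
qed

lemma Rst_Phi_hom:
  assumes s: "s \<in> Phi_hom v X i j"
  shows "rs X i j s \<in> Phi_hom v X i i"
proof -
  have "rs X i j s = Eta X i |` dom s"
    unfolding rs_def by (rule map_eqI) (auto simp: restrict_map_def comp_rstp_Some)
  then show ?thesis using Eta_restrict_Phi_hom[OF Phi_homD(1)[OF s] Top_pD(1)[OF Phi_homD(3)[OF s]]] by simp
qed

lemma tau_star_Top_p:
  assumes "p \<in> Top_p E T" "t \<in> Top_p T E'" "\<And>x b. t x = Some b \<Longrightarrow> q b = Some x"
  shows "tau_star p t \<in> Top_p E (fprod E' E q p)"
  unfolding tau_star_def
  by (rule pairp_Top_p)
    (use assms Top_p_comp[of p E T t E'] rstp_Top_p in \<open>auto simp: map_comp_Some_iff rstp_Some\<close>)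

text \<open>The target map along the composite is the composite of the target maps along the
  factors. In the groupoid variant the claim is thereby reduced to composition of partial
  isomorphisms.\<close>

lemma Comp_Phi_hom:
  assumes s: "s \<in> Phi_hom v X i j" and t: "t \<in> Phi_hom v X j k"
  shows "pc X i j k t s \<in> Phi_hom v X i k" (is "?c \<in> _")
proof -
  note I = Phi_homD(1,2)[OF s] Phi_homD(2)[OF t]
  have sT: "\<And>x b. t x = Some b \<Longrightarrow> Src X j k b = Some x"
    using Src_Some[OF I(2,3)] Phi_homD(5,6)[OF t] by blast
  have tau: "tau_star (Tgt X i j) t \<in> Top_p (Ar X i j) (Ar2 X i j k)"
    unfolding Ar2_def using tau_star_Top_p[OF total_mapsD(1)[OF tgt[OF I(1,2)]] Phi_homD(3)[OF t] sT] .
  have c: "?c \<in> Top_p (Sp X i) (Ar X i k)"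
    unfolding pc_def by (rule Top_p_comp[OF Top_p_comp[OF Phi_homD(3)[OF s] tau] mu[OF I]])
  have m: "sr X j k b = tg X i j a" if "s x = Some a" "t (tg X i j a) = Some b" for x a b
    using Phi_homD(6)[OF t that(2)] .
  have sc: "sr X i k c = x" if xc: "?c x = Some c" for x c
  proof -
    obtain a b where ab: "s x = Some a" "t (tg X i j a) = Some b" "c = mu X i j k b a"
      using xc unfolding Comp_Some[OF s t] by blast
    then show ?thesis
      using mu_props(2)[OF I Phi_homD(5)[OF t ab(2)] Phi_homD(5)[OF s ab(1)] m[OF ab(1,2)]]
        Phi_homD(6)[OF s ab(1)] by simp
  qed
  have "Tgt X i k \<circ>\<^sub>m ?c = (Tgt X j k \<circ>\<^sub>m t) \<circ>\<^sub>m (Tgt X i j \<circ>\<^sub>m s)"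
  proof
    fix x
    show "(Tgt X i k \<circ>\<^sub>m ?c) x = ((Tgt X j k \<circ>\<^sub>m t) \<circ>\<^sub>m (Tgt X i j \<circ>\<^sub>m s)) x"
    proof (cases "s x")
      case None
      then have "?c x = None" using Comp_Some[OF s t, of x] by (cases "?c x") auto
      then show ?thesis using None by (simp add: map_comp_def)
    next
      case (Some a)
      then have ta: "(Tgt X i j \<circ>\<^sub>m s) x = Some (tg X i j a)" using Tgt_comp_Some[OF s] by blast
      show ?thesis
      proof (cases "t (tg X i j a)")
        case None
        then have "?c x = None" using Comp_Some[OF s t, of x] Some by (cases "?c x") auto
        then show ?thesis using None ta by (simp del: map_comp_simps add: map_comp_def[of "Tgt X i k" ?c]
          map_comp_def[of "Tgt X j k \<circ>\<^sub>m t"], simp)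
      next
        case b: (Some b)
        then have c: "?c x = Some (mu X i j k b a)" using Comp_Some[OF s t, of x] Some by blast
        have "Tgt X i k (mu X i j k b a) = Some (tg X j k b)"
          using mu_props(1,3)[OF I Phi_homD(5)[OF t b] Phi_homD(5)[OF s Some] m[OF Some b]]
          by (simp add: Tgt_Some[OF I(1,3)])
        moreover have "(Tgt X j k \<circ>\<^sub>m t) (tg X i j a) = Some (tg X j k b)"
          using Tgt_comp_Some[OF t] b by blast
        ultimately show ?thesis
          by (simp only: map_comp_simps(2)[where k=x and ?m2.0="?c", OF c]
              map_comp_simps(2)[where k=x and ?m2.0="Tgt X i j \<circ>\<^sub>m s", OF ta])
      qed
    qed
  qed
  then show ?thesis unfolding Phi_hom_iff[of ?c] using I c sc s t
    by (auto simp: Phi_hom_iff[of s] Phi_hom_iff[of t] intro: partial_isos_comp)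
qed

end

section \<open>The category of partial sections\<close>

context icat
begin

lemma pc_app:
  assumes s: "s \<in> Phi_hom v X i j" and t: "t \<in> Phi_hom v X j k"
  shows "pc X i j k t s x =
    (case s x of None \<Rightarrow> None | Some a \<Rightarrow> map_option (\<lambda>b. mu X i j k b a) (t (tg X i j a)))"
  (is "_ = ?r")
proof -
  have "pc X i j k t s x = Some c \<longleftrightarrow> ?r = Some c" for c
    unfolding Comp_Some[OF s t] by (auto split: option.splits)
  then show ?thesis by (cases ?r) (metis option.exhaust, metis)
qed

lemma rs_app: "s \<in> Phi_hom v X i j \<Longrightarrow> rs X i j s x = (if x \<in> dom s then Some (et X i x) else None)"
  using Rst_Some[of s i j x] by (cases "rs X i j s x") auto

lemma Eta_app: "i \<in> Ix X \<Longrightarrow> Eta X i x = (if x \<in> sp X i then Some (et X i x) else None)"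
  using Eta_Some[of i x] by (cases "Eta X i x") auto

text \<open>Multiplication by a unit arrow does nothing, so precomposing with a restriction is
  restricting the function. The restriction axioms for sections thus become statements about
  domains.\<close>

lemma pc_rs:
  assumes s: "s \<in> Phi_hom v X i j" and t: "t \<in> Phi_hom v X i k"
  shows "pc X i i k t (rs X i j s) x = (if x \<in> dom s then t x else None)"
proof -
  note I = Phi_homD(1)[OF s] Phi_homD(2)[OF t]
  show ?thesis
  proof (cases "x \<in> dom s")
    case True
    then have x: "x \<in> sp X i" using Phi_homD(4)[OF s] by blast
    have "map_option (\<lambda>b. mu X i i k b (et X i x)) (t x) = t x"
    proof (cases "t x")
      case (Some b)
      then show ?thesis using mu_et_right[OF I Phi_homD(5)[OF t Some]] Phi_homD(6)[OF t Some] by simp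
    qed simp
    then show ?thesis using True tg_et[OF I(1) x] pc_app[OF Rst_Phi_hom[OF s] t] rs_app[OF s] by simp
  next
    case False
    then show ?thesis using pc_app[OF Rst_Phi_hom[OF s] t] rs_app[OF s] by simp
  qed
qed

lemma pc_assoc:
  assumes f: "f \<in> Phi_hom v X i j" and g: "g \<in> Phi_hom v X j k" and h: "h \<in> Phi_hom v X k l"
  shows "pc X i k l h (pc X i j k g f) = pc X i j l (pc X j k l h g) f"
proof
  fix x
  note I = Phi_homD(1,2)[OF f] Phi_homD(2)[OF g] Phi_homD(2)[OF h]
  note gf = pc_app[OF f g, of x] and hg = pc_app[OF g h]
  note L = pc_app[OF Comp_Phi_hom[OF f g] h, of x] and R = pc_app[OF f Comp_Phi_hom[OF g h], of x]
  show "pc X i k l h (pc X i j k g f) x = pc X i j l (pc X j k l h g) f x"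
  proof (cases "f x")
    case None
    then show ?thesis using L R gf by simp
  next
    case (Some a)
    note a = Phi_homD(5)[OF f Some]
    show ?thesis
    proof (cases "g (tg X i j a)")
      case None
      then show ?thesis using L R gf hg Some by simp
    next
      case b: (Some b)
      note bb = Phi_homD(5,6)[OF g b]
      have t: "tg X i k (mu X i j k b a) = tg X j k b" using mu_props(3)[OF I(1-3) bb(1) a bb(2)] .
      have "mu X i k l c (mu X i j k b a) = mu X i j l (mu X j k l c b) a" if "h (tg X j k b) = Some c" for c
        using mu_mu[OF I a bb(1) Phi_homD(5)[OF h that] bb(2) Phi_homD(6)[OF h that]] .
      then show ?thesis using L R gf hg Some b t by (cases "h (tg X j k b)") auto
    qed
  qed
qed

lemma UPhi_restriction_category: "restriction_category (UPhi v X)"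
proof (unfold_locales, unfold UPhi_sel)
  show "i \<in> Ix X \<and> j \<in> Ix X" if "f \<in> Phi_hom v X i j" for f i j using Phi_homD(1,2)[OF that] by blast
  show "Eta X i \<in> Phi_hom v X i i" if "i \<in> Ix X" for i by (rule Eta_Phi_hom[OF that])
  fix f i j assume f: "f \<in> Phi_hom v X i j"
  note I = Phi_homD(1,2)[OF f]
  show "pc X i j k g f \<in> Phi_hom v X i k" if "g \<in> Phi_hom v X j k" for g k
    by (rule Comp_Phi_hom[OF f that])
  show "pc X i i j f (Eta X i) = f"
  proof
    fix x
    have "Eta X i = rs X i i (Eta X i)"
      by (rule ext) (simp add: rs_app[OF Eta_Phi_hom[OF I(1)]] Eta_app[OF I(1)] dom_def)
    then have "pc X i i j f (Eta X i) x = (if x \<in> dom (Eta X i) then f x else None)"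
      using pc_rs[OF Eta_Phi_hom[OF I(1)] f, of x] by simp
    also have "\<dots> = f x"
      using Phi_homD(4)[OF f, of x] by (cases "f x") (auto simp: Eta_app[OF I(1)])
    finally show "pc X i i j f (Eta X i) x = f x" .
  qed
  show "pc X i j j (Eta X j) f = f"
  proof
    fix x show "pc X i j j (Eta X j) f x = f x"
    proof (cases "f x")
      case (Some a)
      then show ?thesis
        using pc_app[OF f Eta_Phi_hom[OF I(2)], of x] Eta_app[OF I(2)] Phi_homD(7)[OF f Some]
          mu_et_left[OF I Phi_homD(5)[OF f Some]] by simp
    qed (simp add: pc_app[OF f Eta_Phi_hom[OF I(2)], of x])
  qed
  show "pc X i k l h (pc X i j k g f) = pc X i j l (pc X j k l h g) f"
    if "g \<in> Phi_hom v X j k" "h \<in> Phi_hom v X k l" for g h k l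
    by (rule pc_assoc[OF f that])
  show "rs X i j f \<in> Phi_hom v X i i" by (rule Rst_Phi_hom[OF f])
  show "pc X i i j f (rs X i j f) = f"
    by (rule ext) (auto simp: pc_rs[OF f f] domIff)
  show "pc X i i i (rs X i j f) (rs X i k g) = pc X i i i (rs X i k g) (rs X i j f)"
    if g: "g \<in> Phi_hom v X i k" for g k
    by (rule ext) (simp add: pc_rs[OF g Rst_Phi_hom[OF f]] pc_rs[OF f Rst_Phi_hom[OF g]]
        rs_app[OF f] rs_app[OF g])
  show "rs X i k (pc X i i k g (rs X i j f)) = pc X i i i (rs X i k g) (rs X i j f)"
    if g: "g \<in> Phi_hom v X i k" for g k
    by (rule ext) (simp add: pc_rs[OF f Rst_Phi_hom[OF g]] rs_app[OF g]
        rs_app[OF Comp_Phi_hom[OF Rst_Phi_hom[OF f] g]] domIff pc_rs[OF f g])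
  show "pc X i j j (rs X j k g) f = pc X i i j f (rs X i k (pc X i j k g f))"
    if g: "g \<in> Phi_hom v X j k" for g k
  proof
    fix x
    note gf = Comp_Phi_hom[OF f g]
    show "pc X i j j (rs X j k g) f x = pc X i i j f (rs X i k (pc X i j k g f)) x"
    proof (cases "f x")
      case (Some a)
      then show ?thesis
        using mu_et_left[OF I Phi_homD(5)[OF f Some]]
        by (simp add: pc_app[OF f Rst_Phi_hom[OF g]] pc_rs[OF gf f] rs_app[OF g] domIff pc_app[OF f g])
    qed (simp add: pc_app[OF f Rst_Phi_hom[OF g]] pc_rs[OF gf f])
  qed
qed

lemma rle_UPhi:
  assumes s: "s \<in> Phi_hom v X i j" and t: "t \<in> Phi_hom v X i j"
  shows "rle (UPhi v X) i j s t \<longleftrightarrow> s \<subseteq>\<^sub>m t"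
proof -
  have "rle (UPhi v X) i j s t \<longleftrightarrow> (\<forall>x. s x = (if x \<in> dom s then t x else None))"
    unfolding rle_def UPhi_sel fun_eq_iff pc_rs[OF s t] ..
  then show ?thesis by (auto simp: map_le_def domIff)
qed

lemma rcompat_UPhi:
  assumes s: "s \<in> Phi_hom v X i j" and t: "t \<in> Phi_hom v X i j"
  shows "rcompat (UPhi v X) i j s t \<longleftrightarrow> (\<forall>x a b. s x = Some a \<longrightarrow> t x = Some b \<longrightarrow> a = b)"
proof -
  have "rcompat (UPhi v X) i j s t \<longleftrightarrow>
      (\<forall>x. (if x \<in> dom t then s x else None) = (if x \<in> dom s then t x else None))"
    unfolding rcompat_def UPhi_sel fun_eq_iff pc_rs[OF s t] pc_rs[OF t s] ..
  also have "\<dots> \<longleftrightarrow> (\<forall>x a b. s x = Some a \<longrightarrow> t x = Some b \<longrightarrow> a = b)"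
  proof (intro iffI allI impI)
    fix x a b
    assume "\<forall>x. (if x \<in> dom t then s x else None) = (if x \<in> dom s then t x else None)"
      "s x = Some a" "t x = Some b"
    then show "a = b" by (auto simp: domIff dest!: spec[of _ x])
  next
    fix x assume H: "\<forall>x a b. s x = Some a \<longrightarrow> t x = Some b \<longrightarrow> a = b"
    show "(if x \<in> dom t then s x else None) = (if x \<in> dom s then t x else None)"
      using H[rule_format, of x] by (cases "s x"; cases "t x") (auto simp: domIff)
  qed
  finally show ?thesis .
qed

lemma RIdem_UPhi:
  "e \<in> RIdem (UPhi v X) i \<longleftrightarrow> e \<in> Phi_hom v X i i \<and> (\<forall>x a. e x = Some a \<longrightarrow> a = et X i x)"
proof -
  have "rs X i i e = e \<longleftrightarrow> (\<forall>x a. e x = Some a \<longrightarrow> a = et X i x)" if e: "e \<in> Phi_hom v X i i"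
  proof -
    have "rs X i i e = e \<longleftrightarrow> (\<forall>x. (if x \<in> dom e then Some (et X i x) else None) = e x)"
      unfolding fun_eq_iff rs_app[OF e] ..
    also have "\<dots> \<longleftrightarrow> (\<forall>x a. e x = Some a \<longrightarrow> a = et X i x)"
    proof (intro iffI allI impI)
      fix x a assume "\<forall>x. (if x \<in> dom e then Some (et X i x) else None) = e x" "e x = Some a"
      then show "a = et X i x" by (auto simp: domIff dest!: spec[of _ x])
    next
      fix x assume "\<forall>x a. e x = Some a \<longrightarrow> a = et X i x"
      then show "(if x \<in> dom e then Some (et X i x) else None) = e x"
        by (cases "e x") (auto simp: domIff)
    qed
    finally show ?thesis .
  qed
  then show ?thesis by (auto simp: RIdem_def)
qed

lemma RIdem_UPhi_Some:
  "e \<in> RIdem (UPhi v X) i \<Longrightarrow> e x = Some a \<longleftrightarrow> x \<in> dom e \<and> a = et X i x"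
  unfolding RIdem_UPhi by auto

lemma Eta_restrict_RIdem:
  "i \<in> Ix X \<Longrightarrow> openin (Sp X i) G \<Longrightarrow> Eta X i |` G \<in> RIdem (UPhi v X) i"
  unfolding RIdem_UPhi using Eta_restrict_Phi_hom Eta_Some[of i]
  by (auto simp: restrict_map_def split: if_splits)

lemma dom_Eta_restrict: "i \<in> Ix X \<Longrightarrow> dom (Eta X i |` G) = sp X i \<inter> G"
  by (auto simp: restrict_map_def Eta_app split: if_splits)

text \<open>Cutting down to an open set is composing with its idempotent, so the invertibility of
  the target in the groupoid variant is inherited from \<open>Comp_Phi_hom\<close>.\<close>

lemma Phi_hom_restrict:
  assumes s: "s \<in> Phi_hom v X i j" and G: "openin (Sp X i) G"
  shows "s |` G \<in> Phi_hom v X i j"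
proof -
  note i = Phi_homD(1)[OF s]
  let ?e = "Eta X i |` G"
  have e: "?e \<in> Phi_hom v X i i" by (rule Eta_restrict_Phi_hom[OF i G])
  have re: "rs X i i ?e = ?e" using Eta_restrict_RIdem[OF i G] by (simp add: RIdem_def)
  have "pc X i i j s ?e = s |` G"
  proof
    fix x
    have "pc X i i j s ?e x = (if x \<in> sp X i \<inter> G then s x else None)"
      using pc_rs[OF e s, of x] unfolding re dom_Eta_restrict[OF i] .
    then show "pc X i i j s ?e x = (s |` G) x"
      using Phi_homD(4)[OF s, of x] by (cases "s x") (simp_all add: restrict_map_def)
  qed
  then show ?thesis using Comp_Phi_hom[OF e s] by simp
qed

text \<open>As in \<open>is_joinp_iff\<close>: an upper bound can be cut down to the union of the
  domains and is still a section of the right kind, so joins are unions of graphs.\<close>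

lemma is_join_UPhi:
  assumes S: "S \<subseteq> Phi_hom v X i j"
  shows "is_join (UPhi v X) i j S f \<longleftrightarrow>
    f \<in> Phi_hom v X i j \<and> (\<forall>x y. f x = Some y \<longleftrightarrow> (\<exists>s\<in>S. s x = Some y))"
proof
  assume J: "is_join (UPhi v X) i j S f"
  let ?G = "\<Union>(dom ` S)"
  have f: "f \<in> Phi_hom v X i j" using J by (simp add: is_join_def)
  have ub: "\<And>s. s \<in> S \<Longrightarrow> s \<subseteq>\<^sub>m f" using J S rle_UPhi[OF _ f] by (auto simp: is_join_def)
  have "openin (Sp X i) ?G" using S Top_pD(1)[OF Phi_homD(3)] by blast
  then have r: "f |` ?G \<in> Phi_hom v X i j" by (rule Phi_hom_restrict[OF f])
  have "\<And>s. s \<in> S \<Longrightarrow> s \<subseteq>\<^sub>m f |` ?G" using ub by (force simp: map_le_def restrict_map_def)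
  then have "\<forall>s\<in>S. rle (UPhi v X) i j s (f |` ?G)" using rle_UPhi[OF _ r] S by blast
  then have "rle (UPhi v X) i j f (f |` ?G)" using J r by (simp add: is_join_def)
  then have le: "\<And>x y. f x = Some y \<Longrightarrow> (f |` ?G) x = Some y"
    unfolding rle_UPhi[OF f r] map_le_iff_Some by blast
  have "\<exists>s\<in>S. s x = Some y" if y: "f x = Some y" for x y
  proof -
    obtain s where s: "s \<in> S" "x \<in> dom s"
      using le[OF y] by (auto simp: restrict_map_def split: if_splits)
    then have "s x = f x" using ub by (auto simp: map_le_def)
    then show ?thesis using s y by auto
  qed
  moreover have "f x = Some y" if "s \<in> S" "s x = Some y" for s x y
    using ub that by (force simp: map_le_iff_Some)
  ultimately show "f \<in> Phi_hom v X i j \<and> (\<forall>x y. f x = Some y \<longleftrightarrow> (\<exists>s\<in>S. s x = Some y))"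
    using f by (intro conjI allI iffI) auto
next
  assume H: "f \<in> Phi_hom v X i j \<and> (\<forall>x y. f x = Some y \<longleftrightarrow> (\<exists>s\<in>S. s x = Some y))"
  then have f: "f \<in> Phi_hom v X i j" by blast
  show "is_join (UPhi v X) i j S f"
    unfolding is_join_def UPhi_sel
  proof (intro conjI ballI impI)
    show "f \<in> Phi_hom v X i j" by fact
    show "rle (UPhi v X) i j g f" if "g \<in> S" for g
      using that S H rle_UPhi[of g i j f] by (auto simp: map_le_iff_Some)
    show "rle (UPhi v X) i j f h" if "h \<in> Phi_hom v X i j" "\<forall>g\<in>S. rle (UPhi v X) i j g h" for h
    proof -
      have "g \<subseteq>\<^sub>m h" if "g \<in> S" for g using that S rle_UPhi[of g i j h] \<open>h \<in> _\<close> \<open>\<forall>g\<in>S. _\<close> by blast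
      then show ?thesis unfolding rle_UPhi[OF f that(1)] using H by (auto simp: map_le_iff_Some)
    qed
  qed
qed

text \<open>This pins down partial inverses. Evaluate \<open>s t s = s\<close> at \<open>x\<close>:
  with \<open>b\<close> the value of \<open>t\<close> at the target of \<open>a\<close> and
  \<open>c\<close> the product \<open>b a\<close>, one gets \<open>a = a' c\<close> for an arrow
  \<open>a'\<close> on \<open>s\<close>. As \<open>s\<close> is a bisection, \<open>a' = a\<close>;
  cancelling \<open>a\<close> makes \<open>c\<close> a unit, so \<open>b\<close> is the inverse of
  \<open>a\<close>.\<close>

lemma UPhi_cancel:
  assumes v: "v = Groupoids" and s: "s \<in> Phi_hom v X i j" and t: "t \<in> Phi_hom v X j i"
    and st: "pc X i i j s (pc X i j i t s) = s" and a: "s x = Some a"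
  shows "t (tg X i j a) = Some (iv X i j a)"
proof -
  interpret etale_groupoid X by (rule groupoid[OF v])
  note I = Phi_homD(1,2)[OF s]
  note ts = Comp_Phi_hom[OF s t]
  note aa = Phi_homD(5,6)[OF s a]
  have "pc X i i j s (pc X i j i t s) x = Some a" using st a by simp
  then obtain c a' where c: "pc X i j i t s x = Some c" "s (tg X i i c) = Some a'" "a = mu X i i j a' c"
    unfolding Comp_Some[OF ts s] by blast
  obtain b where b: "t (tg X i j a) = Some b" "c = mu X i j i b a"
    using c(1) a unfolding Comp_Some[OF s t] by auto
  note bb = Phi_homD(5,6)[OF t b(1)]
  note a' = Phi_homD(5,6)[OF s c(2)]
  note cc = mu_props[OF I(1,2,1) bb(1) aa(1) bb(2)]
  have "tg X i j a = tg X i j a'"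
    using c(3) mu_props(3)[OF I(1,1,2) a'(1), of c] cc a'(2) b(2) by metis
  \<comment> \<open>\<open>a\<close> and \<open>a'\<close> lie on \<open>s\<close> and have the same
    target, so they have the same source.\<close>
  then have "x = tg X i i c" using Tgt_comp_inj[OF v s a c(2)] by blast
  then have "a' = a" using c(2) a by simp
  then have ac: "a = mu X i i j a c" using c(3) by simp
  have cA: "c \<in> ar X i i" "sr X i j a = tg X i i c" "sr X i i c = x"
    using cc b(2) aa(2) \<open>x = tg X i i c\<close> by auto
  have "mu X i j i (iv X i j a) (mu X i i j a c) = mu X i i i (mu X i j i (iv X i j a) a) c"
    by (rule mu_mu[OF I(1,1,2,1) cA(1) aa(1) iv_props(1)[OF I aa(1)] cA(2) iv_props(3)[OF I aa(1)]])
  then have "et X i x = c"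
    using ac iv_props(4)[OF I aa(1)] aa(2) mu_et_left[OF I(1,1) cA(1)] cA(2) by simp
  then have e: "mu X i j i b a = et X i x" using b(2) by simp
  have "mu X j j i b (mu X j i j a (iv X i j a)) = mu X j i i (mu X i j i b a) (iv X i j a)"
    by (rule mu_mu[OF I(2,1,2,1) iv_props(1)[OF I aa(1)] aa(1) bb(1)])
      (use iv_props'(1)[OF I aa(1)] bb(2) in auto)
  then have "b = iv X i j a"
    using e mu_et_right[OF I(2,1) bb(1)] iv_props'[OF I aa(1)] bb(2) aa(2)
      mu_et_left[OF I(2,1) iv_props(1)[OF I aa(1)]] by simp
  then show ?thesis using b(1) by simp
qed

text \<open>Since the target map along \<open>s\<close> has a partial inverse \<open>u\<close>, the
  inverse section goes from a target back to its source by \<open>u\<close>, along \<open>s\<close>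
  to the arrow, and then inverts the arrow.\<close>

lemma UPhi_pinv:
  assumes v: "v = Groupoids" and s: "s \<in> Phi_hom v X i j"
  shows "\<exists>t. is_pinv (UPhi v X) i j s t \<and>
    (\<forall>y b. t y = Some b \<longleftrightarrow> (\<exists>x a. s x = Some a \<and> y = tg X i j a \<and> b = iv X i j a))"
proof -
  interpret etale_groupoid X by (rule groupoid[OF v])
  note I = Phi_homD(1,2)[OF s]
  obtain u where u: "u \<in> Top_p (Sp X j) (Sp X i)" "\<forall>x y. (Tgt X i j \<circ>\<^sub>m s) x = Some y \<longleftrightarrow> u y = Some x"
    using s v unfolding Phi_hom_iff partial_isos_iff by blast
  have us: "u y = Some x \<longleftrightarrow> (\<exists>a. s x = Some a \<and> y = tg X i j a)" for x y
    using u(2) unfolding Tgt_comp_Some[OF s] by simp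
  define t where "t = iota X i j \<circ>\<^sub>m (s \<circ>\<^sub>m u)"
  have t: "t y = Some b \<longleftrightarrow> (\<exists>x a. s x = Some a \<and> y = tg X i j a \<and> b = iv X i j a)" for y b
  proof -
    have "t y = Some b \<longleftrightarrow> (\<exists>x a. u y = Some x \<and> s x = Some a \<and> iota X i j a = Some b)"
      unfolding t_def map_comp_Some_iff by blast
    also have "\<dots> \<longleftrightarrow> (\<exists>x a. s x = Some a \<and> y = tg X i j a \<and> b = iv X i j a)"
      unfolding us iota_Some[OF I] using Phi_homD(5)[OF s] by force
    finally show ?thesis .
  qed
  have tT: "t \<in> Top_p (Sp X j) (Ar X j i)"
    unfolding t_def
    by (rule Top_p_comp[OF Top_p_comp[OF u(1) Phi_homD(3)[OF s]] total_mapsD(1)[OF iota_props(1)[OF I]]])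
  have tu: "Tgt X j i \<circ>\<^sub>m t = u"
  proof (rule map_eqI)
    fix y x
    have "(Tgt X j i \<circ>\<^sub>m t) y = Some x \<longleftrightarrow> (\<exists>b. t y = Some b \<and> x = tg X j i b)"
      unfolding map_comp_Some_iff Tgt_Some[OF I(2,1)] using Top_pD(6)[OF tT] by blast
    also have "\<dots> \<longleftrightarrow> (\<exists>x' a. s x' = Some a \<and> y = tg X i j a \<and> x = tg X j i (iv X i j a))"
      unfolding t by blast
    also have "\<dots> \<longleftrightarrow> (\<exists>a. s x = Some a \<and> y = tg X i j a)"
      using iv_props'(1)[OF I Phi_homD(5)[OF s]] Phi_homD(6)[OF s] by metis
    finally show "(Tgt X j i \<circ>\<^sub>m t) y = Some x \<longleftrightarrow> u y = Some x" using us by simp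
  qed
  have "u \<in> partial_isos (Sp X j) (Sp X i)"
    unfolding partial_isos_iff
    using u Top_p_comp[OF Phi_homD(3)[OF s] total_mapsD(1)[OF tgt[OF I]]] by auto
  moreover have "sr X j i b = y" if "t y = Some b" for y b
    using that iv_props(3)[OF I Phi_homD(5)[OF s]] unfolding t by auto
  ultimately have th: "t \<in> Phi_hom v X j i" unfolding Phi_hom_iff using I tT tu by simp
  have ts: "pc X i j i t s = rs X i j s"
  proof
    fix x
    show "pc X i j i t s x = rs X i j s x"
    proof (cases "s x")
      case (Some a)
      then have "t (tg X i j a) = Some (iv X i j a)" using t by blast
      then show ?thesis
        using Some pc_app[OF s th, of x] rs_app[OF s, of x] iv_props(4)[OF I Phi_homD(5)[OF s Some]]
          Phi_homD(6)[OF s Some] by auto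
    qed (simp add: pc_app[OF s th] rs_app[OF s] domIff)
  qed
  have st: "pc X j i j s t = rs X j i t"
  proof
    fix y
    show "pc X j i j s t y = rs X j i t y"
    proof (cases "t y")
      case (Some b)
      then obtain x a where xa: "s x = Some a" "y = tg X i j a" "b = iv X i j a" using t by blast
      note aA = Phi_homD(5)[OF s xa(1)]
      have "tg X j i b = x" using iv_props'(1)[OF I aA] Phi_homD(6)[OF s xa(1)] xa by simp
      then show ?thesis
        using Some pc_app[OF th s, of y] rs_app[OF th, of y] iv_props'(2)[OF I aA] xa by auto
    qed (simp add: pc_app[OF th s] rs_app[OF th] domIff)
  qed
  have "is_pinv (UPhi v X) i j s t"
    unfolding is_pinv_def UPhi_sel
  proof (intro conjI)
    show "t \<in> Phi_hom v X j i" by (rule th)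
    show "pc X i i j s (pc X i j i t s) = s" unfolding ts by (rule ext) (simp add: pc_rs[OF s s] domIff)
    show "pc X j j i t (pc X j i j s t) = t" unfolding st by (rule ext) (simp add: pc_rs[OF th th] domIff)
  qed
  then show ?thesis using t by blast
qed

text \<open>Applying \<open>UPhi_cancel\<close> to \<open>s\<close> and to \<open>t\<close> shows
  that the graph of a partial inverse consists of the inverted arrows of \<open>s\<close>, which
  leaves no freedom.\<close>

lemma UPhi_pinv_unique:
  assumes v: "v = Groupoids" and s: "s \<in> Phi_hom v X i j" and t: "is_pinv (UPhi v X) i j s t"
  shows "t y = Some b \<longleftrightarrow> (\<exists>x a. s x = Some a \<and> y = tg X i j a \<and> b = iv X i j a)"
proof -
  interpret etale_groupoid X by (rule groupoid[OF v])
  note I = Phi_homD(1,2)[OF s]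
  have th: "t \<in> Phi_hom v X j i" and st: "pc X i i j s (pc X i j i t s) = s"
    and ts: "pc X j j i t (pc X j i j s t) = t" using t by (auto simp: is_pinv_def)
  show ?thesis
  proof
    assume b: "t y = Some b"
    have sb: "s (tg X j i b) = Some (iv X j i b)" by (rule UPhi_cancel[OF v th s ts b])
    note bA = Phi_homD(5,6)[OF th b]
    show "\<exists>x a. s x = Some a \<and> y = tg X i j a \<and> b = iv X i j a"
      using sb iv_props'(1)[OF I(2,1) bA(1)] iv_props(2)[OF I(2,1) bA(1)] bA(2) by metis
  next
    assume "\<exists>x a. s x = Some a \<and> y = tg X i j a \<and> b = iv X i j a"
    then show "t y = Some b" using UPhi_cancel[OF v s th st] by blast
  qed
qed

lemma UPhi_inverse_category:
  assumes v: "v = Groupoids"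
  shows "inverse_category (UPhi v X)"
proof -
  interpret R: restriction_category "UPhi v X" by (rule UPhi_restriction_category)
  interpret etale_groupoid X by (rule groupoid[OF v])
  have u: "t = t'" if "s \<in> Phi_hom v X i j" "is_pinv (UPhi v X) i j s t" "is_pinv (UPhi v X) i j s t'"
    for s i j t t'
    by (rule map_eqI) (simp add: UPhi_pinv_unique[OF v that(1,2)] UPhi_pinv_unique[OF v that(1,3)])
  show ?thesis
  proof
    fix s i j assume "s \<in> Hom (UPhi v X) i j"
    then have s: "s \<in> Phi_hom v X i j" by simp
    note I = Phi_homD(1,2)[OF s]
    show ex: "\<exists>!t. is_pinv (UPhi v X) i j s t" using UPhi_pinv[OF v s] u[OF s] by blast
    have p: "is_pinv (UPhi v X) i j s (pinv (UPhi v X) i j s)" (is "is_pinv _ i j s ?t")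
      unfolding pinv_def by (rule theI'[OF ex])
    then have th: "?t \<in> Phi_hom v X j i" by (simp add: is_pinv_def)
    have "rs X i j s = pc X i j i ?t s"
    proof
      fix x
      show "rs X i j s x = pc X i j i ?t s x"
      proof (cases "s x")
        case (Some a)
        then have "?t (tg X i j a) = Some (iv X i j a)" using UPhi_pinv_unique[OF v s p] by blast
        then show ?thesis
          using Some pc_app[OF s th, of x] rs_app[OF s, of x] iv_props(4)[OF I Phi_homD(5)[OF s Some]]
            Phi_homD(6)[OF s Some] by auto
      qed (simp add: pc_app[OF s th] rs_app[OF s] domIff)
    qed
    then show "Rst (UPhi v X) i j s = Comp (UPhi v X) i j i ?t s" by simp
  qed
qed

lemma pinv_UPhi:
  assumes "v = Groupoids" "s \<in> Phi_hom v X i j"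
  shows "pinv (UPhi v X) i j s y = Some b \<longleftrightarrow> (\<exists>x a. s x = Some a \<and> y = tg X i j a \<and> b = iv X i j a)"
  using UPhi_pinv_unique[OF assms] inverse_category.is_pinv[OF UPhi_inverse_category[OF assms(1)]] assms
  by simp

text \<open>Compatibility makes the union a function. In the groupoid variant the target along the
  union must also be invertible: compatibility of the partial inverses makes the union of the
  converses a function as well.\<close>

lemma UPhi_has_join:
  assumes ij: "i \<in> Ix X" "j \<in> Ix X" and S: "S \<subseteq> Phi_hom v X i j"
    and c: "\<And>s t. s \<in> S \<Longrightarrow> t \<in> S \<Longrightarrow> vcompat v (UPhi v X) i j s t"
  shows "munion S \<in> Phi_hom v X i j \<and> (\<forall>x y. munion S x = Some y \<longleftrightarrow> (\<exists>s\<in>S. s x = Some y))"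
proof -
  have rc: "a = b" if "s \<in> S" "t \<in> S" "s x = Some a" "t x = Some b" for s t x a b
  proof -
    have "s \<in> Phi_hom v X i j" "t \<in> Phi_hom v X i j" using that S by auto
    from rcompat_UPhi[OF this] show ?thesis using c[OF that(1,2)] that(3,4) by (simp add: vcompat_def)
  qed
  have m: "munion S x = Some y \<longleftrightarrow> (\<exists>s\<in>S. s x = Some y)" for x y
    using rc by (rule munion_Some)
  have mT: "munion S \<in> Top_p (Sp X i) (Ar X i j)"
  proof (rule Top_p_union[of _ S])
    show "\<exists>s\<in>S. s x = Some y" if "munion S x = Some y" for x y using that m by blast
    show "s \<in> Top_p (Sp X i) (Ar X i j) \<and> s \<subseteq>\<^sub>m munion S" if "s \<in> S" for s
      using that S Phi_homD(3)[of s i j] m unfolding map_le_iff_Some by blast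
  qed
  have Tm: "(Tgt X i j \<circ>\<^sub>m munion S) x = Some y \<longleftrightarrow> (\<exists>s\<in>S. \<exists>a. s x = Some a \<and> y = tg X i j a)" for x y
    unfolding map_comp_Some_iff Tgt_Some[OF ij] m using S Phi_homD(5)[of _ i j] by blast
  have "Tgt X i j \<circ>\<^sub>m munion S \<in> partial_isos (Sp X i) (Sp X j)" if v: "v = Groupoids"
  proof -
    interpret etale_groupoid X by (rule groupoid[OF v])
    interpret IC: inverse_category "UPhi v X" by (rule UPhi_inverse_category[OF v])
    let ?p = "\<lambda>s. pinv (UPhi v X) i j s"
    \<comment> \<open>The converse of the target map along \<open>s\<close>, expressed through the
      partial inverse of \<open>s\<close> because that is where the second half of bicompatibility
      speaks.\<close>
    let ?u = "\<lambda>s. Tgt X j i \<circ>\<^sub>m ?p s"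
    have sH: "s \<in> Phi_hom v X i j" and pH: "?p s \<in> Phi_hom v X j i" if "s \<in> S" for s
      using IC.pinv_in[of s i j] S that by auto
    have us: "?u s y = Some x \<longleftrightarrow> (\<exists>a. s x = Some a \<and> y = tg X i j a)" if s: "s \<in> S" for s x y
    proof -
      have "?u s y = Some x \<longleftrightarrow> (\<exists>x' a. s x' = Some a \<and> y = tg X i j a \<and> x = tg X j i (iv X i j a))"
        unfolding Tgt_comp_Some[OF pH[OF s]] pinv_UPhi[OF v sH[OF s]] by blast
      also have "\<dots> \<longleftrightarrow> (\<exists>a. s x = Some a \<and> y = tg X i j a)"
        using iv_props'(1)[OF ij Phi_homD(5)[OF sH[OF s]]] Phi_homD(6)[OF sH[OF s]] by metis
      finally show ?thesis .
    qed
    have uc: "x = x'" if st: "s \<in> S" "t \<in> S" "?u s y = Some x" "?u t y = Some x'" for s t y x x'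
    proof -
      obtain b b' where b: "?p s y = Some b" "x = tg X j i b" "?p t y = Some b'" "x' = tg X j i b'"
        using st Tgt_comp_Some[OF pH[OF st(1)]] Tgt_comp_Some[OF pH[OF st(2)]] by blast
      have "rcompat (UPhi v X) j i (?p s) (?p t)" using c[OF st(1,2)] v by (simp add: vcompat_def)
      then have "b = b'" using rcompat_UPhi[OF pH[OF st(1)] pH[OF st(2)]] b by blast
      then show ?thesis using b by simp
    qed
    have mu: "munion (?u ` S) y = Some x \<longleftrightarrow> (\<exists>s\<in>S. ?u s y = Some x)" for x y
      using munion_Some[of "?u ` S" y x] uc by blast
    have "munion (?u ` S) \<in> Top_p (Sp X j) (Sp X i)"
    proof (rule Top_p_union[of _ "?u ` S"])
      show "\<exists>s\<in>?u ` S. s x = Some y" if "munion (?u ` S) x = Some y" for x y using that mu by blast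
      show "s \<in> Top_p (Sp X j) (Sp X i) \<and> s \<subseteq>\<^sub>m munion (?u ` S)" if s: "s \<in> ?u ` S" for s
      proof -
        obtain r where r: "r \<in> S" "s = ?u r" using s by blast
        have "s \<in> Top_p (Sp X j) (Sp X i)" unfolding r(2)
          by (rule Top_p_comp[OF Phi_homD(3)[OF pH[OF r(1)]] total_mapsD(1)[OF tgt[OF ij(2,1)]]])
        moreover have "s \<subseteq>\<^sub>m munion (?u ` S)" using mu r unfolding map_le_iff_Some by blast
        ultimately show ?thesis by blast
      qed
    qed
    moreover have "(Tgt X i j \<circ>\<^sub>m munion S) x = Some y \<longleftrightarrow> munion (?u ` S) y = Some x" for x y
      unfolding Tm mu using us by blast
    moreover have "Tgt X i j \<circ>\<^sub>m munion S \<in> Top_p (Sp X i) (Sp X j)"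
      by (rule Top_p_comp[OF mT total_mapsD(1)[OF tgt[OF ij]]])
    ultimately show ?thesis unfolding partial_isos_iff by blast
  qed
  moreover have "sr X i j a = x" if "munion S x = Some a" for x a
    using that m Phi_homD(6)[of _ i j] S by blast
  ultimately show ?thesis unfolding Phi_hom_iff using ij mT m by blast
qed

lemma UPhi_join_category: "join_category (UPhi v X) v"
proof -
  show ?thesis
  proof (intro join_category.intro join_category_axioms.intro UPhi_restriction_category)
    show "inverse_category (UPhi v X)" if "v = Groupoids" by (rule UPhi_inverse_category[OF that])
    fix i j S
    assume ij: "i \<in> Obj (UPhi v X)" "j \<in> Obj (UPhi v X)" and S: "S \<subseteq> Hom (UPhi v X) i j"
      and c: "\<forall>s\<in>S. \<forall>t\<in>S. vcompat v (UPhi v X) i j s t"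
    have SP: "S \<subseteq> Phi_hom v X i j" using S by simp
    let ?m = "munion S"
    have m: "?m \<in> Phi_hom v X i j" "\<And>x y. ?m x = Some y \<longleftrightarrow> (\<exists>s\<in>S. s x = Some y)"
      using UPhi_has_join[OF _ _ SP] ij c by auto
    have "is_join (UPhi v X) i j S ?m" unfolding is_join_UPhi[OF SP] using m by blast
    moreover have "is_join (UPhi v X) h j ((\<lambda>s. pc X h i j s g) ` S) (pc X h i j ?m g)"
      if g: "g \<in> Phi_hom v X h i" for h g
    proof -
      have SS: "(\<lambda>s. pc X h i j s g) ` S \<subseteq> Phi_hom v X h j" using SP Comp_Phi_hom[OF g] by blast
      have "pc X h i j ?m g x = Some y \<longleftrightarrow> (\<exists>s\<in>S. pc X h i j s g x = Some y)" for x y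
      proof -
        have "(\<exists>s\<in>S. pc X h i j s g x = Some y) \<longleftrightarrow>
            (\<exists>s\<in>S. \<exists>a b. g x = Some a \<and> s (tg X h i a) = Some b \<and> y = mu X h i j b a)"
          using Comp_Some[OF g] SP by blast
        then show ?thesis unfolding Comp_Some[OF g m(1)] m(2) by blast
      qed
      then show ?thesis unfolding is_join_UPhi[OF SS] using Comp_Phi_hom[OF g m(1)] by auto
    qed
    ultimately show "has_stable_join (UPhi v X) i j S" unfolding has_stable_join_def by auto
  qed
qed

end

lemma internal_cat_UPhi: "internal_cat v sc X \<Longrightarrow> join_cat v sc (UPhi v X)"
  unfolding internal_cat_iff join_cat_iff using icat.UPhi_join_category by auto

section \<open>The internal category of germs\<close>

lemma PsiW_sel [simp]: "Ix (PsiW C) = Obj C" "Sp (PsiW C) = (\<lambda>i. pt (RLoc C i))"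
  "Ar (PsiW C) = germ_space (W C)" "Src (PsiW C) = germ_base (W C)" "Tgt (PsiW C) = germ_target (W C)"
  "Eta (PsiW C) = (\<lambda>i. sect (W C) i i (Idn C i))" "Mu (PsiW C) = germ_mult (W C)"
  by (simp_all add: PsiW_def Psi_def)

context join_category
begin

lemma Ar2_germE:
  assumes "z \<in> topspace (Ar2 (PsiW C) i j k)"
  obtains f g p where "z = (gm C j k g (push C i j f p), gm C i j f p)"
    "f \<in> Hom C i j" "g \<in> Hom C j k" "p \<in> pts C i" "p (Rst C i j f)" "push C i j f p (Rst C j k g)"
proof -
  obtain b a where z: "z = (b, a)" by (cases z)
  have "(b, a) \<in> topspace (fprod (germ_space (W C) j k) (germ_space (W C) i j)
      (germ_base (W C) j k) (germ_target (W C) i j))"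
    using assms unfolding z Ar2_def by simp
  then obtain g q where g: "g \<in> Hom C j k" "q \<in> pts C j" "q (Rst C j k g)" "b = gm C j k g q"
      "a \<in> topspace (germ_space (W C) i j)" "germ_target (W C) i j a = Some q"
    by (rule fprod_germE)
  obtain f p where f: "f \<in> Hom C i j" "p \<in> pts C i" "p (Rst C i j f)" "a = gm C i j f p"
    using g(5) by (rule germE)
  have "q = push C i j f p" using germ_target_gm[OF f(1-3)] g(6) f(4) by simp
  then show thesis using f g z by (intro that[of g f p]) simp_all
qed

lemma Idn_app: "i \<in> Obj C \<Longrightarrow>
    sect (W C) i i (Idn C i) p = (if p \<in> pts C i then Some (gm C i i (Idn C i) p) else None)"
  using sect_W[OF idn_hom] Idn_rst by auto

lemma push_Idn: "i \<in> Obj C \<Longrightarrow> p \<in> pts C i \<Longrightarrow> push C i i (Idn C i) p = p"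
  by (simp add: push_RIdem idn_RIdem point_idn)

lemma PsiW_source_etale: "source_etale_category (PsiW C)"
proof (unfold_locales, unfold PsiW_sel)
  fix i j assume ij: "i \<in> Obj C" "j \<in> Obj C"
  show "local_homeo (germ_space (W C) i j) (pt (RLoc C i)) (germ_base (W C) i j)"
    by (rule germ_base_local_homeo)
  show "germ_base (W C) i j \<in> total_maps (germ_space (W C) i j) (pt (RLoc C i))"
    by (rule germ_base_total)
  show "germ_target (W C) i j \<in> total_maps (germ_space (W C) i j) (pt (RLoc C j))"
    by (rule germ_target_total)
  show "sect (W C) i i (Idn C i) \<in> Top_p (pt (RLoc C i)) (germ_space (W C) i i)"
    by (rule sect_Top_p[OF idn_hom[OF ij(1)]])
  have bI: "germ_base (W C) i i (gm C i i (Idn C i) p) = Some p" if p: "p \<in> pts C i" for p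
    by (rule germ_base_gm[OF idn_hom[OF ij(1)] p Idn_rst[OF ij(1) p]])
  have tI: "germ_target (W C) i i (gm C i i (Idn C i) p) = Some p" if p: "p \<in> pts C i" for p
    using germ_target_gm[OF idn_hom[OF ij(1)] p Idn_rst[OF ij(1) p]] push_Idn[OF ij(1) p] by simp
  show "germ_base (W C) i i \<circ>\<^sub>m sect (W C) i i (Idn C i) = idp (pt (RLoc C i))"
    using bI by (intro ext) (simp add: map_comp_def Idn_app[OF ij(1)] idp_def topspace_pt[OF ij(1)])
  show "germ_target (W C) i i \<circ>\<^sub>m sect (W C) i i (Idn C i) = idp (pt (RLoc C i))"
    using tI by (intro ext) (simp add: map_comp_def Idn_app[OF ij(1)] idp_def topspace_pt[OF ij(1)])
  show "germ_mult (W C) i i j \<circ>\<^sub>m pairp (idp (germ_space (W C) i j))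
      (sect (W C) i i (Idn C i) \<circ>\<^sub>m germ_base (W C) i j) = idp (germ_space (W C) i j)" (is "?l = ?r")
  proof
    fix a show "?l a = ?r a"
    proof (cases "a \<in> topspace (germ_space (W C) i j)")
      case True
      then obtain f p where f: "f \<in> Hom C i j" "p \<in> pts C i" "p (Rst C i j f)" "a = gm C i j f p"
        by (rule germE)
      have "germ_mult (W C) i i j (gm C i j f p, gm C i i (Idn C i) p) = Some (gm C i j f p)"
        using germ_mult_gm[OF idn_hom[OF ij(1)] f(2) Idn_rst[OF ij(1) f(2)] f(1)] f(3)
        by (simp add: push_Idn[OF ij(1) f(2)] comp_idn[OF f(1)])
      then show ?thesis using True f(4) germ_base_gm[OF f(1-3)] Idn_app[OF ij(1)] f(2)
        by (simp add: pairp_def idp_def)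
    qed (simp add: idp_def pairp_def)
  qed
  show "germ_mult (W C) i j j \<circ>\<^sub>m pairp (sect (W C) j j (Idn C j) \<circ>\<^sub>m germ_target (W C) i j)
      (idp (germ_space (W C) i j)) = idp (germ_space (W C) i j)" (is "?l = ?r")
  proof
    fix a show "?l a = ?r a"
    proof (cases "a \<in> topspace (germ_space (W C) i j)")
      case True
      then obtain f p where f: "f \<in> Hom C i j" "p \<in> pts C i" "p (Rst C i j f)" "a = gm C i j f p"
        by (rule germE)
      note pp = push_point[OF f(1-3)]
      have "germ_mult (W C) i j j (gm C j j (Idn C j) (push C i j f p), gm C i j f p) = Some (gm C i j f p)"
        using germ_mult_gm[OF f(1-3) idn_hom[OF ij(2)] Idn_rst[OF ij(2) pp]]
        by (simp add: idn_comp[OF f(1)])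
      then show ?thesis using True f(4) germ_target_gm[OF f(1-3)] Idn_app[OF ij(2)] pp
        by (simp add: pairp_def idp_def)
    next
      case False
      then show ?thesis by (simp add: idp_def pairp_def map_comp_def split: option.split)
    qed
  qed
  fix k assume k: "k \<in> Obj C"
  show M: "germ_mult (W C) i j k \<in> Top_p (Ar2 (PsiW C) i j k) (germ_space (W C) i k)"
    using germ_mult_spec[OF ij k] unfolding Ar2_def PsiW_sel by blast
  have Mn: "germ_mult (W C) i j k z = None" if "z \<notin> topspace (Ar2 (PsiW C) i j k)" for z
    using Top_pD(2)[OF M] that by (auto simp: domIff)
  show "germ_base (W C) i k \<circ>\<^sub>m germ_mult (W C) i j k = germ_base (W C) i j \<circ>\<^sub>m proj2 (Ar2 (PsiW C) i j k)"
  proof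
    fix z
    show "(germ_base (W C) i k \<circ>\<^sub>m germ_mult (W C) i j k) z =
      (germ_base (W C) i j \<circ>\<^sub>m proj2 (Ar2 (PsiW C) i j k)) z"
    proof (cases "z \<in> topspace (Ar2 (PsiW C) i j k)")
      case True
      then obtain f g p where fg: "z = (gm C j k g (push C i j f p), gm C i j f p)"
        "f \<in> Hom C i j" "g \<in> Hom C j k" "p \<in> pts C i" "p (Rst C i j f)" "push C i j f p (Rst C j k g)"
        by (rule Ar2_germE)
      then show ?thesis
        using True germ_mult_gm[OF fg(2,4,5,3,6)] germ_base_gm[OF fg(2,4,5)] push_rst[OF fg(2,3), of p]
          germ_base_gm[OF comp_in[OF fg(2,3)] fg(4)] by (simp add: proj2_def)
    qed (simp add: Mn proj2_def)
  qed
  show "germ_target (W C) i k \<circ>\<^sub>m germ_mult (W C) i j k = germ_target (W C) j k \<circ>\<^sub>m proj1 (Ar2 (PsiW C) i j k)"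
  proof
    fix z
    show "(germ_target (W C) i k \<circ>\<^sub>m germ_mult (W C) i j k) z =
      (germ_target (W C) j k \<circ>\<^sub>m proj1 (Ar2 (PsiW C) i j k)) z"
    proof (cases "z \<in> topspace (Ar2 (PsiW C) i j k)")
      case True
      then obtain f g p where fg: "z = (gm C j k g (push C i j f p), gm C i j f p)"
        "f \<in> Hom C i j" "g \<in> Hom C j k" "p \<in> pts C i" "p (Rst C i j f)" "push C i j f p (Rst C j k g)"
        by (rule Ar2_germE)
      then show ?thesis
        using True germ_mult_gm[OF fg(2,4,5,3,6)] push_rst[OF fg(2,3), of p]
          germ_target_gm[OF fg(3) push_point[OF fg(2,4,5)] fg(6)]
          germ_target_gm[OF comp_in[OF fg(2,3)] fg(4)] push_comp[OF fg(2,3)] by (simp add: proj1_def)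
    qed (simp add: Mn proj1_def)
  qed
  fix l assume l: "l \<in> Obj C"
  let ?D = "Ar2 (PsiW C) i j k" and ?T = "Ar3 (PsiW C) i j k l"
  show "let T = Ar3 (PsiW C) i j k l; h = proj1 T; gf = proj2 T;
           g = proj1 (Ar2 (PsiW C) i j k) \<circ>\<^sub>m gf; f = proj2 (Ar2 (PsiW C) i j k) \<circ>\<^sub>m gf
       in germ_mult (W C) i k l \<circ>\<^sub>m pairp h (germ_mult (W C) i j k \<circ>\<^sub>m gf) =
          germ_mult (W C) i j l \<circ>\<^sub>m pairp (germ_mult (W C) j k l \<circ>\<^sub>m pairp h g) f"
    unfolding Let_def
  proof
    fix z
    show "(germ_mult (W C) i k l \<circ>\<^sub>m pairp (proj1 ?T) (germ_mult (W C) i j k \<circ>\<^sub>m proj2 ?T)) z =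
      (germ_mult (W C) i j l \<circ>\<^sub>m pairp (germ_mult (W C) j k l \<circ>\<^sub>m pairp (proj1 ?T) (proj1 ?D \<circ>\<^sub>m proj2 ?T))
        (proj2 ?D \<circ>\<^sub>m proj2 ?T)) z"
    proof (cases "z \<in> topspace ?T")
      case True
      obtain c w where z: "z = (c, w)" by (cases z)
      have cw: "(c, w) \<in> topspace (fprod (germ_space (W C) k l) ?D (germ_base (W C) k l)
          (germ_target (W C) j k \<circ>\<^sub>m proj1 ?D))"
        using True unfolding z Ar3_def by simp
      then have w: "w \<in> topspace ?D" by simp
      then obtain f g p where fg: "w = (gm C j k g (push C i j f p), gm C i j f p)"
        "f \<in> Hom C i j" "g \<in> Hom C j k" "p \<in> pts C i" "p (Rst C i j f)" "push C i j f p (Rst C j k g)"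
        by (rule Ar2_germE)
      obtain h r where h: "h \<in> Hom C k l" "r \<in> pts C k" "r (Rst C k l h)" "c = gm C k l h r"
        "(germ_target (W C) j k \<circ>\<^sub>m proj1 ?D) w = Some r"
        using cw by (rule fprod_germE)
      \<comment> \<open>A composable triple of germs is represented by \<open>f\<close> at
        \<open>p\<close>, \<open>g\<close> at its image \<open>q\<close> and \<open>h\<close> at the
        image \<open>r\<close> of \<open>q\<close>; associativity then is associativity in
        \<open>C\<close>.\<close>
      define q where "q = push C i j f p"
      have q: "q \<in> pts C j" "q (Rst C j k g)" using push_point[OF fg(2,4,5)] fg(6) by (auto simp: q_def)
      have r: "r = push C j k g q"
        using h(5) w germ_target_gm[OF fg(3) q] by (simp add: fg(1) proj1_def q_def)
      have gf: "p (Rst C i k (Comp C i j k g f))" using push_rst[OF fg(2,3)] fg(6) by simp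
      have r': "r = push C i k (Comp C i j k g f) p" using r push_comp[OF fg(2,3)] by (simp add: q_def)
      have hg: "q (Rst C j l (Comp C j k l h g))" using push_rst[OF fg(3) h(1)] h(3) r by simp
      have 1: "germ_mult (W C) i j k (gm C j k g q, gm C i j f p) = Some (gm C i k (Comp C i j k g f) p)"
        unfolding q_def by (rule germ_mult_gm[OF fg(2,4,5,3,6)])
      have 2: "germ_mult (W C) j k l (gm C k l h r, gm C j k g q) = Some (gm C j l (Comp C j k l h g) q)"
        unfolding r by (rule germ_mult_gm[OF fg(3) q h(1)]) (use h(3) r in simp)
      have 3: "germ_mult (W C) i k l (gm C k l h r, gm C i k (Comp C i j k g f) p) =
          Some (gm C i l (Comp C i k l h (Comp C i j k g f)) p)"
        unfolding r' by (rule germ_mult_gm[OF comp_in[OF fg(2,3)] fg(4) gf h(1)]) (use h(3) r' in simp)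
      have 4: "germ_mult (W C) i j l (gm C j l (Comp C j k l h g) q, gm C i j f p) =
          Some (gm C i l (Comp C i j l (Comp C j k l h g) f) p)"
        unfolding q_def by (rule germ_mult_gm[OF fg(2,4,5) comp_in[OF fg(3) h(1)]]) (use hg q_def in simp)
      show ?thesis
        using True w 1 2 3 4 comp_assoc[OF fg(2,3) h(1)]
        by (simp add: z h(4) fg(1) q_def[symmetric] pairp_def proj1_def proj2_def)
    next
      case False
      then show ?thesis by (simp add: proj1_def proj2_def pairp_def map_comp_def)
    qed
  qed
qed

section \<open>Inversion of germs\<close>

text \<open>If \<open>f\<close> and \<open>g\<close> agree on \<open>e\<close>, then
  \<open>h = f e\<close> lies below both. Inversion preserves the order, so the inverses of
  \<open>f\<close> and \<open>g\<close> agree on the range of \<open>h\<close>, and the image of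
  \<open>p\<close> belongs to that range.\<close>

lemma agr_pinv:
  assumes v: "v = Groupoids" and f: "f \<in> Hom C i j" and g: "g \<in> Hom C i j" and p: "p \<in> pts C i"
    and a: "agr C i j f g p"
  shows "agr C j i (pinv C i j f) (pinv C i j g) (push C i j f p)"
proof -
  interpret I: inverse_category C by (rule inverses[OF v])
  obtain e where e: "e \<in> RIdem C i" "p e" "Comp C i i j f e = Comp C i i j g e"
    using a by (auto simp: agr_def)
  have pf: "p (Rst C i j f)" "p (Rst C i j g)" using a by (auto simp: agr_def)
  define h where "h = Comp C i i j f e"
  have h: "h \<in> Hom C i j" using f RIdem_in[OF e(1)] by (simp add: h_def)
  have r: "Comp C i j j (Rst C j i (pinv C i j s)) s = s" if "s \<in> Hom C i j" for s
    using I.rst_eq[OF I.pinv_in[OF that]] I.pinv_pinv[OF that] I.comp_pinv_comp'(1)[OF that] by simp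
  \<comment> \<open>The restriction of the inverse of \<open>h\<close> is the range of
    \<open>h\<close>: a neighbourhood of the image point, as \<open>h\<close> is defined at
    \<open>p\<close>.\<close>
  let ?d = "Rst C j i (pinv C i j h)"
  have d: "?d \<in> RIdem C j" using h by (intro rst_RIdem) simp
  have "rle C i j h f" "rle C i j h g"
    using rle_comp_RIdem[OF f e(1)] rle_comp_RIdem[OF g e(1)] e(3) by (simp_all add: h_def)
  then have "rle C j i (pinv C i j h) (pinv C i j f)" "rle C j i (pinv C i j h) (pinv C i j g)"
    using I.rle_pinv f g h by auto
  then have eq: "Comp C j j i (pinv C i j f) ?d = Comp C j j i (pinv C i j g) ?d"
    by (simp add: rle_def)
  have df: "Comp C i j j ?d f \<in> Hom C i j" using f RIdem_in[OF d] by simp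
  have "Comp C i i j (Comp C i j j ?d f) e = Comp C i i j f e"
    using comp_assoc'[OF RIdem_in[OF e(1)] f RIdem_in[OF d]] r[OF h] by (simp add: h_def)
  then have "Comp C i i i (Rst C i j (Comp C i j j ?d f)) e = Comp C i i i (Rst C i j f) e"
    using rst_comp_RIdem[OF df e(1)] rst_comp_RIdem[OF f e(1)] by simp
  then have "p (Rst C i j (Comp C i j j ?d f))"
    using point_comp[OF p rst_RIdem[OF df] e(1)] point_comp[OF p rst_RIdem[OF f] e(1)] pf e(2) by simp
  then have 1: "push C i j f p ?d" using d by (simp add: push_def)
  have 2: "push C i j f p (Rst C j i (pinv C i j f))"
    using r[OF f] pf rst_RIdem[OF I.pinv_in[OF f]] by (simp add: push_def)
  have 3: "push C i j f p (Rst C j i (pinv C i j g))"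
    unfolding push_agr[OF f g p a] using r[OF g] pf rst_RIdem[OF I.pinv_in[OF g]] by (simp add: push_def)
  show ?thesis unfolding agr_def using 1 2 3 d eq by blast
qed

lemma push_rst_pinv:
  assumes v: "v = Groupoids" and f: "f \<in> Hom C i j" "p (Rst C i j f)"
  shows "push C i j f p (Rst C j i (pinv C i j f))"
proof -
  interpret I: inverse_category C by (rule inverses[OF v])
  have "Comp C i j j (Rst C j i (pinv C i j f)) f = f"
    using I.rst_eq[OF I.pinv_in[OF f(1)]] I.pinv_pinv[OF f(1)] I.comp_pinv_comp'(1)[OF f(1)] by simp
  then show ?thesis using f rst_RIdem[OF I.pinv_in[OF f(1)]] by (simp add: push_def)
qed

lemma push_pinv:
  assumes v: "v = Groupoids" and f: "f \<in> Hom C i j" "p \<in> pts C i" "p (Rst C i j f)"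
  shows "push C j i (pinv C i j f) (push C i j f p) = p"
proof -
  interpret I: inverse_category C by (rule inverses[OF v])
  have "push C j i (pinv C i j f) (push C i j f p) = push C i i (Rst C i j f) p"
    using push_comp[OF f(1) I.pinv_in[OF f(1)], of p] I.rst_eq[OF f(1)] by simp
  also have "\<dots> = p" by (rule push_RIdem[OF rst_RIdem[OF f(1)] f(2,3)])
  finally show ?thesis .
qed

text \<open>The inverse of the germ of \<open>f\<close> at \<open>p\<close> is the germ of
  \<open>pinv C i j f\<close> at the image of \<open>p\<close>. By \<open>agr_pinv\<close> this
  assignment is constant on germs, so \<open>germ_glue\<close> makes it a continuous map.\<close>

lemma PsiW_etale_groupoid:
  assumes v: "v = Groupoids"
  shows "etale_groupoid (PsiW C)"
proof (intro etale_groupoid.intro etale_groupoid_axioms.intro PsiW_source_etale)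
  interpret I: inverse_category C by (rule inverses[OF v])
  let ?P = "\<lambda>i j t. t \<in> Top_p (germ_space (W C) i j) (germ_space (W C) j i) \<and>
    (\<forall>f\<in>Hom C i j. t \<circ>\<^sub>m sect (W C) i j f = sect (W C) j i (pinv C i j f) \<circ>\<^sub>m tmap (snd (W C)) i j f)"
  note r = push_rst_pinv[OF v] and pp = push_pinv[OF v]
  have k: "(sect (W C) j i (pinv C i j f) \<circ>\<^sub>m tmap (snd (W C)) i j f) p =
      (if p \<in> pts C i \<and> p (Rst C i j f) then Some (gm C j i (pinv C i j f) (push C i j f p)) else None)"
    if f: "f \<in> Hom C i j" for i j f p
    using r[OF f] push_point[OF f] f by (simp add: map_comp_def tmap_W[OF f] sect_W[OF I.pinv_in[OF f]])
  have "\<exists>t. ?P i j t" for i j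
  proof -
    have "\<exists>!t. ?P i j t"
    proof (rule germ_glue)
      fix f assume f: "f \<in> Hom C i j"
      show "sect (W C) j i (pinv C i j f) \<circ>\<^sub>m tmap (snd (W C)) i j f
          \<in> Top_p (pt (RLoc C i)) (germ_space (W C) j i)"
        using Top_p_comp[OF tmap_W_Top_p[OF f] sect_Top_p[OF I.pinv_in[OF f]]] by simp
      show "dom (sect (W C) j i (pinv C i j f) \<circ>\<^sub>m tmap (snd (W C)) i j f) \<subseteq> dom (sect (W C) i j f)"
        unfolding dom_sect[OF f] by (auto simp: k[OF f, unfolded W_sel] dom_def split: if_splits)
      fix g p assume g: "g \<in> Hom C i j" "p \<in> pts C i" "agr C i j f g p"
      have pf: "p (Rst C i j f)" "p (Rst C i j g)" using g(3) by (auto simp: agr_def)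
      have "gm C j i (pinv C i j f) (push C i j f p) = gm C j i (pinv C i j g) (push C i j g p)"
        using gm_eq_iff[OF I.pinv_in[OF f] I.pinv_in[OF g(1)] push_point[OF f g(2) pf(1)] r[where p=p, OF f pf(1)]]
          agr_pinv[OF v f g] push_agr[OF f g] by simp
      then show "(sect (W C) j i (pinv C i j f) \<circ>\<^sub>m tmap (snd (W C)) i j f) p =
          (sect (W C) j i (pinv C i j g) \<circ>\<^sub>m tmap (snd (W C)) i j g) p"
        using pf g(2) by (simp only: k[OF f] k[OF g(1)])
    qed
    then show ?thesis by blast
  qed
  then obtain t where t: "\<And>i j. ?P i j (t i j)" by metis
  have tv: "t i j (gm C i j f p) = Some (gm C j i (pinv C i j f) (push C i j f p))"
    if f: "f \<in> Hom C i j" "p \<in> pts C i" "p (Rst C i j f)" for i j f p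
  proof -
    have "t i j \<circ>\<^sub>m sect (W C) i j f = sect (W C) j i (pinv C i j f) \<circ>\<^sub>m tmap (snd (W C)) i j f"
      using t f(1) by blast
    then have "(t i j \<circ>\<^sub>m sect (W C) i j f) p = (sect (W C) j i (pinv C i j f) \<circ>\<^sub>m tmap (snd (W C)) i j f) p"
      by simp
    then show ?thesis using f unfolding k[OF f(1)] by (simp add: sect_W)
  qed
  have tn: "t i j a = None" if "a \<notin> topspace (germ_space (W C) i j)" for i j a
    using t[of i j] that Top_pD(2) by (auto simp: domIff)
  show "\<exists>\<iota>. \<forall>i \<in> Ix (PsiW C). \<forall>j \<in> Ix (PsiW C).
      \<iota> i j \<in> total_maps (Ar (PsiW C) i j) (Ar (PsiW C) j i) \<and>
      \<iota> i j \<circ>\<^sub>m \<iota> j i = idp (Ar (PsiW C) j i) \<and>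
      Src (PsiW C) j i \<circ>\<^sub>m \<iota> i j = Tgt (PsiW C) i j \<and>
      Mu (PsiW C) i j i \<circ>\<^sub>m pairp (\<iota> i j) (idp (Ar (PsiW C) i j)) = Eta (PsiW C) i \<circ>\<^sub>m Src (PsiW C) i j"
    unfolding PsiW_sel
  proof (intro exI[of _ t] ballI conjI)
    fix i j assume ij: "i \<in> Obj C" "j \<in> Obj C"
    have "dom (t i j) = topspace (germ_space (W C) i j)"
      using t[of i j] Top_pD(2) tv by (fastforce elim!: germE)
    then show "t i j \<in> total_maps (germ_space (W C) i j) (germ_space (W C) j i)"
      unfolding total_maps_iff using t by blast
    show "t i j \<circ>\<^sub>m t j i = idp (germ_space (W C) j i)"
    proof
      fix a show "(t i j \<circ>\<^sub>m t j i) a = idp (germ_space (W C) j i) a"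
      proof (cases "a \<in> topspace (germ_space (W C) j i)")
        case True
        then obtain f p where f: "f \<in> Hom C j i" "p \<in> pts C j" "p (Rst C j i f)" "a = gm C j i f p"
          by (rule germE)
        show ?thesis using True tv[OF f(1-3)] tv[OF I.pinv_in[OF f(1)] push_point[OF f(1-3)] r[where p=p, OF f(1,3)]]
          pp[OF f(1-3)] I.pinv_pinv[OF f(1)] f(4) by (simp add: idp_def)
      qed (simp add: tn idp_def)
    qed
    show "germ_base (W C) j i \<circ>\<^sub>m t i j = germ_target (W C) i j"
    proof
      fix a show "(germ_base (W C) j i \<circ>\<^sub>m t i j) a = germ_target (W C) i j a"
      proof (cases "a \<in> topspace (germ_space (W C) i j)")
        case True
        then obtain f p where f: "f \<in> Hom C i j" "p \<in> pts C i" "p (Rst C i j f)" "a = gm C i j f p"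
          by (rule germE)
        show ?thesis using tv[OF f(1-3)] germ_base_gm[OF I.pinv_in[OF f(1)] push_point[OF f(1-3)] r[where p=p, OF f(1,3)]]
          germ_target_gm[OF f(1-3)] f(4) by simp
      next
        case False
        then have "germ_target (W C) i j a = None"
          using germ_target_total[of i j] unfolding total_maps_iff by (auto simp: domIff)
        then show ?thesis using tn[OF False] by simp
      qed
    qed
    show "germ_mult (W C) i j i \<circ>\<^sub>m pairp (t i j) (idp (germ_space (W C) i j)) =
      sect (W C) i i (Idn C i) \<circ>\<^sub>m germ_base (W C) i j" (is "?l = ?r")
    proof
      fix a show "?l a = ?r a"
      proof (cases "a \<in> topspace (germ_space (W C) i j)")
        case True
        then obtain f p where f: "f \<in> Hom C i j" "p \<in> pts C i" "p (Rst C i j f)" "a = gm C i j f p"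
          by (rule germE)
        \<comment> \<open>The product is the germ of the restriction of \<open>f\<close>, and an
          idempotent holding at \<open>p\<close> has the germ of the identity.\<close>
        have "germ_mult (W C) i j i (gm C j i (pinv C i j f) (push C i j f p), gm C i j f p) =
            Some (gm C i i (Rst C i j f) p)"
          using germ_mult_gm[OF f(1-3) I.pinv_in[OF f(1)] r[where p=p, OF f(1,3)]] I.rst_eq[OF f(1)] by simp
        then show ?thesis
          using tv[OF f(1-3)] True f(4) gm_RIdem[OF rst_RIdem[OF f(1)] f(2,3)] germ_base_gm[OF f(1-3)]
            Idn_app[OF ij(1)] f(2) by (simp add: pairp_def idp_def)
      next
        case False
        then show ?thesis using dom_germ_base[of i j] tn[OF False]
          by (simp add: pairp_def map_comp_def germ_base_def topspace_germ_space)
      qed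
    qed
  qed
qed

lemma PsiW_icat: "icat (PsiW C) v"
  by (intro icat.intro icat_axioms.intro PsiW_source_etale PsiW_etale_groupoid)

lemma sr_gm: "f \<in> Hom C i j \<Longrightarrow> p \<in> pts C i \<Longrightarrow> p (Rst C i j f) \<Longrightarrow> sr (PsiW C) i j (gm C i j f p) = p"
  by (simp add: sr_def germ_base_gm)

lemma tg_gm: "f \<in> Hom C i j \<Longrightarrow> p \<in> pts C i \<Longrightarrow> p (Rst C i j f) \<Longrightarrow>
    tg (PsiW C) i j (gm C i j f p) = push C i j f p"
  by (simp add: tg_def germ_target_gm)

lemma et_PsiW: "i \<in> Obj C \<Longrightarrow> p \<in> pts C i \<Longrightarrow> et (PsiW C) i p = gm C i i (Idn C i) p"
  by (simp add: et_def Idn_app)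

lemma mu_gm: "f \<in> Hom C i j \<Longrightarrow> p \<in> pts C i \<Longrightarrow> p (Rst C i j f) \<Longrightarrow> g \<in> Hom C j k \<Longrightarrow>
    push C i j f p (Rst C j k g) \<Longrightarrow>
    mu (PsiW C) i j k (gm C j k g (push C i j f p)) (gm C i j f p) = gm C i k (Comp C i j k g f) p"
  by (simp add: mu_def germ_mult_gm)

end

lemma join_cat_PsiW: "join_cat v sc C \<Longrightarrow> internal_cat v sc (PsiW C)"
  unfolding internal_cat_iff join_cat_iff using join_category.PsiW_icat by auto

section \<open>Cofunctors pointwise\<close>

text \<open>Bridge from equations of partial maps to equations of elements, once the common domain
  \<open>T\<close> is known; it serves to translate the cofunctor axioms.\<close>

lemma comp_eq_iff:
  assumes "\<And>z. z \<in> T \<Longrightarrow> f z = Some (k z)" "\<And>z. z \<notin> T \<Longrightarrow> f z = None" "\<And>z. z \<notin> T \<Longrightarrow> h z = None"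
  shows "g \<circ>\<^sub>m f = h \<longleftrightarrow> (\<forall>z\<in>T. g (k z) = h z)"
proof
  assume "g \<circ>\<^sub>m f = h"
  then have "(g \<circ>\<^sub>m f) z = h z" for z by simp
  then show "\<forall>z\<in>T. g (k z) = h z" using assms(1) by (metis map_comp_simps(2))
next
  assume H: "\<forall>z\<in>T. g (k z) = h z"
  show "g \<circ>\<^sub>m f = h"
  proof
    fix z show "(g \<circ>\<^sub>m f) z = h z" using H assms by (cases "z \<in> T") (simp_all add: map_comp_def)
  qed
qed

definition co :: "('i, 'a, 'b, 'j, 'c, 'd) cofun \<Rightarrow> 'i \<Rightarrow> 'c \<Rightarrow> 'a" where "co F i y = the (cob F i y)"
definition ca :: "('i, 'a, 'b, 'j, 'c, 'd) cofun \<Rightarrow> 'i \<Rightarrow> 'i \<Rightarrow> 'b \<Rightarrow> 'c \<Rightarrow> 'd" where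
  "ca F i j a y = the (car F i j (a, y))"

text \<open>The typing of a cofunctor without its equations. Under it \<open>co\<close> and
  \<open>ca\<close> take values in the right sets, so that the equations can be stated for
  elements.\<close>

locale pre_cofunctor = X: partite_category X + Y: partite_category Y
  for X :: "('i, 'a, 'b) pcat" and Y :: "('j, 'c, 'd) pcat" +
  fixes F :: "('i, 'a, 'b, 'j, 'c, 'd) cofun"
  assumes cix: "cix F \<in> Ix X \<rightarrow>\<^sub>E Ix Y"
    and cob_out: "\<And>i. i \<notin> Ix X \<Longrightarrow> cob F i = Map.empty"
    and car_out: "\<And>i j. i \<notin> Ix X \<or> j \<notin> Ix X \<Longrightarrow> car F i j = Map.empty"
    and cob_total: "\<And>i. i \<in> Ix X \<Longrightarrow> cob F i \<in> total_maps (Sp Y (cix F i)) (Sp X i)"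
    and car_total: "\<And>i j. i \<in> Ix X \<Longrightarrow> j \<in> Ix X \<Longrightarrow>
      car F i j \<in> total_maps (act_dom X Y (cix F) (cob F) i j) (Ar Y (cix F i) (cix F j))"
begin

lemma cix_in: "i \<in> Ix X \<Longrightarrow> cix F i \<in> Ix Y"
  using cix by (auto simp: PiE_def Pi_def)

lemma cob_Some: "i \<in> Ix X \<Longrightarrow> cob F i y = Some x \<longleftrightarrow> y \<in> sp Y (cix F i) \<and> x = co F i y"
  unfolding co_def by (rule total_Some[OF cob_total])

lemma cob_app: "i \<in> Ix X \<Longrightarrow> cob F i y = (if y \<in> sp Y (cix F i) then Some (co F i y) else None)"
  using cob_Some[of i y] by (cases "cob F i y") auto

lemma co_in: "i \<in> Ix X \<Longrightarrow> y \<in> sp Y (cix F i) \<Longrightarrow> co F i y \<in> sp X i"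
  using cob_Some total_mapsD(3)[OF cob_total] by blast

lemma act_dom_iff:
  assumes "i \<in> Ix X" "j \<in> Ix X"
  shows "(a, y) \<in> topspace (act_dom X Y (cix F) (cob F) i j) \<longleftrightarrow>
    a \<in> ar X i j \<and> y \<in> sp Y (cix F i) \<and> sr X i j a = co F i y"
proof -
  have "Src X i j a = cob F i y \<longleftrightarrow> sr X i j a = co F i y" if "a \<in> ar X i j" "y \<in> sp Y (cix F i)"
  proof -
    have "Src X i j a = Some (sr X i j a)" using X.Src_Some[OF assms] that by simp
    then show ?thesis using cob_app[OF assms(1), of y] that by simp
  qed
  then show ?thesis by (auto simp: act_dom_def)
qed

lemma car_Some:
  assumes "i \<in> Ix X" "j \<in> Ix X"
  shows "car F i j (a, y) = Some c \<longleftrightarrow>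
    a \<in> ar X i j \<and> y \<in> sp Y (cix F i) \<and> sr X i j a = co F i y \<and> c = ca F i j a y"
  using total_Some[OF car_total[OF assms], of "(a, y)"] act_dom_iff[OF assms] by (auto simp: ca_def)

lemma ca_in:
  assumes "i \<in> Ix X" "j \<in> Ix X" "a \<in> ar X i j" "y \<in> sp Y (cix F i)" "sr X i j a = co F i y"
  shows "ca F i j a y \<in> ar Y (cix F i) (cix F j)"
  using car_Some[OF assms(1,2), of a y] total_mapsD(3)[OF car_total[OF assms(1,2)]] assms by blast

definition src_ax :: bool where
  "src_ax \<longleftrightarrow> (\<forall>i\<in>Ix X. \<forall>j\<in>Ix X. \<forall>a\<in>ar X i j. \<forall>y\<in>sp Y (cix F i). sr X i j a = co F i y \<longrightarrow>
     sr Y (cix F i) (cix F j) (ca F i j a y) = y \<and>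
     co F j (tg Y (cix F i) (cix F j) (ca F i j a y)) = tg X i j a)"

definition unit_ax :: bool where
  "unit_ax \<longleftrightarrow> (\<forall>i\<in>Ix X. \<forall>y\<in>sp Y (cix F i). ca F i i (et X i (co F i y)) y = et Y (cix F i) y)"

definition mult_ax :: bool where
  "mult_ax \<longleftrightarrow> (\<forall>i\<in>Ix X. \<forall>j\<in>Ix X. \<forall>k\<in>Ix X. \<forall>a\<in>ar X i j. \<forall>b\<in>ar X j k. \<forall>y\<in>sp Y (cix F i).
     sr X i j a = co F i y \<longrightarrow> sr X j k b = tg X i j a \<longrightarrow>
     ca F i k (mu X i j k b a) y = mu Y (cix F i) (cix F j) (cix F k)
       (ca F j k b (tg Y (cix F i) (cix F j) (ca F i j a y))) (ca F i j a y))"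

lemma src_ax_iff:
  "src_ax \<longleftrightarrow> (\<forall>i\<in>Ix X. \<forall>j\<in>Ix X. let D = act_dom X Y (cix F) (cob F) i j in
        car F i j \<in> total_maps D (Ar Y (cix F i) (cix F j)) \<and>
        Src Y (cix F i) (cix F j) \<circ>\<^sub>m car F i j = proj2 D \<and>
        cob F j \<circ>\<^sub>m (Tgt Y (cix F i) (cix F j) \<circ>\<^sub>m car F i j) = Tgt X i j \<circ>\<^sub>m proj1 D)"
proof -
  have "(Src Y (cix F i) (cix F j) \<circ>\<^sub>m car F i j = proj2 (act_dom X Y (cix F) (cob F) i j) \<and>
        cob F j \<circ>\<^sub>m (Tgt Y (cix F i) (cix F j) \<circ>\<^sub>m car F i j) =
          Tgt X i j \<circ>\<^sub>m proj1 (act_dom X Y (cix F) (cob F) i j)) \<longleftrightarrow>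
      (\<forall>a\<in>ar X i j. \<forall>y\<in>sp Y (cix F i). sr X i j a = co F i y \<longrightarrow>
       sr Y (cix F i) (cix F j) (ca F i j a y) = y \<and>
       co F j (tg Y (cix F i) (cix F j) (ca F i j a y)) = tg X i j a)"
    (is "?A \<and> ?B \<longleftrightarrow> ?R")
    if ij: "i \<in> Ix X" "j \<in> Ix X" for i j
  proof -
    let ?D = "act_dom X Y (cix F) (cob F) i j"
    note J = cix_in[OF ij(1)] cix_in[OF ij(2)]
    have c: "car F i j z = Some (ca F i j (fst z) (snd z))" if "z \<in> topspace ?D" for z
      using that act_dom_iff[OF ij, of "fst z" "snd z"] car_Some[OF ij, of "fst z" "snd z"] by simp
    have n: "car F i j z = None" if "z \<notin> topspace ?D" for z
      using that car_total[OF ij] by (auto simp: total_maps_iff domIff)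
    have "?A \<longleftrightarrow> (\<forall>z\<in>topspace ?D. Src Y (cix F i) (cix F j) (ca F i j (fst z) (snd z)) = proj2 ?D z)"
      by (rule comp_eq_iff[OF c n]) (auto simp: proj2_def)
    also have "\<dots> \<longleftrightarrow> (\<forall>z\<in>topspace ?D. sr Y (cix F i) (cix F j) (ca F i j (fst z) (snd z)) = snd z)"
    proof (rule ball_cong[OF refl])
      fix z assume z: "z \<in> topspace ?D"
      then have "ca F i j (fst z) (snd z) \<in> ar Y (cix F i) (cix F j)"
        using act_dom_iff[OF ij, of "fst z" "snd z"] ca_in[OF ij] by simp
      then show "Src Y (cix F i) (cix F j) (ca F i j (fst z) (snd z)) = proj2 ?D z \<longleftrightarrow>
          sr Y (cix F i) (cix F j) (ca F i j (fst z) (snd z)) = snd z"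
        using z Y.Src_Some[OF J, of "ca F i j (fst z) (snd z)" "snd z"] by (auto simp: proj2_def)
    qed
    finally have A: "?A \<longleftrightarrow> \<dots>" .
    have "?B \<longleftrightarrow> (\<forall>z\<in>topspace ?D. (cob F j \<circ>\<^sub>m Tgt Y (cix F i) (cix F j)) (ca F i j (fst z) (snd z)) =
        (Tgt X i j \<circ>\<^sub>m proj1 ?D) z)"
      unfolding map_comp_assoc[symmetric] by (rule comp_eq_iff[OF c n]) (auto simp: proj1_def)
    also have "\<dots> \<longleftrightarrow> (\<forall>z\<in>topspace ?D.
        co F j (tg Y (cix F i) (cix F j) (ca F i j (fst z) (snd z))) = tg X i j (fst z))"
    proof (rule ball_cong[OF refl])
      fix z assume z: "z \<in> topspace ?D"
      let ?c = "ca F i j (fst z) (snd z)"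
      have za: "fst z \<in> ar X i j" using z act_dom_iff[OF ij, of "fst z" "snd z"] by simp
      have cA: "?c \<in> ar Y (cix F i) (cix F j)"
        using z act_dom_iff[OF ij, of "fst z" "snd z"] ca_in[OF ij] by simp
      have 1: "Tgt Y (cix F i) (cix F j) ?c = Some (tg Y (cix F i) (cix F j) ?c)"
        using Y.Tgt_Some[OF J] cA by simp
      have 2: "cob F j (tg Y (cix F i) (cix F j) ?c) = Some (co F j (tg Y (cix F i) (cix F j) ?c))"
        using cob_app[OF ij(2)] Y.tg_in[OF J cA] by simp
      have 3: "Tgt X i j (fst z) = Some (tg X i j (fst z))" using X.Tgt_Some[OF ij] za by simp
      show "(cob F j \<circ>\<^sub>m Tgt Y (cix F i) (cix F j)) ?c = (Tgt X i j \<circ>\<^sub>m proj1 ?D) z \<longleftrightarrow>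
          co F j (tg Y (cix F i) (cix F j) ?c) = tg X i j (fst z)"
        using z 1 2 3 by (simp add: proj1_def)
    qed
    finally have B: "?B \<longleftrightarrow> \<dots>" .
    show ?thesis unfolding A B using act_dom_iff[OF ij] by force
  qed
  then show ?thesis unfolding src_ax_def Let_def using car_total by simp
qed

lemma unit_ax_iff:
  "unit_ax \<longleftrightarrow> (\<forall>i\<in>Ix X. car F i i \<circ>\<^sub>m pairp (Eta X i \<circ>\<^sub>m cob F i) (idp (Sp Y (cix F i))) = Eta Y (cix F i))"
proof -
  have "car F i i \<circ>\<^sub>m pairp (Eta X i \<circ>\<^sub>m cob F i) (idp (Sp Y (cix F i))) = Eta Y (cix F i) \<longleftrightarrow>
      (\<forall>y\<in>sp Y (cix F i). ca F i i (et X i (co F i y)) y = et Y (cix F i) y)"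
    if i: "i \<in> Ix X" for i
  proof -
    note J = cix_in[OF i]
    have p: "pairp (Eta X i \<circ>\<^sub>m cob F i) (idp (Sp Y (cix F i))) y = Some (et X i (co F i y), y)"
      if "y \<in> sp Y (cix F i)" for y
    proof -
      have "Eta X i (co F i y) = Some (et X i (co F i y))" using X.Eta_Some[OF i] co_in[OF i that] by simp
      then show ?thesis using that cob_app[OF i, of y] by (simp add: pairp_def idp_def)
    qed
    have "car F i i \<circ>\<^sub>m pairp (Eta X i \<circ>\<^sub>m cob F i) (idp (Sp Y (cix F i))) = Eta Y (cix F i) \<longleftrightarrow>
        (\<forall>y\<in>sp Y (cix F i). car F i i (et X i (co F i y), y) = Eta Y (cix F i) y)"
    proof (rule comp_eq_iff[OF p])
      fix y assume y: "y \<notin> sp Y (cix F i)"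
      then show "pairp (Eta X i \<circ>\<^sub>m cob F i) (idp (Sp Y (cix F i))) y = None"
        by (simp add: pairp_def map_comp_def cob_app[OF i])
      show "Eta Y (cix F i) y = None" using y Y.Eta_Some[OF J, of y] by (cases "Eta Y (cix F i) y") auto
    qed
    also have "\<dots> \<longleftrightarrow> (\<forall>y\<in>sp Y (cix F i). ca F i i (et X i (co F i y)) y = et Y (cix F i) y)"
    proof (rule ball_cong[OF refl])
      fix y assume y: "y \<in> sp Y (cix F i)"
      have "car F i i (et X i (co F i y), y) = Some (ca F i i (et X i (co F i y)) y)"
        using car_Some[OF i i] y X.et_in[OF i co_in[OF i y]] X.sr_et[OF i co_in[OF i y]] by simp
      moreover have "Eta Y (cix F i) y = Some (et Y (cix F i) y)" using Y.Eta_Some[OF J] y by simp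
      ultimately show "car F i i (et X i (co F i y), y) = Eta Y (cix F i) y \<longleftrightarrow>
          ca F i i (et X i (co F i y)) y = et Y (cix F i) y" by simp
    qed
    finally show ?thesis .
  qed
  then show ?thesis unfolding unit_ax_def by simp
qed

lemma src_axD:
  assumes src_ax "i \<in> Ix X" "j \<in> Ix X" "a \<in> ar X i j" "y \<in> sp Y (cix F i)" "sr X i j a = co F i y"
  shows "sr Y (cix F i) (cix F j) (ca F i j a y) = y"
    "co F j (tg Y (cix F i) (cix F j) (ca F i j a y)) = tg X i j a"
    "tg Y (cix F i) (cix F j) (ca F i j a y) \<in> sp Y (cix F j)"
  using assms Y.tg_in[OF cix_in[OF assms(2)] cix_in[OF assms(3)] ca_in[OF assms(2-)]]
  unfolding src_ax_def by blast+

text \<open>The source and target equations come first: they guarantee that the second action, taken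
  at the target of the first, is defined, and that the two results are composable.\<close>

lemma mult_ax_iff:
  assumes S: src_ax
  shows "mult_ax \<longleftrightarrow> (\<forall>i\<in>Ix X. \<forall>j\<in>Ix X. \<forall>k\<in>Ix X.
        let D = act_dom X Y (cix F) (cob F) i j;
            T = fprod (Ar X j k) D (Src X j k) (Tgt X i j \<circ>\<^sub>m proj1 D);
            g = proj1 T; f = proj1 D \<circ>\<^sub>m proj2 T; y = proj2 D \<circ>\<^sub>m proj2 T;
            b = car F i j \<circ>\<^sub>m proj2 T
        in car F i k \<circ>\<^sub>m pairp (Mu X i j k \<circ>\<^sub>m pairp g f) y =
           Mu Y (cix F i) (cix F j) (cix F k) \<circ>\<^sub>m
             pairp (car F j k \<circ>\<^sub>m pairp g (Tgt Y (cix F i) (cix F j) \<circ>\<^sub>m b)) b)"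
proof -
  have "(let D = act_dom X Y (cix F) (cob F) i j;
            T = fprod (Ar X j k) D (Src X j k) (Tgt X i j \<circ>\<^sub>m proj1 D);
            g = proj1 T; f = proj1 D \<circ>\<^sub>m proj2 T; y = proj2 D \<circ>\<^sub>m proj2 T;
            b = car F i j \<circ>\<^sub>m proj2 T
        in car F i k \<circ>\<^sub>m pairp (Mu X i j k \<circ>\<^sub>m pairp g f) y =
           Mu Y (cix F i) (cix F j) (cix F k) \<circ>\<^sub>m
             pairp (car F j k \<circ>\<^sub>m pairp g (Tgt Y (cix F i) (cix F j) \<circ>\<^sub>m b)) b) \<longleftrightarrow>
      (\<forall>a\<in>ar X i j. \<forall>b\<in>ar X j k. \<forall>y\<in>sp Y (cix F i).
       sr X i j a = co F i y \<longrightarrow> sr X j k b = tg X i j a \<longrightarrow>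
       ca F i k (mu X i j k b a) y = mu Y (cix F i) (cix F j) (cix F k)
         (ca F j k b (tg Y (cix F i) (cix F j) (ca F i j a y))) (ca F i j a y))"
    (is "?L \<longleftrightarrow> ?R") if I: "i \<in> Ix X" "j \<in> Ix X" "k \<in> Ix X" for i j k
  proof -
    note J = cix_in[OF I(1)] cix_in[OF I(2)] cix_in[OF I(3)]
    define D where "D = act_dom X Y (cix F) (cob F) i j"
    define T where "T = fprod (Ar X j k) D (Src X j k) (Tgt X i j \<circ>\<^sub>m proj1 D)"
    let ?l = "car F i k \<circ>\<^sub>m pairp (Mu X i j k \<circ>\<^sub>m pairp (proj1 T) (proj1 D \<circ>\<^sub>m proj2 T)) (proj2 D \<circ>\<^sub>m proj2 T)"
    let ?r = "Mu Y (cix F i) (cix F j) (cix F k) \<circ>\<^sub>m pairp (car F j k \<circ>\<^sub>m pairp (proj1 T)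
        (Tgt Y (cix F i) (cix F j) \<circ>\<^sub>m (car F i j \<circ>\<^sub>m proj2 T))) (car F i j \<circ>\<^sub>m proj2 T)"
    have Diff: "(a, y) \<in> topspace D \<longleftrightarrow> a \<in> ar X i j \<and> y \<in> sp Y (cix F i) \<and> sr X i j a = co F i y" for a y
      unfolding D_def by (rule act_dom_iff[OF I(1,2)])
    have Tiff: "(b, a, y) \<in> topspace T \<longleftrightarrow> b \<in> ar X j k \<and> (a, y) \<in> topspace D \<and> sr X j k b = tg X i j a"
      for b a y
    proof -
      have "Src X j k b = (Tgt X i j \<circ>\<^sub>m proj1 D) (a, y) \<longleftrightarrow> sr X j k b = tg X i j a"
        if H: "b \<in> ar X j k" "(a, y) \<in> topspace D"
      proof -
        have "Src X j k b = Some (sr X j k b)" using X.Src_Some[OF I(2,3)] H by simp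
        moreover have "Tgt X i j a = Some (tg X i j a)" using X.Tgt_Some[OF I(1,2)] H Diff by simp
        ultimately show ?thesis using H by (simp add: proj1_def)
      qed
      then show ?thesis unfolding T_def by auto
    qed
    have n: "?l z = None" "?r z = None" if "z \<notin> topspace T" for z :: "'b \<times> 'b \<times> 'c"
      using that by (simp_all add: proj1_def pairp_def map_comp_def)
    have ev: "?l (b, a, y) = ?r (b, a, y) \<longleftrightarrow>
        ca F i k (mu X i j k b a) y = mu Y (cix F i) (cix F j) (cix F k)
         (ca F j k b (tg Y (cix F i) (cix F j) (ca F i j a y))) (ca F i j a y)"
      if z: "(b, a, y) \<in> topspace T" for b a y
    proof -
      have b: "b \<in> ar X j k" "sr X j k b = tg X i j a" and d: "(a, y) \<in> topspace D" using z Tiff by auto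
      then have a: "a \<in> ar X i j" "y \<in> sp Y (cix F i)" "sr X i j a = co F i y" using Diff by auto
      let ?c = "ca F i j a y"
      note s = src_axD[OF S I(1,2) a] and c = ca_in[OF I(1,2) a]
      note m = X.mu_props[OF I b(1) a(1) b(2)]
      have b': "sr X j k b = co F j (tg Y (cix F i) (cix F j) ?c)" using b s by simp
      note s' = src_axD[OF S I(2,3) b(1) s(3) b'] and c' = ca_in[OF I(2,3) b(1) s(3) b']
      have 1: "Mu X i j k (b, a) = Some (mu X i j k b a)" using X.Mu_Some[OF I] a b by simp
      have 2: "car F i k (mu X i j k b a, y) = Some (ca F i k (mu X i j k b a) y)"
        using car_Some[OF I(1,3)] m a by simp
      have 3: "car F i j (a, y) = Some ?c" using car_Some[OF I(1,2)] a by simp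
      have 4: "Tgt Y (cix F i) (cix F j) ?c = Some (tg Y (cix F i) (cix F j) ?c)"
        using Y.Tgt_Some[OF J(1,2)] c by simp
      have 5: "car F j k (b, tg Y (cix F i) (cix F j) ?c) = Some (ca F j k b (tg Y (cix F i) (cix F j) ?c))"
        using car_Some[OF I(2,3)] b(1) s(3) b' by simp
      have 6: "Mu Y (cix F i) (cix F j) (cix F k) (ca F j k b (tg Y (cix F i) (cix F j) ?c), ?c) =
          Some (mu Y (cix F i) (cix F j) (cix F k) (ca F j k b (tg Y (cix F i) (cix F j) ?c)) ?c)"
        using Y.Mu_Some[OF J] c c' s'(1) by simp
      have "?l (b, a, y) = Some (ca F i k (mu X i j k b a) y)"
        using z d 1 2 by (simp add: pairp_def proj1_def proj2_def)
      moreover have "?r (b, a, y) =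
          Some (mu Y (cix F i) (cix F j) (cix F k) (ca F j k b (tg Y (cix F i) (cix F j) ?c)) ?c)"
        using z d 3 4 5 6 by (simp add: pairp_def proj1_def proj2_def)
      ultimately show ?thesis by simp
    qed
    have "?L \<longleftrightarrow> ?l = ?r" unfolding Let_def D_def T_def ..
    also have "\<dots> \<longleftrightarrow> (\<forall>z. ?l z = ?r z)" by (rule fun_eq_iff)
    also have "\<dots> \<longleftrightarrow> (\<forall>b a y. (b, a, y) \<in> topspace T \<longrightarrow> ?l (b, a, y) = ?r (b, a, y))"
    proof (intro iffI allI impI)
      fix z :: "'b \<times> 'b \<times> 'c"
      assume H: "\<forall>b a y. (b, a, y) \<in> topspace T \<longrightarrow> ?l (b, a, y) = ?r (b, a, y)"
      obtain b a y where z: "z = (b, a, y)" by (cases z)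
      show "?l z = ?r z"
      proof (cases "z \<in> topspace T")
        case True then show ?thesis using H unfolding z by blast
      next
        case False then show ?thesis using n[OF False] by (simp only:)
      qed
    qed blast
    also have "\<dots> \<longleftrightarrow> ?R" using ev Tiff Diff by blast
    finally show ?thesis .
  qed
  then show ?thesis unfolding mult_ax_def by simp
qed

lemma cofunctor_iff: "cofunctor X Y F \<longleftrightarrow> src_ax \<and> unit_ax \<and> mult_ax"
proof -
  have "cofunctor X Y F \<longleftrightarrow> src_ax \<and> unit_ax \<and> (\<forall>i\<in>Ix X. \<forall>j\<in>Ix X. \<forall>k\<in>Ix X.
        let D = act_dom X Y (cix F) (cob F) i j;
            T = fprod (Ar X j k) D (Src X j k) (Tgt X i j \<circ>\<^sub>m proj1 D);
            g = proj1 T; f = proj1 D \<circ>\<^sub>m proj2 T; y = proj2 D \<circ>\<^sub>m proj2 T;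
            b = car F i j \<circ>\<^sub>m proj2 T
        in car F i k \<circ>\<^sub>m pairp (Mu X i j k \<circ>\<^sub>m pairp g f) y =
           Mu Y (cix F i) (cix F j) (cix F k) \<circ>\<^sub>m
             pairp (car F j k \<circ>\<^sub>m pairp g (Tgt Y (cix F i) (cix F j) \<circ>\<^sub>m b)) b)"
    unfolding cofunctor_def src_ax_iff unit_ax_iff using cix cob_out car_out cob_total by simp
  then show ?thesis using mult_ax_iff by blast
qed

end

locale cofunctor_data = pre_cofunctor X Y F
  for X :: "('i, 'a, 'b) pcat" and Y :: "('j, 'c, 'd) pcat" and F +
  assumes S: src_ax and Un: unit_ax and M: mult_ax
begin

lemmas ca_src = src_axD[OF S]

lemma ca_unit: "i \<in> Ix X \<Longrightarrow> y \<in> sp Y (cix F i) \<Longrightarrow> ca F i i (et X i (co F i y)) y = et Y (cix F i) y"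
  using Un unfolding unit_ax_def by blast

lemma ca_mult: "i \<in> Ix X \<Longrightarrow> j \<in> Ix X \<Longrightarrow> k \<in> Ix X \<Longrightarrow> a \<in> ar X i j \<Longrightarrow> b \<in> ar X j k \<Longrightarrow>
    y \<in> sp Y (cix F i) \<Longrightarrow> sr X i j a = co F i y \<Longrightarrow> sr X j k b = tg X i j a \<Longrightarrow>
    ca F i k (mu X i j k b a) y = mu Y (cix F i) (cix F j) (cix F k)
      (ca F j k b (tg Y (cix F i) (cix F j) (ca F i j a y))) (ca F i j a y)"
  using M unfolding mult_ax_def by blast

end

lemma cofunctor_dataI:
  assumes "partite_category X" "partite_category Y" "cofunctor X Y F"
  shows "cofunctor_data X Y F"
proof -
  have "pre_cofunctor X Y F"
    using assms(3) unfolding cofunctor_def Let_def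
    by (intro pre_cofunctor.intro pre_cofunctor_axioms.intro assms(1,2)) auto
  then interpret pre_cofunctor X Y F .
  show ?thesis using assms(3) cofunctor_iff by unfold_locales auto
qed

text \<open>The action of \<open>\<Phi> F\<close> on partial sections.\<close>

definition um :: "('i, 'a, 'b, 'j, 'c, 'd) cofun \<Rightarrow> 'i \<Rightarrow> 'i \<Rightarrow> ('a \<rightharpoonup> 'b) \<Rightarrow> ('c \<rightharpoonup> 'd)" where
  "um F i j s = car F i j \<circ>\<^sub>m pairp (s \<circ>\<^sub>m cob F i) (rstp (s \<circ>\<^sub>m cob F i))"

lemma UPhi_map_sel [simp]: "fob (UPhi_map v X F) = cix F"
  "fmap (UPhi_map v X F) = (\<lambda>i j. \<lambda>s\<in>Phi_hom v X i j. um F i j s)"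
  by (simp_all add: UPhi_map_def U_map_def Phi_map_def um_def)

locale cofunctor_icat = X: icat X v + Y: icat Y v + cofunctor_data X Y F
  for X :: "('i, 'a, 'b) pcat" and Y :: "('j, 'c, 'd) pcat" and F v
begin

lemma um_Some:
  assumes s: "s \<in> Phi_hom v X i j"
  shows "um F i j s y = Some c \<longleftrightarrow>
    y \<in> sp Y (cix F i) \<and> (\<exists>a. s (co F i y) = Some a \<and> c = ca F i j a y)"
proof -
  note I = X.Phi_homD(1,2)[OF s]
  have "um F i j s y = Some c \<longleftrightarrow> (\<exists>a. (s \<circ>\<^sub>m cob F i) y = Some a \<and> car F i j (a, y) = Some c)"
    unfolding um_def comp_pairp_rstp_Some ..
  also have "\<dots> \<longleftrightarrow> (\<exists>a. y \<in> sp Y (cix F i) \<and> s (co F i y) = Some a \<and> car F i j (a, y) = Some c)"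
    unfolding map_comp_Some_iff cob_Some[OF I(1)] by blast
  also have "\<dots> \<longleftrightarrow> y \<in> sp Y (cix F i) \<and> (\<exists>a. s (co F i y) = Some a \<and> c = ca F i j a y)"
    unfolding car_Some[OF I] using X.Phi_homD(5,6)[OF s] by blast
  finally show ?thesis .
qed

lemma um_app:
  assumes s: "s \<in> Phi_hom v X i j"
  shows "um F i j s y = (if y \<in> sp Y (cix F i) then map_option (\<lambda>a. ca F i j a y) (s (co F i y)) else None)"
  (is "_ = ?r")
proof -
  have "um F i j s y = Some c \<longleftrightarrow> ?r = Some c" for c unfolding um_Some[OF s] by auto
  then show ?thesis by (cases ?r) (metis option.exhaust, metis)
qed

lemma um_Top_p:
  assumes s: "s \<in> Phi_hom v X i j"
  shows "um F i j s \<in> Top_p (Sp Y (cix F i)) (Ar Y (cix F i) (cix F j))"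
proof -
  note I = X.Phi_homD(1,2)[OF s]
  have c: "s \<circ>\<^sub>m cob F i \<in> Top_p (Sp Y (cix F i)) (Ar X i j)"
    by (rule Top_p_comp[OF total_mapsD(1)[OF cob_total[OF I(1)]] X.Phi_homD(3)[OF s]])
  have "pairp (s \<circ>\<^sub>m cob F i) (rstp (s \<circ>\<^sub>m cob F i)) \<in>
      Top_p (Sp Y (cix F i)) (fprod (Ar X i j) (Sp Y (cix F i)) (Src X i j) (cob F i))"
  proof (rule pairp_Top_p[OF c rstp_Top_p[OF c]])
    fix y a y' assume H: "(s \<circ>\<^sub>m cob F i) y = Some a" "rstp (s \<circ>\<^sub>m cob F i) y = Some y'"
    then obtain x where x: "cob F i y = Some x" "s x = Some a" "y' = y"
      by (auto simp: map_comp_Some_iff rstp_Some)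
    then show "Src X i j a = cob F i y'"
      using X.Src_Some[OF I] X.Phi_homD(5,6)[OF s x(2)] by simp
  qed
  then show ?thesis unfolding um_def
    using Top_p_comp[OF _ total_mapsD(1)[OF car_total[OF I]]] unfolding act_dom_def by blast
qed

lemma um_src:
  assumes s: "s \<in> Phi_hom v X i j" and c: "um F i j s y = Some c"
  shows "sr Y (cix F i) (cix F j) c = y"
proof -
  note I = X.Phi_homD(1,2)[OF s]
  obtain a where a: "y \<in> sp Y (cix F i)" "s (co F i y) = Some a" "c = ca F i j a y"
    using c unfolding um_Some[OF s] by blast
  show ?thesis
    using ca_src[OF I X.Phi_homD(5)[OF s a(2)] a(1) X.Phi_homD(6)[OF s a(2)]] a by auto
qed

lemma um_Tgt_Some:
  assumes s: "s \<in> Phi_hom v X i j"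
  shows "(Tgt Y (cix F i) (cix F j) \<circ>\<^sub>m um F i j s) y = Some z \<longleftrightarrow>
    y \<in> sp Y (cix F i) \<and> (\<exists>a. s (co F i y) = Some a \<and> z = tg Y (cix F i) (cix F j) (ca F i j a y))"
proof -
  note I = X.Phi_homD(1,2)[OF s]
  have "(Tgt Y (cix F i) (cix F j) \<circ>\<^sub>m um F i j s) y = Some z \<longleftrightarrow>
      (\<exists>c. um F i j s y = Some c \<and> z = tg Y (cix F i) (cix F j) c)"
    unfolding map_comp_Some_iff Y.Tgt_Some[OF cix_in[OF I(1)] cix_in[OF I(2)]]
    using Top_pD(6)[OF um_Top_p[OF s]] by blast
  then show ?thesis unfolding um_Some[OF s] by blast
qed

text \<open>If \<open>a\<close> acts at \<open>y\<close> with target \<open>z\<close>, then the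
  inverse of \<open>a\<close> acts at \<open>z\<close>. By multiplicativity the product of the two
  actions is the action of a unit at \<open>y\<close>, so it leads back to \<open>y\<close>. A
  cofunctor therefore carries local bisections to local bisections.\<close>

lemma um_inverse:
  assumes v: "v = Groupoids" and s: "s \<in> Phi_hom v X i j"
    and z: "(Tgt Y (cix F i) (cix F j) \<circ>\<^sub>m um F i j s) y = Some z"
  shows "(Tgt Y (cix F j) (cix F i) \<circ>\<^sub>m um F j i (pinv (UPhi v X) i j s)) z = Some y"
proof -
  interpret G: etale_groupoid X by (rule X.groupoid[OF v])
  interpret IC: inverse_category "UPhi v X" by (rule X.UPhi_inverse_category[OF v])
  let ?t = "pinv (UPhi v X) i j s"
  have t: "?t \<in> Phi_hom v X j i" using IC.pinv_in[of s i j] s by simp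
  note I = X.Phi_homD(1,2)[OF s] and J = cix_in[OF X.Phi_homD(1)[OF s]] cix_in[OF X.Phi_homD(2)[OF s]]
  obtain a where a: "y \<in> sp Y (cix F i)" "s (co F i y) = Some a"
      "z = tg Y (cix F i) (cix F j) (ca F i j a y)"
    using z unfolding um_Tgt_Some[OF s] by blast
  note aA = X.Phi_homD(5,6)[OF s a(2)]
  note c = ca_src[OF I aA(1) a(1) aA(2)]
  have "?t (tg X i j a) = Some (iv X i j a)" using X.pinv_UPhi[OF v s] a(2) by blast
  then have tz: "?t (co F j z) = Some (iv X i j a)" using c(2) a(3) by simp
  note ia = G.iv_props[OF I aA(1)]
  have iz: "sr X j i (iv X i j a) = co F j z" using ia(3) c(2) a(3) by simp
  have "mu Y (cix F i) (cix F j) (cix F i) (ca F j i (iv X i j a) z) (ca F i j a y) =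
      ca F i i (mu X i j i (iv X i j a) a) y"
    using ca_mult[OF I(1,2,1) aA(1) ia(1) a(1) aA(2) ia(3)] a(3) by simp
  also have "\<dots> = et Y (cix F i) y" using ia(4) aA(2) ca_unit[OF I(1) a(1)] by simp
  finally have "tg Y (cix F i) (cix F i) (mu Y (cix F i) (cix F j) (cix F i)
      (ca F j i (iv X i j a) z) (ca F i j a y)) = y"
    using Y.tg_et[OF J(1) a(1)] by simp
  moreover have zs: "z \<in> sp Y (cix F j)" using c(3) a(3) by simp
  moreover have "sr Y (cix F j) (cix F i) (ca F j i (iv X i j a) z) = tg Y (cix F i) (cix F j) (ca F i j a y)"
    using ca_src(1)[OF I(2,1) ia(1) zs iz] a(3) by simp
  ultimately have "tg Y (cix F j) (cix F i) (ca F j i (iv X i j a) z) = y"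
    using Y.mu_props(3)[OF J(1,2,1) ca_in[OF I(2,1) ia(1) zs iz] ca_in[OF I aA(1) a(1) aA(2)]] by simp
  then show ?thesis unfolding um_Tgt_Some[OF t] using tz zs by blast
qed

lemma um_Phi_hom:
  assumes s: "s \<in> Phi_hom v X i j"
  shows "um F i j s \<in> Phi_hom v Y (cix F i) (cix F j)"
  unfolding Y.Phi_hom_iff
proof (intro conjI impI allI)
  note I = X.Phi_homD(1,2)[OF s]
  show J: "cix F i \<in> Ix Y" "cix F j \<in> Ix Y" using cix_in I by auto
  show "um F i j s \<in> Top_p (Sp Y (cix F i)) (Ar Y (cix F i) (cix F j))" by (rule um_Top_p[OF s])
  show "sr Y (cix F i) (cix F j) c = y" if "um F i j s y = Some c" for y c by (rule um_src[OF s that])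
  assume v: "v = Groupoids"
  interpret IC: inverse_category "UPhi v X" by (rule X.UPhi_inverse_category[OF v])
  let ?t = "pinv (UPhi v X) i j s"
  have t: "?t \<in> Phi_hom v X j i" using IC.pinv_in[of s i j] s by simp
  have tt: "pinv (UPhi v X) j i ?t = s" using IC.pinv_pinv[of s i j] s by simp
  \<comment> \<open>Partial inversion is an involution, so \<open>um_inverse\<close> applies to
    \<open>s\<close> and to its inverse and yields both directions.\<close>
  have "(Tgt Y (cix F i) (cix F j) \<circ>\<^sub>m um F i j s) y = Some z \<longleftrightarrow>
      (Tgt Y (cix F j) (cix F i) \<circ>\<^sub>m um F j i ?t) z = Some y" for y z
    using um_inverse[OF v s, of y z] um_inverse[OF v t, of z y] unfolding tt by blast
  moreover have "Tgt Y (cix F i) (cix F j) \<circ>\<^sub>m um F i j s \<in> Top_p (Sp Y (cix F i)) (Sp Y (cix F j))"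
    by (rule Top_p_comp[OF um_Top_p[OF s] total_mapsD(1)[OF Y.tgt[OF J]]])
  moreover have "Tgt Y (cix F j) (cix F i) \<circ>\<^sub>m um F j i ?t \<in> Top_p (Sp Y (cix F j)) (Sp Y (cix F i))"
    by (rule Top_p_comp[OF um_Top_p[OF t] total_mapsD(1)[OF Y.tgt[OF J(2,1)]]])
  ultimately show "Tgt Y (cix F i) (cix F j) \<circ>\<^sub>m um F i j s \<in> partial_isos (Sp Y (cix F i)) (Sp Y (cix F j))"
    unfolding partial_isos_iff by blast
qed

lemma UPhi_map_functor: "is_functor (UPhi v X) (UPhi v Y) (UPhi_map v X F)"
  unfolding is_functor_def UPhi_sel UPhi_map_sel
proof (intro conjI allI ballI)
  show "cix F \<in> Ix X \<rightarrow>\<^sub>E Ix Y" by (rule cix)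
  show "(\<lambda>s\<in>Phi_hom v X i j. um F i j s) \<in> Phi_hom v X i j \<rightarrow>\<^sub>E Phi_hom v Y (cix F i) (cix F j)" for i j
    using um_Phi_hom by (intro restrict_PiE_iff[THEN iffD2] ballI) blast
  show "(\<lambda>s\<in>Phi_hom v X i i. um F i i s) (Eta X i) = Eta Y (cix F i)" if i: "i \<in> Ix X" for i
  proof -
    have "um F i i (Eta X i) = Eta Y (cix F i)"
    proof
      fix y
      show "um F i i (Eta X i) y = Eta Y (cix F i) y"
        unfolding um_app[OF X.Eta_Phi_hom[OF i]] X.Eta_app[OF i] Y.Eta_app[OF cix_in[OF i]]
        using co_in[OF i] ca_unit[OF i] by simp
    qed
    then show ?thesis using X.Eta_Phi_hom[OF i] by simp
  qed
  show "(\<lambda>s\<in>Phi_hom v X i k. um F i k s) (pc X i j k g f) =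
      pc Y (cix F i) (cix F j) (cix F k) ((\<lambda>s\<in>Phi_hom v X j k. um F j k s) g)
       ((\<lambda>s\<in>Phi_hom v X i j. um F i j s) f)"
    if f: "f \<in> Phi_hom v X i j" and g: "g \<in> Phi_hom v X j k" for i j k f g
  proof -
    note I = X.Phi_homD(1,2)[OF f] X.Phi_homD(2)[OF g]
    have "um F i k (pc X i j k g f) = pc Y (cix F i) (cix F j) (cix F k) (um F j k g) (um F i j f)"
    proof
      fix y
      note L = um_app[OF X.Comp_Phi_hom[OF f g], of y] X.pc_app[OF f g]
        and R = Y.pc_app[OF um_Phi_hom[OF f] um_Phi_hom[OF g], of y] um_app[OF f] um_app[OF g]
      show "um F i k (pc X i j k g f) y =
          pc Y (cix F i) (cix F j) (cix F k) (um F j k g) (um F i j f) y"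
      proof (cases "y \<in> sp Y (cix F i)")
        case y: True
        show ?thesis
        proof (cases "f (co F i y)")
          case None
          then show ?thesis using L R by simp
        next
          case a: (Some a)
          note aA = X.Phi_homD(5,6)[OF f a]
          note c = ca_src[OF I(1,2) aA(1) y aA(2)]
          have "ca F i k (mu X i j k b a) y = mu Y (cix F i) (cix F j) (cix F k)
              (ca F j k b (tg Y (cix F i) (cix F j) (ca F i j a y))) (ca F i j a y)"
            if b: "g (tg X i j a) = Some b" for b
            using ca_mult[OF I aA(1) X.Phi_homD(5)[OF g b] y aA(2) X.Phi_homD(6)[OF g b]] .
          then show ?thesis using L R y a c by (cases "g (tg X i j a)") simp_all
        qed
      qed (use L R in simp)
    qed
    then show ?thesis using f g X.Comp_Phi_hom[OF f g] by simp
  qed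
qed

text \<open>The transported section is computed value by value, so unions of sections go to unions;
  restrictions are preserved because unit arrows act as units.\<close>

lemma UPhi_map_join_functor: "join_functor v (UPhi v X) (UPhi v Y) (UPhi_map v X F)"
  unfolding join_functor_iff[OF X.UPhi_join_category Y.UPhi_join_category]
proof (intro conjI allI ballI impI UPhi_map_functor)
  fix i j f assume "f \<in> Hom (UPhi v X) i j"
  then have f: "f \<in> Phi_hom v X i j" by simp
  note I = X.Phi_homD(1,2)[OF f]
  have "um F i i (rs X i j f) = rs Y (cix F i) (cix F j) (um F i j f)"
  proof
    fix y
    show "um F i i (rs X i j f) y = rs Y (cix F i) (cix F j) (um F i j f) y"
      using um_app[OF X.Rst_Phi_hom[OF f], of y] X.rs_app[OF f] Y.rs_app[OF um_Phi_hom[OF f], of y]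
        um_app[OF f, of y] ca_unit[OF I(1), of y] by (auto simp: domIff)
  qed
  then show "fmap (UPhi_map v X F) i i (Rst (UPhi v X) i j f) =
      Rst (UPhi v Y) (fob (UPhi_map v X F) i) (fob (UPhi_map v X F) j) (fmap (UPhi_map v X F) i j f)"
    using f X.Rst_Phi_hom[OF f] by simp
next
  fix i j S f assume "S \<subseteq> Hom (UPhi v X) i j" "is_join (UPhi v X) i j S f"
  then have S: "S \<subseteq> Phi_hom v X i j" and f: "f \<in> Phi_hom v X i j"
    and J: "\<And>x y. f x = Some y \<longleftrightarrow> (\<exists>s\<in>S. s x = Some y)"
    using X.is_join_UPhi[of S i j f] by auto
  have SS: "um F i j ` S \<subseteq> Phi_hom v Y (cix F i) (cix F j)" using S um_Phi_hom by blast
  have "um F i j f y = Some c \<longleftrightarrow> (\<exists>s\<in>um F i j ` S. s y = Some c)" for y c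
  proof -
    have "(\<exists>s\<in>um F i j ` S. s y = Some c) \<longleftrightarrow>
        (\<exists>s\<in>S. y \<in> sp Y (cix F i) \<and> (\<exists>a. s (co F i y) = Some a \<and> c = ca F i j a y))"
      using um_Some S by blast
    then show ?thesis unfolding um_Some[OF f] J by blast
  qed
  then have "is_join (UPhi v Y) (cix F i) (cix F j) (um F i j ` S) (um F i j f)"
    unfolding Y.is_join_UPhi[OF SS] using um_Phi_hom[OF f] by blast
  moreover have "(\<lambda>s\<in>Phi_hom v X i j. um F i j s) ` S = um F i j ` S"
    using S by (intro image_cong) auto
  ultimately show "is_join (UPhi v Y) (fob (UPhi_map v X F) i) (fob (UPhi_map v X F) j)
      (fmap (UPhi_map v X F) i j ` S) (fmap (UPhi_map v X F) i j f)"
    using f by simp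
qed

end

lemma cofunctor_icatI:
  assumes "icat X v" "icat Y v" "cofunctor X Y F"
  shows "cofunctor_icat X Y F v"
proof -
  interpret X: icat X v by fact
  interpret Y: icat Y v by fact
  interpret cofunctor_data X Y F
    by (rule cofunctor_dataI[OF X.partite_category_axioms Y.partite_category_axioms assms(3)])
  show ?thesis by unfold_locales
qed

lemma UPhi_map_id:
  assumes "icat X v"
  shows "UPhi_map v X (id_cofunctor X) = id_functor (UPhi v X)"
proof -
  interpret X: icat X v by fact
  have "um (id_cofunctor X) i j s = s" if s: "s \<in> Phi_hom v X i j" for i j s
  proof (rule map_eqI)
    fix x a
    note I = X.Phi_homD(1,2)[OF s]
    have d: "(a, x) \<in> topspace (act_dom X X (\<lambda>i. i) (\<lambda>i. idp (Sp X i)) i j)" if a: "s x = Some a" for a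
      using X.Phi_homD(4,5,6)[OF s a] X.Src_Some[OF I, of a x] by (simp add: act_dom_def idp_def)
    have "um (id_cofunctor X) i j s x = Some a \<longleftrightarrow>
        (\<exists>b. s x = Some b \<and> proj1 (act_dom X X (\<lambda>i. i) (\<lambda>i. idp (Sp X i)) i j) (b, x) = Some a)"
      unfolding um_def comp_pairp_rstp_Some using I comp_idp[OF X.Phi_homD(3)[OF s]]
      by (simp add: id_cofunctor_def)
    also have "\<dots> \<longleftrightarrow> s x = Some a" using d by (auto simp: proj1_Some)
    finally show "um (id_cofunctor X) i j s x = Some a \<longleftrightarrow> s x = Some a" .
  qed
  then have f: "(\<lambda>i j. \<lambda>s\<in>Phi_hom v X i j. um (id_cofunctor X) i j s) =
      (\<lambda>i j. \<lambda>s\<in>Phi_hom v X i j. s)"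
    by (intro ext) (simp add: restrict_def)
  have "fmap (UPhi_map v X (id_cofunctor X)) = fmap (id_functor (UPhi v X))"
    unfolding UPhi_map_sel f by (simp add: id_functor_def)
  moreover have "fob (UPhi_map v X (id_cofunctor X)) = fob (id_functor (UPhi v X))"
    by (simp add: id_functor_def id_cofunctor_def)
  ultimately show ?thesis by simp
qed

lemma car_comp_Some:
  "car (comp_cofunctor X G F) i j (a, z) = Some c \<longleftrightarrow>
    (\<exists>y b. cob G (cix F i) z = Some y \<and> car F i j (a, y) = Some b \<and>
      car G (cix F i) (cix F j) (b, z) = Some c)"
  by (auto simp: comp_cofunctor_def Let_def map_comp_Some_iff pairp_Some)

lemma um_comp_Some:
  "um (comp_cofunctor X G F) i j s z = Some c \<longleftrightarrow> um G (cix F i) (cix F j) (um F i j s) z = Some c"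
proof -
  have "um (comp_cofunctor X G F) i j s z = Some c \<longleftrightarrow>
      (\<exists>a y x. cob G (cix F i) z = Some y \<and> cob F i y = Some x \<and> s x = Some a \<and>
        car (comp_cofunctor X G F) i j (a, z) = Some c)"
    unfolding um_def comp_pairp_rstp_Some by (auto simp: comp_cofunctor_def map_comp_Some_iff)
  also have "\<dots> \<longleftrightarrow> (\<exists>y x a b. cob G (cix F i) z = Some y \<and> cob F i y = Some x \<and> s x = Some a \<and>
      car F i j (a, y) = Some b \<and> car G (cix F i) (cix F j) (b, z) = Some c)"
    unfolding car_comp_Some by force
  also have "\<dots> \<longleftrightarrow> um G (cix F i) (cix F j) (um F i j s) z = Some c"
    unfolding um_def comp_pairp_rstp_Some[of "car G (cix F i) (cix F j)"]
    unfolding map_comp_Some_iff[of _ "cob G (cix F i)"] comp_pairp_rstp_Some map_comp_Some_iff[of s] by blast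
  finally show ?thesis .
qed

lemma UPhi_map_comp:
  assumes "icat X v" "icat Y v" "cofunctor X Y F"
  shows "UPhi_map v X (comp_cofunctor X G F) = comp_functor (UPhi v X) (UPhi_map v Y G) (UPhi_map v X F)"
proof -
  interpret cofunctor_icat X Y F v by (rule cofunctor_icatI[OF assms])
  have "um (comp_cofunctor X G F) i j s = um G (cix F i) (cix F j) (um F i j s)" for i j s
    by (rule map_eqI) (rule um_comp_Some)
  then have "fmap (UPhi_map v X (comp_cofunctor X G F)) =
      fmap (comp_functor (UPhi v X) (UPhi_map v Y G) (UPhi_map v X F))"
    unfolding UPhi_map_sel comp_functor_def ftor.simps UPhi_sel
    by (intro ext) (auto simp: restrict_def um_Phi_hom)
  moreover have "fob (UPhi_map v X (comp_cofunctor X G F)) =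
      fob (comp_functor (UPhi v X) (UPhi_map v Y G) (UPhi_map v X F))"
    by (simp add: comp_functor_def comp_cofunctor_def)
  ultimately show ?thesis by simp
qed

section \<open>Functoriality of germs and the unit\<close>

lemma PsiW_map_sel:
  "cix (PsiW_map A B H) = fob H"
  "cob (PsiW_map A B H) = (\<lambda>i. if i \<in> Obj A
     then pt_map (RLoc B (fob H i)) (RLoc A i) (fmap H i i) else Map.empty)"
  "i \<in> Obj A \<Longrightarrow> j \<in> Obj A \<Longrightarrow> car (PsiW_map A B H) i j =
    (THE h. h \<in> Top_p (fprod (germ_space (W A) i j) (pt (RLoc B (fob H i))) (germ_base (W A) i j)
          (cob (PsiW_map A B H) i)) (germ_space (W B) (fob H i) (fob H j)) \<and>
     (\<forall>f \<in> Hom A i j. h \<circ>\<^sub>m pairp (sect (W A) i j f \<circ>\<^sub>m cob (PsiW_map A B H) i)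
         (rstp (sect (W A) i j f \<circ>\<^sub>m cob (PsiW_map A B H) i)) =
       sect (W B) (fob H i) (fob H j) (fmap H i j f)))"
  "i \<notin> Obj A \<or> j \<notin> Obj A \<Longrightarrow> car (PsiW_map A B H) i j = Map.empty"
  by (auto simp: PsiW_map_def Psi_map_def W_map_def act_dom_def Psi_def)

section \<open>Action of a join-preserving functor on points and germs\<close>

locale join_functor_cat = A: join_category A v + B: join_category B v
  for A :: "('o, 'm) rcat" and B :: "('p, 'n) rcat" and v +
  fixes H :: "('o, 'm, 'p, 'n) ftor"
  assumes H_functor: "join_functor v A B H"
begin

lemma is_functor: "is_functor A B H"
  and H_rst: "f \<in> Hom A i j \<Longrightarrow> fmap H i i (Rst A i j f) = Rst B (fob H i) (fob H j) (fmap H i j f)"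
  and H_join: "S \<subseteq> Hom A i j \<Longrightarrow> is_join A i j S f \<Longrightarrow>
    is_join B (fob H i) (fob H j) (fmap H i j ` S) (fmap H i j f)"
  using H_functor unfolding join_functor_iff[OF A.join_category_axioms B.join_category_axioms] by auto

lemmas H_obj = is_functorD(1)[OF is_functor] and H_in = is_functorD(2)[OF is_functor]
  and H_idn = is_functorD(3)[OF is_functor] and H_comp = is_functorD(4)[OF is_functor]

lemma H_RIdem: "e \<in> RIdem A i \<Longrightarrow> fmap H i i e \<in> RIdem B (fob H i)"
  using H_in[of e i i] H_rst[of e i i] by (simp add: RIdem_def)

text \<open>The functor induces a frame homomorphism on idempotents, and points are composed with
  it. This is the object part of the cofunctor and runs against \<open>H\<close>.\<close>

definition pull :: "'o \<Rightarrow> ('n \<Rightarrow> bool) \<Rightarrow> 'm \<Rightarrow> bool" where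
  "pull i p = (\<lambda>e. e \<in> RIdem A i \<and> p (fmap H i i e))"

lemma pull_rst: "f \<in> Hom A i j \<Longrightarrow> pull i p (Rst A i j f) \<longleftrightarrow> p (Rst B (fob H i) (fob H j) (fmap H i j f))"
  using A.rst_RIdem H_rst by (simp add: pull_def)

lemma pull_point:
  assumes i: "i \<in> Obj A" and p: "p \<in> pts B (fob H i)"
  shows "pull i p \<in> pts A i"
  unfolding A.points_iff[OF i]
proof (intro conjI allI ballI impI)
  show "pull i p x \<Longrightarrow> x \<in> RIdem A i" for x by (simp add: pull_def)
  show "pull i p (Idn A i)"
    using A.idn_RIdem[OF i] H_idn[OF i] B.point_idn[OF H_obj[OF i] p] by (simp add: pull_def)
  show "pull i p (Comp A i i i x y) \<longleftrightarrow> pull i p x \<and> pull i p y"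
    if x: "x \<in> RIdem A i" and y: "y \<in> RIdem A i" for x y
    using A.RIdem_comp[OF x y] H_comp[OF A.RIdem_in[OF y] A.RIdem_in[OF x]]
      B.point_comp[OF p H_RIdem[OF x] H_RIdem[OF y]] x y by (simp add: pull_def)
  show "pull i p e \<longleftrightarrow> (\<exists>x\<in>S. pull i p x)" if S: "S \<subseteq> RIdem A i" and e: "is_join A i i S e" for S e
  proof -
    have "S \<subseteq> Hom A i i" using S A.RIdem_in by blast
    then have "is_join B (fob H i) (fob H i) (fmap H i i ` S) (fmap H i i e)" by (rule H_join[OF _ e])
    moreover have "fmap H i i ` S \<subseteq> RIdem B (fob H i)" using S H_RIdem by blast
    ultimately have "p (fmap H i i e) \<longleftrightarrow> (\<exists>x\<in>fmap H i i ` S. p x)"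
      using B.point_join[OF p] by blast
    then show ?thesis using A.join_RIdem[OF S e] S unfolding pull_def by auto
  qed
qed

text \<open>A functor preserves an equation \<open>f e = g e\<close>. Hence sending the germ of
  \<open>f\<close> at the pulled back point to the germ of \<open>H f\<close> at \<open>p\<close>
  does not depend on the representative.\<close>

lemma pull_agr:
  assumes f: "f \<in> Hom A i j" and g: "g \<in> Hom A i j" and a: "agr A i j f g (pull i p)"
  shows "agr B (fob H i) (fob H j) (fmap H i j f) (fmap H i j g) p"
proof -
  obtain e where e: "e \<in> RIdem A i" "pull i p e" "Comp A i i j f e = Comp A i i j g e"
    using a by (auto simp: agr_def)
  have "Comp B (fob H i) (fob H i) (fob H j) (fmap H i j f) (fmap H i i e) =
      Comp B (fob H i) (fob H i) (fob H j) (fmap H i j g) (fmap H i i e)"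
    using H_comp[OF A.RIdem_in[OF e(1)] f] H_comp[OF A.RIdem_in[OF e(1)] g] e(3) by simp
  moreover have "p (fmap H i i e)" using e(2) by (simp add: pull_def)
  ultimately show ?thesis using a H_RIdem[OF e(1)] pull_rst[OF f] pull_rst[OF g] unfolding agr_def by blast
qed

text \<open>\<open>H\<close> preserves restrictions of composites, so pulling points back commutes
  with pushing them forward along maps. On germs this is the target equation of a cofunctor.\<close>

lemma push_pull:
  assumes f: "f \<in> Hom A i j"
  shows "push A i j f (pull i p) = pull j (push B (fob H i) (fob H j) (fmap H i j f) p)"
proof
  fix e
  show "push A i j f (pull i p) e = pull j (push B (fob H i) (fob H j) (fmap H i j f) p) e"
  proof (cases "e \<in> RIdem A j")
    case True
    have "Comp A i j j e f \<in> Hom A i j" using f A.RIdem_in[OF True] by simp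
    from pull_rst[OF this, of p] show ?thesis
      using True H_comp[OF f A.RIdem_in[OF True]] H_RIdem[OF True] unfolding push_def pull_def by simp
  qed (simp add: push_def pull_def)
qed

abbreviation F where "F \<equiv> PsiW_map A B H"

lemma cob_F: "i \<in> Obj A \<Longrightarrow> cob F i = (\<lambda>p. if p \<in> pts B (fob H i) then Some (pull i p) else None)"
  using B.point_idn[OF H_obj[of i]]
  by (intro ext) (auto simp: PsiW_map_sel(2) pt_map_def A.RLoc_top H_idn pull_def, auto simp: RLoc_def)

lemma cob_F_total:
  assumes i: "i \<in> Obj A"
  shows "cob F i \<in> total_maps (pt (RLoc B (fob H i))) (pt (RLoc A i))"
  unfolding total_maps_iff Top_p_iff
proof (intro conjI allI impI)
  show "ran (cob F i) \<subseteq> topspace (pt (RLoc A i))"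
    using pull_point[OF i] by (auto simp: cob_F[OF i] A.topspace_pt[OF i] ran_def)
  show "dom (cob F i) = topspace (pt (RLoc B (fob H i)))"
    by (auto simp: cob_F[OF i] B.topspace_pt[OF H_obj[OF i]] dom_def)
  fix V assume "openin (pt (RLoc A i)) V"
  then obtain e where e: "e \<in> RIdem A i" "V = {p \<in> pts A i. p e}" using A.openin_pt[OF i] by blast
  have "pre (cob F i) V = {p \<in> pts B (fob H i). p (fmap H i i e)}"
    using pull_point[OF i] e by (auto simp: cob_F[OF i] pre_def pull_def split: if_splits)
  then show "openin (pt (RLoc B (fob H i))) (pre (cob F i) V)"
    using B.openin_ptI[OF H_RIdem[OF e(1)]] by simp
qed

lemma car_F:
  assumes ij: "i \<in> Obj A" "j \<in> Obj A"
  shows "car F i j \<in> Top_p (fprod (germ_space (W A) i j) (pt (RLoc B (fob H i))) (germ_base (W A) i j)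
          (cob F i)) (germ_space (W B) (fob H i) (fob H j))" (is "_ \<in> ?T")
    and "\<And>f. f \<in> Hom A i j \<Longrightarrow> um F i j (sect (W A) i j f) = sect (W B) (fob H i) (fob H j) (fmap H i j f)"
proof -
  have "\<exists>!h. h \<in> ?T \<and> (\<forall>f\<in>Hom A i j. h \<circ>\<^sub>m pairp (sect (W A) i j f \<circ>\<^sub>m cob F i)
      (rstp (sect (W A) i j f \<circ>\<^sub>m cob F i)) = sect (W B) (fob H i) (fob H j) (fmap H i j f))"
  proof (rule A.fprod_glue[OF cob_F_total[OF ij(1)]])
    fix f assume f: "f \<in> Hom A i j"
    show "sect (W B) (fob H i) (fob H j) (fmap H i j f) \<in>
        Top_p (pt (RLoc B (fob H i))) (germ_space (W B) (fob H i) (fob H j))"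
      by (rule B.sect_Top_p[OF H_in[OF f]])
    show "dom (sect (W B) (fob H i) (fob H j) (fmap H i j f)) \<subseteq> dom (sect (W A) i j f \<circ>\<^sub>m cob F i)"
    proof
      fix p assume "p \<in> dom (sect (W B) (fob H i) (fob H j) (fmap H i j f))"
      then have p: "p \<in> pts B (fob H i)" "pull i p (Rst A i j f)"
        using pull_rst[OF f] by (auto simp: B.dom_sect[OF H_in[OF f]])
      then show "p \<in> dom (sect (W A) i j f \<circ>\<^sub>m cob F i)"
        using pull_point[OF ij(1) p(1)] by (simp add: dom_def cob_F[OF ij(1)] A.sect_W[OF f])
    qed
    fix g q p
    assume g: "g \<in> Hom A i j" "q \<in> pts A i" "cob F i p = Some q" "agr A i j f g q"
    then have p: "p \<in> pts B (fob H i)" "q = pull i p" by (auto simp: cob_F[OF ij(1)] split: if_splits)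
    have a: "agr B (fob H i) (fob H j) (fmap H i j f) (fmap H i j g) p"
      using pull_agr[OF f g(1)] g(4) p(2) by simp
    then show "sect (W B) (fob H i) (fob H j) (fmap H i j f) p = sect (W B) (fob H i) (fob H j) (fmap H i j g) p"
      using B.gm_eq_iff[OF H_in[OF f] H_in[OF g(1)] p(1)] p(1)
      by (auto simp: B.sect_W[OF H_in[OF f]] B.sect_W[OF H_in[OF g(1)]] agr_def)
  qed
  from theI'[OF this] show "car F i j \<in> ?T"
    and "\<And>f. f \<in> Hom A i j \<Longrightarrow> um F i j (sect (W A) i j f) = sect (W B) (fob H i) (fob H j) (fmap H i j f)"
    unfolding um_def PsiW_map_sel(3)[OF ij] by auto
qed

lemma car_F_gm:
  assumes ij: "i \<in> Obj A" "j \<in> Obj A" and f: "f \<in> Hom A i j" and p: "p \<in> pts B (fob H i)"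
    and d: "pull i p (Rst A i j f)"
  shows "car F i j (gm A i j f (pull i p), p) = Some (gm B (fob H i) (fob H j) (fmap H i j f) p)"
proof -
  have "cob F i p = Some (pull i p)" using p by (simp add: cob_F[OF ij(1)])
  then have "car F i j (gm A i j f (pull i p), p) = sect (W B) (fob H i) (fob H j) (fmap H i j f) p"
    using A.fprod_eval[OF car_F(2)[OF ij f, unfolded um_def] f pull_point[OF ij(1) p] d] by simp
  then show ?thesis using p d pull_rst[OF f] by (simp add: B.sect_W[OF H_in[OF f]])
qed

lemma act_dom_FE:
  assumes ij: "i \<in> Obj A" "j \<in> Obj A"
    and z: "(a, p) \<in> topspace (act_dom (PsiW A) (PsiW B) (cix F) (cob F) i j)"
  obtains f where "f \<in> Hom A i j" "p \<in> pts B (fob H i)" "pull i p (Rst A i j f)" "a = gm A i j f (pull i p)"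
proof -
  have "(a, p) \<in> topspace (fprod (germ_space (W A) i j) (pt (RLoc B (fob H i))) (germ_base (W A) i j)
          (cob F i))" using z by (simp add: act_dom_def PsiW_map_sel(1))
  then obtain f q where f: "f \<in> Hom A i j" "q \<in> pts A i" "q (Rst A i j f)" "a = gm A i j f q"
      "p \<in> topspace (pt (RLoc B (fob H i)))" "cob F i p = Some q"
    by (rule A.fprod_germE)
  then have "q = pull i p" "p \<in> pts B (fob H i)" by (auto simp: cob_F[OF ij(1)] split: if_splits)
  then show thesis using that[of f] f by simp
qed

lemma car_F_Some:
  assumes ij: "i \<in> Obj A" "j \<in> Obj A"
  shows "car F i j (a, p) = Some c \<longleftrightarrow> (\<exists>f. f \<in> Hom A i j \<and> p \<in> pts B (fob H i) \<and>
    pull i p (Rst A i j f) \<and> a = gm A i j f (pull i p) \<and> c = gm B (fob H i) (fob H j) (fmap H i j f) p)"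
proof
  assume c: "car F i j (a, p) = Some c"
  then have "(a, p) \<in> topspace (act_dom (PsiW A) (PsiW B) (cix F) (cob F) i j)"
    using Top_pD(5)[OF car_F(1)[OF ij] c] by (simp add: act_dom_def PsiW_map_sel(1))
  then obtain f where f: "f \<in> Hom A i j" "p \<in> pts B (fob H i)" "pull i p (Rst A i j f)" "a = gm A i j f (pull i p)"
    by (rule act_dom_FE[OF ij])
  then show "\<exists>f. f \<in> Hom A i j \<and> p \<in> pts B (fob H i) \<and>
    pull i p (Rst A i j f) \<and> a = gm A i j f (pull i p) \<and> c = gm B (fob H i) (fob H j) (fmap H i j f) p"
    using car_F_gm[OF ij f(1-3)] c by auto
next
  assume "\<exists>f. f \<in> Hom A i j \<and> p \<in> pts B (fob H i) \<and>
    pull i p (Rst A i j f) \<and> a = gm A i j f (pull i p) \<and> c = gm B (fob H i) (fob H j) (fmap H i j f) p"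
  then show "car F i j (a, p) = Some c" using car_F_gm[OF ij] by blast
qed

text \<open>Once arrows are written as germs, the source and target equations rest on
  \<open>push_pull\<close>, and the unit and multiplication equations are preservation of identities
  and composites by \<open>H\<close>.\<close>

lemma PsiW_map_cofunctor: "cofunctor (PsiW A) (PsiW B) F"
proof -
  interpret SA: source_etale_category "PsiW A" by (rule A.PsiW_source_etale)
  interpret SB: source_etale_category "PsiW B" by (rule B.PsiW_source_etale)
  have P: "pre_cofunctor (PsiW A) (PsiW B) F"
  proof unfold_locales
    show "cix F \<in> Ix (PsiW A) \<rightarrow>\<^sub>E Ix (PsiW B)"
      using is_functor by (simp add: PsiW_map_sel(1) is_functor_def)
    show "\<And>i. i \<notin> Ix (PsiW A) \<Longrightarrow> cob F i = Map.empty" by (simp add: PsiW_map_sel(2))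
    show "\<And>i j. i \<notin> Ix (PsiW A) \<or> j \<notin> Ix (PsiW A) \<Longrightarrow> car F i j = Map.empty"
      by (simp add: PsiW_map_sel(4))
    show "\<And>i. i \<in> Ix (PsiW A) \<Longrightarrow> cob F i \<in> total_maps (Sp (PsiW B) (cix F i)) (Sp (PsiW A) i)"
      using cob_F_total by (simp add: PsiW_map_sel(1))
    fix i j assume "i \<in> Ix (PsiW A)" "j \<in> Ix (PsiW A)"
    then have ij: "i \<in> Obj A" "j \<in> Obj A" by auto
    show "car F i j \<in> total_maps (act_dom (PsiW A) (PsiW B) (cix F) (cob F) i j)
        (Ar (PsiW B) (cix F i) (cix F j))"
      unfolding total_maps_iff
    proof
      show t: "car F i j \<in> Top_p (act_dom (PsiW A) (PsiW B) (cix F) (cob F) i j)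
          (Ar (PsiW B) (cix F i) (cix F j))"
        using car_F(1)[OF ij] by (simp add: act_dom_def PsiW_map_sel(1))
      have "z \<in> dom (car F i j)" if z: "z \<in> topspace (act_dom (PsiW A) (PsiW B) (cix F) (cob F) i j)" for z
      proof -
        obtain a p where ap: "z = (a, p)" by (cases z)
        obtain f where f: "f \<in> Hom A i j" "p \<in> pts B (fob H i)" "pull i p (Rst A i j f)" "a = gm A i j f (pull i p)"
          using z unfolding ap by (rule act_dom_FE[OF ij])
        show ?thesis using car_F_gm[OF ij f(1-3)] ap f(4) by auto
      qed
      then show "dom (car F i j) = topspace (act_dom (PsiW A) (PsiW B) (cix F) (cob F) i j)"
        using Top_pD(2)[OF t] by blast
    qed
  qed
  interpret P: pre_cofunctor "PsiW A" "PsiW B" F by (rule P)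
  have co: "co F i p = pull i p" if "i \<in> Obj A" "p \<in> pts B (fob H i)" for i p
    using that by (simp add: co_def cob_F)
  have ca: "ca F i j (gm A i j f (pull i p)) p = gm B (fob H i) (fob H j) (fmap H i j f) p"
    if "f \<in> Hom A i j" "p \<in> pts B (fob H i)" "pull i p (Rst A i j f)" for f i j p
    using car_F_gm[OF A.hom_dom[OF that(1)] A.hom_cod[OF that(1)] that] by (simp add: ca_def)
  have sp: "p \<in> sp (PsiW B) (cix F i) \<longleftrightarrow> p \<in> pts B (fob H i)" if "i \<in> Obj A" for i p
    using B.topspace_pt[OF H_obj[OF that]] by (simp add: PsiW_map_sel(1))
  have E: "\<exists>f. f \<in> Hom A i j \<and> pull i p (Rst A i j f) \<and> a = gm A i j f (pull i p)"
    if i: "i \<in> Obj A" and a: "a \<in> ar (PsiW A) i j" and p: "p \<in> pts B (fob H i)"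
      and s: "sr (PsiW A) i j a = co F i p" for a i j p
  proof -
    have "a \<in> topspace (germ_space (W A) i j)" using a by simp
    then obtain f q where f: "f \<in> Hom A i j" "q \<in> pts A i" "q (Rst A i j f)" "a = gm A i j f q"
      by (rule A.germE)
    then have "q = pull i p" using A.sr_gm[OF f(1-3)] s co[OF i p] by simp
    then show ?thesis using f by blast
  qed
  have src: P.src_ax
    unfolding P.src_ax_def
  proof (intro ballI impI)
    fix i j a p assume H: "i \<in> Ix (PsiW A)" "j \<in> Ix (PsiW A)" "a \<in> ar (PsiW A) i j"
      "p \<in> sp (PsiW B) (cix F i)" "sr (PsiW A) i j a = co F i p"
    then have ij: "i \<in> Obj A" "j \<in> Obj A" by auto
    have p: "p \<in> pts B (fob H i)" using H(4) sp[OF ij(1)] by blast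
    obtain f where f: "f \<in> Hom A i j" "pull i p (Rst A i j f)" "a = gm A i j f (pull i p)"
      using E[OF ij(1) H(3) p H(5)] by blast
    note Hf = H_in[OF f(1)]
    have d: "p (Rst B (fob H i) (fob H j) (fmap H i j f))" using pull_rst[OF f(1)] f(2) by blast
    show "sr (PsiW B) (cix F i) (cix F j) (ca F i j a p) = p \<and>
        co F j (tg (PsiW B) (cix F i) (cix F j) (ca F i j a p)) = tg (PsiW A) i j a"
      unfolding f(3) ca[OF f(1) p f(2)] PsiW_map_sel(1)
      using B.sr_gm[OF Hf p d] B.tg_gm[OF Hf p d] co[OF ij(2) B.push_point[OF Hf p d]]
        A.tg_gm[OF f(1) pull_point[OF ij(1) p] f(2)] push_pull[OF f(1)] by simp
  qed
  moreover have P.unit_ax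
    unfolding P.unit_ax_def
  proof (intro ballI)
    fix i p assume H: "i \<in> Ix (PsiW A)" "p \<in> sp (PsiW B) (cix F i)"
    then have i: "i \<in> Obj A" by auto
    have p: "p \<in> pts B (fob H i)" using H(2) sp[OF i] by blast
    note q = pull_point[OF i p]
    show "ca F i i (et (PsiW A) i (co F i p)) p = et (PsiW B) (cix F i) p"
      unfolding co[OF i p] A.et_PsiW[OF i q] PsiW_map_sel(1) B.et_PsiW[OF H_obj[OF i] p]
        ca[OF A.idn_hom[OF i] p A.Idn_rst[OF i q]] H_idn[OF i] ..
  qed
  moreover have P.mult_ax
    unfolding P.mult_ax_def
  proof (intro ballI impI)
    fix i j k a b p assume H: "i \<in> Ix (PsiW A)" "j \<in> Ix (PsiW A)" "k \<in> Ix (PsiW A)"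
      "a \<in> ar (PsiW A) i j" "b \<in> ar (PsiW A) j k" "p \<in> sp (PsiW B) (cix F i)"
      "sr (PsiW A) i j a = co F i p" "sr (PsiW A) j k b = tg (PsiW A) i j a"
    then have I: "i \<in> Obj A" "j \<in> Obj A" "k \<in> Obj A" by auto
    have p: "p \<in> pts B (fob H i)" using H(6) sp[OF I(1)] by blast
    note q = pull_point[OF I(1) p]
    obtain f where f: "f \<in> Hom A i j" "pull i p (Rst A i j f)" "a = gm A i j f (pull i p)"
      using E[OF I(1) H(4) p H(7)] by blast
    note Hf = H_in[OF f(1)]
    have d: "p (Rst B (fob H i) (fob H j) (fmap H i j f))" using pull_rst[OF f(1)] f(2) by blast
    \<comment> \<open>The second germ sits at the image of the pulled back point, which by
      \<open>push_pull\<close> is the pullback of \<open>p'\<close>; so \<open>H\<close> can be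
      applied to it at \<open>p'\<close>.\<close>
    define p' where "p' = push B (fob H i) (fob H j) (fmap H i j f) p"
    have p': "p' \<in> pts B (fob H j)" unfolding p'_def by (rule B.push_point[OF Hf p d])
    have t: "tg (PsiW A) i j a = pull j p'"
      unfolding f(3) A.tg_gm[OF f(1) q f(2)] push_pull[OF f(1)] p'_def ..
    then have "sr (PsiW A) j k b = co F j p'" using H(8) co[OF I(2) p'] by simp
    then obtain g where g: "g \<in> Hom A j k" "pull j p' (Rst A j k g)" "b = gm A j k g (pull j p')"
      using E[OF I(2) H(5) p'] by blast
    note Hg = H_in[OF g(1)]
    have d': "p' (Rst B (fob H j) (fob H k) (fmap H j k g))" using pull_rst[OF g(1)] g(2) by blast
    have pq: "push A i j f (pull i p) = pull j p'" unfolding push_pull[OF f(1)] p'_def ..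
    have gq: "push A i j f (pull i p) (Rst A j k g)" unfolding pq by (rule g(2))
    have gf: "pull i p (Rst A i k (Comp A i j k g f))" using A.push_rst[OF f(1) g(1)] gq by simp
    have m: "mu (PsiW A) i j k b a = gm A i k (Comp A i j k g f) (pull i p)"
      using A.mu_gm[OF f(1) q f(2) g(1) gq] unfolding pq f(3) g(3) .
    have cf: "ca F i j a p = gm B (fob H i) (fob H j) (fmap H i j f) p" unfolding f(3) by (rule ca[OF f(1) p f(2)])
    have tp: "tg (PsiW B) (fob H i) (fob H j) (ca F i j a p) = p'"
      unfolding cf p'_def by (rule B.tg_gm[OF Hf p d])
    have cg: "ca F j k b p' = gm B (fob H j) (fob H k) (fmap H j k g) p'"
      unfolding g(3) by (rule ca[OF g(1) p' g(2)])
    show "ca F i k (mu (PsiW A) i j k b a) p = mu (PsiW B) (cix F i) (cix F j) (cix F k)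
        (ca F j k b (tg (PsiW B) (cix F i) (cix F j) (ca F i j a p))) (ca F i j a p)"
      unfolding PsiW_map_sel(1) tp cg unfolding cf m
      unfolding ca[OF A.comp_in[OF f(1) g(1)] p gf] H_comp[OF f(1) g(1)]
      using B.mu_gm[OF Hf p d Hg] d' unfolding p'_def by simp
  qed
  ultimately show ?thesis using P.cofunctor_iff by blast
qed

end

lemma join_functor_catI:
  "join_category A v \<Longrightarrow> join_category B v \<Longrightarrow> join_functor v A B H \<Longrightarrow> join_functor_cat A B v H"
  by (simp add: join_functor_cat_def join_functor_cat_axioms_def)

section \<open>Identities and composites of functors and of their cofunctors\<close>

lemma id_functor_join:
  assumes "join_category A v"
  shows "join_functor v A A (id_functor A)"
proof -
  interpret join_category A v by fact
  have im: "(\<lambda>f. if f \<in> Hom A i j then f else undefined) ` S = S" if "S \<subseteq> Hom A i j" for S i j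
    using that by (force simp: image_iff)
  have "i \<in> Obj A" "j \<in> Obj A" if "is_join A i j S f" for i j S f
    using is_join_in[OF that] hom_obj by blast+
  then show ?thesis
    unfolding join_functor_iff[OF assms assms] is_functor_def id_functor_def ftor.simps
    using hom_dom hom_cod by (auto simp: im idn_hom is_join_in simp del: if_image_distrib)
qed

lemma comp_functor_join:
  assumes "join_category A v" "join_category B v" "join_category C v"
    and H: "join_functor v A B H" and K: "join_functor v B C K"
  shows "join_functor v A C (comp_functor A K H)"
proof -
  interpret H: join_functor_cat A B v H by (rule join_functor_catI) fact+
  interpret K: join_functor_cat B C v K by (rule join_functor_catI) fact+
  have o: "fob (comp_functor A K H) i = fob K (fob H i)" if "i \<in> Obj A" for i
    using that by (simp add: comp_functor_def)
  have m: "fmap (comp_functor A K H) i j f = fmap K (fob H i) (fob H j) (fmap H i j f)"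
    if "f \<in> Hom A i j" for i j f using that by (simp add: comp_functor_def)
  show ?thesis
    unfolding join_functor_iff[OF assms(1,3)] is_functor_def
  proof (intro conjI allI ballI impI)
    show "fob (comp_functor A K H) \<in> Obj A \<rightarrow>\<^sub>E Obj C"
      using H.H_obj K.H_obj by (simp add: comp_functor_def)
    show "fmap (comp_functor A K H) i j \<in> Hom A i j \<rightarrow>\<^sub>E
        Hom C (fob (comp_functor A K H) i) (fob (comp_functor A K H) j)" for i j
      using K.H_in[OF H.H_in] H.A.hom_dom H.A.hom_cod
      by (auto simp: comp_functor_def restrict_PiE_iff)
    show "fmap (comp_functor A K H) i i (Idn A i) = Idn C (fob (comp_functor A K H) i)" if "i \<in> Obj A" for i
      using that H.H_idn K.H_idn H.H_obj by (simp add: o m H.A.idn_hom)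
    fix i j f assume f: "f \<in> Hom A i j"
    note ij = H.A.hom_dom[OF f] H.A.hom_cod[OF f]
    show "fmap (comp_functor A K H) i k (Comp A i j k g f) =
        Comp C (fob (comp_functor A K H) i) (fob (comp_functor A K H) j) (fob (comp_functor A K H) k)
         (fmap (comp_functor A K H) j k g) (fmap (comp_functor A K H) i j f)" if g: "g \<in> Hom A j k" for k g
      using H.H_comp[OF f g] K.H_comp[OF H.H_in[OF f] H.H_in[OF g]] ij H.A.hom_cod[OF g]
      by (simp add: o m f g)
    show "fmap (comp_functor A K H) i i (Rst A i j f) =
        Rst C (fob (comp_functor A K H) i) (fob (comp_functor A K H) j) (fmap (comp_functor A K H) i j f)"
      using H.H_rst[OF f] K.H_rst[OF H.H_in[OF f]] ij by (simp add: o m f)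
  next
    fix i j S f assume S: "S \<subseteq> Hom A i j" and j: "is_join A i j S f"
    note f = H.A.is_join_in[OF j]
    have "fmap H i j ` S \<subseteq> Hom B (fob H i) (fob H j)" using S H.H_in by blast
    from K.H_join[OF this H.H_join[OF S j]]
    have "is_join C (fob K (fob H i)) (fob K (fob H j)) ((\<lambda>s. fmap K (fob H i) (fob H j) (fmap H i j s)) ` S)
        (fmap K (fob H i) (fob H j) (fmap H i j f))" by (simp add: image_image)
    moreover have "fmap (comp_functor A K H) i j ` S = (\<lambda>s. fmap K (fob H i) (fob H j) (fmap H i j s)) ` S"
      using S m by (intro image_cong) auto
    ultimately show "is_join C (fob (comp_functor A K H) i) (fob (comp_functor A K H) j)
        (fmap (comp_functor A K H) i j ` S) (fmap (comp_functor A K H) i j f)"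
      using H.A.hom_dom[OF f] H.A.hom_cod[OF f] by (simp add: o m f)
  qed
qed

lemma map_pair_eqI: "(\<And>a y c. f (a, y) = Some c \<longleftrightarrow> g (a, y) = Some c) \<Longrightarrow> f = g"
  by (rule map_eqI) auto

lemma PsiW_map_id:
  assumes "join_category A v"
  shows "PsiW_map A A (id_functor A) = id_cofunctor (PsiW A)"
proof -
  interpret I: join_functor_cat A A v "id_functor A"
    by (rule join_functor_catI[OF assms assms id_functor_join[OF assms]])
  have o: "fob (id_functor A) i = i" if "i \<in> Obj A" for i using that by (simp add: id_functor_def)
  have m: "fmap (id_functor A) i j f = f" if "f \<in> Hom A i j" for f i j using that by (simp add: id_functor_def)
  have pl: "I.pull i p = p" if "p \<in> pts A i" for i p
    using I.A.point_RIdem[OF that] m[OF I.A.RIdem_in] by (auto simp: I.pull_def fun_eq_iff)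
  have cb: "cob I.F i = idp (pt (RLoc A i))" if i: "i \<in> Obj A" for i
    using pl by (intro ext) (simp add: I.cob_F[OF i] o[OF i] idp_def I.A.topspace_pt[OF i])
  have "cob I.F = cob (id_cofunctor (PsiW A))"
  proof
    fix i show "cob I.F i = cob (id_cofunctor (PsiW A)) i"
      using cb[of i] by (cases "i \<in> Obj A") (simp_all add: id_cofunctor_def PsiW_map_sel(2))
  qed
  moreover have "car I.F i j = car (id_cofunctor (PsiW A)) i j" for i j
  proof (cases "i \<in> Obj A \<and> j \<in> Obj A")
    case True
    then have ij: "i \<in> Obj A" "j \<in> Obj A" by auto
    have ci: "car (id_cofunctor (PsiW A)) i j =
        proj1 (fprod (germ_space (W A) i j) (pt (RLoc A i)) (germ_base (W A) i j) (idp (pt (RLoc A i))))"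
      using ij by (simp add: id_cofunctor_def act_dom_def)
    show ?thesis
    proof (rule map_pair_eqI)
      fix a p c
      show "car I.F i j (a, p) = Some c \<longleftrightarrow> car (id_cofunctor (PsiW A)) i j (a, p) = Some c"
      proof
        assume "car I.F i j (a, p) = Some c"
        then obtain f where f: "f \<in> Hom A i j" "p \<in> pts A i" "p (Rst A i j f)" "a = gm A i j f p" "c = gm A i j f p"
          unfolding I.car_F_Some[OF ij] using pl o[OF ij(1)] o[OF ij(2)] m by auto
        then show "car (id_cofunctor (PsiW A)) i j (a, p) = Some c"
          unfolding ci proj1_Some
          using I.A.gm_in[OF f(1-3)] I.A.germ_base_gm[OF f(1-3)] f
          by (simp add: idp_def I.A.topspace_pt[OF ij(1)])
      next
        assume "car (id_cofunctor (PsiW A)) i j (a, p) = Some c"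
        then have ac: "c = a" and d: "(a, p) \<in> topspace (fprod (germ_space (W A) i j) (pt (RLoc A i))
            (germ_base (W A) i j) (idp (pt (RLoc A i))))"
          unfolding ci proj1_Some by simp_all
        obtain f q where f: "f \<in> Hom A i j" "q \<in> pts A i" "q (Rst A i j f)" "a = gm A i j f q"
            "idp (pt (RLoc A i)) p = Some q"
          using d by (rule I.A.fprod_germE)
        then have "q = p" by (simp add: idp_Some)
        then show "car I.F i j (a, p) = Some c"
          unfolding I.car_F_Some[OF ij] using f pl o[OF ij(1)] o[OF ij(2)] m ac by auto
      qed
    qed
  next
    case False
    then show ?thesis by (auto simp: PsiW_map_sel(4) id_cofunctor_def)
  qed
  then have "car I.F = car (id_cofunctor (PsiW A))" by blast
  moreover have "cix I.F = cix (id_cofunctor (PsiW A))"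
    by (simp add: PsiW_map_sel(1) id_functor_def id_cofunctor_def)
  ultimately show ?thesis by simp
qed

lemma PsiW_map_comp:
  assumes A: "join_category A v" and B: "join_category B v" and C: "join_category C v"
    and H: "join_functor v A B H" and K: "join_functor v B C K"
  shows "PsiW_map A C (comp_functor A K H) = comp_cofunctor (PsiW A) (PsiW_map B C K) (PsiW_map A B H)"
proof -
  interpret H: join_functor_cat A B v H by (rule join_functor_catI) fact+
  interpret K: join_functor_cat B C v K by (rule join_functor_catI) fact+
  let ?KH = "comp_functor A K H"
  interpret KH: join_functor_cat A C v ?KH
    by (rule join_functor_catI[OF A C comp_functor_join[OF A B C H K]])
  have o: "fob ?KH i = fob K (fob H i)" if "i \<in> Obj A" for i
    using that by (simp add: comp_functor_def)
  have m: "fmap ?KH i j f = fmap K (fob H i) (fob H j) (fmap H i j f)"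
    if "f \<in> Hom A i j" for i j f using that by (simp add: comp_functor_def)
  \<comment> \<open>Pulling back along a composite is pulling back twice; with this, both sides take
    the germ of \<open>f\<close> to the germ of its image under the composite functor.\<close>
  have pl: "KH.pull i p = H.pull i (K.pull (fob H i) p)" for i p
    using m[OF H.A.RIdem_in] H.H_RIdem by (auto simp: KH.pull_def H.pull_def K.pull_def fun_eq_iff)
  have cb: "cob KH.F i = cob (comp_cofunctor (PsiW A) K.F H.F) i" for i
  proof (cases "i \<in> Obj A")
    case True
    show ?thesis
      using True K.pull_point[OF H.H_obj[OF True]]
      by (intro ext) (simp add: comp_cofunctor_def KH.cob_F H.cob_F K.cob_F[OF H.H_obj[OF True]] o pl
          PsiW_map_sel(1) map_comp_def)
  next
    case False
    then show ?thesis by (simp add: comp_cofunctor_def PsiW_map_sel(2))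
  qed
  have "car KH.F i j = car (comp_cofunctor (PsiW A) K.F H.F) i j" for i j
  proof (cases "i \<in> Obj A \<and> j \<in> Obj A")
    case True
    then have ij: "i \<in> Obj A" "j \<in> Obj A" by auto
    note HJ = H.H_obj[OF ij(1)] H.H_obj[OF ij(2)]
    show ?thesis
    proof (rule map_pair_eqI)
      fix a r c
      let ?q = "K.pull (fob H i) r"
      show "car KH.F i j (a, r) = Some c \<longleftrightarrow> car (comp_cofunctor (PsiW A) K.F H.F) i j (a, r) = Some c"
      proof
        assume "car KH.F i j (a, r) = Some c"
        then obtain f where f: "f \<in> Hom A i j" "r \<in> pts C (fob K (fob H i))" "H.pull i ?q (Rst A i j f)"
            "a = gm A i j f (H.pull i ?q)"
            "c = gm C (fob K (fob H i)) (fob K (fob H j)) (fmap K (fob H i) (fob H j) (fmap H i j f)) r"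
          unfolding KH.car_F_Some[OF ij] using o[OF ij(1)] o[OF ij(2)] m pl by auto
        note q = K.pull_point[OF HJ(1) f(2)]
        have "cob K.F (fob H i) r = Some ?q" using f(2) by (simp add: K.cob_F[OF HJ(1)])
        moreover have "car H.F i j (a, ?q) = Some (gm B (fob H i) (fob H j) (fmap H i j f) ?q)"
          unfolding f(4) by (rule H.car_F_gm[OF ij f(1) q f(3)])
        moreover have "car K.F (fob H i) (fob H j) (gm B (fob H i) (fob H j) (fmap H i j f) ?q, r) = Some c"
          unfolding f(5) by (rule K.car_F_gm[OF HJ H.H_in[OF f(1)] f(2)]) (use H.pull_rst[OF f(1)] f(3) in blast)
        ultimately show "car (comp_cofunctor (PsiW A) K.F H.F) i j (a, r) = Some c"
          unfolding car_comp_Some PsiW_map_sel(1) by blast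
      next
        assume "car (comp_cofunctor (PsiW A) K.F H.F) i j (a, r) = Some c"
        then obtain q b where qb: "cob K.F (fob H i) r = Some q" "car H.F i j (a, q) = Some b"
            "car K.F (fob H i) (fob H j) (b, r) = Some c"
          unfolding car_comp_Some PsiW_map_sel(1) by blast
        have r: "r \<in> pts C (fob K (fob H i))" and q: "q = ?q"
          using qb(1) by (auto simp: K.cob_F[OF HJ(1)] split: if_splits)
        obtain f where f: "f \<in> Hom A i j" "H.pull i ?q (Rst A i j f)" "a = gm A i j f (H.pull i ?q)"
            "b = gm B (fob H i) (fob H j) (fmap H i j f) ?q"
          using qb(2) unfolding H.car_F_Some[OF ij] q by blast
        have "?q (Rst B (fob H i) (fob H j) (fmap H i j f))" using H.pull_rst[OF f(1)] f(2) by blast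
        then have "car K.F (fob H i) (fob H j) (b, r) =
            Some (gm C (fob K (fob H i)) (fob K (fob H j)) (fmap K (fob H i) (fob H j) (fmap H i j f)) r)"
          unfolding f(4) by (rule K.car_F_gm[OF HJ H.H_in[OF f(1)] r])
        then show "car KH.F i j (a, r) = Some c"
          unfolding KH.car_F_Some[OF ij] using qb(3) f r o[OF ij(1)] o[OF ij(2)] m[OF f(1)] pl by auto
      qed
    qed
  next
    case False
    then have "car KH.F i j = Map.empty" "car H.F i j = Map.empty" by (auto simp: PsiW_map_sel(4))
    then show ?thesis
      by (intro map_eqI) (auto simp: car_comp_Some)
  qed
  then have "car KH.F = car (comp_cofunctor (PsiW A) K.F H.F)" by blast
  moreover have "cob KH.F = cob (comp_cofunctor (PsiW A) K.F H.F)" using cb by blast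
  moreover have "cix KH.F = cix (comp_cofunctor (PsiW A) K.F H.F)"
    by (simp add: comp_cofunctor_def PsiW_map_sel(1) comp_functor_def)
  ultimately show ?thesis by simp
qed

section \<open>The unit\<close>

context join_category
begin

text \<open>The target map along the section of \<open>f\<close> is the action of \<open>f\<close>
  on points. In the groupoid variant its partial inverse is the action of the inverse of
  \<open>f\<close>.\<close>

lemma sect_Phi_hom:
  assumes f: "f \<in> Hom C i j"
  shows "sect (W C) i j f \<in> Phi_hom v (PsiW C) i j"
proof -
  interpret X: icat "PsiW C" v by (rule PsiW_icat)
  have "germ_target (W C) i j \<circ>\<^sub>m sect (W C) i j f \<in> partial_isos (pt (RLoc C i)) (pt (RLoc C j))"
    if v: "v = Groupoids"
  proof -
    interpret I: inverse_category C by (rule inverses[OF v])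
    let ?g = "pinv C i j f"
    have g: "?g \<in> Hom C j i" "pinv C j i ?g = f" using f I.pinv_pinv by auto
    have t: "germ_target (W C) i j \<circ>\<^sub>m sect (W C) i j f = tmap (snd (W C)) i j f"
      using germ_target_spec[of i j] f by blast
    have 1: "tmap (snd (W C)) j i (pinv C i j f) q = Some p"
      if "tmap (snd (W C)) i j f p = Some q" "f \<in> Hom C i j" for i j f p q
      using that push_point[OF that(2)] push_rst_pinv[OF v that(2)] push_pinv[OF v that(2)]
      by (auto simp: tmap_W[OF that(2)] tmap_W[OF I.pinv_in[OF that(2)]] split: if_splits)
    have "tmap (snd (W C)) i j f p = Some q \<longleftrightarrow> tmap (snd (W C)) j i ?g q = Some p" for p q
      using 1[of i j f p q] 1[of j i ?g q p] f g by metis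
    moreover have "tmap (snd (W C)) i j f \<in> Top_p (pt (RLoc C i)) (pt (RLoc C j))"
      "tmap (snd (W C)) j i ?g \<in> Top_p (pt (RLoc C j)) (pt (RLoc C i))"
      using tmap_W_Top_p[OF f] tmap_W_Top_p[OF g(1)] by simp_all
    ultimately show ?thesis unfolding t partial_isos_iff by blast
  qed
  then show ?thesis
    unfolding X.Phi_hom_iff using hom_dom[OF f] hom_cod[OF f] sect_Top_p[OF f] sr_gm[OF f]
    by (auto simp: sect_Some[OF f])
qed

lemma unit_at_sel: "i \<in> Obj C \<Longrightarrow> fob (unit_at C) i = i"
  "f \<in> Hom C i j \<Longrightarrow> fmap (unit_at C) i j f = sect (W C) i j f"
  by (simp_all add: unit_at_def)

text \<open>Composites and restrictions are computed by \<open>mu_gm\<close> and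
  \<open>gm_RIdem\<close>. For joins, \<open>rst_join\<close> tells where the section of the join is
  defined, and each member agrees with the join on its own domain, so the germs coincide.\<close>

lemma unit_join_functor: "join_functor v C (UPhi v (PsiW C)) (unit_at C)"
proof -
  interpret X: icat "PsiW C" v by (rule PsiW_icat)
  show ?thesis
    unfolding join_functor_iff[OF join_category_axioms X.UPhi_join_category] is_functor_def UPhi_sel PsiW_sel
  proof (intro conjI allI ballI impI)
    show "fob (unit_at C) \<in> Obj C \<rightarrow>\<^sub>E Obj C" by (simp add: unit_at_def)
    show "fmap (unit_at C) i j \<in> Hom C i j \<rightarrow>\<^sub>E Phi_hom v (PsiW C) (fob (unit_at C) i) (fob (unit_at C) j)" for i j
      using sect_Phi_hom hom_dom hom_cod by (auto simp: unit_at_def restrict_PiE_iff)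
    show "fmap (unit_at C) i i (Idn C i) = sect (W C) (fob (unit_at C) i) (fob (unit_at C) i)
        (Idn C (fob (unit_at C) i))" if "i \<in> Obj C" for i
      using that by (simp add: unit_at_sel idn_hom)
    fix i j f assume f: "f \<in> Hom C i j"
    note ij = hom_dom[OF f] hom_cod[OF f]
    show "fmap (unit_at C) i k (Comp C i j k g f) =
        pc (PsiW C) (fob (unit_at C) i) (fob (unit_at C) j) (fob (unit_at C) k)
         (fmap (unit_at C) j k g) (fmap (unit_at C) i j f)" if g: "g \<in> Hom C j k" for k g
    proof -
      note gf = comp_in[OF f g]
      have "sect (W C) i k (Comp C i j k g f) = pc (PsiW C) i j k (sect (W C) j k g) (sect (W C) i j f)"
      proof
        fix p
        show "sect (W C) i k (Comp C i j k g f) p =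
            pc (PsiW C) i j k (sect (W C) j k g) (sect (W C) i j f) p"
        proof (cases "p \<in> pts C i \<and> p (Rst C i j f)")
          case True
          then have p: "p \<in> pts C i" "p (Rst C i j f)" by auto
          show ?thesis
            unfolding X.pc_app[OF sect_Phi_hom[OF f] sect_Phi_hom[OF g]]
            using p push_point[OF f p] push_rst[OF f g] tg_gm[OF f p] mu_gm[OF f p g]
            by (simp add: sect_W[OF f] sect_W[OF g] sect_W[OF gf])
        next
          case False
          then have "\<not> (p \<in> pts C i \<and> p (Rst C i k (Comp C i j k g f)))" using rst_comp_le[OF f g] by blast
          then show ?thesis using False
            unfolding X.pc_app[OF sect_Phi_hom[OF f] sect_Phi_hom[OF g]]
            by (auto simp: sect_W[OF f] sect_W[OF gf])
        qed
      qed
      then show ?thesis using f g gf ij hom_cod[OF g] by (simp add: unit_at_sel)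
    qed
    have "sect (W C) i i (Rst C i j f) = rs (PsiW C) i j (sect (W C) i j f)"
    proof
      fix p
      show "sect (W C) i i (Rst C i j f) p = rs (PsiW C) i j (sect (W C) i j f) p"
        using gm_RIdem[OF rst_RIdem[OF f]] et_PsiW[OF ij(1)]
        by (simp add: X.rs_app[OF sect_Phi_hom[OF f]] sect_W[OF rst_hom[OF f]] dom_sect[OF f] rst_rst[OF f])
    qed
    then show "fmap (unit_at C) i i (Rst C i j f) =
        rs (PsiW C) (fob (unit_at C) i) (fob (unit_at C) j) (fmap (unit_at C) i j f)"
      using f ij by (simp add: unit_at_sel)
  next
    fix i j S f assume S: "S \<subseteq> Hom C i j" and J: "is_join C i j S f"
    note f = is_join_in[OF J]
    have SS: "sect (W C) i j ` S \<subseteq> Phi_hom v (PsiW C) i j" using S sect_Phi_hom by blast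
    have "sect (W C) i j f p = Some a \<longleftrightarrow> (\<exists>s\<in>sect (W C) i j ` S. s p = Some a)" for p a
    proof (cases "p \<in> pts C i")
      case p: True
      have "Rst C i j ` S \<subseteq> RIdem C i" using S rst_RIdem by blast
      then have 1: "p (Rst C i j f) \<longleftrightarrow> (\<exists>s\<in>S. p (Rst C i j s))"
        using point_join[OF p _ rst_join[OF S J]] by auto
      have 2: "gm C i j s p = gm C i j f p" if s: "s \<in> S" "p (Rst C i j s)" for s
      proof -
        have sH: "s \<in> Hom C i j" using S s by blast
        have "Comp C i i j s (Rst C i j s) = Comp C i i j f (Rst C i j s)"
          using is_join_ub[OF J s(1)] comp_rst[OF sH] by (simp add: rle_def)
        then have "agr C i j s f p" unfolding agr_def using 1 s rst_RIdem[OF sH] by blast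
        then show ?thesis using gm_eq_iff[OF sH f p s(2)] by simp
      qed
      have "(\<exists>s\<in>sect (W C) i j ` S. s p = Some a) \<longleftrightarrow> (\<exists>s\<in>S. p (Rst C i j s) \<and> a = gm C i j s p)"
        using sect_Some S p by blast
      also have "\<dots> \<longleftrightarrow> (\<exists>s\<in>S. p (Rst C i j s)) \<and> a = gm C i j f p" using 2 by auto
      finally show ?thesis unfolding sect_Some[OF f] using 1 p by blast
    next
      case False
      have "sect (W C) i j s p = None" if "s \<in> S" for s
        using S that False sect_W[of s i j] by auto
      then show ?thesis using False by (auto simp: sect_W[OF f])
    qed
    then have "is_join (UPhi v (PsiW C)) i j (sect (W C) i j ` S) (sect (W C) i j f)"
      unfolding X.is_join_UPhi[OF SS] using sect_Phi_hom[OF f] by blast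
    moreover have "fmap (unit_at C) i j ` S = sect (W C) i j ` S"
      using S unit_at_sel(2) by (intro image_cong) auto
    ultimately show "is_join (UPhi v (PsiW C)) (fob (unit_at C) i) (fob (unit_at C) j)
        (fmap (unit_at C) i j ` S) (fmap (unit_at C) i j f)"
      using f hom_dom[OF f] hom_cod[OF f] by (simp add: unit_at_sel)
  qed
qed

end

text \<open>The arrow part of \<open>PsiW_map\<close> is characterised by sending the section of
  \<open>f\<close> to the section of its image; naturality is that characterisation.\<close>

lemma unit_natural:
  assumes "join_category A v" "join_category B v" "join_functor v A B H"
  shows "comp_functor A (unit_at B) H =
    comp_functor A (UPhi_map v (PsiW A) (PsiW_map A B H)) (unit_at A)"
proof -
  interpret H: join_functor_cat A B v H by (rule join_functor_catI) fact+
  have "fob (unit_at B) (fob H i) = fob (UPhi_map v (PsiW A) H.F) (fob (unit_at A) i)" if "i \<in> Obj A" for i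
    using that H.H_obj by (simp add: H.A.unit_at_sel H.B.unit_at_sel PsiW_map_sel(1))
  moreover have "fmap (unit_at B) (fob H i) (fob H j) (fmap H i j f) =
      fmap (UPhi_map v (PsiW A) H.F) (fob (unit_at A) i) (fob (unit_at A) j) (fmap (unit_at A) i j f)"
    if f: "f \<in> Hom A i j" for i j f
    using f H.car_F(2)[OF H.A.hom_dom[OF f] H.A.hom_cod[OF f] f] H.H_in[OF f] H.A.sect_Phi_hom[OF f]
      H.A.hom_dom[OF f] H.A.hom_cod[OF f]
    by (simp add: H.A.unit_at_sel H.B.unit_at_sel)
  ultimately show ?thesis
    unfolding comp_functor_def by (auto simp: restrict_def fun_eq_iff)
qed

section \<open>The counit\<close>

text \<open>The point of the locale of idempotents that is determined by \<open>x\<close>; this is the object part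
  of the counit as a total function.\<close>

definition px :: "variant \<Rightarrow> ('i, 'a, 'b) pcat \<Rightarrow> 'i \<Rightarrow> 'a \<Rightarrow> ('a \<rightharpoonup> 'b) \<Rightarrow> bool" where
  "px v X i x = (\<lambda>e. e \<in> RIdem (UPhi v X) i \<and> x \<in> dom e)"

lemma counit_sel:
  "cix (counit_at v X) = (\<lambda>i\<in>Ix X. i)"
  "cob (counit_at v X) i = (\<lambda>x. if i \<in> Ix X \<and> x \<in> sp X i then Some (px v X i x) else None)"
  "i \<in> Ix X \<Longrightarrow> j \<in> Ix X \<Longrightarrow> car (counit_at v X) i j =
    (THE h. h \<in> Top_p (fprod (germ_space (W (UPhi v X)) i j) (Sp X i) (germ_base (W (UPhi v X)) i j)
          (cob (counit_at v X) i)) (Ar X i j) \<and>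
       (\<forall>s \<in> Phi_hom v X i j. h \<circ>\<^sub>m pairp (sect (W (UPhi v X)) i j s \<circ>\<^sub>m cob (counit_at v X) i)
          (rstp (sect (W (UPhi v X)) i j s \<circ>\<^sub>m cob (counit_at v X) i)) = s))"
  "i \<notin> Ix X \<or> j \<notin> Ix X \<Longrightarrow> car (counit_at v X) i j = Map.empty"
  by (auto simp: counit_at_def counit_ob_def px_def act_dom_def fun_eq_iff)

text \<open>Bundles an internal category with its category of partial sections, so that the germ
  calculus is available for the latter.\<close>

locale counit_cat = X: icat X v + C: join_category "UPhi v X" v
  for X :: "('i, 'a, 'b) pcat" and v
begin

abbreviation C where "C \<equiv> UPhi v X"
abbreviation K where "K \<equiv> counit_at v X"
abbreviation pp where "pp \<equiv> px v X"

lemma pc_RIdem_Some: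
  assumes "e \<in> RIdem C i" "s \<in> Phi_hom v X i j"
  shows "pc X i i j s e x = (if x \<in> dom e then s x else None)"
proof -
  have e: "e \<in> Phi_hom v X i i" "rs X i i e = e" using assms(1) by (auto simp: RIdem_def)
  show ?thesis using X.pc_rs[OF e(1) assms(2), of x] unfolding e(2) .
qed

lemma px_RIdem: "e \<in> RIdem C i \<Longrightarrow> pp i x e \<longleftrightarrow> x \<in> dom e"
  by (simp add: px_def)

text \<open>The domain of a composite of idempotents is an intersection, and that of a join is a
  union, so membership of \<open>x\<close> in the domain respects meets and joins.\<close>

lemma px_point:
  assumes i: "i \<in> Ix X" and x: "x \<in> sp X i"
  shows "pp i x \<in> pts C i"
proof -
  have iC: "i \<in> Obj C" using i by simp
  show ?thesis
    unfolding C.points_iff[OF iC]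
  proof (intro conjI allI ballI impI)
    show "pp i x y \<Longrightarrow> y \<in> RIdem C i" for y by (simp add: px_def)
    show "pp i x (Idn C i)"
      using C.idn_RIdem[OF iC] x by (simp add: px_def X.Eta_app[OF i] dom_def)
    show "pp i x (Comp C i i i e d) \<longleftrightarrow> pp i x e \<and> pp i x d"
      if e: "e \<in> RIdem C i" and d: "d \<in> RIdem C i" for e d
      using C.RIdem_comp[OF e d] e d pc_RIdem_Some[OF d, of e i x] C.RIdem_in[OF e]
      by (auto simp: px_def domIff)
    show "pp i x e \<longleftrightarrow> (\<exists>y\<in>S. pp i x y)" if S: "S \<subseteq> RIdem C i" and e: "is_join C i i S e" for S e
    proof -
      have SP: "S \<subseteq> Phi_hom v X i i" using S C.RIdem_in by auto
      have "x \<in> dom e \<longleftrightarrow> (\<exists>y\<in>S. x \<in> dom y)"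
        using e unfolding X.is_join_UPhi[OF SP] by (metis domI domD)
      then show ?thesis using C.join_RIdem[OF S e] S by (auto simp: px_def)
    qed
  qed
qed

lemma px_rst: "s \<in> Phi_hom v X i j \<Longrightarrow> pp i x (rs X i j s) \<longleftrightarrow> x \<in> dom s"
  using C.rst_RIdem[of s i j] by (auto simp: px_def X.rs_app dom_def split: if_splits)

text \<open>The neighbourhood \<open>e\<close> on which the sections agree contains
  \<open>x\<close>, so their values there can be compared by evaluation.\<close>

lemma agr_px:
  assumes s: "s \<in> Phi_hom v X i j" and t: "t \<in> Phi_hom v X i j" and a: "agr C i j s t (pp i x)"
  shows "s x = t x"
proof -
  obtain e where e: "e \<in> RIdem C i" "pp i x e" "pc X i i j s e = pc X i i j t e"
    using a by (auto simp: agr_def)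
  have "x \<in> dom e" using e px_RIdem by blast
  then show ?thesis using fun_cong[OF e(3), of x] pc_RIdem_Some[OF e(1) s, of x]
      pc_RIdem_Some[OF e(1) t, of x] by simp
qed

text \<open>Here source-etaleness enters: the image of \<open>t\<close> is open, so \<open>s\<close>
  stays inside it on a neighbourhood of \<open>x\<close>, and there an arrow on both sections has
  one source, which makes the sections equal.\<close>

lemma agr_pxI:
  assumes s: "s \<in> Phi_hom v X i j" and t: "t \<in> Phi_hom v X i j" and a: "s x = Some a" "t x = Some a"
  shows "agr C i j s t (pp i x)"
proof -
  note I = X.Phi_homD(1,2)[OF s]
  have "Src X i j \<circ>\<^sub>m t = rstp t" using t by (simp add: Phi_hom_def)
  then have "openin (Ar X i j) (ran t)"
    by (rule local_homeo_section_open[OF X.src_local_homeo[OF I] X.Phi_homD(3)[OF t]])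
  then have G: "openin (Sp X i) (pre s (ran t))" (is "openin _ ?G") by (rule Top_pD(4)[OF X.Phi_homD(3)[OF s]])
  have eq: "s y = t y" if y: "y \<in> ?G" for y
  proof -
    obtain b z where "s y = Some b" "t z = Some b" using y by (auto simp: pre_def ran_def)
    then show ?thesis using X.Phi_homD(6)[OF s] X.Phi_homD(6)[OF t] by metis
  qed
  let ?e = "Eta X i |` ?G"
  have e: "?e \<in> RIdem C i" by (rule X.Eta_restrict_RIdem[OF I(1) G])
  have x: "x \<in> ?G" using a by (force simp: pre_def ran_def)
  then have "pp i x ?e"
    using X.Phi_homD(4)[OF s a(1)] by (simp add: px_RIdem[OF e] X.Eta_app[OF I(1)] domIff)
  moreover have "pc X i i j s ?e = pc X i i j t ?e"
    using eq by (intro ext) (auto simp: pc_RIdem_Some[OF e s] pc_RIdem_Some[OF e t] X.dom_Eta_restrict[OF I(1)])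
  moreover have "pp i x (rs X i j s)" "pp i x (rs X i j t)"
    using a by (auto simp: px_rst[OF s] px_rst[OF t])
  ultimately show ?thesis unfolding agr_def using e by auto
qed

lemma push_px:
  assumes s: "s \<in> Phi_hom v X i j" and a: "s x = Some a"
  shows "push C i j s (pp i x) = pp j (tg X i j a)"
proof
  fix e
  show "push C i j s (pp i x) e = pp j (tg X i j a) e"
  proof (cases "e \<in> RIdem C j")
    case True
    have e: "e \<in> Phi_hom v X j j" using C.RIdem_in[OF True] by simp
    have "push C i j s (pp i x) e \<longleftrightarrow> pp i x (rs X i j (pc X i j j e s))" using True by (simp add: push_def)
    also have "\<dots> \<longleftrightarrow> x \<in> dom (pc X i j j e s)" by (rule px_rst[OF X.Comp_Phi_hom[OF s e]])
    also have "\<dots> \<longleftrightarrow> tg X i j a \<in> dom e" using a by (simp add: X.pc_app[OF s e] domIff)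
    finally show ?thesis using px_RIdem[OF True] by simp
  qed (simp add: push_def px_def)
qed

lemma gm_px_eq:
  assumes "s \<in> Phi_hom v X i j" "t \<in> Phi_hom v X i j" "x \<in> sp X i" "x \<in> dom s"
  shows "gm C i j s (pp i x) = gm C i j t (pp i x) \<longleftrightarrow> s x = t x"
proof -
  have i: "i \<in> Ix X" using X.Phi_homD(1)[OF assms(1)] .
  have "gm C i j s (pp i x) = gm C i j t (pp i x) \<longleftrightarrow> agr C i j s t (pp i x)"
    using C.gm_eq_iff[of s i j t "pp i x" "pp i x"] px_point[OF i assms(3)] px_rst[OF assms(1)] assms by simp
  also have "\<dots> \<longleftrightarrow> s x = t x"
    using agr_px[OF assms(1,2)] agr_pxI[OF assms(1,2)] assms(4) by auto
  finally show ?thesis .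
qed

lemma cob_K: "i \<in> Ix X \<Longrightarrow> cob K i = (\<lambda>x. if x \<in> sp X i then Some (pp i x) else None)"
  by (simp add: counit_sel(2))

lemma cob_K_total:
  assumes i: "i \<in> Ix X"
  shows "cob K i \<in> total_maps (Sp X i) (pt (RLoc C i))"
proof -
  have iC: "i \<in> Obj C" using i by simp
  show ?thesis
    unfolding total_maps_iff Top_p_iff
  proof (intro conjI allI impI)
    show "ran (cob K i) \<subseteq> topspace (pt (RLoc C i))"
      using px_point[OF i] by (auto simp: cob_K[OF i] C.topspace_pt[OF iC] ran_def)
    show "dom (cob K i) = sp X i" by (auto simp: cob_K[OF i] dom_def)
    fix V assume "openin (pt (RLoc C i)) V"
    then obtain e where e: "e \<in> RIdem C i" "V = {p \<in> pts C i. p e}" using C.openin_pt[OF iC] by blast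
    have eH: "e \<in> Phi_hom v X i i" using C.RIdem_in[OF e(1)] by simp
    have "pre (cob K i) V = dom e"
      using px_point[OF i] e px_RIdem[OF e(1)] X.Phi_homD(4)[OF eH]
      by (auto simp: cob_K[OF i] pre_def split: if_splits)
    then show "openin (Sp X i) (pre (cob K i) V)" using Top_pD(1)[OF X.Phi_homD(3)[OF eH]] by simp
  qed
qed

text \<open>The arrow part of the counit is glued from the sections themselves: the family assigns
  to \<open>s\<close> the map \<open>s\<close>, and \<open>agr_px\<close> is the compatibility
  required by \<open>fprod_glue\<close>.\<close>

lemma car_K:
  assumes ij: "i \<in> Ix X" "j \<in> Ix X"
  shows "car K i j \<in> Top_p (fprod (germ_space (W C) i j) (Sp X i) (germ_base (W C) i j)
          (cob K i)) (Ar X i j)" (is "_ \<in> ?T")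
    and "\<And>s. s \<in> Phi_hom v X i j \<Longrightarrow> um K i j (sect (W C) i j s) = s"
proof -
  have "\<exists>!h. h \<in> ?T \<and> (\<forall>s\<in>Hom C i j. h \<circ>\<^sub>m pairp (sect (W C) i j s \<circ>\<^sub>m cob K i)
      (rstp (sect (W C) i j s \<circ>\<^sub>m cob K i)) = s)"
  proof (rule C.fprod_glue[OF cob_K_total[OF ij(1)]])
    fix s assume sC: "s \<in> Hom C i j"
    then have s: "s \<in> Phi_hom v X i j" by simp
    show "s \<in> Top_p (Sp X i) (Ar X i j)" by (rule X.Phi_homD(3)[OF s])
    show "dom s \<subseteq> dom (sect (W C) i j s \<circ>\<^sub>m cob K i)"
    proof
      fix x assume x: "x \<in> dom s"
      then have "x \<in> sp X i" using X.Phi_homD(4)[OF s] by blast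
      then show "x \<in> dom (sect (W C) i j s \<circ>\<^sub>m cob K i)"
        using x px_point[OF ij(1)] px_rst[OF s] by (simp add: dom_def cob_K[OF ij(1)] C.sect_W[OF sC])
    qed
    fix t q x
    assume t: "t \<in> Hom C i j" "q \<in> pts C i" "cob K i x = Some q" "agr C i j s t q"
    then have "q = pp i x" by (auto simp: cob_K[OF ij(1)] split: if_splits)
    then show "s x = t x" using agr_px[OF s _] t by simp
  qed
  from theI'[OF this] show "car K i j \<in> ?T"
    and "\<And>s. s \<in> Phi_hom v X i j \<Longrightarrow> um K i j (sect (W C) i j s) = s"
    unfolding um_def counit_sel(3)[OF ij] by auto
qed

lemma car_K_gm:
  assumes s: "s \<in> Phi_hom v X i j" and a: "s x = Some a"
  shows "car K i j (gm C i j s (pp i x), x) = Some a"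
proof -
  note I = X.Phi_homD(1,2)[OF s] and x = X.Phi_homD(4)[OF s a]
  have "cob K i x = Some (pp i x)" using x by (simp add: cob_K[OF I(1)])
  moreover have "s \<in> Hom C i j" "pp i x (Rst C i j s)" using s a px_rst[OF s] by auto
  ultimately show ?thesis
    using C.fprod_eval[OF car_K(2)[OF I s, unfolded um_def] _ px_point[OF I(1) x]] a by simp
qed

lemma germ_px:
  assumes i: "i \<in> Ix X" and b: "b \<in> topspace (germ_space (W C) i j)" and x: "x \<in> sp X i"
    and s: "germ_base (W C) i j b = Some (pp i x)"
  shows "\<exists>s a. s \<in> Phi_hom v X i j \<and> s x = Some a \<and> b = gm C i j s (pp i x)"
proof -
  obtain s q where f: "s \<in> Hom C i j" "q \<in> pts C i" "q (Rst C i j s)" "b = gm C i j s q"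
    using b by (rule C.germE)
  then have "q = pp i x" using C.germ_base_gm[OF f(1-3)] s by simp
  moreover have sP: "s \<in> Phi_hom v X i j" using f by simp
  ultimately show ?thesis using f px_rst[OF sP, of x] by auto
qed

lemma act_dom_KE:
  assumes ij: "i \<in> Ix X" "j \<in> Ix X"
    and z: "(b, x) \<in> topspace (fprod (germ_space (W C) i j) (Sp X i) (germ_base (W C) i j) (cob K i))"
  shows "\<exists>s a. s \<in> Phi_hom v X i j \<and> s x = Some a \<and> b = gm C i j s (pp i x)"
proof -
  have x: "x \<in> sp X i" and b: "b \<in> topspace (germ_space (W C) i j)" "germ_base (W C) i j b = cob K i x"
    using z by auto
  show ?thesis by (rule germ_px[OF ij(1) b(1) x]) (use b(2) x in \<open>simp add: cob_K[OF ij(1)]\<close>)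
qed

lemma car_K_Some:
  assumes ij: "i \<in> Ix X" "j \<in> Ix X"
  shows "car K i j (b, x) = Some a \<longleftrightarrow>
    (\<exists>s. s \<in> Phi_hom v X i j \<and> s x = Some a \<and> b = gm C i j s (pp i x))"
proof
  assume c: "car K i j (b, x) = Some a"
  obtain s a' where s: "s \<in> Phi_hom v X i j" "s x = Some a'" "b = gm C i j s (pp i x)"
    using act_dom_KE[OF ij Top_pD(5)[OF car_K(1)[OF ij] c]] by blast
  then show "\<exists>s. s \<in> Phi_hom v X i j \<and> s x = Some a \<and> b = gm C i j s (pp i x)"
    using car_K_gm[OF s(1,2)] c by auto
next
  assume "\<exists>s. s \<in> Phi_hom v X i j \<and> s x = Some a \<and> b = gm C i j s (pp i x)"
  then show "car K i j (b, x) = Some a" using car_K_gm by blast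
qed

lemma counit_cofunctor: "cofunctor (PsiW C) X K"
proof -
  interpret SA: source_etale_category "PsiW C" by (rule C.PsiW_source_etale)
  have ci: "cix K i = i" if "i \<in> Ix X" for i using that by (simp add: counit_sel(1))
  have P: "pre_cofunctor (PsiW C) X K"
  proof unfold_locales
    show "cix K \<in> Ix (PsiW C) \<rightarrow>\<^sub>E Ix X" by (simp add: counit_sel(1))
    show "\<And>i. i \<notin> Ix (PsiW C) \<Longrightarrow> cob K i = Map.empty" by (simp add: counit_sel(2))
    show "\<And>i j. i \<notin> Ix (PsiW C) \<or> j \<notin> Ix (PsiW C) \<Longrightarrow> car K i j = Map.empty"
      by (simp add: counit_sel(4))
    show "\<And>i. i \<in> Ix (PsiW C) \<Longrightarrow> cob K i \<in> total_maps (Sp X (cix K i)) (Sp (PsiW C) i)"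
      using cob_K_total ci by simp
    fix i j assume "i \<in> Ix (PsiW C)" "j \<in> Ix (PsiW C)"
    then have ij: "i \<in> Ix X" "j \<in> Ix X" by auto
    have D: "act_dom (PsiW C) X (cix K) (cob K) i j =
        fprod (germ_space (W C) i j) (Sp X i) (germ_base (W C) i j) (cob K i)"
      using ci[OF ij(1)] by (simp add: act_dom_def)
    show "car K i j \<in> total_maps (act_dom (PsiW C) X (cix K) (cob K) i j) (Ar X (cix K i) (cix K j))"
      unfolding total_maps_iff D ci[OF ij(1)] ci[OF ij(2)]
    proof
      show t: "car K i j \<in> Top_p (fprod (germ_space (W C) i j) (Sp X i) (germ_base (W C) i j) (cob K i)) (Ar X i j)"
        by (rule car_K(1)[OF ij])
      have "z \<in> dom (car K i j)"
        if z: "z \<in> topspace (fprod (germ_space (W C) i j) (Sp X i) (germ_base (W C) i j) (cob K i))" for z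
      proof -
        obtain b x where bx: "z = (b, x)" by (cases z)
        obtain s a where "s \<in> Phi_hom v X i j" "s x = Some a" "b = gm C i j s (pp i x)"
          using act_dom_KE[OF ij z[unfolded bx]] by blast
        then show ?thesis using car_K_gm bx by blast
      qed
      then show "dom (car K i j) = topspace (fprod (germ_space (W C) i j) (Sp X i) (germ_base (W C) i j) (cob K i))"
        using Top_pD(2)[OF t] by blast
    qed
  qed
  interpret P: pre_cofunctor "PsiW C" X K by (rule P)
  have co: "co K i x = pp i x" if "i \<in> Ix X" "x \<in> sp X i" for i x
    using that by (simp add: co_def cob_K)
  have ca: "ca K i j (gm C i j s (pp i x)) x = a" if "s \<in> Phi_hom v X i j" "s x = Some a" for s i j x a
    using car_K_gm[OF that] by (simp add: ca_def)
  have E: "\<exists>s a. s \<in> Phi_hom v X i j \<and> s x = Some a \<and> b = gm C i j s (pp i x)"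
    if i: "i \<in> Ix X" and b: "b \<in> ar (PsiW C) i j" and x: "x \<in> sp X i" and s: "sr (PsiW C) i j b = co K i x"
    for b i j x
  proof (rule germ_px[OF i _ x])
    show bT: "b \<in> topspace (germ_space (W C) i j)" using b by simp
    obtain q where "germ_base (W C) i j b = Some q" using bT C.dom_germ_base[of i j] by blast
    then show "germ_base (W C) i j b = Some (pp i x)" using s co[OF i x] by (simp add: sr_def)
  qed
  have tgs: "tg (PsiW C) i j (gm C i j s (pp i x)) = pp j (tg X i j a)"
    if "s \<in> Phi_hom v X i j" "s x = Some a" for s i j x a
    using C.tg_gm[of s i j "pp i x"] px_point[OF X.Phi_homD(1,4)[OF that(1)]] px_rst[OF that(1)]
      push_px[OF that] X.Phi_homD(4)[OF that] that X.Phi_homD(1)[OF that(1)] by auto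
  have srs: "sr (PsiW C) i j (gm C i j s (pp i x)) = pp i x"
    if "s \<in> Phi_hom v X i j" "s x = Some a" for s i j x a
    using C.sr_gm[of s i j "pp i x"] px_point[OF X.Phi_homD(1,4)[OF that(1)]] px_rst[OF that(1)]
      X.Phi_homD(4)[OF that] that X.Phi_homD(1)[OF that(1)] by auto
  have src: P.src_ax
    unfolding P.src_ax_def
  proof (intro ballI impI)
    fix i j b x assume H: "i \<in> Ix (PsiW C)" "j \<in> Ix (PsiW C)" "b \<in> ar (PsiW C) i j"
      "x \<in> sp X (cix K i)" "sr (PsiW C) i j b = co K i x"
    then have ij: "i \<in> Ix X" "j \<in> Ix X" by auto
    have x: "x \<in> sp X i" using H(4) ci[OF ij(1)] by simp
    obtain s a where s: "s \<in> Phi_hom v X i j" "s x = Some a" "b = gm C i j s (pp i x)"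
      using E[OF ij(1) H(3) x H(5)] by blast
    show "sr X (cix K i) (cix K j) (ca K i j b x) = x \<and>
        co K j (tg X (cix K i) (cix K j) (ca K i j b x)) = tg (PsiW C) i j b"
      unfolding s(3) ca[OF s(1,2)] ci[OF ij(1)] ci[OF ij(2)] tgs[OF s(1,2)]
      using X.Phi_homD(6)[OF s(1,2)] co[OF ij(2) X.Phi_homD(7)[OF s(1,2)]] by simp
  qed
  moreover have P.unit_ax
    unfolding P.unit_ax_def
  proof (intro ballI)
    fix i x assume H: "i \<in> Ix (PsiW C)" "x \<in> sp X (cix K i)"
    then have i: "i \<in> Ix X" "i \<in> Obj C" by auto
    have x: "x \<in> sp X i" using H(2) ci[OF i(1)] by simp
    have "Eta X i x = Some (et X i x)" using x X.Eta_Some[OF i(1)] by simp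
    then show "ca K i i (et (PsiW C) i (co K i x)) x = et X (cix K i) x"
      unfolding co[OF i(1) x] C.et_PsiW[OF i(2) px_point[OF i(1) x]] ci[OF i(1)]
      using ca[OF X.Eta_Phi_hom[OF i(1)]] by simp
  qed
  moreover have P.mult_ax
    unfolding P.mult_ax_def
  proof (intro ballI impI)
    fix i j k b c x assume H: "i \<in> Ix (PsiW C)" "j \<in> Ix (PsiW C)" "k \<in> Ix (PsiW C)"
      "b \<in> ar (PsiW C) i j" "c \<in> ar (PsiW C) j k" "x \<in> sp X (cix K i)"
      "sr (PsiW C) i j b = co K i x" "sr (PsiW C) j k c = tg (PsiW C) i j b"
    then have I: "i \<in> Ix X" "j \<in> Ix X" "k \<in> Ix X" by auto
    have x: "x \<in> sp X i" using H(6) ci[OF I(1)] by simp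
    obtain s a where s: "s \<in> Phi_hom v X i j" "s x = Some a" "b = gm C i j s (pp i x)"
      using E[OF I(1) H(4) x H(7)] by blast
    define y where "y = tg X i j a"
    have y: "y \<in> sp X j" unfolding y_def by (rule X.Phi_homD(7)[OF s(1,2)])
    have "sr (PsiW C) j k c = co K j y" using H(8) tgs[OF s(1,2)] co[OF I(2) y] s(3) by (simp add: y_def)
    then obtain t d where t: "t \<in> Phi_hom v X j k" "t y = Some d" "c = gm C j k t (pp j y)"
      using E[OF I(2) H(5) y] by blast
    have pq: "push C i j s (pp i x) = pp j y" unfolding y_def by (rule push_px[OF s(1,2)])
    have d1: "pp i x (Rst C i j s)" using px_rst[OF s(1)] s(2) by auto
    have d2: "push C i j s (pp i x) (Rst C j k t)" unfolding pq using px_rst[OF t(1)] t(2) by auto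
    have m: "mu (PsiW C) i j k c b = gm C i k (pc X i j k t s) (pp i x)"
      using C.mu_gm[of s i j "pp i x" t k] s(1) t(1) px_point[OF I(1) x] d1 d2 unfolding pq s(3) t(3) by simp
    have ts: "pc X i j k t s x = Some (mu X i j k d a)"
      using s t by (simp add: X.pc_app[OF s(1) t(1)] y_def)
    have cb: "ca K i j b x = a" unfolding s(3) by (rule ca[OF s(1,2)])
    have cc: "ca K j k c y = d" unfolding t(3) by (rule ca[OF t(1,2)])
    show "ca K i k (mu (PsiW C) i j k c b) x = mu X (cix K i) (cix K j) (cix K k)
        (ca K j k c (tg X (cix K i) (cix K j) (ca K i j b x))) (ca K i j b x)"
      unfolding ci[OF I(1)] ci[OF I(2)] ci[OF I(3)] cb y_def[symmetric] cc m
      by (rule ca[OF X.Comp_Phi_hom[OF s(1) t(1)] ts])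
  qed
  ultimately show ?thesis using P.cofunctor_iff by blast
qed

text \<open>On maps this is the defining property of the arrow part of the counit, as recorded in
  \<open>car_K\<close>.\<close>

lemma counit_triangle:
  "comp_functor C (UPhi_map v (PsiW C) K) (unit_at C) = id_functor C"
proof -
  have "fob (UPhi_map v (PsiW C) K) (fob (unit_at C) i) = i" if "i \<in> Obj C" for i
    using that by (simp add: C.unit_at_sel counit_sel(1))
  moreover have "fmap (UPhi_map v (PsiW C) K) (fob (unit_at C) i) (fob (unit_at C) j) (fmap (unit_at C) i j s) = s"
    if s: "s \<in> Hom C i j" for i j s
    using s C.sect_Phi_hom[OF s] car_K(2)[of i j s] X.Phi_homD(1,2)[of s i j] C.unit_at_sel(2)[OF s]
    by (simp add: C.unit_at_sel(1))
  ultimately show ?thesis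
    unfolding comp_functor_def id_functor_def by (auto simp: restrict_def fun_eq_iff)
qed

end

lemma counit_catI: "icat X v \<Longrightarrow> counit_cat X v"
  by (simp add: counit_cat_def icat.UPhi_join_category)

text \<open>Both sides send the germ of \<open>s\<close> at the point given by
  \<open>co F i y\<close>, paired with \<open>y\<close>, to the value at \<open>y\<close> of the
  transported section \<open>um F i j s\<close>.\<close>

lemma counit_natural:
  assumes X: "icat X v" and Y: "icat Y v" and F: "cofunctor X Y F"
  shows "comp_cofunctor (PsiW (UPhi v X)) F (counit_at v X) =
    comp_cofunctor (PsiW (UPhi v X)) (counit_at v Y) (PsiW_map (UPhi v X) (UPhi v Y) (UPhi_map v X F))"
    (is "?L = ?R")
proof -
  interpret F: cofunctor_icat X Y F v by (rule cofunctor_icatI[OF X Y F])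
  interpret KX: counit_cat X v by (rule counit_catI[OF X])
  interpret KY: counit_cat Y v by (rule counit_catI[OF Y])
  interpret J: join_functor_cat "UPhi v X" "UPhi v Y" v "UPhi_map v X F"
    by (rule join_functor_catI[OF KX.C.join_category_axioms KY.C.join_category_axioms F.UPhi_map_join_functor])
  let ?A = "UPhi v X" and ?B = "UPhi v Y"
  have pl: "J.pull i (px v Y (cix F i) y) = px v X i (co F i y)"
    if i: "i \<in> Ix X" and y: "y \<in> sp Y (cix F i)" for i y
  proof
    fix e
    show "J.pull i (px v Y (cix F i) y) e = px v X i (co F i y) e"
    proof (cases "e \<in> RIdem ?A i")
      case True
      have e: "e \<in> Phi_hom v X i i" using KX.C.RIdem_in[OF True] by simp
      have "um F i i e \<in> RIdem ?B (cix F i)" using J.H_RIdem[OF True] e by simp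
      moreover have "y \<in> dom (um F i i e) \<longleftrightarrow> co F i y \<in> dom e"
        using y by (simp add: F.um_app[OF e] domIff)
      ultimately show ?thesis using True e by (simp add: J.pull_def px_def)
    qed (simp add: J.pull_def px_def)
  qed
  have cK: "cix (counit_at v X) i = i" if "i \<in> Ix X" for i using that by (simp add: counit_sel(1))
  have "cob ?L i = cob ?R i" for i
  proof (cases "i \<in> Ix X")
    case i: True
    show ?thesis
    proof
      fix y
      show "cob ?L i y = cob ?R i y"
      proof (cases "y \<in> sp Y (cix F i)")
        case y: True
        have "cob ?L i y = Some (px v X i (co F i y))"
          using i y F.co_in[OF i y] by (simp add: comp_cofunctor_def cK F.cob_app KX.cob_K)
        moreover have "px v Y (cix F i) y \<in> pts ?B (fob (UPhi_map v X F) i)"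
          using KY.px_point[OF F.cix_in[OF i] y] by simp
        ultimately show ?thesis
          using i y pl[OF i y] F.cix_in[OF i]
          by (simp add: comp_cofunctor_def PsiW_map_sel(1) KY.cob_K J.cob_F)
      next
        case False
        then show ?thesis using i F.cix_in[OF i]
          by (simp add: comp_cofunctor_def cK PsiW_map_sel(1) F.cob_app KY.cob_K map_comp_def)
      qed
    qed
  next
    case False
    then show ?thesis
      by (auto simp: comp_cofunctor_def counit_sel(2) PsiW_map_sel(2) map_comp_def fun_eq_iff split: option.split)
  qed
  then have cob: "cob ?L = cob ?R" by blast
  have "car ?L i j = car ?R i j" for i j
  proof (cases "i \<in> Ix X \<and> j \<in> Ix X")
    case True
    then have ij: "i \<in> Ix X" "j \<in> Ix X" and ijA: "i \<in> Obj ?A" "j \<in> Obj ?A" by auto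
    note FJ = F.cix_in[OF ij(1)] F.cix_in[OF ij(2)]
    show ?thesis
    proof (rule map_pair_eqI)
      fix b y c
      show "car ?L i j (b, y) = Some c \<longleftrightarrow> car ?R i j (b, y) = Some c"
      proof
        assume "car ?L i j (b, y) = Some c"
        then obtain x a where x: "cob F i y = Some x" "car KX.K i j (b, x) = Some a" "car F i j (a, y) = Some c"
          unfolding car_comp_Some cK[OF ij(1)] cK[OF ij(2)] by blast
        have y: "y \<in> sp Y (cix F i)" "x = co F i y" using x(1) F.cob_Some[OF ij(1)] by auto
        obtain s where s: "s \<in> Phi_hom v X i j" "s x = Some a" "b = gm ?A i j s (px v X i x)"
          using x(2) unfolding KX.car_K_Some[OF ij] by blast
        have c: "um F i j s y = Some c"
          using F.um_Some[OF s(1)] F.car_Some[OF ij] x(3) s(2) y by auto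
        let ?q = "px v Y (cix F i) y"
        have q: "?q \<in> pts ?B (fob (UPhi_map v X F) i)" using KY.px_point[OF FJ(1) y(1)] by simp
        have pq: "J.pull i ?q = px v X i x" using pl[OF ij(1) y(1)] y(2) by simp
        have d: "J.pull i ?q (Rst ?A i j s)" unfolding pq using KX.px_rst[OF s(1)] s(2) by auto
        have "car J.F i j (b, ?q) = Some (gm ?B (cix F i) (cix F j) (um F i j s) ?q)"
          using J.car_F_gm[OF ijA _ q d] s(1,3) pq by simp
        moreover have "car KY.K (cix F i) (cix F j) (gm ?B (cix F i) (cix F j) (um F i j s) ?q, y) = Some c"
          by (rule KY.car_K_gm[OF F.um_Phi_hom[OF s(1)] c])
        moreover have "cob KY.K (cix F i) y = Some ?q" using y(1) by (simp add: KY.cob_K[OF FJ(1)])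
        ultimately show "car ?R i j (b, y) = Some c"
          unfolding car_comp_Some PsiW_map_sel(1) UPhi_map_sel by blast
      next
        assume "car ?R i j (b, y) = Some c"
        then obtain q d where q: "cob KY.K (cix F i) y = Some q" "car J.F i j (b, q) = Some d"
            "car KY.K (cix F i) (cix F j) (d, y) = Some c"
          unfolding car_comp_Some PsiW_map_sel(1) UPhi_map_sel by blast
        have y: "y \<in> sp Y (cix F i)" and qq: "q = px v Y (cix F i) y"
          using q(1) by (auto simp: KY.cob_K[OF FJ(1)] split: if_splits)
        obtain s where s: "s \<in> Phi_hom v X i j" "J.pull i q (Rst ?A i j s)" "b = gm ?A i j s (J.pull i q)"
            "d = gm ?B (cix F i) (cix F j) (um F i j s) q"
          using q(2) unfolding J.car_F_Some[OF ijA] by auto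
        obtain t where t: "t \<in> Phi_hom v Y (cix F i) (cix F j)" "t y = Some c"
            "d = gm ?B (cix F i) (cix F j) t q"
          using q(3) unfolding KY.car_K_Some[OF FJ] qq by blast
        note pq = pl[OF ij(1) y, folded qq]
        have cs: "co F i y \<in> dom s" using s(2) KX.px_rst[OF s(1)] unfolding pq by simp
        then have "y \<in> dom (um F i j s)" using y by (simp add: F.um_app[OF s(1)] domIff)
        \<comment> \<open>Two sections represent the same germ at the point of \<open>y\<close>,
          which by \<open>gm_px_eq\<close> means equal values at \<open>y\<close>.\<close>
        then have "um F i j s y = t y"
          using KY.gm_px_eq[OF F.um_Phi_hom[OF s(1)] t(1) y] s(4) t(3) unfolding qq by simp
        then have c: "um F i j s y = Some c" using t(2) by simp
        then obtain a where a: "s (co F i y) = Some a" "c = ca F i j a y" using F.um_Some[OF s(1)] by blast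
        have "car KX.K i j (b, co F i y) = Some a"
          unfolding s(3) pq by (rule KX.car_K_gm[OF s(1) a(1)])
        moreover have "cob F i y = Some (co F i y)" using y by (simp add: F.cob_app[OF ij(1)])
        moreover have "car F i j (a, y) = Some c"
          using F.car_Some[OF ij] y a F.X.Phi_homD(5,6)[OF s(1) a(1)] by simp
        ultimately show "car ?L i j (b, y) = Some c"
          unfolding car_comp_Some cK[OF ij(1)] cK[OF ij(2)] by blast
      qed
    qed
  next
    case False
    then have "car KX.K i j = Map.empty" "car J.F i j = Map.empty" by (auto simp: PsiW_map_sel(4) counit_sel(4))
    then show ?thesis by (intro map_pair_eqI) (auto simp: car_comp_Some)
  qed
  then have "car ?L = car ?R" by blast
  moreover have "cix ?L = cix ?R"
    using F.cix_in by (auto simp: comp_cofunctor_def PsiW_map_sel(1) counit_sel(1) fun_eq_iff)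
  ultimately show ?thesis using cob by simp
qed

lemma (in join_category) car_id_PsiW_Some:
  assumes ij: "i \<in> Obj C" "j \<in> Obj C"
  shows "car (id_cofunctor (PsiW C)) i j (a, p) = Some c \<longleftrightarrow>
    (\<exists>f. f \<in> Hom C i j \<and> p \<in> pts C i \<and> p (Rst C i j f) \<and> a = gm C i j f p \<and> c = a)"
proof -
  have ci: "car (id_cofunctor (PsiW C)) i j =
      proj1 (fprod (germ_space (W C) i j) (pt (RLoc C i)) (germ_base (W C) i j) (idp (pt (RLoc C i))))"
    using ij by (simp add: id_cofunctor_def act_dom_def)
  show ?thesis
  proof
    assume "car (id_cofunctor (PsiW C)) i j (a, p) = Some c"
    then have ac: "c = a" and d: "(a, p) \<in> topspace (fprod (germ_space (W C) i j) (pt (RLoc C i))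
        (germ_base (W C) i j) (idp (pt (RLoc C i))))"
      unfolding ci proj1_Some by simp_all
    obtain f q where f: "f \<in> Hom C i j" "q \<in> pts C i" "q (Rst C i j f)" "a = gm C i j f q"
        "idp (pt (RLoc C i)) p = Some q"
      using d by (rule fprod_germE)
    then have "q = p" by (simp add: idp_Some)
    then show "\<exists>f. f \<in> Hom C i j \<and> p \<in> pts C i \<and> p (Rst C i j f) \<and> a = gm C i j f p \<and> c = a"
      using f ac by blast
  next
    assume "\<exists>f. f \<in> Hom C i j \<and> p \<in> pts C i \<and> p (Rst C i j f) \<and> a = gm C i j f p \<and> c = a"
    then obtain f where f: "f \<in> Hom C i j" "p \<in> pts C i" "p (Rst C i j f)" "a = gm C i j f p" "c = a" by blast
    then show "car (id_cofunctor (PsiW C)) i j (a, p) = Some c"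
      unfolding ci proj1_Some using gm_in[OF f(1-3)] germ_base_gm[OF f(1-3)]
      by (simp add: idp_def topspace_pt[OF ij(1)])
  qed
qed

lemma unit_triangle:
  assumes A: "join_category A v"
  shows "comp_cofunctor (PsiW A) (counit_at v (PsiW A)) (PsiW_map A (UPhi v (PsiW A)) (unit_at A)) =
    id_cofunctor (PsiW A)" (is "?L = ?R")
proof -
  interpret A: join_category A v by fact
  interpret K: counit_cat "PsiW A" v by (rule counit_catI[OF A.PsiW_icat])
  let ?B = "UPhi v (PsiW A)"
  interpret J: join_functor_cat A ?B v "unit_at A"
    by (rule join_functor_catI[OF A K.C.join_category_axioms A.unit_join_functor])
  have o: "fob (unit_at A) i = i" if "i \<in> Obj A" for i using that by (rule A.unit_at_sel)
  have m: "fmap (unit_at A) i j f = sect (W A) i j f" if "f \<in> Hom A i j" for i j f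
    using that by (rule A.unit_at_sel)
  have sp: "sp (PsiW A) i = pts A i" if "i \<in> Obj A" for i using A.topspace_pt[OF that] by simp
  \<comment> \<open>The section of an idempotent \<open>e\<close> is defined at \<open>p\<close>
    exactly when \<open>p e\<close> holds, so passing to the point over \<open>p\<close> and pulling
    back along the unit recovers \<open>p\<close>.\<close>
  have pl: "J.pull i (px v (PsiW A) i p) = p" if i: "i \<in> Obj A" and p: "p \<in> pts A i" for i p
  proof
    fix e
    show "J.pull i (px v (PsiW A) i p) e = p e"
    proof (cases "e \<in> RIdem A i")
      case True
      have "sect (W A) i i e \<in> RIdem ?B i" using J.H_RIdem[OF True] m[OF A.RIdem_in[OF True]] o[OF i] by simp
      moreover have "p \<in> dom (sect (W A) i i e) \<longleftrightarrow> p e"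
        using A.dom_sect[OF A.RIdem_in[OF True]] p A.RIdem_rst[OF True] by simp
      ultimately show ?thesis using True m[OF A.RIdem_in[OF True]] by (simp add: J.pull_def px_def)
    next
      case False
      then show ?thesis using A.point_RIdem[OF p] by (auto simp: J.pull_def)
    qed
  qed
  have "cob ?L i = cob ?R i" for i
  proof (cases "i \<in> Obj A")
    case i: True
    show ?thesis
    proof
      fix p
      show "cob ?L i p = cob ?R i p"
      proof (cases "p \<in> pts A i")
        case p: True
        have "px v (PsiW A) i p \<in> pts ?B i" using K.px_point[of i p] i p sp[OF i] by simp
        then show ?thesis using i p pl[OF i p] sp[OF i] o[OF i] J.cob_F[OF i] K.cob_K[of i]
          by (simp add: comp_cofunctor_def id_cofunctor_def PsiW_map_sel(1) idp_def)
      next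
        case False
        then show ?thesis using i sp[OF i] o[OF i] K.cob_K[of i]
          by (simp add: comp_cofunctor_def id_cofunctor_def PsiW_map_sel(1) idp_def map_comp_def)
      qed
    qed
  next
    case False
    then show ?thesis by (simp add: comp_cofunctor_def id_cofunctor_def PsiW_map_sel(2))
  qed
  then have cob: "cob ?L = cob ?R" by blast
  have "car ?L i j = car ?R i j" for i j
  proof (cases "i \<in> Obj A \<and> j \<in> Obj A")
    case True
    then have ij: "i \<in> Obj A" "j \<in> Obj A" by auto
    then have ijX: "i \<in> Ix (PsiW A)" "j \<in> Ix (PsiW A)" by auto
    show ?thesis
    proof (rule map_pair_eqI)
      fix a p c
      let ?q = "px v (PsiW A) i p"
      show "car ?L i j (a, p) = Some c \<longleftrightarrow> car ?R i j (a, p) = Some c"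
        unfolding A.car_id_PsiW_Some[OF ij]
      proof
        assume "car ?L i j (a, p) = Some c"
        then obtain q b where q: "cob K.K i p = Some q" "car J.F i j (a, q) = Some b"
            "car K.K i j (b, p) = Some c"
          unfolding car_comp_Some PsiW_map_sel(1) o[OF ij(1)] o[OF ij(2)] by blast
        have p: "p \<in> pts A i" and qq: "q = ?q"
          using q(1) K.cob_K[OF ijX(1)] sp[OF ij(1)] by (auto split: if_splits)
        obtain f where f: "f \<in> Hom A i j" "p (Rst A i j f)" "a = gm A i j f p"
            "b = gm ?B i j (sect (W A) i j f) q"
          using q(2) pl[OF ij(1) p] m unfolding J.car_F_Some[OF ij] o[OF ij(1)] o[OF ij(2)] qq by auto
        have s: "sect (W A) i j f p = Some (gm A i j f p)" using f p by (simp add: A.sect_W)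
        have "car K.K i j (b, p) = Some (gm A i j f p)"
          unfolding f(4) qq by (rule K.car_K_gm[OF A.sect_Phi_hom[OF f(1)] s])
        then show "\<exists>f. f \<in> Hom A i j \<and> p \<in> pts A i \<and> p (Rst A i j f) \<and> a = gm A i j f p \<and> c = a"
          using q(3) f p by auto
      next
        assume "\<exists>f. f \<in> Hom A i j \<and> p \<in> pts A i \<and> p (Rst A i j f) \<and> a = gm A i j f p \<and> c = a"
        then obtain f where f: "f \<in> Hom A i j" "p \<in> pts A i" "p (Rst A i j f)" "a = gm A i j f p" "c = a" by blast
        have s: "sect (W A) i j f p = Some c" using f by (simp add: A.sect_W)
        have q: "?q \<in> pts ?B i" using K.px_point[OF ijX(1), of p] f(2) sp[OF ij(1)] by simp
        have "cob K.K i p = Some ?q" using f(2) sp[OF ij(1)] K.cob_K[OF ijX(1)] by simp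
        moreover have "car J.F i j (a, ?q) = Some (gm ?B i j (sect (W A) i j f) ?q)"
          using J.car_F_gm[OF ij f(1), of ?q] q f pl[OF ij(1) f(2)] m[OF f(1)] o[OF ij(1)] o[OF ij(2)] by simp
        moreover have "car K.K i j (gm ?B i j (sect (W A) i j f) ?q, p) = Some c"
          by (rule K.car_K_gm[OF A.sect_Phi_hom[OF f(1)] s])
        ultimately show "car ?L i j (a, p) = Some c"
          unfolding car_comp_Some PsiW_map_sel(1) o[OF ij(1)] o[OF ij(2)] by blast
      qed
    qed
  next
    case False
    then have "car J.F i j = Map.empty" "car ?R i j = Map.empty"
      by (auto simp: PsiW_map_sel(4) id_cofunctor_def)
    then show ?thesis by (intro map_pair_eqI) (auto simp: car_comp_Some)
  qed
  then have "car ?L = car ?R" by blast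
  moreover have "cix ?L = cix ?R"
    using o by (auto simp: comp_cofunctor_def id_cofunctor_def PsiW_map_sel(1) counit_sel(1) fun_eq_iff)
  ultimately show ?thesis using cob by simp
qed

section \<open>Sober spaces\<close>

text \<open>An irreducible closed \<open>Z\<close> becomes the point that holds at \<open>e\<close>
  when some member of \<open>Z\<close> does. Irreducibility is used for meets: if no member
  satisfied both \<open>x\<close> and \<open>y\<close>, then \<open>Z\<close> would be a union of
  two proper closed subsets.\<close>

lemma (in join_category) sober_pt:
  assumes i: "i \<in> Obj C"
  shows "sober (pt (RLoc C i))"
  unfolding sober_def
proof (intro allI impI)
  let ?T = "pt (RLoc C i)"
  fix Z assume Z: "irreducible_closed ?T Z"
  then have cZ: "closedin ?T Z" and nZ: "Z \<noteq> {}"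
    and irr: "\<And>Z1 Z2. closedin ?T Z1 \<Longrightarrow> closedin ?T Z2 \<Longrightarrow> Z = Z1 \<union> Z2 \<Longrightarrow> Z = Z1 \<or> Z = Z2"
    unfolding irreducible_closed_def by blast+
  have Zp: "Z \<subseteq> pts C i" using closedin_subset[OF cZ] topspace_pt[OF i] by simp
  define p where "p = (\<lambda>e. e \<in> RIdem C i \<and> (\<exists>q\<in>Z. q e))"
  have p: "p \<in> pts C i"
    unfolding points_iff[OF i]
  proof (intro conjI allI ballI impI)
    show "p x \<Longrightarrow> x \<in> RIdem C i" for x by (simp add: p_def)
    show "p (Idn C i)" using nZ Zp point_idn[OF i] idn_RIdem[OF i] by (auto simp: p_def)
    show "p (Comp C i i i x y) \<longleftrightarrow> p x \<and> p y" if x: "x \<in> RIdem C i" and y: "y \<in> RIdem C i" for x y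
    proof
      assume "p (Comp C i i i x y)"
      then show "p x \<and> p y" using Zp point_comp[OF _ x y] x y unfolding p_def by blast
    next
      assume xy: "p x \<and> p y"
      let ?D = "\<lambda>e. Z - {q \<in> pts C i. q e}"
      have "\<exists>q\<in>Z. q x \<and> q y"
      proof (rule ccontr)
        assume "\<not> (\<exists>q\<in>Z. q x \<and> q y)"
        then have "Z = ?D x \<union> ?D y" by blast
        then have "Z = ?D x \<or> Z = ?D y"
          by (intro irr closedin_diff cZ openin_ptI x y)
        then show False using xy Zp unfolding p_def by blast
      qed
      then show "p (Comp C i i i x y)" using Zp point_comp[OF _ x y] RIdem_comp[OF x y] unfolding p_def by blast
    qed
    show "p e \<longleftrightarrow> (\<exists>x\<in>S. p x)" if S: "S \<subseteq> RIdem C i" and e: "is_join C i i S e" for S e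
    proof -
      have "(\<exists>q\<in>Z. q e) \<longleftrightarrow> (\<exists>q\<in>Z. \<exists>x\<in>S. q x)" using point_join[OF _ S e] Zp by blast
      then show ?thesis using join_RIdem[OF S e] S unfolding p_def by blast
    qed
  qed
  \<comment> \<open>Closures of points are read off from the specialization order on points; this
    also yields uniqueness of the generic point.\<close>
  have cl: "q \<in> ?T closure_of {r} \<longleftrightarrow> q \<in> pts C i \<and> (\<forall>e\<in>RIdem C i. q e \<longrightarrow> r e)"
    if r: "r \<in> pts C i" for q r
  proof -
    have "q \<in> ?T closure_of {r} \<longleftrightarrow> q \<in> pts C i \<and> (\<forall>G. q \<in> G \<and> openin ?T G \<longrightarrow> r \<in> G)"
      by (simp add: in_closure_of topspace_pt[OF i])
    moreover have "(\<forall>G. q \<in> G \<and> openin ?T G \<longrightarrow> r \<in> G) \<longleftrightarrow> (\<forall>e\<in>RIdem C i. q e \<longrightarrow> r e)"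
      if q: "q \<in> pts C i"
    proof (rule iffI; intro ballI allI impI)
      fix e assume H: "\<forall>G. q \<in> G \<and> openin ?T G \<longrightarrow> r \<in> G" and e: "e \<in> RIdem C i" "q e"
      have "r \<in> {p \<in> pts C i. p e}" by (rule H[rule_format]) (use q e openin_ptI in simp)
      then show "r e" by simp
    next
      fix G assume H: "\<forall>e\<in>RIdem C i. q e \<longrightarrow> r e" and G: "q \<in> G \<and> openin ?T G"
      then obtain e where "e \<in> RIdem C i" "G = {p \<in> pts C i. p e}" using openin_pt[OF i] by auto
      then show "r \<in> G" using H G r by simp
    qed
    ultimately show ?thesis by blast
  qed
  show "\<exists>!x. x \<in> topspace ?T \<and> Z = ?T closure_of {x}"
  proof (rule ex1I[of _ p])
    have "q \<in> Z" if q: "q \<in> pts C i" "\<forall>e\<in>RIdem C i. q e \<longrightarrow> p e" for q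
    proof (rule ccontr)
      assume nq: "q \<notin> Z"
      have "openin ?T (pts C i - Z)" using cZ topspace_pt[OF i] unfolding closedin_def by simp
      then obtain e where e: "e \<in> RIdem C i" "pts C i - Z = {q \<in> pts C i. q e}"
        unfolding openin_pt[OF i] by auto
      have "q \<in> pts C i - Z" using q nq by simp
      then have "q e" unfolding e(2) by simp
      then have "p e" using q(2) e(1) by simp
      then obtain r where r: "r \<in> Z" "r e" unfolding p_def by blast
      then have "r \<in> pts C i - Z" unfolding e(2) using Zp by auto
      then show False using r by simp
    qed
    moreover have "q \<in> pts C i" "\<forall>e\<in>RIdem C i. q e \<longrightarrow> p e" if "q \<in> Z" for q
      using that Zp by (auto simp: p_def)
    ultimately have "q \<in> Z \<longleftrightarrow> q \<in> ?T closure_of {p}" for q unfolding cl[OF p] by metis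
    then have "Z = ?T closure_of {p}" by (rule Set.set_eqI)
    then show "p \<in> topspace ?T \<and> Z = ?T closure_of {p}" using p topspace_pt[OF i] by simp
  next
    fix r assume r: "r \<in> topspace ?T \<and> Z = ?T closure_of {r}"
    then have rp: "r \<in> pts C i" using topspace_pt[OF i] by simp
    have qZ: "q \<in> Z \<longleftrightarrow> q \<in> pts C i \<and> (\<forall>e\<in>RIdem C i. q e \<longrightarrow> r e)" for q
      using r cl[OF rp, of q] by simp
    then have "r \<in> Z" using rp by simp
    then have "r e \<longleftrightarrow> p e" for e
      using qZ point_RIdem[OF rp, of e] unfolding p_def by metis
    then show "r = p" by (rule ext)
  qed
qed

section \<open>Sobriety of a space of objects in terms of points of its locale\<close>

context counit_cat
begin

lemma px_Eta:
  assumes "i \<in> Ix X" "openin (Sp X i) G" "x \<in> sp X i"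
  shows "pp i x (Eta X i |` G) \<longleftrightarrow> x \<in> G"
  using px_RIdem[OF X.Eta_restrict_RIdem[OF assms(1,2)]] assms
  by (simp add: X.Eta_app[OF assms(1)] domIff)

lemma dom_RIdem_open: "e \<in> RIdem C i \<Longrightarrow> openin (Sp X i) (dom e)"
  using Top_pD(1)[OF X.Phi_homD(3)[of e i i]] by (simp add: RIdem_def)

lemma px_inj:
  assumes "i \<in> Ix X" "x \<in> sp X i" "y \<in> sp X i"
    "\<And>G. openin (Sp X i) G \<Longrightarrow> x \<in> G \<longleftrightarrow> y \<in> G"
  shows "pp i x = pp i y"
  using assms(4)[OF dom_RIdem_open] by (auto simp: px_def fun_eq_iff)

text \<open>The hypothesis says that the open sets containing \<open>x\<close> are those meeting
  \<open>Z\<close>. A point outside \<open>Z\<close> has the complement of \<open>Z\<close> as a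
  neighbourhood missing \<open>x\<close>, and a point of \<open>Z\<close> has no such
  neighbourhood.\<close>

lemma closure_char:
  assumes i: "i \<in> Ix X" and Z: "closedin (Sp X i) Z" and x: "x \<in> sp X i"
    and p: "\<And>G. openin (Sp X i) G \<Longrightarrow> pp i x (Eta X i |` G) \<longleftrightarrow> G \<inter> Z \<noteq> {}"
  shows "Z = Sp X i closure_of {x}"
proof -
  have xG: "x \<in> G \<longleftrightarrow> G \<inter> Z \<noteq> {}" if "openin (Sp X i) G" for G
    using p[OF that] px_Eta[OF i that x] by simp
  have "y \<in> Z" if y: "y \<in> sp X i" "\<And>G. y \<in> G \<Longrightarrow> openin (Sp X i) G \<Longrightarrow> x \<in> G" for y
  proof (rule ccontr)
    assume ny: "y \<notin> Z"
    have o: "openin (Sp X i) (sp X i - Z)" using Z unfolding closedin_def by blast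
    then have "x \<in> sp X i - Z" using y ny by blast
    then show False using xG[OF o] by blast
  qed
  moreover have "x \<in> G" if "y \<in> Z" "y \<in> G" "openin (Sp X i) G" for y G
    using xG[OF that(3)] that by blast
  ultimately show ?thesis using closedin_subset[OF Z] unfolding closure_of_def by blast
qed

text \<open>Points of the locale correspond to irreducible closed sets: a point goes to the
  complement of the largest open set at which it fails, and a closed \<open>Z\<close> to the point
  holding at the open sets that meet \<open>Z\<close>. Under this correspondence
  \<open>pp i x\<close> matches the closure of \<open>x\<close>.\<close>

lemma sober_iff:
  assumes i: "i \<in> Ix X"
  shows "sober (Sp X i) \<longleftrightarrow> (\<forall>p\<in>pts C i. \<exists>!x. x \<in> sp X i \<and> pp i x = p)"
proof
  have iC: "i \<in> Obj C" using i by simp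
  assume sob: "sober (Sp X i)"
  show "\<forall>p\<in>pts C i. \<exists>!x. x \<in> sp X i \<and> pp i x = p"
  proof
    fix p assume p: "p \<in> pts C i"
    let ?S = "{e \<in> RIdem C i. \<not> p e}"
    \<comment> \<open>The largest idempotent at which \<open>p\<close> fails: it is a join of such
      idempotents, and points respect joins, so \<open>p\<close> fails at it too.\<close>
    obtain E where E: "E \<in> RIdem C i" "is_join C i i ?S E" using C.RIdem_has_join[OF iC, of ?S] by blast
    have "?S \<subseteq> RIdem C i" by blast
    then have nE: "\<not> p E" using C.point_join[OF p _ E(2)] by blast
    have EH: "E \<in> Phi_hom v X i i" using C.RIdem_in[OF E(1)] by simp
    define Z where "Z = sp X i - dom E"
    have Z: "closedin (Sp X i) Z" unfolding Z_def by (intro closedin_diff closedin_topspace dom_RIdem_open E)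
    have pe: "p e \<longleftrightarrow> dom e \<inter> Z \<noteq> {}" if e: "e \<in> RIdem C i" for e
    proof -
      have eH: "e \<in> Phi_hom v X i i" using C.RIdem_in[OF e] by simp
      have "p e \<longleftrightarrow> \<not> dom e \<subseteq> dom E"
      proof
        assume pe: "p e"
        show "\<not> dom e \<subseteq> dom E"
        proof
          assume sub: "dom e \<subseteq> dom E"
          have "rle C i i e E"
            unfolding X.rle_UPhi[OF eH EH] map_le_def
            using sub X.RIdem_UPhi_Some[OF e] X.RIdem_UPhi_Some[OF E(1)] by (metis domD subsetD)
          then show False using C.point_mono[OF p pe E(1)] nE by blast
        qed
      next
        assume nsub: "\<not> dom e \<subseteq> dom E"
        show "p e"
        proof (rule ccontr)
          assume "\<not> p e"
          then have "rle C i i e E" using C.is_join_ub[OF E(2)] e by blast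
          then show False using nsub X.rle_UPhi[OF eH EH] map_le_implies_dom_le by blast
        qed
      qed
      then show ?thesis using openin_subset[OF dom_RIdem_open[OF e]] unfolding Z_def by blast
    qed
    have pG: "p (Eta X i |` G) \<longleftrightarrow> G \<inter> Z \<noteq> {}" if G: "openin (Sp X i) G" for G
      using pe[OF X.Eta_restrict_RIdem[OF i G]] X.dom_Eta_restrict[OF i, of G] openin_subset[OF G]
      by (simp add: Int_absorb1)
    have "irreducible_closed (Sp X i) Z"
      unfolding irreducible_closed_def
    proof (intro conjI allI impI)
      show "closedin (Sp X i) Z" by (rule Z)
      show "Z \<noteq> {}" using pe[OF C.idn_RIdem[OF iC]] C.point_idn[OF iC p] by blast
      fix Z1 Z2 assume H: "closedin (Sp X i) Z1" "closedin (Sp X i) Z2" "Z = Z1 \<union> Z2"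
      show "Z = Z1 \<or> Z = Z2"
      proof (rule ccontr)
        assume n: "\<not> (Z = Z1 \<or> Z = Z2)"
        \<comment> \<open>If both parts were proper, their open complements would meet
          \<open>Z\<close>, so \<open>p\<close> would hold at both and hence at their meet, which is
          disjoint from \<open>Z\<close>.\<close>
        let ?e1 = "Eta X i |` (sp X i - Z1)" and ?e2 = "Eta X i |` (sp X i - Z2)"
        have o: "openin (Sp X i) (sp X i - Z1)" "openin (Sp X i) (sp X i - Z2)"
          using H unfolding closedin_def by blast+
        note e = X.Eta_restrict_RIdem[OF i o(1)] X.Eta_restrict_RIdem[OF i o(2)]
        have Zs: "Z \<subseteq> sp X i" by (auto simp: Z_def)
        have "p ?e1" "p ?e2" using pG[OF o(1)] pG[OF o(2)] n H(3) Zs by blast+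
        then have "p (pc X i i i ?e1 ?e2)" using C.point_comp[OF p e] by simp
        moreover have ec: "pc X i i i ?e1 ?e2 \<in> RIdem C i" using C.RIdem_comp[OF e] by simp
        moreover have "dom (pc X i i i ?e1 ?e2) \<subseteq> dom ?e1 \<inter> dom ?e2"
          using pc_RIdem_Some[OF e(2), of ?e1 i] C.RIdem_in[OF e(1)] by (auto simp: dom_def split: if_splits)
        ultimately have "dom ?e1 \<inter> dom ?e2 \<inter> Z \<noteq> {}" using pe[OF ec] by blast
        then show False using H(3) X.dom_Eta_restrict[OF i] by blast
      qed
    qed
    then have ex: "\<exists>!x. x \<in> sp X i \<and> Z = Sp X i closure_of {x}" using sob unfolding sober_def by blast
    have eq: "pp i x = p \<longleftrightarrow> Z = Sp X i closure_of {x}" if x: "x \<in> sp X i" for x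
    proof
      assume "pp i x = p"
      then show "Z = Sp X i closure_of {x}" using closure_char[OF i Z x] pG by simp
    next
      assume Zx: "Z = Sp X i closure_of {x}"
      show "pp i x = p"
      proof
        fix e
        show "pp i x e = p e"
        proof (cases "e \<in> RIdem C i")
          case True
          have "x \<in> dom e \<longleftrightarrow> dom e \<inter> Z \<noteq> {}"
            unfolding Zx openin_Int_closure_of_eq_empty[OF dom_RIdem_open[OF True]] by simp
          then show ?thesis using pe[OF True] px_RIdem[OF True] by simp
        qed (use C.point_RIdem[OF p] in \<open>auto simp: px_def\<close>)
      qed
    qed
    then show "\<exists>!x. x \<in> sp X i \<and> pp i x = p" using ex by blast
  qed
next
  have iC: "i \<in> Obj C" using i by simp
  assume bij: "\<forall>p\<in>pts C i. \<exists>!x. x \<in> sp X i \<and> pp i x = p"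
  show "sober (Sp X i)"
    unfolding sober_def
  proof (intro allI impI)
    fix Z assume "irreducible_closed (Sp X i) Z"
    then have Z: "closedin (Sp X i) Z" and nZ: "Z \<noteq> {}"
      and irr: "\<And>Z1 Z2. closedin (Sp X i) Z1 \<Longrightarrow> closedin (Sp X i) Z2 \<Longrightarrow> Z = Z1 \<union> Z2 \<Longrightarrow> Z = Z1 \<or> Z = Z2"
      unfolding irreducible_closed_def by blast+
    have Zs: "Z \<subseteq> sp X i" by (rule closedin_subset[OF Z])
    define p where "p = (\<lambda>e. e \<in> RIdem C i \<and> dom e \<inter> Z \<noteq> {})"
    have p: "p \<in> pts C i"
      unfolding C.points_iff[OF iC]
    proof (intro conjI allI ballI impI)
      show "p x \<Longrightarrow> x \<in> RIdem C i" for x by (simp add: p_def)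
      have "dom (Eta X i) = sp X i" by (auto simp: X.Eta_app[OF i] split: if_splits)
      then show "p (Idn C i)" using nZ Zs C.idn_RIdem[OF iC] by (auto simp: p_def)
      show "p (Comp C i i i e d) \<longleftrightarrow> p e \<and> p d" if e: "e \<in> RIdem C i" and d: "d \<in> RIdem C i" for e d
      proof -
        have dm: "dom (pc X i i i e d) = dom e \<inter> dom d"
          using pc_RIdem_Some[OF d, of e i] C.RIdem_in[OF e] by (auto simp: dom_def split: if_splits)
        have "dom e \<inter> dom d \<inter> Z \<noteq> {} \<longleftrightarrow> dom e \<inter> Z \<noteq> {} \<and> dom d \<inter> Z \<noteq> {}"
        proof (intro iffI conjI)
          assume H: "dom e \<inter> Z \<noteq> {} \<and> dom d \<inter> Z \<noteq> {}"
          show "dom e \<inter> dom d \<inter> Z \<noteq> {}"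
          proof
            assume "dom e \<inter> dom d \<inter> Z = {}"
            then have "Z = (Z - dom e) \<union> (Z - dom d)" by blast
            then have "Z = Z - dom e \<or> Z = Z - dom d"
              by (intro irr closedin_diff Z dom_RIdem_open e d)
            then show False using H by blast
          qed
        qed blast+
        then show ?thesis using C.RIdem_comp[OF e d] e d by (simp add: p_def dm)
      qed
      show "p e \<longleftrightarrow> (\<exists>y\<in>S. p y)" if S: "S \<subseteq> RIdem C i" and e: "is_join C i i S e" for S e
      proof -
        have SP: "S \<subseteq> Phi_hom v X i i" using S C.RIdem_in by auto
        have de: "dom e = (\<Union>y\<in>S. dom y)"
          using e unfolding X.is_join_UPhi[OF SP] by (auto simp: dom_def)
        have "dom e \<inter> Z \<noteq> {} \<longleftrightarrow> (\<exists>y\<in>S. dom y \<inter> Z \<noteq> {})" unfolding de by auto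
        moreover have "(\<exists>y\<in>S. p y) \<longleftrightarrow> (\<exists>y\<in>S. dom y \<inter> Z \<noteq> {})"
          unfolding p_def using S by (intro bex_cong refl) auto
        moreover have "p e \<longleftrightarrow> dom e \<inter> Z \<noteq> {}" using C.join_RIdem[OF S e] by (simp only: p_def simp_thms)
        ultimately show ?thesis by simp
      qed
    qed
    have pG: "p (Eta X i |` G) \<longleftrightarrow> G \<inter> Z \<noteq> {}" if G: "openin (Sp X i) G" for G
      using X.Eta_restrict_RIdem[OF i G] X.dom_Eta_restrict[OF i, of G] openin_subset[OF G]
      by (simp add: p_def Int_absorb1)
    obtain x where x: "x \<in> sp X i" "pp i x = p" using bij p by blast
    have Zx: "Z = Sp X i closure_of {x}" by (rule closure_char[OF i Z x(1)]) (use pG x in simp)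
    show "\<exists>!x. x \<in> sp X i \<and> Z = Sp X i closure_of {x}"
    proof (rule ex1I[of _ x])
      show "x \<in> sp X i \<and> Z = Sp X i closure_of {x}" using x Zx by blast
      fix y assume y: "y \<in> sp X i \<and> Z = Sp X i closure_of {y}"
      \<comment> \<open>An open set contains a point exactly when it meets the closure of that
        point, so points with the same closure have the same image under
        \<open>pp i\<close>.\<close>
      have "y \<in> G \<longleftrightarrow> x \<in> G" if G: "openin (Sp X i) G" for G
      proof -
        have "r \<in> G \<longleftrightarrow> G \<inter> Z \<noteq> {}" if "r \<in> sp X i" "Z = Sp X i closure_of {r}" for r
          unfolding that(2) openin_Int_closure_of_eq_empty[OF G] by simp
        then show ?thesis using x Zx y by blast
      qed
      then have "pp i y = pp i x" using px_inj[OF i] x y by blast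
      then show "y = x" using bij p x y by blast
    qed
  qed
qed

end

section \<open>Sections through a given arrow\<close>

context icat
begin

text \<open>For categories a local inverse of the source map suffices. For groupoids the target must
  be invertible along the section too: a local section \<open>s\<close> of the source and a local
  section \<open>t\<close> of the target through \<open>a\<close> are taken, and \<open>s\<close> is
  cut down to the arrows that lie on both.\<close>

lemma section_through:
  assumes I: "i \<in> Ix X" "j \<in> Ix X" and a: "a \<in> ar X i j"
  shows "\<exists>s\<in>Phi_hom v X i j. s (sr X i j a) = Some a"
proof -
  have loc: "\<exists>t. t \<in> Top_p (Sp X i) (Ar X i j) \<and> Src X i j \<circ>\<^sub>m t = rstp t \<and> t (sr X i j a) = Some a"
    if H: "i \<in> Ix X" "j \<in> Ix X" "a \<in> ar X i j" for i j a
  proof -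
    obtain u where u: "u \<in> partial_isos (Ar X i j) (Sp X i)" "a \<in> dom u" "u \<subseteq>\<^sub>m Src X i j"
      using src_local_homeo[OF H(1,2)] H(3) unfolding local_homeo_iff by blast
    then obtain t where t: "t \<in> Top_p (Sp X i) (Ar X i j)" "\<And>x y. u x = Some y \<longleftrightarrow> t y = Some x"
      unfolding partial_isos_iff by blast
    have "(Src X i j \<circ>\<^sub>m t) x = Some y \<longleftrightarrow> rstp t x = Some y" for x y
    proof -
      have "Src X i j b = Some x" if "t x = Some b" for b
        using t(2)[of b x] u(3) that unfolding map_le_iff_Some by blast
      then show ?thesis unfolding map_comp_Some_iff rstp_Some by (metis domD domI option.inject)
    qed
    then have "Src X i j \<circ>\<^sub>m t = rstp t" by (rule map_eqI)
    moreover obtain x where x: "u a = Some x" using u(2) by blast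
    then have "Src X i j a = Some x" using u(3) unfolding map_le_iff_Some by blast
    then have "x = sr X i j a" by (simp add: sr_def)
    then have "t (sr X i j a) = Some a" using t(2) x by blast
    ultimately show ?thesis using t(1) by blast
  qed
  obtain s where s: "s \<in> Top_p (Sp X i) (Ar X i j)" "Src X i j \<circ>\<^sub>m s = rstp s" "s (sr X i j a) = Some a"
    using loc[OF I a] by blast
  have ss: "sr X i j b = x" if "s x = Some b" for x b
    using section_Some[OF s(2) that] by (simp add: sr_def)
  show ?thesis
  proof (cases v)
    case Categories
    then have "s \<in> Phi_hom v X i j" unfolding Phi_hom_iff using I s(1) ss by auto
    then show ?thesis using s(3) by blast
  next
    case Groupoids
    interpret etale_groupoid X by (rule groupoid[OF Groupoids])
    note ia = iv_props[OF I a]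
    \<comment> \<open>A source section through the inverse arrow, followed by inversion, is a
      section of the target map through \<open>a\<close>.\<close>
    obtain t0 where t0: "t0 \<in> Top_p (Sp X j) (Ar X j i)" "Src X j i \<circ>\<^sub>m t0 = rstp t0"
        "t0 (sr X j i (iv X i j a)) = Some (iv X i j a)"
      using loc[OF I(2,1) ia(1)] by blast
    define t where "t = iota X j i \<circ>\<^sub>m t0"
    have tT: "t \<in> Top_p (Sp X j) (Ar X i j)"
      unfolding t_def by (rule Top_p_comp[OF t0(1) total_mapsD(1)[OF iota_props(1)[OF I(2,1)]]])
    have t_Some: "t y = Some b \<longleftrightarrow> (\<exists>c. t0 y = Some c \<and> b = iv X j i c)" for y b
      unfolding t_def map_comp_Some_iff iota_Some[OF I(2,1)] using Top_pD(6)[OF t0(1)] by blast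
    have ta: "t (tg X i j a) = Some a"
      unfolding t_Some using t0(3) ia(2,3) by (intro exI[of _ "iv X i j a"]) simp
    have tt: "tg X i j b = y" if tb: "t y = Some b" for y b
    proof -
      obtain c where c: "t0 y = Some c" "b = iv X j i c" using tb t_Some by blast
      have "sr X j i c = y" using section_Some[OF t0(2) c(1)] by (simp add: sr_def)
      then show ?thesis using iv_props'(1)[OF I(2,1) Top_pD(6)[OF t0(1) c(1)]] c(2) by simp
    qed
    \<comment> \<open>Inversion is an involution, so the image of \<open>t\<close> is the preimage
      of the open image of \<open>t0\<close>.\<close>
    have r: "pre (iota X i j) (ran t0) = ran t"
    proof (intro equalityI subsetI)
      fix b assume "b \<in> pre (iota X i j) (ran t0)"
      then obtain y where "b \<in> ar X i j" "t0 y = Some (iv X i j b)"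
        by (auto simp: pre_def ran_def iota_Some[OF I])
      then have "t y = Some b" unfolding t_Some using iv_props(2)[OF I] by metis
      then show "b \<in> ran t" by (rule ranI)
    next
      fix b assume "b \<in> ran t"
      then obtain y c where c: "t0 y = Some c" "b = iv X j i c" unfolding ran_def t_Some by blast
      note cA = Top_pD(6)[OF t0(1) c(1)]
      have "iota X i j b = Some c" using iv_props(1,2)[OF I(2,1) cA] c(2) iota_Some[OF I] by simp
      then show "b \<in> pre (iota X i j) (ran t0)" using c(1) by (auto simp: pre_def ran_def)
    qed
    have ot: "openin (Ar X i j) (ran t)"
      unfolding r[symmetric]
      by (rule Top_pD(4)[OF total_mapsD(1)[OF iota_props(1)[OF I]]
            local_homeo_section_open[OF src_local_homeo[OF I(2,1)] t0(1,2)]])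
    have os: "openin (Ar X i j) (ran s)" by (rule local_homeo_section_open[OF src_local_homeo[OF I] s(1,2)])
    \<comment> \<open>On arrows lying on both sections, the source and the target each determine the
      arrow, so the target map is injective along \<open>s'\<close>.\<close>
    define s' where "s' = s |` pre s (ran t)"
    have s'T: "s' \<in> Top_p (Sp X i) (Ar X i j)"
      unfolding s'_def by (rule restrict_Top_p[OF s(1) Top_pD(4)[OF s(1) ot]])
    have s': "s' x = Some b \<longleftrightarrow> s x = Some b \<and> b \<in> ran t" for x b
      unfolding s'_def by (auto simp: restrict_map_def pre_def)
    \<comment> \<open>The converse of the target map along \<open>s'\<close>: from a target to the
      arrow on \<open>t\<close>, and on to its source.\<close>
    define t' where "t' = Src X i j \<circ>\<^sub>m (t |` pre t (ran s))"
    have t'T: "t' \<in> Top_p (Sp X j) (Sp X i)"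
      unfolding t'_def
      by (rule Top_p_comp[OF restrict_Top_p[OF tT Top_pD(4)[OF tT os]] total_mapsD(1)[OF src[OF I]]])
    have t': "t' y = Some x \<longleftrightarrow> (\<exists>b. t y = Some b \<and> b \<in> ran s \<and> x = sr X i j b)" for x y
    proof -
      have "(t |` pre t (ran s)) y = Some b \<longleftrightarrow> t y = Some b \<and> b \<in> ran s" for b
        by (auto simp: restrict_map_def pre_def)
      then show ?thesis unfolding t'_def map_comp_Some_iff Src_Some[OF I] using Top_pD(6)[OF tT] by blast
    qed
    have "(Tgt X i j \<circ>\<^sub>m s') x = Some y \<longleftrightarrow> t' y = Some x" for x y
    proof
      assume "(Tgt X i j \<circ>\<^sub>m s') x = Some y"
      then obtain b where b: "s x = Some b" "b \<in> ran t" "y = tg X i j b"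
        unfolding map_comp_Some_iff s' Tgt_Some[OF I] by blast
      then obtain z where "t z = Some b" by (auto simp: ran_def)
      then have "t y = Some b" using tt b(3) by simp
      then show "t' y = Some x" unfolding t' using b(1) ss[OF b(1)] by (blast intro: ranI)
    next
      assume "t' y = Some x"
      then obtain b where b: "t y = Some b" "b \<in> ran s" "x = sr X i j b" unfolding t' by blast
      then obtain z where "s z = Some b" by (auto simp: ran_def)
      then have "s x = Some b" using ss b(3) by simp
      moreover have "b \<in> ran t" using b(1) by (rule ranI)
      moreover have "Tgt X i j b = Some y" using Tgt_Some[OF I] Top_pD(6)[OF tT b(1)] tt[OF b(1)] by simp
      ultimately show "(Tgt X i j \<circ>\<^sub>m s') x = Some y" unfolding map_comp_Some_iff s' by blast
    qed
    then have "Tgt X i j \<circ>\<^sub>m s' \<in> partial_isos (Sp X i) (Sp X j)"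
      unfolding partial_isos_iff using t'T Top_p_comp[OF s'T total_mapsD(1)[OF tgt[OF I]]] by blast
    then have "s' \<in> Phi_hom v X i j" unfolding Phi_hom_iff using I s'T s' ss by blast
    moreover have "s' (sr X i j a) = Some a" unfolding s' using s(3) ta by (blast intro: ranI)
    ultimately show ?thesis by blast
  qed
qed

end

section \<open>Left fixpoints\<close>

context counit_cat
begin

text \<open>The object part of an inverse cofunctor is a two-sided inverse of \<open>pp i\<close>,
  and bijectivity of \<open>pp i\<close> is sobriety by \<open>sober_iff\<close>.\<close>

lemma left_fixpoint_sober:
  assumes L: "left_fixpoint v X" and i: "i \<in> Ix X"
  shows "sober (Sp X i)"
  unfolding sober_iff[OF i]
proof
  obtain G where G: "comp_cofunctor (PsiW C) G K = id_cofunctor (PsiW C)"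
      "comp_cofunctor X K G = id_cofunctor X"
    using L unfolding left_fixpoint_def cofunctor_iso_def by blast
  have iC: "i \<in> Obj C" using i by simp
  have "cix (comp_cofunctor (PsiW C) G K) i = cix (id_cofunctor (PsiW C)) i" unfolding G(1) ..
  then have ci: "cix G i = i" using i by (simp add: comp_cofunctor_def id_cofunctor_def counit_sel(1))
  have "cob (comp_cofunctor (PsiW C) G K) i = cob (id_cofunctor (PsiW C)) i" unfolding G(1) ..
  then have 1: "cob K i \<circ>\<^sub>m cob G i = idp (pt (RLoc C i))"
    using i by (simp add: comp_cofunctor_def id_cofunctor_def counit_sel(1))
  have "cob (comp_cofunctor X K G) i = cob (id_cofunctor X) i" unfolding G(2) ..
  then have 2: "cob G i \<circ>\<^sub>m cob K i = idp (Sp X i)"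
    using i by (simp add: comp_cofunctor_def id_cofunctor_def ci)
  fix p assume p: "p \<in> pts C i"
  then have "(cob K i \<circ>\<^sub>m cob G i) p = Some p" using 1 by (simp add: idp_def C.topspace_pt[OF iC])
  then obtain x where x: "cob G i p = Some x" "cob K i x = Some p" by (auto simp: map_comp_Some_iff)
  show "\<exists>!x. x \<in> sp X i \<and> pp i x = p"
  proof (rule ex1I[of _ x])
    show "x \<in> sp X i \<and> pp i x = p" using x(2) by (auto simp: cob_K[OF i] split: if_splits)
    fix y assume y: "y \<in> sp X i \<and> pp i y = p"
    then have "(cob G i \<circ>\<^sub>m cob K i) y = Some x" using x(1) by (simp add: cob_K[OF i])
    then show "y = x" using y 2 by (simp add: idp_def)
  qed
qed

definition unpx :: "'i \<Rightarrow> (('a \<rightharpoonup> 'b) \<Rightarrow> bool) \<Rightarrow> 'a" where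
  "unpx i p = (THE x. x \<in> sp X i \<and> pp i x = p)"

text \<open>An arrow \<open>a\<close> over the point corresponding to \<open>p\<close> is sent to
  the germ at \<open>p\<close> of a section through \<open>a\<close>. Such sections exist by
  \<open>section_through\<close>, and \<open>gm_px_eq\<close> makes the germ independent of the one
  chosen.\<close>

definition counit_inv ::
    "('i, 'a, 'b, 'i, ('a \<rightharpoonup> 'b) \<Rightarrow> bool, ('a \<rightharpoonup> 'b, ('a \<rightharpoonup> 'b) \<Rightarrow> bool) germ) cofun" where
  "counit_inv = \<lparr>cix = (\<lambda>i\<in>Ix X. i),
     cob = (\<lambda>i p. if i \<in> Ix X \<and> p \<in> pts C i then Some (unpx i p) else None),
     car = (\<lambda>i j (a, p). if i \<in> Ix X \<and> j \<in> Ix X \<and> p \<in> pts C i \<and> a \<in> ar X i j \<and> sr X i j a = unpx i p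
       then Some (gm C i j (SOME s. s \<in> Phi_hom v X i j \<and> s (unpx i p) = Some a) p) else None)\<rparr>"

lemma sober_left_fixpoint:
  assumes sob: "\<And>i. i \<in> Ix X \<Longrightarrow> sober (Sp X i)"
  shows "left_fixpoint v X"
proof -
  let ?G = counit_inv
  interpret SA: source_etale_category "PsiW C" by (rule C.PsiW_source_etale)
  have ex: "\<exists>!x. x \<in> sp X i \<and> pp i x = p" if "i \<in> Ix X" "p \<in> pts C i" for i p
    using sob[OF that(1), unfolded sober_iff[OF that(1)]] that(2) by (rule bspec)
  have u: "unpx i p \<in> sp X i \<and> pp i (unpx i p) = p" if "i \<in> Ix X" "p \<in> pts C i" for i p
    unfolding unpx_def by (rule theI'[OF ex[OF that]])
  have up: "unpx i (pp i x) = x" if i: "i \<in> Ix X" and x: "x \<in> sp X i" for i x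
    unfolding unpx_def by (rule the1_equality[OF ex[OF i px_point[OF i x]]]) (use x in simp)
  have ci: "cix ?G i = i" if "i \<in> Ix X" for i using that by (simp add: counit_inv_def)
  have cob: "cob ?G i = (\<lambda>p. if p \<in> pts C i then Some (unpx i p) else None)" if "i \<in> Ix X" for i
    using that by (simp add: counit_inv_def)
  have car: "car ?G i j (a, p) = Some b \<longleftrightarrow>
      p \<in> pts C i \<and> (\<exists>s. s \<in> Phi_hom v X i j \<and> s (unpx i p) = Some a \<and> b = gm C i j s p)"
    if I: "i \<in> Ix X" "j \<in> Ix X" for i j a p b
  proof (cases "p \<in> pts C i")
    case p: True
    let ?x = "unpx i p"
    have x: "?x \<in> sp X i" "pp i ?x = p" using u[OF I(1) p] by auto
    let ?s = "SOME s. s \<in> Phi_hom v X i j \<and> s ?x = Some a"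
    \<comment> \<open>Sections with the same value at the point have the same germ there, so the
      section picked by \<open>SOME\<close> may be replaced by any other through
      \<open>a\<close>.\<close>
    have g: "gm C i j s p = gm C i j ?s p \<and> a \<in> ar X i j \<and> sr X i j a = ?x"
      if s: "s \<in> Phi_hom v X i j" "s ?x = Some a" for s
    proof -
      have S: "?s \<in> Phi_hom v X i j \<and> ?s ?x = Some a" by (rule someI[of _ s]) (use s in blast)
      have "?x \<in> dom s" using s(2) by blast
      then have "gm C i j s (pp i ?x) = gm C i j ?s (pp i ?x)"
        using gm_px_eq[OF s(1) conjunct1[OF S] x(1)] S s(2) by simp
      then show ?thesis using x(2) X.Phi_homD(5,6)[OF s] by simp
    qed
    show ?thesis
    proof
      assume c: "car ?G i j (a, p) = Some b"
      then have aA: "a \<in> ar X i j" "sr X i j a = ?x" "b = gm C i j ?s p"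
        using I by (auto simp: counit_inv_def split: if_splits)
      obtain s where "s \<in> Phi_hom v X i j" "s ?x = Some a" using X.section_through[OF I aA(1)] aA(2) by auto
      then show "p \<in> pts C i \<and> (\<exists>s. s \<in> Phi_hom v X i j \<and> s ?x = Some a \<and> b = gm C i j s p)"
        using g aA(3) p by auto
    next
      assume "p \<in> pts C i \<and> (\<exists>s. s \<in> Phi_hom v X i j \<and> s ?x = Some a \<and> b = gm C i j s p)"
      then obtain s where "s \<in> Phi_hom v X i j" "s ?x = Some a" "b = gm C i j s p" by blast
      then show "car ?G i j (a, p) = Some b" using g[of s] p I by (simp add: counit_inv_def)
    qed
  next
    case False
    then show ?thesis by (simp add: counit_inv_def)
  qed
  have cobT: "cob ?G i \<in> total_maps (pt (RLoc C i)) (Sp X i)" if i: "i \<in> Ix X" for i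
  proof -
    have iC: "i \<in> Obj C" using i by simp
    show ?thesis
      unfolding total_maps_iff Top_p_iff
    proof (intro conjI allI impI)
      show "ran (cob ?G i) \<subseteq> sp X i" using u[OF i] by (auto simp: cob[OF i] ran_def)
      show "dom (cob ?G i) = topspace (pt (RLoc C i))"
        by (auto simp: cob[OF i] C.topspace_pt[OF iC] dom_def)
      fix V assume V: "openin (Sp X i) V"
      \<comment> \<open>The inverse of the bijection is continuous because each open
        \<open>V\<close> carries an idempotent, and that idempotent holds at the points coming from
        \<open>V\<close>.\<close>
      have "pre (cob ?G i) V = {p \<in> pts C i. p (Eta X i |` V)}"
      proof -
        have "unpx i p \<in> V \<longleftrightarrow> p (Eta X i |` V)" if p: "p \<in> pts C i" for p
          using px_Eta[OF i V] u[OF i p] by metis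
        then show ?thesis by (auto simp: cob[OF i] pre_def split: if_splits)
      qed
      then show "openin (pt (RLoc C i)) (pre (cob ?G i) V)"
        using C.openin_ptI[OF X.Eta_restrict_RIdem[OF i V]] by simp
    qed
  qed
  have D: "act_dom X (PsiW C) (cix ?G) (cob ?G) i j = fprod (Ar X i j) (pt (RLoc C i)) (Src X i j) (cob ?G i)"
    if "i \<in> Ix X" for i j using ci[OF that] by (simp add: act_dom_def)
  have Diff: "(a, p) \<in> topspace (fprod (Ar X i j) (pt (RLoc C i)) (Src X i j) (cob ?G i)) \<longleftrightarrow>
      p \<in> pts C i \<and> a \<in> ar X i j \<and> sr X i j a = unpx i p" if I: "i \<in> Ix X" "j \<in> Ix X" for i j a p
  proof -
    have iC: "i \<in> Obj C" using I by simp
    have "Src X i j a = cob ?G i p \<longleftrightarrow> sr X i j a = unpx i p" if "a \<in> ar X i j" "p \<in> pts C i"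
    proof -
      have "Src X i j a = Some (sr X i j a)" using X.Src_Some[OF I] that by simp
      then show ?thesis using that by (simp add: cob[OF I(1)])
    qed
    then show ?thesis by (auto simp: C.topspace_pt[OF iC])
  qed
  have sec: "\<exists>s. s \<in> Phi_hom v X i j \<and> s (unpx i p) = Some a"
    if "i \<in> Ix X" "j \<in> Ix X" "a \<in> ar X i j" "sr X i j a = unpx i p" for i j a p
    using X.section_through[OF that(1-3)] that(4) by auto
  have sd: "p (Rst C i j s)" if "p \<in> pts C i" "s \<in> Phi_hom v X i j" "s (unpx i p) = Some a" for p i j s a
    using px_rst[OF that(2), of "unpx i p"] u[OF X.Phi_homD(1)[OF that(2)] that(1)] that(3) by auto
  have "pre_cofunctor X (PsiW C) ?G"
  proof unfold_locales
    show "cix ?G \<in> Ix X \<rightarrow>\<^sub>E Ix (PsiW C)" by (simp add: counit_inv_def)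
    show "\<And>i. i \<notin> Ix X \<Longrightarrow> cob ?G i = Map.empty" by (simp add: counit_inv_def)
    show "\<And>i j. i \<notin> Ix X \<or> j \<notin> Ix X \<Longrightarrow> car ?G i j = Map.empty"
      by (auto simp: counit_inv_def fun_eq_iff)
    show "\<And>i. i \<in> Ix X \<Longrightarrow> cob ?G i \<in> total_maps (Sp (PsiW C) (cix ?G i)) (Sp X i)"
      using cobT ci by simp
    fix i j assume I: "i \<in> Ix X" "j \<in> Ix X"
    have dm: "dom (car ?G i j) = topspace (fprod (Ar X i j) (pt (RLoc C i)) (Src X i j) (cob ?G i))"
      (is "_ = topspace ?D")
    proof -
      have "(a, p) \<in> dom (car ?G i j) \<longleftrightarrow> (a, p) \<in> topspace ?D" for a p
      proof -
        have "(a, p) \<in> dom (car ?G i j) \<longleftrightarrow> (\<exists>b. car ?G i j (a, p) = Some b)"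
          by (simp add: dom_def)
        also have "\<dots> \<longleftrightarrow> p \<in> pts C i \<and> (\<exists>s\<in>Phi_hom v X i j. s (unpx i p) = Some a)"
          unfolding car[OF I] by blast
        also have "\<dots> \<longleftrightarrow> (a, p) \<in> topspace ?D"
          unfolding Diff[OF I]
        proof (intro conj_cong refl iffI)
          assume "\<exists>s\<in>Phi_hom v X i j. s (unpx i p) = Some a"
          then obtain s where s: "s \<in> Phi_hom v X i j" "s (unpx i p) = Some a" by blast
          then show "a \<in> ar X i j \<and> sr X i j a = unpx i p" using X.Phi_homD(5,6)[OF s] by simp
        next
          assume "a \<in> ar X i j \<and> sr X i j a = unpx i p"
          then show "\<exists>s\<in>Phi_hom v X i j. s (unpx i p) = Some a" using sec[OF I, of a p] by blast
        qed
        finally show ?thesis .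
      qed
      then show ?thesis by (simp only: set_eq_iff split_paired_All simp_thms)
    qed
    have "car ?G i j \<in> Top_p ?D (germ_space (W C) i j)"
    proof (rule fprod_Top_pI[OF X.src_local_homeo[OF I] cobT[OF I(1)], of "Phi_hom v X i j"])
      show "s \<in> Top_p (Sp X i) (Ar X i j)" "Src X i j \<circ>\<^sub>m s = rstp s" if "s \<in> Phi_hom v X i j" for s
        using that by (auto simp: Phi_hom_def)
      show "\<exists>s\<in>Phi_hom v X i j. a \<in> ran s" if "a \<in> ar X i j" for a
        using X.section_through[OF I that] by (blast intro: ranI)
      show "dom (car ?G i j) \<subseteq> topspace ?D" using dm by simp
      fix s assume s: "s \<in> Phi_hom v X i j"
      then have sH: "s \<in> Hom C i j" by simp
      \<comment> \<open>Along a section \<open>s\<close> the candidate inverse becomes the section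
        of germs of \<open>s\<close>, which is continuous. As sections pass through all arrows,
        \<open>fprod_Top_pI\<close> then gives continuity.\<close>
      have "car ?G i j \<circ>\<^sub>m pairp (s \<circ>\<^sub>m cob ?G i) (rstp (s \<circ>\<^sub>m cob ?G i)) = sect (W C) i j s"
      proof (rule map_eqI)
        fix p b
        have "(car ?G i j \<circ>\<^sub>m pairp (s \<circ>\<^sub>m cob ?G i) (rstp (s \<circ>\<^sub>m cob ?G i))) p = Some b \<longleftrightarrow>
            (\<exists>a. p \<in> pts C i \<and> s (unpx i p) = Some a \<and> car ?G i j (a, p) = Some b)"
          unfolding comp_pairp_rstp_Some unfolding map_comp_Some_iff by (auto simp: cob[OF I(1)] split: if_splits)
        also have "\<dots> \<longleftrightarrow> sect (W C) i j s p = Some b"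
        proof
          assume "\<exists>a. p \<in> pts C i \<and> s (unpx i p) = Some a \<and> car ?G i j (a, p) = Some b"
          then obtain a t where H: "p \<in> pts C i" "s (unpx i p) = Some a" "t \<in> Phi_hom v X i j"
              "t (unpx i p) = Some a" "b = gm C i j t p" unfolding car[OF I] by blast
          have "unpx i p \<in> dom t" using H(4) by blast
          then have "gm C i j t (pp i (unpx i p)) = gm C i j s (pp i (unpx i p))"
            using gm_px_eq[OF H(3) s conjunct1[OF u[OF I(1) H(1)]]] H(2,4) by simp
          then show "sect (W C) i j s p = Some b"
            using H sd[OF H(1) s H(2)] u[OF I(1) H(1)] by (simp add: C.sect_W[OF sH])
        next
          assume "sect (W C) i j s p = Some b"
          then have p: "p \<in> pts C i" "p (rs X i j s)" "b = gm C i j s p"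
            by (auto simp: C.sect_W[OF sH] split: if_splits)
          then have "unpx i p \<in> dom s" using px_rst[OF s, of "unpx i p"] u[OF I(1) p(1)] by simp
          then show "\<exists>a. p \<in> pts C i \<and> s (unpx i p) = Some a \<and> car ?G i j (a, p) = Some b"
            using p s unfolding car[OF I] by blast
        qed
        finally show "(car ?G i j \<circ>\<^sub>m pairp (s \<circ>\<^sub>m cob ?G i) (rstp (s \<circ>\<^sub>m cob ?G i))) p = Some b \<longleftrightarrow>
            sect (W C) i j s p = Some b" .
      qed
      then show "car ?G i j \<circ>\<^sub>m pairp (s \<circ>\<^sub>m cob ?G i) (rstp (s \<circ>\<^sub>m cob ?G i)) \<in>
          Top_p (pt (RLoc C i)) (germ_space (W C) i j)"
        using C.sect_Top_p[OF sH] by simp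
    qed
    then show "car ?G i j \<in> total_maps (act_dom X (PsiW C) (cix ?G) (cob ?G) i j)
        (Ar (PsiW C) (cix ?G i) (cix ?G j))"
      unfolding total_maps_iff D[OF I(1)] ci[OF I(1)] ci[OF I(2)] using dm by simp
  qed
  then interpret P: pre_cofunctor X "PsiW C" ?G .
  have co: "co ?G i p = unpx i p" if "i \<in> Ix X" "p \<in> pts C i" for i p
    using that by (simp add: co_def cob)
  have ca: "ca ?G i j a p = gm C i j s p" if "p \<in> pts C i" "s \<in> Phi_hom v X i j" "s (unpx i p) = Some a"
    for i j a p s
  proof -
    have "car ?G i j (a, p) = Some (gm C i j s p)"
      using car[OF X.Phi_homD(1,2)[OF that(2)]] that by blast
    then show ?thesis by (simp add: ca_def)
  qed
  have sp: "p \<in> sp (PsiW C) (cix ?G i) \<longleftrightarrow> p \<in> pts C i" if "i \<in> Ix X" for i p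
    using C.topspace_pt[of i] that ci[OF that] by simp
  have tgs: "tg (PsiW C) i j (gm C i j s p) = pp j (tg X i j a)" "sr (PsiW C) i j (gm C i j s p) = p"
    if H: "p \<in> pts C i" "s \<in> Phi_hom v X i j" "s (unpx i p) = Some a" for i j s p a
  proof -
    have sH: "s \<in> Hom C i j" using H(2) by simp
    show "sr (PsiW C) i j (gm C i j s p) = p" by (rule C.sr_gm[OF sH H(1) sd[OF H]])
    show "tg (PsiW C) i j (gm C i j s p) = pp j (tg X i j a)"
      using C.tg_gm[OF sH H(1) sd[OF H]] push_px[OF H(2,3)] u[OF X.Phi_homD(1)[OF H(2)] H(1)] by simp
  qed
  have P.src_ax
    unfolding P.src_ax_def
  proof (intro ballI impI)
    fix i j a p assume H: "i \<in> Ix X" "j \<in> Ix X" "a \<in> ar X i j" "p \<in> sp (PsiW C) (cix ?G i)"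
      "sr X i j a = co ?G i p"
    have p: "p \<in> pts C i" using sp[OF H(1)] H(4) by blast
    obtain s where s: "s \<in> Phi_hom v X i j" "s (unpx i p) = Some a"
      using sec[OF H(1-3)] H(5) co[OF H(1) p] by auto
    note y = X.Phi_homD(7)[OF s]
    show "sr (PsiW C) (cix ?G i) (cix ?G j) (ca ?G i j a p) = p \<and>
        co ?G j (tg (PsiW C) (cix ?G i) (cix ?G j) (ca ?G i j a p)) = tg X i j a"
      unfolding ci[OF H(1)] ci[OF H(2)] ca[OF p s] tgs[OF p s]
      using co[OF H(2) px_point[OF H(2) y]] up[OF H(2) y] by simp
  qed
  moreover have P.unit_ax
    unfolding P.unit_ax_def
  proof (intro ballI)
    fix i p assume H: "i \<in> Ix X" "p \<in> sp (PsiW C) (cix ?G i)"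
    have p: "p \<in> pts C i" using sp[OF H(1)] H(2) by blast
    have "Eta X i (unpx i p) = Some (et X i (unpx i p))" using X.Eta_Some[OF H(1)] u[OF H(1) p] by simp
    then show "ca ?G i i (et X i (co ?G i p)) p = et (PsiW C) (cix ?G i) p"
      unfolding co[OF H(1) p] ci[OF H(1)] using ca[OF p X.Eta_Phi_hom[OF H(1)]] C.et_PsiW[of i p] H(1) p by simp
  qed
  moreover have P.mult_ax
    unfolding P.mult_ax_def
  proof (intro ballI impI)
    fix i j k a b p assume H: "i \<in> Ix X" "j \<in> Ix X" "k \<in> Ix X" "a \<in> ar X i j" "b \<in> ar X j k"
      "p \<in> sp (PsiW C) (cix ?G i)" "sr X i j a = co ?G i p" "sr X j k b = tg X i j a"
    have p: "p \<in> pts C i" using sp[OF H(1)] H(6) by blast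
    obtain s where s: "s \<in> Phi_hom v X i j" "s (unpx i p) = Some a"
      using sec[OF H(1,2,4)] H(7) co[OF H(1) p] by auto
    define q where "q = pp j (tg X i j a)"
    note y = X.Phi_homD(7)[OF s]
    have q: "q \<in> pts C j" unfolding q_def by (rule px_point[OF H(2) y])
    have uq: "unpx j q = tg X i j a" unfolding q_def by (rule up[OF H(2) y])
    obtain t where t: "t \<in> Phi_hom v X j k" "t (unpx j q) = Some b"
      using sec[OF H(2,3,5)] H(8) uq by metis
    have sH: "s \<in> Hom C i j" "t \<in> Hom C j k" using s t by auto
    have pq: "push C i j s p = q"
      using push_px[OF s] u[OF H(1) p] by (simp add: q_def)
    have ts: "pc X i j k t s (unpx i p) = Some (mu X i j k b a)"
      using s t uq by (simp add: X.pc_app[OF s(1) t(1)])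
    have m: "mu (PsiW C) i j k (gm C j k t q) (gm C i j s p) = gm C i k (pc X i j k t s) p"
      using C.mu_gm[OF sH(1) p sd[OF p s] sH(2)] sd[OF q t] unfolding pq by simp
    show "ca ?G i k (mu X i j k b a) p = mu (PsiW C) (cix ?G i) (cix ?G j) (cix ?G k)
        (ca ?G j k b (tg (PsiW C) (cix ?G i) (cix ?G j) (ca ?G i j a p))) (ca ?G i j a p)"
      unfolding ci[OF H(1)] ci[OF H(2)] ci[OF H(3)] ca[OF p s] tgs(1)[OF p s] q_def[symmetric] ca[OF q t] m
      by (rule ca[OF p X.Comp_Phi_hom[OF s(1) t(1)] ts])
  qed
  ultimately have G: "cofunctor X (PsiW C) ?G" using P.cofunctor_iff by blast
  have cK: "cix K i = i" if "i \<in> Ix X" for i using that by (simp add: counit_sel(1))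
  have "comp_cofunctor (PsiW C) ?G K = id_cofunctor (PsiW C)" (is "?L = ?R")
  proof -
    have "cob ?L i = cob ?R i" for i
    proof (cases "i \<in> Ix X")
      case True
      then show ?thesis using u[OF True] C.topspace_pt[of i]
        by (intro ext) (simp add: comp_cofunctor_def id_cofunctor_def cK cob cob_K idp_def map_comp_def)
    next
      case False
      then show ?thesis by (simp add: comp_cofunctor_def id_cofunctor_def counit_sel(2) map_comp_def fun_eq_iff
            split: option.split)
    qed
    then have "cob ?L = cob ?R" by blast
    moreover have "car ?L i j = car ?R i j" for i j
    proof (cases "i \<in> Ix X \<and> j \<in> Ix X")
      case True
      then have I: "i \<in> Ix X" "j \<in> Ix X" and IC: "i \<in> Obj C" "j \<in> Obj C" by auto
      show ?thesis
      proof (rule map_pair_eqI)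
        fix b p c
        show "car ?L i j (b, p) = Some c \<longleftrightarrow> car ?R i j (b, p) = Some c"
          unfolding C.car_id_PsiW_Some[OF IC]
        proof
          assume "car ?L i j (b, p) = Some c"
          then obtain x a where x: "cob ?G i p = Some x" "car K i j (b, x) = Some a" "car ?G i j (a, p) = Some c"
            unfolding car_comp_Some cK[OF I(1)] cK[OF I(2)] by blast
          have p: "p \<in> pts C i" "x = unpx i p" using x(1) by (auto simp: cob[OF I(1)] split: if_splits)
          note up = u[OF I(1) p(1)]
          obtain s where s: "s \<in> Phi_hom v X i j" "s (unpx i p) = Some a" "b = gm C i j s p"
            using x(2) up unfolding car_K_Some[OF I] p(2) by auto
          have "c = gm C i j s p" using x(3) ca[OF p(1) s(1,2)] by (simp add: ca_def)
          then show "\<exists>f. f \<in> Hom C i j \<and> p \<in> pts C i \<and> p (Rst C i j f) \<and> b = gm C i j f p \<and> c = b"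
            using s p sd[OF p(1) s(1,2)] by auto
        next
          assume "\<exists>f. f \<in> Hom C i j \<and> p \<in> pts C i \<and> p (Rst C i j f) \<and> b = gm C i j f p \<and> c = b"
          then obtain s where s: "s \<in> Phi_hom v X i j" "p \<in> pts C i" "p (rs X i j s)" "b = gm C i j s p" "c = b"
            by auto
          note up = u[OF I(1) s(2)]
          obtain a where a: "s (unpx i p) = Some a" using px_rst[OF s(1), of "unpx i p"] up s(3) by auto
          have "cob ?G i p = Some (unpx i p)" using s(2) by (simp add: cob[OF I(1)])
          moreover have "car K i j (b, unpx i p) = Some a"
            unfolding car_K_Some[OF I] using s(1,4) a up by auto
          moreover have "car ?G i j (a, p) = Some c" unfolding car[OF I] using s a by blast
          ultimately show "car ?L i j (b, p) = Some c"
            unfolding car_comp_Some cK[OF I(1)] cK[OF I(2)] by blast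
        qed
      qed
    next
      case False
      then have "car K i j = Map.empty" "car ?R i j = Map.empty"
        by (auto simp: counit_sel(4) id_cofunctor_def)
      then show ?thesis by (intro map_pair_eqI) (auto simp: car_comp_Some)
    qed
    then have "car ?L = car ?R" by blast
    moreover have "cix ?L = cix ?R"
      by (auto simp: comp_cofunctor_def id_cofunctor_def counit_inv_def counit_sel(1) fun_eq_iff)
    ultimately show ?thesis by simp
  qed
  moreover have "comp_cofunctor X K ?G = id_cofunctor X" (is "?L = ?R")
  proof -
    have "cob ?L i = cob ?R i" for i
    proof (cases "i \<in> Ix X")
      case True
      then show ?thesis using up[OF True] px_point[OF True]
        by (intro ext) (simp add: comp_cofunctor_def id_cofunctor_def ci cob cob_K idp_def map_comp_def)
    next
      case False
      then show ?thesis by (simp add: comp_cofunctor_def id_cofunctor_def counit_inv_def map_comp_def fun_eq_iff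
            split: option.split)
    qed
    then have "cob ?L = cob ?R" by blast
    moreover have "car ?L i j = car ?R i j" for i j
    proof (cases "i \<in> Ix X \<and> j \<in> Ix X")
      case True
      then have I: "i \<in> Ix X" "j \<in> Ix X" by auto
      have idS: "car ?R i j (a, x) = Some c \<longleftrightarrow> x \<in> sp X i \<and> a \<in> ar X i j \<and> sr X i j a = x \<and> c = a" for a x c
      proof -
        have "car ?R i j = proj1 (fprod (Ar X i j) (Sp X i) (Src X i j) (idp (Sp X i)))"
          using I by (simp add: id_cofunctor_def act_dom_def)
        moreover have "Src X i j a = idp (Sp X i) x \<longleftrightarrow> sr X i j a = x" if "a \<in> ar X i j" "x \<in> sp X i"
          using that X.Src_Some[OF I, of a x] by (auto simp: idp_def)
        ultimately show ?thesis by (auto simp: proj1_Some)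
      qed
      show ?thesis
      proof (rule map_pair_eqI)
        fix a x c
        show "car ?L i j (a, x) = Some c \<longleftrightarrow> car ?R i j (a, x) = Some c"
          unfolding idS
        proof
          assume "car ?L i j (a, x) = Some c"
          then obtain p b where b: "cob K i x = Some p" "car ?G i j (a, p) = Some b" "car K i j (b, x) = Some c"
            unfolding car_comp_Some ci[OF I(1)] ci[OF I(2)] by blast
          have x: "x \<in> sp X i" "p = pp i x" using b(1) by (auto simp: cob_K[OF I(1)] split: if_splits)
          obtain s where s: "s \<in> Phi_hom v X i j" "s x = Some a" "b = gm C i j s (pp i x)"
            using b(2) up[OF I(1) x(1)] unfolding car[OF I] x(2) by auto
          have "car K i j (b, x) = Some a" unfolding s(3) by (rule car_K_gm[OF s(1,2)])
          then show "x \<in> sp X i \<and> a \<in> ar X i j \<and> sr X i j a = x \<and> c = a"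
            using b(3) x X.Phi_homD(5,6)[OF s(1,2)] by simp
        next
          assume H: "x \<in> sp X i \<and> a \<in> ar X i j \<and> sr X i j a = x \<and> c = a"
          then have x: "x \<in> sp X i" by blast
          obtain s where s: "s \<in> Phi_hom v X i j" "s x = Some a" using X.section_through[OF I, of a] H by auto
          have "cob K i x = Some (pp i x)" using x by (simp add: cob_K[OF I(1)])
          moreover have "car ?G i j (a, pp i x) = Some (gm C i j s (pp i x))"
            unfolding car[OF I] using px_point[OF I(1) x] s up[OF I(1) x] by auto
          moreover have "car K i j (gm C i j s (pp i x), x) = Some c" using car_K_gm[OF s] H by simp
          ultimately show "car ?L i j (a, x) = Some c"
            unfolding car_comp_Some ci[OF I(1)] ci[OF I(2)] by blast
        qed
      qed
    next
      case False
      then have "car ?G i j = Map.empty" "car ?R i j = Map.empty"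
        by (auto simp: counit_inv_def id_cofunctor_def fun_eq_iff)
      then show ?thesis by (intro map_pair_eqI) (auto simp: car_comp_Some)
    qed
    then have "car ?L = car ?R" by blast
    moreover have "cix ?L = cix ?R"
      by (auto simp: comp_cofunctor_def id_cofunctor_def counit_inv_def counit_sel(1) fun_eq_iff)
    ultimately show ?thesis by simp
  qed
  ultimately show ?thesis unfolding left_fixpoint_def cofunctor_iso_def using counit_cofunctor G by blast
qed

end

section \<open>Right fixpoints\<close>

context join_category
begin

lemma spatial_eqI:
  assumes "spatial (RLoc C i)" "x \<in> RIdem C i" "y \<in> RIdem C i" "\<And>p. p \<in> pts C i \<Longrightarrow> p x = p y"
  shows "x = y"
  using assms unfolding spatial_def by (auto simp: RLoc_def)

lemma unit_functor_cat: "join_functor_cat C (UPhi v (PsiW C)) v (unit_at C)"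
  by (rule join_functor_catI[OF join_category_axioms icat.UPhi_join_category[OF PsiW_icat] unit_join_functor])

lemma sect_comp:
  assumes "f \<in> Hom C i j" "g \<in> Hom C j k"
  shows "sect (W C) i k (Comp C i j k g f) = pc (PsiW C) i j k (sect (W C) j k g) (sect (W C) i j f)"
  using join_functor_cat.H_comp[OF unit_functor_cat assms] assms
    hom_dom[OF assms(1)] hom_cod[OF assms(1)] hom_cod[OF assms(2)] by (simp add: unit_at_sel)

lemma sect_rst:
  assumes "f \<in> Hom C i j"
  shows "sect (W C) i i (Rst C i j f) = rs (PsiW C) i j (sect (W C) i j f)"
  using join_functor_cat.H_rst[OF unit_functor_cat assms] assms hom_dom[OF assms] hom_cod[OF assms]
  by (simp add: unit_at_sel)

text \<open>The idempotent \<open>E\<close> of \<open>agr_open\<close> holds at the same points as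
  the restrictions of \<open>f\<close> and of \<open>g\<close>, because equal sections have equal
  germs. Spatiality identifies the three, so the maps agree on their whole domain.\<close>

lemma sect_inj:
  assumes sp: "spatial (RLoc C i)" and f: "f \<in> Hom C i j" and g: "g \<in> Hom C i j"
    and eq: "sect (W C) i j f = sect (W C) i j g"
  shows "f = g"
proof -
  obtain E where E: "E \<in> RIdem C i" "\<forall>p\<in>pts C i. p E \<longleftrightarrow> agr C i j f g p"
      "Comp C i i j f E = Comp C i i j g E" using agr_open[OF f g] by blast
  have "agr C i j f g p \<longleftrightarrow> p (Rst C i j f)" "p (Rst C i j f) \<longleftrightarrow> p (Rst C i j g)" if p: "p \<in> pts C i" for p
  proof -
    have e: "sect (W C) i j f p = sect (W C) i j g p" using eq by simp
    show 1: "p (Rst C i j f) \<longleftrightarrow> p (Rst C i j g)"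
      using e p by (auto simp: sect_W[OF f] sect_W[OF g] split: if_splits)
    show "agr C i j f g p \<longleftrightarrow> p (Rst C i j f)"
    proof
      assume d: "p (Rst C i j f)"
      then have "gm C i j f p = gm C i j g p" using e p 1 by (simp add: sect_W[OF f] sect_W[OF g])
      then show "agr C i j f g p" using gm_eq_iff[OF f g p d] by blast
    qed (simp add: agr_def)
  qed
  then have "E = Rst C i j f" "E = Rst C i j g"
    using E(2) by (auto intro!: spatial_eqI[OF sp E(1)] rst_RIdem[OF f] rst_RIdem[OF g])
  then show ?thesis using E(3) comp_rst[OF f] comp_rst[OF g] by simp
qed

lemma gm_restrict:
  assumes f: "f \<in> Hom C i j" and e: "e \<in> RIdem C i" and p: "p \<in> pts C i" "p (Rst C i j f)" "p e"
  shows "gm C i j (Comp C i i j f e) p = gm C i j f p" "p (Rst C i j (Comp C i i j f e))"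
proof -
  have fe: "Comp C i i j f e \<in> Hom C i j" using f RIdem_in[OF e] by simp
  show r: "p (Rst C i j (Comp C i i j f e))"
    using rst_comp_RIdem[OF f e] point_comp[OF p(1) rst_RIdem[OF f] e] p by simp
  have "Comp C i i j (Comp C i i j f e) e = Comp C i i j f e"
    using comp_assoc'[OF RIdem_in[OF e] RIdem_in[OF e] f] RIdem_idem[OF e] by simp
  then have "agr C i j (Comp C i i j f e) f p" unfolding agr_def using r p e by blast
  then show "gm C i j (Comp C i i j f e) p = gm C i j f p" using gm_eq_iff[OF fe f p(1) r] by blast
qed

lemma sect_surj:
  assumes sp: "\<And>i. i \<in> Obj C \<Longrightarrow> spatial (RLoc C i)" and s: "s \<in> Phi_hom v (PsiW C) i j"
  shows "\<exists>f\<in>Hom C i j. sect (W C) i j f = s"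
proof -
  interpret X: icat "PsiW C" v by (rule PsiW_icat)
  interpret J: join_functor_cat C "UPhi v (PsiW C)" v "unit_at C" by (rule unit_functor_cat)
  let ?B = "UPhi v (PsiW C)"
  have ij: "i \<in> Obj C" "j \<in> Obj C" using X.Phi_homD(1,2)[OF s] by auto
  \<comment> \<open>Taking all maps whose section lies below \<open>s\<close> avoids choosing a
    representative at each point.\<close>
  define S where "S = {h \<in> Hom C i j. sect (W C) i j h \<subseteq>\<^sub>m s}"
  have SH: "S \<subseteq> Hom C i j" by (auto simp: S_def)
  have rc: "rcompat C i j h k"
    if h: "h \<in> Hom C i j" and k: "k \<in> Hom C i j" and c: "rcompat ?B i j (sect (W C) i j h) (sect (W C) i j k)"
    for h k i j
  proof -
    have "sect (W C) i j (Comp C i i j h (Rst C i j k)) = sect (W C) i j (Comp C i i j k (Rst C i j h))"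
      using c h k by (simp add: rcompat_def sect_comp[OF rst_hom] sect_rst)
    then have "Comp C i i j h (Rst C i j k) = Comp C i i j k (Rst C i j h)"
      using h k hom_dom[OF h] by (intro sect_inj[OF sp]) auto
    then show ?thesis by (simp add: rcompat_def)
  qed
  have "vcompat v C i j h k" if hk: "h \<in> S" "k \<in> S" for h k
  proof -
    have H: "h \<in> Hom C i j" "k \<in> Hom C i j" and le: "sect (W C) i j h \<subseteq>\<^sub>m s" "sect (W C) i j k \<subseteq>\<^sub>m s"
      using hk by (auto simp: S_def)
    note P = sect_Phi_hom[OF H(1)] sect_Phi_hom[OF H(2)]
    \<comment> \<open>The sections of members of \<open>S\<close> are bounded by \<open>s\<close>,
      hence compatible in the category of sections; \<open>rc\<close> brings this back to
      \<open>C\<close>.\<close>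
    have "\<forall>s\<in>{sect (W C) i j h, sect (W C) i j k}. \<forall>t\<in>{sect (W C) i j h, sect (W C) i j k}. vcompat v ?B i j s t"
      using J.B.bounded_vcompat[of "{sect (W C) i j h, sect (W C) i j k}" i j s] P s le
        X.rle_UPhi[OF P(1) s] X.rle_UPhi[OF P(2) s] by auto
    then have v: "vcompat v ?B i j (sect (W C) i j h) (sect (W C) i j k)" by blast
    have "rcompat C j i (pinv C i j h) (pinv C i j k)" if g: "v = Groupoids"
    proof -
      interpret I: inverse_category C by (rule inverses[OF g])
      \<comment> \<open>Functors preserve partial inverses, so the second half of bicompatibility
        also concerns sections of maps of \<open>C\<close> and can be reflected by
        \<open>rc\<close>.\<close>
      have "sect (W C) j i (pinv C i j f) = pinv ?B i j (sect (W C) i j f)" if f: "f \<in> Hom C i j" for f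
        using functor_pinv[OF inverses[OF g] X.UPhi_inverse_category[OF g] J.is_functor f] f ij
        by (simp add: unit_at_sel I.pinv_in)
      then have "rcompat ?B j i (sect (W C) j i (pinv C i j h)) (sect (W C) j i (pinv C i j k))"
        using v g H by (simp add: vcompat_def)
      then show ?thesis by (rule rc[OF I.pinv_in[OF H(1)] I.pinv_in[OF H(2)]])
    qed
    then show ?thesis using rc[OF H] v by (simp add: vcompat_def)
  qed
  then obtain f where f: "is_join C i j S f"
    using vjoins[OF ij SH] unfolding has_stable_join_def by blast
  note fH = is_join_in[OF f]
  have "is_join ?B i j (sect (W C) i j ` S) (sect (W C) i j f)"
  proof -
    have "fmap (unit_at C) i j ` S = sect (W C) i j ` S" using SH unit_at_sel(2) by (intro image_cong) auto
    then show ?thesis using J.H_join[OF SH f] ij fH by (simp add: unit_at_sel)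
  qed
  moreover have "sect (W C) i j ` S \<subseteq> Phi_hom v (PsiW C) i j" using SH sect_Phi_hom by blast
  ultimately have fS: "sect (W C) i j f p = Some a \<longleftrightarrow> (\<exists>h\<in>S. sect (W C) i j h p = Some a)" for p a
    using X.is_join_UPhi[of "sect (W C) i j ` S" i j "sect (W C) i j f"] by simp
  have "sect (W C) i j f = s"
  proof (rule map_eqI)
    fix p a
    show "sect (W C) i j f p = Some a \<longleftrightarrow> s p = Some a"
    proof
      assume "sect (W C) i j f p = Some a"
      then show "s p = Some a" unfolding fS by (auto simp: S_def map_le_iff_Some)
    next
      assume a: "s p = Some a"
      have p: "p \<in> pts C i" using X.Phi_homD(4)[OF s a] topspace_pt[OF ij(1)] by simp
      have "a \<in> topspace (germ_space (W C) i j)" using X.Phi_homD(5)[OF s a] by simp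
      then obtain g r where g: "g \<in> Hom C i j" "r \<in> pts C i" "r (Rst C i j g)" "a = gm C i j g r"
        by (rule germE)
      have r: "r = p" using X.Phi_homD(6)[OF s a] sr_gm[OF g(1-3)] g(4) by simp
      have "openin (pt (RLoc C i)) (pre s (ran (sect (W C) i j g)))"
        using Top_pD(4)[OF X.Phi_homD(3)[OF s]] open_ran_sect[OF g(1)] by simp
      then obtain e where e: "e \<in> RIdem C i" "pre s (ran (sect (W C) i j g)) = {q \<in> pts C i. q e}"
        unfolding openin_pt[OF ij(1)] by auto
      have eq: "s q = Some (gm C i j g q)" if q: "q \<in> pts C i" "q e" for q
      proof -
        have "q \<in> pre s (ran (sect (W C) i j g))" using q e(2) by simp
        then obtain b q' where b: "s q = Some b" "sect (W C) i j g q' = Some b"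
          by (auto simp: pre_def ran_def)
        then have q': "q' \<in> pts C i" "q' (Rst C i j g)" "b = gm C i j g q'" using sect_Some[OF g(1)] by auto
        have "q = q'" using X.Phi_homD(6)[OF s b(1)] sr_gm[OF g(1) q'(1,2)] q'(3) by simp
        then show ?thesis using b(1) q'(3) by simp
      qed
      have "sect (W C) i j g p = Some a" using g r by (simp add: sect_W)
      then have "p \<in> pre s (ran (sect (W C) i j g))" using a by (force simp: pre_def ran_def)
      then have pe: "p e" using e(2) by simp
      \<comment> \<open>Cutting \<open>g\<close> down to the neighbourhood \<open>e\<close>, on
        which it represents \<open>s\<close>, gives a member of \<open>S\<close> whose section
        passes through \<open>a\<close>.\<close>
      let ?h = "Comp C i i j g e"
      have h: "?h \<in> Hom C i j" using g(1) RIdem_in[OF e(1)] by simp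
      have "sect (W C) i j ?h \<subseteq>\<^sub>m s"
        unfolding map_le_iff_Some
      proof (intro allI impI)
        fix q b assume "sect (W C) i j ?h q = Some b"
        then have q: "q \<in> pts C i" "q (Rst C i j ?h)" "b = gm C i j ?h q" using sect_Some[OF h] by auto
        then have qe: "q (Rst C i j g)" "q e"
          using rst_comp_RIdem[OF g(1) e(1)] point_comp[OF q(1) rst_RIdem[OF g(1)] e(1)] by auto
        show "s q = Some b" using eq[OF q(1) qe(2)] gm_restrict(1)[OF g(1) e(1) q(1) qe] q(3) by simp
      qed
      then have "?h \<in> S" using h by (simp add: S_def)
      moreover have "sect (W C) i j ?h p = Some a"
        using gm_restrict[OF g(1) e(1) p _ pe] g(3,4) r p by (simp add: sect_W[OF h])
      ultimately show "sect (W C) i j f p = Some a" unfolding fS by blast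
    qed
  qed
  then show ?thesis using fH by blast
qed

text \<open>By \<open>sect_inj\<close> and \<open>sect_surj\<close> the unit is bijective on
  hom-sets, so its inverse respects composition and restriction. Joins are preserved because the
  order is preserved and reflected (\<open>le\<close>) and a join is a least upper bound.\<close>

lemma spatial_right_fixpoint:
  assumes sp: "\<And>i. i \<in> Obj C \<Longrightarrow> spatial (RLoc C i)"
  shows "right_fixpoint v C"
proof -
  interpret X: icat "PsiW C" v by (rule PsiW_icat)
  let ?B = "UPhi v (PsiW C)"
  interpret B: join_category ?B v by (rule X.UPhi_join_category)
  define g where "g i j s = (THE f. f \<in> Hom C i j \<and> sect (W C) i j f = s)" for i j s
  have gs: "g i j (sect (W C) i j f) = f" if f: "f \<in> Hom C i j" for i j f
    unfolding g_def
  proof (rule the_equality)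
    show "f \<in> Hom C i j \<and> sect (W C) i j f = sect (W C) i j f" using f by simp
    show "h = f" if "h \<in> Hom C i j \<and> sect (W C) i j h = sect (W C) i j f" for h
      using sect_inj[OF sp[OF hom_dom[OF f]], of h j f] that f by blast
  qed
  have sg: "g i j s \<in> Hom C i j" "sect (W C) i j (g i j s) = s" if s: "s \<in> Phi_hom v (PsiW C) i j" for i j s
  proof -
    obtain f where f: "f \<in> Hom C i j" "sect (W C) i j f = s" using sect_surj[OF sp s] by blast
    then show "g i j s \<in> Hom C i j" "sect (W C) i j (g i j s) = s" using gs[OF f(1)] by auto
  qed
  define G where "G = \<lparr>fob = (\<lambda>i\<in>Obj C. i), fmap = (\<lambda>i j. \<lambda>s\<in>Phi_hom v (PsiW C) i j. g i j s)\<rparr>"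
  have Go: "fob G i = i" if "i \<in> Obj C" for i using that by (simp add: G_def)
  have Gm: "fmap G i j s = g i j s" if "s \<in> Phi_hom v (PsiW C) i j" for i j s using that by (simp add: G_def)
  have o: "i \<in> Obj C" "j \<in> Obj C" if "s \<in> Phi_hom v (PsiW C) i j" for s i j
    using X.Phi_homD(1,2)[OF that] by auto
  have gc: "g i k (pc (PsiW C) i j k t s) = Comp C i j k (g j k t) (g i j s)"
    if s: "s \<in> Phi_hom v (PsiW C) i j" and t: "t \<in> Phi_hom v (PsiW C) j k" for i j k s t
    using gs[OF comp_in[OF sg(1)[OF s] sg(1)[OF t]]] sect_comp[OF sg(1)[OF s] sg(1)[OF t]] sg(2)[OF s] sg(2)[OF t]
    by simp
  have gr: "g i i (rs (PsiW C) i j s) = Rst C i j (g i j s)" if s: "s \<in> Phi_hom v (PsiW C) i j" for i j s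
    using gs[OF rst_hom[OF sg(1)[OF s]]] sect_rst[OF sg(1)[OF s]] sg(2)[OF s] by simp
  have le: "rle C i j (g i j s) (g i j t) \<longleftrightarrow> rle ?B i j s t"
    if s: "s \<in> Phi_hom v (PsiW C) i j" and t: "t \<in> Phi_hom v (PsiW C) i j" for i j s t
  proof -
    have r: "pc (PsiW C) i i j t (rs (PsiW C) i j s) \<in> Phi_hom v (PsiW C) i j"
      by (rule X.Comp_Phi_hom[OF X.Rst_Phi_hom[OF s] t])
    have "rle C i j (g i j s) (g i j t) \<longleftrightarrow> g i j s = g i j (pc (PsiW C) i i j t (rs (PsiW C) i j s))"
      unfolding rle_def gc[OF X.Rst_Phi_hom[OF s] t] gr[OF s] ..
    also have "\<dots> \<longleftrightarrow> s = pc (PsiW C) i i j t (rs (PsiW C) i j s)" using sg(2)[OF s] sg(2)[OF r] by metis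
    finally show ?thesis by (simp add: rle_def)
  qed
  have "join_functor v ?B C G"
    unfolding join_functor_iff[OF B.join_category_axioms join_category_axioms] is_functor_def UPhi_sel PsiW_sel
  proof (intro conjI allI ballI impI)
    show "fob G \<in> Obj C \<rightarrow>\<^sub>E Obj C" by (simp add: G_def)
    show "fmap G i j \<in> Phi_hom v (PsiW C) i j \<rightarrow>\<^sub>E Hom C (fob G i) (fob G j)" for i j
      using sg(1) o Go by (auto simp: G_def restrict_PiE_iff)
    show "fmap G i i (sect (W C) i i (Idn C i)) = Idn C (fob G i)" if "i \<in> Obj C" for i
      using gs[OF idn_hom[OF that]] Gm[OF sect_Phi_hom[OF idn_hom[OF that]]] Go[OF that] by simp
    fix i j s assume s: "s \<in> Phi_hom v (PsiW C) i j"
    show "fmap G i k (pc (PsiW C) i j k t s) = Comp C (fob G i) (fob G j) (fob G k) (fmap G j k t) (fmap G i j s)"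
      if t: "t \<in> Phi_hom v (PsiW C) j k" for k t
      using gc[OF s t] o[OF s] o[OF t] Gm[OF s] Gm[OF t] Gm[OF X.Comp_Phi_hom[OF s t]] by (simp add: Go)
    show "fmap G i i (rs (PsiW C) i j s) = Rst C (fob G i) (fob G j) (fmap G i j s)"
      using gr[OF s] o[OF s] Gm[OF s] Gm[OF X.Rst_Phi_hom[OF s]] by (simp add: Go)
  next
    fix i j S f assume S: "S \<subseteq> Phi_hom v (PsiW C) i j" and J: "is_join ?B i j S f"
    have f: "f \<in> Phi_hom v (PsiW C) i j" using B.is_join_in[OF J] by simp
    have im: "fmap G i j ` S = g i j ` S" using S Gm by (intro image_cong) auto
    have "is_join C i j (g i j ` S) (g i j f)"
      unfolding is_join_def
    proof (intro conjI ballI impI)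
      show "g i j f \<in> Hom C i j" by (rule sg(1)[OF f])
      show "rle C i j t (g i j f)" if t: "t \<in> g i j ` S" for t
      proof -
        obtain s where s: "s \<in> S" "t = g i j s" using t by blast
        then have "s \<in> Phi_hom v (PsiW C) i j" using S by blast
        then show ?thesis using le[OF _ f] B.is_join_ub[OF J s(1)] s(2) by simp
      qed
      fix h assume h: "h \<in> Hom C i j" and ub: "\<forall>t\<in>g i j ` S. rle C i j t h"
      note hP = sect_Phi_hom[OF h]
      have "rle ?B i j s (sect (W C) i j h)" if "s \<in> S" for s
      proof -
        have "s \<in> Phi_hom v (PsiW C) i j" using S that by blast
        then show ?thesis using le[OF _ hP] ub that gs[OF h] by auto
      qed
      then have "rle ?B i j f (sect (W C) i j h)" using J hP unfolding is_join_def by simp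
      then show "rle C i j (g i j f) h" using le[OF f hP] gs[OF h] by simp
    qed
    then show "is_join C (fob G i) (fob G j) (fmap G i j ` S) (fmap G i j f)"
      using im Gm[OF f] o[OF f] by (simp add: Go)
  qed
  moreover have "comp_functor C G (unit_at C) = id_functor C"
    unfolding comp_functor_def id_functor_def
    using Go Gm[OF sect_Phi_hom] gs hom_dom hom_cod
    by (auto simp: unit_at_sel restrict_def fun_eq_iff)
  moreover have "comp_functor ?B (unit_at C) G = id_functor ?B"
    unfolding comp_functor_def id_functor_def
    using Go Gm sg o by (auto simp: unit_at_sel restrict_def fun_eq_iff)
  ultimately show ?thesis
    unfolding right_fixpoint_def join_functor_iso_def using unit_join_functor by blast
qed

text \<open>A left inverse of the unit makes \<open>sect\<close> injective. Idempotents that hold at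
  the same points have the same section, since wherever they hold both have the germ of the
  identity.\<close>

lemma right_fixpoint_spatial:
  assumes R: "right_fixpoint v C" and i: "i \<in> Obj C"
  shows "spatial (RLoc C i)"
  unfolding spatial_def
proof (intro ballI impI)
  obtain G where G: "comp_functor C G (unit_at C) = id_functor C"
    using R unfolding right_fixpoint_def join_functor_iso_def by blast
  have inj: "fmap G i i (sect (W C) i i f) = f" if f: "f \<in> Hom C i i" for f
  proof -
    have "fmap (comp_functor C G (unit_at C)) i i f = fmap (id_functor C) i i f" unfolding G ..
    then show ?thesis using f i by (simp add: comp_functor_def id_functor_def unit_at_sel)
  qed
  fix x y assume xy: "x \<in> carrier (RLoc C i)" "y \<in> carrier (RLoc C i)" "x \<noteq> y"
  then have x: "x \<in> RIdem C i" and y: "y \<in> RIdem C i" by (auto simp: RLoc_def)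
  show "\<exists>p\<in>pts C i. p x \<noteq> p y"
  proof (rule ccontr)
    assume "\<not> (\<exists>p\<in>pts C i. p x \<noteq> p y)"
    then have e: "\<And>p. p \<in> pts C i \<Longrightarrow> p x = p y" by blast
    have "sect (W C) i i x = sect (W C) i i y"
    proof
      fix p show "sect (W C) i i x p = sect (W C) i i y p"
        using e[of p] gm_RIdem[OF x, of p] gm_RIdem[OF y, of p]
        by (auto simp: sect_W[OF RIdem_in[OF x]] sect_W[OF RIdem_in[OF y]] RIdem_rst[OF x] RIdem_rst[OF y])
    qed
    then show False using inj[OF RIdem_in[OF x]] inj[OF RIdem_in[OF y]] xy(3) by simp
  qed
qed

end

theorem theorem8p14:
  fixes v :: variant and sc :: scope
    and A :: "('o1, 'm1) rcat" and B :: "('o2, 'm2) rcat" and C :: "('o3, 'm3) rcat"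
    and X :: "('i1, 'a1, 'b1) pcat" and Y :: "('i2, 'a2, 'b2) pcat" and Z :: "('i3, 'a3, 'b3) pcat"
  shows
    \<comment> \<open>\<open>\<Psi>W\<close> is a functor\<close>
    "(join_cat v sc A \<longrightarrow> internal_cat v sc (PsiW A)) \<and>
     (\<forall>H. join_cat v sc A \<and> join_cat v sc B \<and> join_functor v A B H \<longrightarrow>
        cofunctor (PsiW A) (PsiW B) (PsiW_map A B H)) \<and>
     (join_cat v sc A \<longrightarrow> PsiW_map A A (id_functor A) = id_cofunctor (PsiW A)) \<and>
     (\<forall>H K. join_cat v sc A \<and> join_cat v sc B \<and> join_cat v sc C \<and>
        join_functor v A B H \<and> join_functor v B C K \<longrightarrow>
        PsiW_map A C (comp_functor A K H) =
        comp_cofunctor (PsiW A) (PsiW_map B C K) (PsiW_map A B H)) \<and>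
     \<comment> \<open>\<open>U\<Phi>\<close>, respectively \<open>U\<Phi>\<^sub>g\<close>, is a functor\<close>
     (internal_cat v sc X \<longrightarrow> join_cat v sc (UPhi v X)) \<and>
     (\<forall>F. internal_cat v sc X \<and> internal_cat v sc Y \<and> cofunctor X Y F \<longrightarrow>
        join_functor v (UPhi v X) (UPhi v Y) (UPhi_map v X F)) \<and>
     (internal_cat v sc X \<longrightarrow> UPhi_map v X (id_cofunctor X) = id_functor (UPhi v X)) \<and>
     (\<forall>F G. internal_cat v sc X \<and> internal_cat v sc Y \<and> internal_cat v sc Z \<and>
        cofunctor X Y F \<and> cofunctor Y Z G \<longrightarrow>
        UPhi_map v X (comp_cofunctor X G F) =
        comp_functor (UPhi v X) (UPhi_map v Y G) (UPhi_map v X F)) \<and>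
     \<comment> \<open>the unit and the counit are natural transformations\<close>
     (join_cat v sc A \<longrightarrow> join_functor v A (UPhi v (PsiW A)) (unit_at A)) \<and>
     (\<forall>H. join_cat v sc A \<and> join_cat v sc B \<and> join_functor v A B H \<longrightarrow>
        comp_functor A (unit_at B) H =
        comp_functor A (UPhi_map v (PsiW A) (PsiW_map A B H)) (unit_at A)) \<and>
     (internal_cat v sc X \<longrightarrow> cofunctor (PsiW (UPhi v X)) X (counit_at v X)) \<and>
     (\<forall>F. internal_cat v sc X \<and> internal_cat v sc Y \<and> cofunctor X Y F \<longrightarrow>
        comp_cofunctor (PsiW (UPhi v X)) F (counit_at v X) =
        comp_cofunctor (PsiW (UPhi v X)) (counit_at v Y)
          (PsiW_map (UPhi v X) (UPhi v Y) (UPhi_map v X F))) \<and>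
     \<comment> \<open>triangle identities\<close>
     (join_cat v sc A \<longrightarrow>
        comp_cofunctor (PsiW A) (counit_at v (PsiW A))
          (PsiW_map A (UPhi v (PsiW A)) (unit_at A)) = id_cofunctor (PsiW A)) \<and>
     (internal_cat v sc X \<longrightarrow>
        comp_functor (UPhi v X) (UPhi_map v (PsiW (UPhi v X)) (counit_at v X))
          (unit_at (UPhi v X)) = id_functor (UPhi v X)) \<and>
     \<comment> \<open>the adjunction is Galois\<close>
     (join_cat v sc A \<longrightarrow> left_fixpoint v (PsiW A)) \<and>
     \<comment> \<open>the fixpoints\<close>
     (internal_cat v sc X \<longrightarrow> (left_fixpoint v X \<longleftrightarrow> (\<forall>i \<in> Ix X. sober (Sp X i)))) \<and>
     (join_cat v sc A \<longrightarrow> (right_fixpoint v A \<longleftrightarrow> (\<forall>i \<in> Obj A. spatial (RLoc A i))))"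
proof (intro conjI allI impI)
  show "internal_cat v sc (PsiW A)" if "join_cat v sc A" using that by (rule join_cat_PsiW)
  show "cofunctor (PsiW A) (PsiW B) (PsiW_map A B H)"
    if "join_cat v sc A \<and> join_cat v sc B \<and> join_functor v A B H" for H
    using that by (intro join_functor_cat.PsiW_map_cofunctor[where v=v] join_functor_catI) (auto simp: join_cat_iff)
  show "PsiW_map A A (id_functor A) = id_cofunctor (PsiW A)" if "join_cat v sc A"
    using that by (intro PsiW_map_id[where v=v]) (simp add: join_cat_iff)
  show "PsiW_map A C (comp_functor A K H) =
      comp_cofunctor (PsiW A) (PsiW_map B C K) (PsiW_map A B H)"
    if "join_cat v sc A \<and> join_cat v sc B \<and> join_cat v sc C \<and> join_functor v A B H \<and> join_functor v B C K"
    for H K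
    using that by (intro PsiW_map_comp[where v=v]) (auto simp: join_cat_iff)
  show "join_cat v sc (UPhi v X)" if "internal_cat v sc X" using that by (rule internal_cat_UPhi)
  show "join_functor v (UPhi v X) (UPhi v Y) (UPhi_map v X F)"
    if "internal_cat v sc X \<and> internal_cat v sc Y \<and> cofunctor X Y F" for F
    using that by (intro cofunctor_icat.UPhi_map_join_functor cofunctor_icatI) (auto simp: internal_cat_iff)
  show "UPhi_map v X (id_cofunctor X) = id_functor (UPhi v X)" if "internal_cat v sc X"
    using that by (intro UPhi_map_id) (simp add: internal_cat_iff)
  show "UPhi_map v X (comp_cofunctor X G F) = comp_functor (UPhi v X) (UPhi_map v Y G) (UPhi_map v X F)"
    if "internal_cat v sc X \<and> internal_cat v sc Y \<and> internal_cat v sc Z \<and> cofunctor X Y F \<and> cofunctor Y Z G"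
    for F G
    using that by (intro UPhi_map_comp) (auto simp: internal_cat_iff)
  show "join_functor v A (UPhi v (PsiW A)) (unit_at A)" if "join_cat v sc A"
    using that by (intro join_category.unit_join_functor) (simp add: join_cat_iff)
  show "comp_functor A (unit_at B) H = comp_functor A (UPhi_map v (PsiW A) (PsiW_map A B H)) (unit_at A)"
    if "join_cat v sc A \<and> join_cat v sc B \<and> join_functor v A B H" for H
    using that by (intro unit_natural) (auto simp: join_cat_iff)
  show "cofunctor (PsiW (UPhi v X)) X (counit_at v X)" if "internal_cat v sc X"
    using that by (intro counit_cat.counit_cofunctor counit_catI) (simp add: internal_cat_iff)
  show "comp_cofunctor (PsiW (UPhi v X)) F (counit_at v X) =
      comp_cofunctor (PsiW (UPhi v X)) (counit_at v Y) (PsiW_map (UPhi v X) (UPhi v Y) (UPhi_map v X F))"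
    if "internal_cat v sc X \<and> internal_cat v sc Y \<and> cofunctor X Y F" for F
    using that by (intro counit_natural) (auto simp: internal_cat_iff)
  show "comp_cofunctor (PsiW A) (counit_at v (PsiW A)) (PsiW_map A (UPhi v (PsiW A)) (unit_at A)) =
      id_cofunctor (PsiW A)" if "join_cat v sc A"
    using that by (intro unit_triangle) (simp add: join_cat_iff)
  show "comp_functor (UPhi v X) (UPhi_map v (PsiW (UPhi v X)) (counit_at v X)) (unit_at (UPhi v X)) =
      id_functor (UPhi v X)" if "internal_cat v sc X"
    using that by (intro counit_cat.counit_triangle counit_catI) (simp add: internal_cat_iff)
  show "left_fixpoint v (PsiW A)" if "join_cat v sc A"
  proof -
    interpret A: join_category A v using that by (simp add: join_cat_iff)
    show ?thesis
      \<comment> \<open>The spaces of objects of \<open>PsiW A\<close> are spaces of points, which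
        are sober by \<open>sober_pt\<close>.\<close>
      by (rule counit_cat.sober_left_fixpoint[OF counit_catI[OF A.PsiW_icat]]) (simp add: A.sober_pt)
  qed
  show "left_fixpoint v X \<longleftrightarrow> (\<forall>i \<in> Ix X. sober (Sp X i))" if "internal_cat v sc X"
  proof -
    interpret X: counit_cat X v using that by (intro counit_catI) (simp add: internal_cat_iff)
    show ?thesis using X.left_fixpoint_sober X.sober_left_fixpoint by blast
  qed
  show "right_fixpoint v A \<longleftrightarrow> (\<forall>i \<in> Obj A. spatial (RLoc A i))" if "join_cat v sc A"
  proof -
    interpret A: join_category A v using that by (simp add: join_cat_iff)
    show ?thesis using A.right_fixpoint_spatial A.spatial_right_fixpoint by blast
  qed
qed

end
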